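(* Let $k>2$ and let $g$ be an adapted metric on $(M;\mathcal D_1,\ldots,\mathcal D_k)$ such that all $\mathcal D_\mu$ are pairwise mixed totally geodesic and pairwise mixed integrable, and $n_\mu>1$ for all $\mu\ge2$. Then a pair $(g,\mathfrak T)$, where $\mathfrak T$ is the contorsion tensor of a statistical connection on $(M,g)$, is critical for the action $\bar J_{\mathcal D}$ with respect to adapted variations of $g$ preserving the volume of $(M,g)$ and all variations of $\mathfrak T$ if and only if $(M,g)$ is locally a product, i.e., all $\mathcal D_\mu$ are integrable and totally geodesic, and $\mathfrak T$ is the contorsion of any statistical connection satisfying, for all $\mu=1,\ldots,k$: (i) $\langle\mathfrak T_XY,Z\rangle=0$ for all $X,Y\in\mathcal D_\mu$ and $Z\in\mathcal D_\mu^\bot$; (ii) ${\rm Tr}_\mu^\bot\mathfrak T=0={\rm Tr}_\mu^\top\mathfrak T$; (iii) $\langle\mathfrak T_XY,Z\rangle=0$ for $X,Y,Z$ each from a different distribution.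
   Context: Setting. $M$ is a connected smooth manifold with $TM=\mathcal D_1+\ldots+\mathcal D_k$ a direct sum of subbundles (distributions) of ranks $n_\mu$. A pseudo-Riemannian metric $g=\langle\cdot,\cdot\rangle$ is adapted if all $\mathcal D_\mu$ are non-degenerate and pairwise orthogonal. $P_\mu^\bot$ is the orthoprojector onto $\mathcal D_\mu^\bot=\bigoplus_{\nu\ne\mu}\mathcal D_\nu$. $\{E_{\mu,a}\}$, $\{\mathcal E_{\mu,i}\}$ are local orthonormal frames of $\mathcal D_\mu$, $\mathcal D_\mu^\bot$; $\varepsilon=\pm1$ is the square of the corresponding frame vector. $\nabla$ is the Levi-Civita connection, $\bar\nabla=\nabla+\mathfrak T$ with contorsion $(1,2)$-tensor $\mathfrak T$. $\bar\nabla$ is statistical if $\langle\mathfrak T_XY,Z\rangle$ is totally symmetric. ${\rm Tr}_\mu^\top\mathfrak T=\sum_a\varepsilon_a\mathfrak T_{E_{\mu,a}}E_{\mu,a}$, ${\rm Tr}_\mu^\bot\mathfrak T=\sum_i\varepsilon_i\mathfrak T_{\mathcal E_{\mu,i}}\mathcal E_{\mu,i}$. Mixed scalar curvature: with $\bar R_{X,Y}=[\bar\nabla_Y,\bar\nabla_X]+\bar\nabla_{[X,Y]}$, $\overline{\rm S}_{\mathcal D_1,\ldots,\mathcal D_k}=\frac12\sum_{\nu<\mu}\sum_{a,b}\varepsilon_a\varepsilon_b(\langle\bar R_{E_{\nu,a},E_{\mu,b}}E_{\nu,a},E_{\mu,b}\rangle+\langle\bar R_{E_{\mu,b},E_{\nu,a}}E_{\mu,b},E_{\nu,a}\rangle)$.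 The action is $\bar J_{\mathcal D}(g,\mathfrak T)=\int_M\overline{\rm S}_{\mathcal D_1,\ldots,\mathcal D_k}\,{\rm d\,vol}_g$ (over a relatively compact domain $\Omega$ containing the supports of variations if $M$ is non-compact; volume-preserving then refers to $\Omega$). Adapted variation: smooth family $g_t$ of adapted metrics, $g_0=g$, $\partial_tg_t$ supported in $\Omega$. Variation of $\mathfrak T$: smooth family of $(1,2)$-tensors $\mathfrak T_t$, $\mathfrak T_0=\mathfrak T$, $\partial_t\mathfrak T_t$ supported in $\Omega$. The pair is critical if the derivative of the action at $t=0$ vanishes for all (volume-preserving) adapted variations of $g$ with $\mathfrak T$ fixed and for all variations of $\mathfrak T$ with $g$ fixed. $\mathcal D_\mu$ is totally geodesic if $h_\mu(X,Y)=\frac12P_\mu^\bot(\nabla_XY+\nabla_YX)$ vanishes for $X,Y\in\mathcal D_\mu$. A pair $(\mathcal D_\mu,\mathcal D_\nu)$, $\mu\ne\nu$, is mixed totally geodesic (resp. mixed integrable) if the orthogonal projection of $\nabla_XY+\nabla_YX$ (resp. $[X,Y]$) onto $(\mathcal D_\mu\oplus\mathcal D_\nu)^\bot$ vanishes for all $X\in\mathcal D_\mu$, $Y\in\mathcal D_\nu$. *)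

theory Defs
  imports "HOL-Analysis.Analysis"
begin

section \<open>Smooth maps between normed spaces\<close>

primrec iter_dderiv ::
  "'a list \<Rightarrow> ('a::real_normed_vector \<Rightarrow> 'b::real_normed_vector) \<Rightarrow> 'a \<Rightarrow> 'b" where
  "iter_dderiv [] f = f"
| "iter_dderiv (v # vs) f = (\<lambda>x. frechet_derivative (iter_dderiv vs f) (at x) v)"

text \<open>Used for open \<open>S\<close> in a finite-dimensional space only, where it is the usual
  \<open>C\<^sup>\<infinity>\<close> condition: all iterated directional derivatives exist and are differentiable
  (hence continuous).\<close>

definition smooth_on ::
  "'a set \<Rightarrow> ('a::euclidean_space \<Rightarrow> 'b::real_normed_vector) \<Rightarrow> bool" where
  "smooth_on S f \<longleftrightarrow> (\<forall>vs. \<forall>x\<in>S. iter_dderiv vs f differentiable (at x))"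

section \<open>Smooth manifolds\<close>

text \<open>The manifold is a whole type \<open>'m\<close> (Hausdorff and second countable by its type classes),
  of dimension \<open>CARD('n)\<close>; its smooth structure is given by an atlas, not necessarily maximal.
  A chart is a pair of its domain and its coordinate map.\<close>

type_synonym ('m, 'n) chart = "'m set \<times> ('m \<Rightarrow> real ^ 'n)"

definition chart_inv :: "('m, 'n::finite) chart \<Rightarrow> real ^ 'n \<Rightarrow> 'm" where
  "chart_inv c = inv_into (fst c) (snd c)"

definition chart_image :: "('m, 'n::finite) chart \<Rightarrow> (real ^ 'n) set" where
  "chart_image c = snd c ` fst c"

definition is_chart :: "('m::topological_space, 'n::finite) chart \<Rightarrow> bool" where
  "is_chart c \<longleftrightarrow> open (fst c) \<and> open (chart_image c) \<and>
     homeomorphism (fst c) (chart_image c) (snd c) (chart_inv c)"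

definition smooth_atlas :: "('m::topological_space, 'n::finite) chart set \<Rightarrow> bool" where
  "smooth_atlas A \<longleftrightarrow>
     (\<forall>c\<in>A. is_chart c) \<and> (\<Union>c\<in>A. fst c) = UNIV \<and>
     (\<forall>c\<in>A. \<forall>d\<in>A. smooth_on (snd c ` (fst c \<inter> fst d)) (snd d \<circ> chart_inv c))"

definition connected_smooth_manifold ::
  "('m::{t2_space, second_countable_topology}, 'n::finite) chart set \<Rightarrow> bool" where
  "connected_smooth_manifold A \<longleftrightarrow> smooth_atlas A \<and> connected (UNIV :: 'm set)"

definition smooth_fun :: "('m, 'n::finite) chart set \<Rightarrow> ('m \<Rightarrow> real) \<Rightarrow> bool" where
  "smooth_fun A f \<longleftrightarrow> (\<forall>c\<in>A. smooth_on (chart_image c) (f \<circ> chart_inv c))"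

section \<open>Tangent vectors, vector fields and tensor fields\<close>

text \<open>The tangent space at \<open>p\<close> is \<open>real ^ 'n\<close>, identified through a chart chosen once and for
  all at \<open>p\<close>. As the chosen chart varies with \<open>p\<close> without any regularity, smoothness of a
  section is never that of the raw function of \<open>p\<close>: it always refers to the components in the
  charts of the atlas, obtained with the derivatives of the transition maps.\<close>

definition chart_at :: "('m, 'n::finite) chart set \<Rightarrow> 'm \<Rightarrow> ('m, 'n) chart" where
  "chart_at A p = (SOME c. c \<in> A \<and> p \<in> fst c)"

definition transition_deriv ::
  "('m, 'n::finite) chart \<Rightarrow> ('m, 'n) chart \<Rightarrow> 'm \<Rightarrow> real ^ 'n \<Rightarrow> real ^ 'n" where
  "transition_deriv c d p = frechet_derivative (snd d \<circ> chart_inv c) (at (snd c p))"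

definition chart_components ::
  "('m, 'n::finite) chart set \<Rightarrow> ('m, 'n) chart \<Rightarrow> 'm \<Rightarrow> real ^ 'n \<Rightarrow> real ^ 'n" where
  "chart_components A c p v = transition_deriv (chart_at A p) c p v"

text \<open>The coordinate vector \<open>\<partial>/\<partial>x\<^sub>i\<close> of the chart \<open>c\<close> at \<open>p\<close>.\<close>

definition coord_vec ::
  "('m, 'n::finite) chart set \<Rightarrow> ('m, 'n) chart \<Rightarrow> 'n \<Rightarrow> 'm \<Rightarrow> real ^ 'n" where
  "coord_vec A c i p = transition_deriv c (chart_at A p) p (axis i 1)"

type_synonym ('m, 'n) vfield = "'m \<Rightarrow> real ^ 'n"
type_synonym ('m, 'n) metric = "'m \<Rightarrow> real ^ 'n \<Rightarrow> real ^ 'n \<Rightarrow> real"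
type_synonym ('m, 'n) tensor12 = "'m \<Rightarrow> real ^ 'n \<Rightarrow> real ^ 'n \<Rightarrow> real ^ 'n"
type_synonym ('m, 'n) distribution = "'m \<Rightarrow> (real ^ 'n) set"
type_synonym ('m, 'n) connection = "('m, 'n) vfield \<Rightarrow> ('m, 'n) vfield \<Rightarrow> ('m, 'n) vfield"

definition smooth_vfield ::
  "('m, 'n::finite) chart set \<Rightarrow> ('m, 'n) vfield \<Rightarrow> bool" where
  "smooth_vfield A X \<longleftrightarrow> (\<forall>c\<in>A. smooth_on (chart_image c)
     (\<lambda>x. chart_components A c (chart_inv c x) (X (chart_inv c x))))"

definition metric_comp ::
  "('m, 'n::finite) chart set \<Rightarrow> ('m, 'n) chart \<Rightarrow> ('m, 'n) metric \<Rightarrow> 'n \<Rightarrow> 'n \<Rightarrow> 'm \<Rightarrow> real" where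
  "metric_comp A c g i j p = g p (coord_vec A c i p) (coord_vec A c j p)"

definition tensor12_comp ::
  "('m, 'n::finite) chart set \<Rightarrow> ('m, 'n) chart \<Rightarrow> ('m, 'n) tensor12 \<Rightarrow> 'n \<Rightarrow> 'n \<Rightarrow> 'm \<Rightarrow> real ^ 'n" where
  "tensor12_comp A c T i j p =
     chart_components A c p (T p (coord_vec A c i p) (coord_vec A c j p))"

definition pseudo_riemannian_metric ::
  "('m, 'n::finite) chart set \<Rightarrow> ('m, 'n) metric \<Rightarrow> bool" where
  "pseudo_riemannian_metric A g \<longleftrightarrow>
     (\<forall>p. bilinear (g p)) \<and> (\<forall>p u v. g p u v = g p v u) \<and>
     (\<forall>p u. (\<forall>v. g p u v = 0) \<longrightarrow> u = 0) \<and>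
     (\<forall>c\<in>A. \<forall>i j. smooth_on (chart_image c) (metric_comp A c g i j \<circ> chart_inv c))"

definition smooth_tensor12 ::
  "('m, 'n::finite) chart set \<Rightarrow> ('m, 'n) tensor12 \<Rightarrow> bool" where
  "smooth_tensor12 A T \<longleftrightarrow>
     (\<forall>p. bilinear (T p)) \<and>
     (\<forall>c\<in>A. \<forall>i j. smooth_on (chart_image c) (tensor12_comp A c T i j \<circ> chart_inv c))"

text \<open>\<open>X f\<close> for a vector field \<open>X\<close> and a function \<open>f\<close>.\<close>

definition vf_deriv ::
  "('m, 'n::finite) chart set \<Rightarrow> ('m, 'n) vfield \<Rightarrow> ('m \<Rightarrow> real) \<Rightarrow> 'm \<Rightarrow> real" where
  "vf_deriv A X f p =
     frechet_derivative (f \<circ> chart_inv (chart_at A p)) (at (snd (chart_at A p) p)) (X p)"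

definition lie_bracket ::
  "('m, 'n::finite) chart set \<Rightarrow> ('m, 'n) vfield \<Rightarrow> ('m, 'n) vfield \<Rightarrow> ('m, 'n) vfield" where
  "lie_bracket A X Y = (THE Z. smooth_vfield A Z \<and>
     (\<forall>f. smooth_fun A f \<longrightarrow> (\<forall>p. vf_deriv A Z f p =
        vf_deriv A X (vf_deriv A Y f) p - vf_deriv A Y (vf_deriv A X f) p)))"

section \<open>Distributions\<close>

text \<open>Local frames are restrictions of global smooth vector fields; by bump functions this is no
  loss of generality. The same applies to every quantification over vector fields below.\<close>

definition smooth_distribution ::
  "('m::topological_space, 'n::finite) chart set \<Rightarrow> nat \<Rightarrow> ('m, 'n) distribution \<Rightarrow> bool" where
  "smooth_distribution A r W \<longleftrightarrow>
     (\<forall>p. subspace (W p) \<and> dim (W p) = r) \<and>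
     (\<forall>p. \<exists>U E. open U \<and> p \<in> U \<and> (\<forall>a<r. smooth_vfield A (E a)) \<and>
        (\<forall>q\<in>U. W q = span ((\<lambda>a. E a q) ` {..<r})))"

text \<open>\<open>TM = D 1 + \<dots> + D k\<close>, a direct sum of distributions of ranks \<open>n 1, \<dots>, n k\<close>.\<close>

definition almost_multi_product ::
  "('m::topological_space, 'n::finite) chart set \<Rightarrow> nat \<Rightarrow> (nat \<Rightarrow> nat) \<Rightarrow>
   (nat \<Rightarrow> ('m, 'n) distribution) \<Rightarrow> bool" where
  "almost_multi_product A k n D \<longleftrightarrow>
     (\<forall>\<mu>\<in>{1..k}. smooth_distribution A (n \<mu>) (D \<mu>)) \<and>
     (\<forall>p v. \<exists>!x. (\<forall>\<mu>\<in>{1..k}. x \<mu> \<in> D \<mu> p) \<and> (\<forall>\<mu>. \<mu> \<notin> {1..k} \<longrightarrow> x \<mu> = 0) \<and>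
        v = (\<Sum>\<mu>=1..k. x \<mu>))"

definition section_of ::
  "('m, 'n::finite) chart set \<Rightarrow> ('m, 'n) distribution \<Rightarrow> ('m, 'n) vfield \<Rightarrow> bool" where
  "section_of A W X \<longleftrightarrow> smooth_vfield A X \<and> (\<forall>p. X p \<in> W p)"

definition g_perp ::
  "('m, 'n::finite) metric \<Rightarrow> ('m, 'n) distribution \<Rightarrow> ('m, 'n) distribution" where
  "g_perp g W = (\<lambda>p. {v. \<forall>w\<in>W p. g p v w = 0})"

definition dist_sum ::
  "('m, 'n::finite) distribution \<Rightarrow> ('m, 'n) distribution \<Rightarrow> ('m, 'n) distribution" where
  "dist_sum V W = (\<lambda>p. {v + w | v w. v \<in> V p \<and> w \<in> W p})"

text \<open>The \<open>g\<close>-orthogonal projection onto \<open>W\<close>; meaningful when \<open>W\<close> is non-degenerate.\<close>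

definition g_proj ::
  "('m, 'n::finite) metric \<Rightarrow> ('m, 'n) distribution \<Rightarrow> 'm \<Rightarrow> real ^ 'n \<Rightarrow> real ^ 'n" where
  "g_proj g W p v = (THE w. w \<in> W p \<and> (\<forall>z\<in>W p. g p (v - w) z = 0))"

definition adapted_metric ::
  "('m, 'n::finite) chart set \<Rightarrow> nat \<Rightarrow> (nat \<Rightarrow> ('m, 'n) distribution) \<Rightarrow>
   ('m, 'n) metric \<Rightarrow> bool" where
  "adapted_metric A k D g \<longleftrightarrow>
     pseudo_riemannian_metric A g \<and>
     (\<forall>\<mu>\<in>{1..k}. \<forall>p. \<forall>u\<in>D \<mu> p. (\<forall>v\<in>D \<mu> p. g p u v = 0) \<longrightarrow> u = 0) \<and>
     (\<forall>\<mu>\<in>{1..k}. \<forall>\<nu>\<in>{1..k}. \<mu> \<noteq> \<nu> \<longrightarrow> (\<forall>p. \<forall>u\<in>D \<mu> p. \<forall>v\<in>D \<nu> p. g p u v = 0))"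

section \<open>Connections and curvature\<close>

definition affine_connection ::
  "('m, 'n::finite) chart set \<Rightarrow> ('m, 'n) connection \<Rightarrow> bool" where
  "affine_connection A nab \<longleftrightarrow>
     (\<forall>X Y. smooth_vfield A X \<and> smooth_vfield A Y \<longrightarrow> smooth_vfield A (nab X Y)) \<and>
     (\<forall>X Y Z. smooth_vfield A X \<and> smooth_vfield A Y \<and> smooth_vfield A Z \<longrightarrow>
        (\<forall>p. nab (\<lambda>q. X q + Y q) Z p = nab X Z p + nab Y Z p) \<and>
        (\<forall>p. nab X (\<lambda>q. Y q + Z q) p = nab X Y p + nab X Z p)) \<and>
     (\<forall>f X Y. smooth_fun A f \<and> smooth_vfield A X \<and> smooth_vfield A Y \<longrightarrow>
        (\<forall>p. nab (\<lambda>q. f q *\<^sub>R X q) Y p = f p *\<^sub>R nab X Y p) \<and>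
        (\<forall>p. nab X (\<lambda>q. f q *\<^sub>R Y q) p = vf_deriv A X f p *\<^sub>R Y p + f p *\<^sub>R nab X Y p))"

definition is_levi_civita ::
  "('m, 'n::finite) chart set \<Rightarrow> ('m, 'n) metric \<Rightarrow> ('m, 'n) connection \<Rightarrow> bool" where
  "is_levi_civita A g nab \<longleftrightarrow>
     affine_connection A nab \<and>
     (\<forall>X Y. smooth_vfield A X \<and> smooth_vfield A Y \<longrightarrow>
        (\<forall>p. nab X Y p - nab Y X p = lie_bracket A X Y p)) \<and>
     (\<forall>X Y Z. smooth_vfield A X \<and> smooth_vfield A Y \<and> smooth_vfield A Z \<longrightarrow>
        (\<forall>p. vf_deriv A X (\<lambda>q. g q (Y q) (Z q)) p =
               g p (nab X Y p) (Z p) + g p (Y p) (nab X Z p)))"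

text \<open>Determined on smooth vector fields, the only ones it is ever applied to.\<close>

definition levi_civita ::
  "('m, 'n::finite) chart set \<Rightarrow> ('m, 'n) metric \<Rightarrow> ('m, 'n) connection" where
  "levi_civita A g = (SOME nab. is_levi_civita A g nab)"

definition contorted_connection ::
  "('m, 'n::finite) chart set \<Rightarrow> ('m, 'n) metric \<Rightarrow> ('m, 'n) tensor12 \<Rightarrow> ('m, 'n) connection" where
  "contorted_connection A g T = (\<lambda>X Y p. levi_civita A g X Y p + T p (X p) (Y p))"

definition statistical_contorsion ::
  "('m, 'n::finite) chart set \<Rightarrow> ('m, 'n) metric \<Rightarrow> ('m, 'n) tensor12 \<Rightarrow> bool" where
  "statistical_contorsion A g T \<longleftrightarrow> smooth_tensor12 A T \<and>
     (\<forall>p u v w. g p (T p u v) w = g p (T p v u) w \<and> g p (T p u v) w = g p (T p u w) v)"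

text \<open>Sign convention: \<open>R\<^sub>X\<^sub>Y = [\<nabla>\<^sub>Y, \<nabla>\<^sub>X] + \<nabla>\<^bsub>[X,Y]\<^esub>\<close>.\<close>

definition curvature ::
  "('m, 'n::finite) chart set \<Rightarrow> ('m, 'n) connection \<Rightarrow>
   ('m, 'n) vfield \<Rightarrow> ('m, 'n) vfield \<Rightarrow> ('m, 'n) vfield \<Rightarrow> ('m, 'n) vfield" where
  "curvature A nab X Y Z =
     (\<lambda>p. nab Y (nab X Z) p - nab X (nab Y Z) p + nab (lie_bracket A X Y) Z p)"

definition orthonormal_frame_at ::
  "('m::topological_space, 'n::finite) chart set \<Rightarrow> ('m, 'n) metric \<Rightarrow> ('m, 'n) distribution \<Rightarrow>
   'm \<Rightarrow> (nat \<Rightarrow> ('m, 'n) vfield) \<Rightarrow> bool" where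
  "orthonormal_frame_at A g W p E \<longleftrightarrow>
     (\<forall>a<dim (W p). smooth_vfield A (E a)) \<and>
     (\<exists>U. open U \<and> p \<in> U \<and> (\<forall>q\<in>U.
        W q = span ((\<lambda>a. E a q) ` {..<dim (W p)}) \<and>
        (\<forall>a<dim (W p). g q (E a q) (E a q) \<in> {1, -1}) \<and>
        (\<forall>a<dim (W p). \<forall>b<dim (W p). a \<noteq> b \<longrightarrow> g q (E a q) (E b q) = 0)))"

text \<open>The quantities computed below from the chosen frame do not depend on the choice.\<close>

definition onframe ::
  "('m::topological_space, 'n::finite) chart set \<Rightarrow> ('m, 'n) metric \<Rightarrow> ('m, 'n) distribution \<Rightarrow>
   'm \<Rightarrow> nat \<Rightarrow> ('m, 'n) vfield" where
  "onframe A g W p = (SOME E. orthonormal_frame_at A g W p E)"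

definition trace_along ::
  "('m::topological_space, 'n::finite) chart set \<Rightarrow> ('m, 'n) metric \<Rightarrow> ('m, 'n) distribution \<Rightarrow>
   ('m, 'n) tensor12 \<Rightarrow> ('m, 'n) vfield" where
  "trace_along A g W T p =
     (let E = onframe A g W p in
      \<Sum>a<dim (W p). g p (E a p) (E a p) *\<^sub>R T p (E a p) (E a p))"

definition mixed_scalar_curvature ::
  "('m::topological_space, 'n::finite) chart set \<Rightarrow> nat \<Rightarrow> (nat \<Rightarrow> ('m, 'n) distribution) \<Rightarrow>
   ('m, 'n) metric \<Rightarrow> ('m, 'n) tensor12 \<Rightarrow> 'm \<Rightarrow> real" where
  "mixed_scalar_curvature A k D g T p =
     (let R = curvature A (contorted_connection A g T);
          E = (\<lambda>\<mu>. onframe A g (D \<mu>) p)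
      in 1/2 * (\<Sum>\<mu>=1..k. \<Sum>\<nu>=1..<\<mu>. \<Sum>a<dim (D \<nu> p). \<Sum>b<dim (D \<mu> p).
           g p (E \<nu> a p) (E \<nu> a p) * g p (E \<mu> b p) (E \<mu> b p) *
           (g p (R (E \<nu> a) (E \<mu> b) (E \<nu> a) p) (E \<mu> b p) +
            g p (R (E \<mu> b) (E \<nu> a) (E \<mu> b) p) (E \<nu> a p))))"

section \<open>The action and its critical points\<close>

text \<open>The Borel measure with density \<open>\<bar>det (g\<^sub>i\<^sub>j)\<bar>\<^bsup>1/2\<^esup>\<close> in every chart.\<close>

definition volume_measure ::
  "('m::topological_space, 'n::finite) chart set \<Rightarrow> ('m, 'n) metric \<Rightarrow> 'm measure" where
  "volume_measure A g = (THE M. sets M = sets borel \<and>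
     (\<forall>c\<in>A. \<forall>S\<in>sets borel. S \<subseteq> fst c \<longrightarrow>
        emeasure M S = (\<integral>\<^sup>+x\<in>snd c ` S.
          ennreal (sqrt \<bar>det (\<chi> i j. metric_comp A c g i j (chart_inv c x))\<bar>) \<partial>lborel)))"

definition action ::
  "('m::topological_space, 'n::finite) chart set \<Rightarrow> nat \<Rightarrow> (nat \<Rightarrow> ('m, 'n) distribution) \<Rightarrow>
   'm set \<Rightarrow> ('m, 'n) metric \<Rightarrow> ('m, 'n) tensor12 \<Rightarrow> real" where
  "action A k D \<Omega> g T =
     set_lebesgue_integral (volume_measure A g) \<Omega> (mixed_scalar_curvature A k D g T)"

text \<open>On a compact manifold the action is taken over the whole manifold.\<close>

definition action_domain :: "'m::topological_space set \<Rightarrow> bool" where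
  "action_domain \<Omega> \<longleftrightarrow> open \<Omega> \<and> connected \<Omega> \<and> \<Omega> \<noteq> {} \<and> compact (closure \<Omega>) \<and>
     (compact (UNIV :: 'm set) \<longrightarrow> \<Omega> = UNIV)"

definition adapted_variation ::
  "('m::topological_space, 'n::finite) chart set \<Rightarrow> nat \<Rightarrow> (nat \<Rightarrow> ('m, 'n) distribution) \<Rightarrow>
   'm set \<Rightarrow> ('m, 'n) metric \<Rightarrow> real \<Rightarrow> (real \<Rightarrow> ('m, 'n) metric) \<Rightarrow> bool" where
  "adapted_variation A k D \<Omega> g \<epsilon> gt \<longleftrightarrow>
     0 < \<epsilon> \<and> gt 0 = g \<and> (\<forall>t\<in>{-\<epsilon><..<\<epsilon>}. adapted_metric A k D (gt t)) \<and>
     (\<forall>c\<in>A. \<forall>i j. smooth_on ({-\<epsilon><..<\<epsilon>} \<times> chart_image c)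
        (\<lambda>(t, x). metric_comp A c (gt t) i j (chart_inv c x))) \<and>
     (\<forall>t\<in>{-\<epsilon><..<\<epsilon>}. closure {p. \<exists>u v. deriv (\<lambda>s. gt s p u v) t \<noteq> 0} \<subseteq> \<Omega>)"

definition volume_preserving ::
  "('m::topological_space, 'n::finite) chart set \<Rightarrow> 'm set \<Rightarrow> real \<Rightarrow>
   (real \<Rightarrow> ('m, 'n) metric) \<Rightarrow> bool" where
  "volume_preserving A \<Omega> \<epsilon> gt \<longleftrightarrow>
     (\<forall>t\<in>{-\<epsilon><..<\<epsilon>}. measure (volume_measure A (gt t)) \<Omega> = measure (volume_measure A (gt 0)) \<Omega>)"

definition contorsion_variation ::
  "('m::topological_space, 'n::finite) chart set \<Rightarrow> 'm set \<Rightarrow> ('m, 'n) tensor12 \<Rightarrow>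
   real \<Rightarrow> (real \<Rightarrow> ('m, 'n) tensor12) \<Rightarrow> bool" where
  "contorsion_variation A \<Omega> T \<epsilon> Tt \<longleftrightarrow>
     0 < \<epsilon> \<and> Tt 0 = T \<and> (\<forall>t\<in>{-\<epsilon><..<\<epsilon>}. smooth_tensor12 A (Tt t)) \<and>
     (\<forall>c\<in>A. \<forall>i j. smooth_on ({-\<epsilon><..<\<epsilon>} \<times> chart_image c)
        (\<lambda>(t, x). tensor12_comp A c (Tt t) i j (chart_inv c x))) \<and>
     (\<forall>t\<in>{-\<epsilon><..<\<epsilon>}.
        closure {p. \<exists>u v. vector_derivative (\<lambda>s. Tt s p u v) (at t) \<noteq> 0} \<subseteq> \<Omega>)"

definition critical_pair ::
  "('m::topological_space, 'n::finite) chart set \<Rightarrow> nat \<Rightarrow> (nat \<Rightarrow> ('m, 'n) distribution) \<Rightarrow>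
   ('m, 'n) metric \<Rightarrow> ('m, 'n) tensor12 \<Rightarrow> bool" where
  "critical_pair A k D g T \<longleftrightarrow> (\<forall>\<Omega>. action_domain \<Omega> \<longrightarrow>
     (\<forall>\<epsilon> gt. adapted_variation A k D \<Omega> g \<epsilon> gt \<and> volume_preserving A \<Omega> \<epsilon> gt \<longrightarrow>
        ((\<lambda>t. action A k D \<Omega> (gt t) T) has_real_derivative 0) (at 0)) \<and>
     (\<forall>\<epsilon> Tt. contorsion_variation A \<Omega> T \<epsilon> Tt \<longrightarrow>
        ((\<lambda>t. action A k D \<Omega> g (Tt t)) has_real_derivative 0) (at 0)))"

section \<open>Extrinsic geometry of distributions\<close>

definition second_fundamental_form ::
  "('m, 'n::finite) chart set \<Rightarrow> ('m, 'n) metric \<Rightarrow> ('m, 'n) distribution \<Rightarrow>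
   ('m, 'n) vfield \<Rightarrow> ('m, 'n) vfield \<Rightarrow> ('m, 'n) vfield" where
  "second_fundamental_form A g W X Y p = (1/2) *\<^sub>R
     g_proj g (g_perp g W) p (levi_civita A g X Y p + levi_civita A g Y X p)"

definition totally_geodesic ::
  "('m, 'n::finite) chart set \<Rightarrow> ('m, 'n) metric \<Rightarrow> ('m, 'n) distribution \<Rightarrow> bool" where
  "totally_geodesic A g W \<longleftrightarrow>
     (\<forall>X Y. section_of A W X \<and> section_of A W Y \<longrightarrow>
        (\<forall>p. second_fundamental_form A g W X Y p = 0))"

definition integrable_distribution ::
  "('m, 'n::finite) chart set \<Rightarrow> ('m, 'n) distribution \<Rightarrow> bool" where
  "integrable_distribution A W \<longleftrightarrow>
     (\<forall>X Y. section_of A W X \<and> section_of A W Y \<longrightarrow> section_of A W (lie_bracket A X Y))"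

definition mixed_totally_geodesic ::
  "('m, 'n::finite) chart set \<Rightarrow> ('m, 'n) metric \<Rightarrow> ('m, 'n) distribution \<Rightarrow>
   ('m, 'n) distribution \<Rightarrow> bool" where
  "mixed_totally_geodesic A g V W \<longleftrightarrow>
     (\<forall>X Y. section_of A V X \<and> section_of A W Y \<longrightarrow>
        (\<forall>p. g_proj g (g_perp g (dist_sum V W)) p
               (levi_civita A g X Y p + levi_civita A g Y X p) = 0))"

definition mixed_integrable ::
  "('m, 'n::finite) chart set \<Rightarrow> ('m, 'n) metric \<Rightarrow> ('m, 'n) distribution \<Rightarrow>
   ('m, 'n) distribution \<Rightarrow> bool" where
  "mixed_integrable A g V W \<longleftrightarrow>
     (\<forall>X Y. section_of A V X \<and> section_of A W Y \<longrightarrow>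
        (\<forall>p. g_proj g (g_perp g (dist_sum V W)) p (lie_bracket A X Y p) = 0))"

definition locally_product ::
  "('m, 'n::finite) chart set \<Rightarrow> nat \<Rightarrow> (nat \<Rightarrow> ('m, 'n) distribution) \<Rightarrow>
   ('m, 'n) metric \<Rightarrow> bool" where
  "locally_product A k D g \<longleftrightarrow>
     (\<forall>\<mu>\<in>{1..k}. integrable_distribution A (D \<mu>) \<and> totally_geodesic A g (D \<mu>))"

end

theory Submission
 imports Defs
begin

text \<open>
 A variation of the metric or of the contorsion changes the connection by a tensor \<open>S\<close>, and the mixed scalar
 curvature by the trace of a covariant derivative of \<open>S\<close> over the pairs \<open>a, b\<close> of frame vectors from different
 distributions. With \<open>A(u, v, w) = \<langle>S u v, w\<rangle> - \<langle>S u w, v\<rangle>\<close>, the terms containing derivatives of \<open>S\<close> are the divergence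
 of the field \<open>Z = \<Sum> \<epsilon>\<^sub>a \<epsilon>\<^sub>b A(a, a, b) b\<close>, up to terms algebraic in \<open>S\<close>, and the divergence integrates to zero.

 For \<open>S = \<phi> \<langle>x, \<cdot>\<rangle> \<langle>y, \<cdot>\<rangle> z\<close> with a bump function \<open>\<phi>\<close>, the algebraic terms are the sum of a term in the contorsion,
 which is symmetric in \<open>y, z\<close>, and of a term in the derivatives of the frame, which is skew in \<open>y, z\<close>. Hence both vanish
 for a critical pair: the first gives the conditions on the contorsion, the second gives \<open>\<langle>\<nabla>\<^sub>z x, y\<rangle> = 0\<close> for \<open>x, z\<close> in
 one distribution and \<open>y\<close> in another one. Conversely, for a product metric and such a contorsion both connections
 preserve all the distributions, so that all algebraic terms vanish, and a variation of the metric enters only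
 through \<open>S\<close>.
\<close>

section \<open>Calculus of smooth maps\<close>

text \<open>The symmetry in y, z of the contorsion term is the total symmetry of a statistical
  contorsion; the skewness of the other term holds because the derivatives of the frame meet S only
  through A, which changes sign. The hypotheses on k and on the ranks enter through traces. On a
  distribution of rank n the diagonal equations yield (n - 1) h = 0 for one common value h, which
  says nothing for n = 1; the single distribution that may be a line is therefore compared with a
  larger one. For the contorsion only traces over complements of distributions are controlled, and
  the trace over one distribution is recovered as the trace over the complement of another one. In
  the converse direction all adapted metrics share one orthogonal splitting. A curvature that maps
  every distribution to itself has mixed trace zero for each of these metrics, so the moving frame
  and the moving volume contribute nothing. Tangent spaces are identified through charts chosen
  without any regularity. This shapes the foundations: each object gets a coordinate formula and an
  argument that the chart does not matter.\<close>

abbreviation dird :: "('a::real_normed_vector => 'b::real_normed_vector) => 'a => 'a => 'b" where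
 "dird f x v \<equiv> frechet_derivative f (at x) v"

lemma dird_eq: "(f has_derivative f') (at x) ==> dird f x v = f' v" by (simp add: frechet_derivative_at[symmetric])

lemma differentiable_dird: "f differentiable (at x) ==> (f has_derivative dird f x) (at x)" by (simp add: frechet_derivative_works)

section \<open>Smoothness of finite order and its closure properties\<close>

lemma iter_dderiv_append: "iter_dderiv (vs @ ws) f = iter_dderiv vs (iter_dderiv ws f)" by (induct vs) auto

text \<open>Counting the order makes the product rule and the chain rule provable by induction. The
  recursion peels off the innermost derivative, whereas \<open>iter_dderiv\<close> adds a direction
  on the outside; \<open>nsmooth_iff\<close> reconciles the two by reading the list of directions
  from its end.\<close>

primrec nsmooth :: "nat => 'a set => ('a::euclidean_space => 'b::real_normed_vector) => bool" where
 "nsmooth 0 S f \<longleftrightarrow> (ALL x:S. f differentiable (at x))"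
| "nsmooth (Suc k) S f \<longleftrightarrow> (ALL x:S. f differentiable (at x)) & (ALL v. nsmooth k S (%x. dird f x v))"

lemma nsmooth_iff:
 "nsmooth k S f \<longleftrightarrow> (ALL vs. length vs <= k --> (ALL x:S. iter_dderiv vs f differentiable (at x)))" proof (induct k arbitrary: f)
 case 0 show ?case by simp
next
 case (Suc k)
 show ?case proof
  assume a: "nsmooth (Suc k) S f"
  show "ALL vs. length vs <= Suc k --> (ALL x:S. iter_dderiv vs f differentiable (at x))" proof (intro allI impI ballI)
   fix vs :: "'a list" and x assume l: "length vs <= Suc k" and x: "x : S"
   show "iter_dderiv vs f differentiable (at x)" proof (cases vs rule: rev_cases)
    case Nil thus ?thesis using a x by simp
   next
    case (snoc ws w)
    thus ?thesis using a x l Suc[of "%x. dird f x w"] by (auto simp: iter_dderiv_append)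
   qed
  qed
 next
  assume a: "ALL vs. length vs <= Suc k --> (ALL x:S. iter_dderiv vs f differentiable (at x))"
  have "nsmooth k S (%x. dird f x v)" for v unfolding Suc proof (intro allI impI ballI)
   fix vs :: "'a list" and x assume "length vs <= k" "x : S"
   thus "iter_dderiv vs (%x. dird f x v) differentiable (at x)" using a[rule_format, of "vs @ [v]" x] by (simp add: iter_dderiv_append)
  qed
  moreover have "ALL x:S. f differentiable (at x)" using a[rule_format, of "[]"] by simp
  ultimately show "nsmooth (Suc k) S f" by simp
 qed
qed

lemma smooth_on_iff_nsmooth: "smooth_on S f \<longleftrightarrow> (ALL k. nsmooth k S f)" unfolding smooth_on_def nsmooth_iff by blast

lemma nsmooth_differentiable: "nsmooth k S f ==> x : S ==> f differentiable (at x)" by (cases k) auto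

lemma nsmooth_SucD: "nsmooth (Suc k) S f ==> nsmooth k S f" unfolding nsmooth_iff by auto

lemma nsmooth_cong:
 assumes "open S" "!!x. x : S ==> f x = g x" shows "nsmooth k S f \<longleftrightarrow> nsmooth k S g" proof -
 have diff: "f differentiable (at x)" if "open S" "!!x. x : S ==> f x = g x" "x : S"
  "g differentiable (at x)" for f g :: "'a => 'b" and x and S
  using that has_derivative_transform_within_open[of g _ x UNIV S f] unfolding differentiable_def by metis
 show ?thesis using assms proof (induct k arbitrary: f g)
  case 0 thus ?case using diff[of S f g] diff[of S g f] unfolding nsmooth.simps by metis
 next
  case (Suc k)
  have 1: "nsmooth k S (%x. dird f x v) \<longleftrightarrow> nsmooth k S (%x. dird g x v)"
   if "ALL x:S. f differentiable (at x)" for v proof (rule Suc(1)[OF Suc(2)])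
   fix x assume "x : S"
   thus "dird f x v = dird g x v" using frechet_derivative_transform_within_open[of f x S g] that Suc(2,3) by metis
  qed
  have 2: "(ALL x:S. f differentiable (at x)) \<longleftrightarrow> (ALL x:S. g differentiable (at x))"
   using diff[of S f g] diff[of S g f] Suc(2,3) by metis
  show ?case unfolding nsmooth.simps 2[symmetric] using 1 by blast
 qed
qed

text \<open>Lets each induction step work with a convenient formula for the derivative instead of
  the chosen one; openness of S allows the exchange, since a derivative depends on values near the
  point only.\<close>

lemma nsmooth_Suc_derivI:
 assumes "open S" "!!x. x : S ==> (f has_derivative f' x) (at x)"
  "!!v. nsmooth k S (%x. f' x v)" shows "nsmooth (Suc k) S f" proof -
 have "nsmooth k S (%x. dird f x v)" for v by (subst nsmooth_cong[OF assms(1)]) (auto simp: dird_eq[OF assms(2)] assms(3))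
 thus ?thesis using assms(2) unfolding differentiable_def nsmooth.simps by blast
qed

lemma nsmooth_const: "nsmooth k S (%x. c)" by (induct k arbitrary: c) auto

lemma nsmooth_add:
 assumes "open S" "nsmooth k S f" "nsmooth k S g" shows "nsmooth k S (%x. f x + g x)" using assms(2,3) proof (induct k arbitrary: f g)
 case (Suc k)
 show ?case by (rule nsmooth_Suc_derivI[OF assms(1) has_derivative_add[OF differentiable_dird differentiable_dird]])
   (use Suc in auto)
qed auto

lemma nsmooth_bounded_linear:
 assumes "open S" "bounded_linear h" "nsmooth k S f" shows "nsmooth k S (%x. h (f x))" using assms(3) proof (induct k arbitrary: f)
 case 0 thus ?case using bounded_linear.has_derivative[OF assms(2)] unfolding differentiable_def nsmooth.simps by blast
next
 case (Suc k)
 show ?case by (rule nsmooth_Suc_derivI[OF assms(1) bounded_linear.has_derivative[OF assms(2) differentiable_dird]])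
   (use Suc in auto)
qed

lemma nsmooth_bilinear:
 assumes "open S" "bounded_bilinear h" "nsmooth k S f" "nsmooth k S g" shows "nsmooth k S (%x. h (f x) (g x))" using assms(3,4)
proof (induct k arbitrary: f g)
 case 0 thus ?case using bounded_bilinear.FDERIV[OF assms(2)] unfolding differentiable_def nsmooth.simps by blast
next
 case (Suc k)
 show ?case by (rule nsmooth_Suc_derivI[OF assms(1) bounded_bilinear.FDERIV[OF assms(2) differentiable_dird differentiable_dird]])
   (use Suc nsmooth_SucD[OF Suc(2)] nsmooth_SucD[OF Suc(3)] in \<open>auto intro!: nsmooth_add assms(1)\<close>)
qed

lemma nsmooth_sum:
 assumes "open S" "finite I" "!!i. i : I ==> nsmooth k S (f i)" shows "nsmooth k S (%x. SUM i:I. f i x)"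
 using assms(2,3) by (induct) (auto intro: nsmooth_const nsmooth_add assms(1))

lemma nsmooth_compose:
 fixes f :: "'b::euclidean_space => 'c::real_normed_vector" and g :: "'a::euclidean_space => 'b"
 assumes "open S" "nsmooth k T f" "nsmooth k S g" "g ` S <= T" shows "nsmooth k S (%x. f (g x))" using assms(2,3) proof (induct k arbitrary: f)
 case 0
 thus ?case using assms(4) differentiable_chain_at[of g _ f] by (auto simp: o_def)
next
 case (Suc k)
 have g: "nsmooth k S g" using Suc nsmooth_SucD by blast
 show ?case proof (rule nsmooth_Suc_derivI[OF assms(1)])
  fix x assume x: "x : S"
  have "(f has_derivative dird f (g x)) (at (g x))" using Suc x assms(4) by (intro differentiable_dird) auto
  moreover have "(g has_derivative dird g x) (at x)" using Suc x by (intro differentiable_dird) auto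
  ultimately have d: "((%x. f (g x)) has_derivative (%v. dird f (g x) (dird g x v))) (at x)" using diff_chain_at[of g _ x f] by (simp add: o_def)
  interpret lf: bounded_linear "dird f (g x)" using Suc x assms(4) by (intro has_derivative_bounded_linear[OF differentiable_dird]) auto
  \<comment> \<open>The induction hypothesis covers \<open>dird f (g x) b\<close> for a fixed
    direction b only, so the direction that varies with x is expanded in the basis.\<close>
  have e: "dird f (g x) w = (SUM b:Basis. (w \<bullet> b) *\<^sub>R dird f (g x) b)" for w
   by (subst (1) euclidean_representation[symmetric]) (simp add: lf.sum lf.scaleR)
  show "((%x. f (g x)) has_derivative (%v. SUM b:Basis. (dird g x v \<bullet> b) *\<^sub>R dird f (g x) b)) (at x)"
   using d unfolding e[of "dird g x _"] .
 next
  fix v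
  have "nsmooth k S (%x. dird f (g x) b)" for b using Suc(1)[of "%y. dird f y b"] Suc(2) g by simp
  moreover have "nsmooth k S (%x. dird g x v \<bullet> b)" for b
   using Suc(3) nsmooth_bounded_linear[OF assms(1) bounded_linear_inner_left, of k "%x. dird g x v" b] unfolding nsmooth.simps by blast
  ultimately show "nsmooth k S (%x. SUM b:Basis. (dird g x v \<bullet> b) *\<^sub>R dird f (g x) b)"
   by (intro nsmooth_sum nsmooth_bilinear[OF _ bounded_bilinear_scaleR] assms(1) finite_Basis)
 qed
qed

lemma smooth_on_differentiable: "smooth_on S f ==> x : S ==> f differentiable (at x)"
 unfolding smooth_on_iff_nsmooth using nsmooth_differentiable by blast

lemma smooth_on_has_derivative: "smooth_on S f ==> x : S ==> (f has_derivative dird f x) (at x)"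
 using smooth_on_differentiable differentiable_dird by blast

lemma smooth_on_continuous_on: "smooth_on S f ==> continuous_on S f" using smooth_on_differentiable differentiable_imp_continuous_within
 by (meson continuous_at_imp_continuous_on)

lemma smooth_on_subset: "smooth_on T f ==> S <= T ==> smooth_on S f" unfolding smooth_on_def by blast

lemma smooth_on_pointwise: "(!!x. x : S ==> EX U. x : U & smooth_on U f) ==> smooth_on S f" unfolding smooth_on_def by blast

lemma smooth_on_cong:
 assumes "open S" "!!x. x : S ==> f x = g x" shows "smooth_on S f \<longleftrightarrow> smooth_on S g"
 unfolding smooth_on_iff_nsmooth using nsmooth_cong[OF assms] by simp

lemma smooth_on_dird: "smooth_on S f ==> smooth_on S (%x. dird f x v)" unfolding smooth_on_iff_nsmooth using nsmooth.simps(2) by blast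

lemma smooth_on_const: "smooth_on S (%x. c)" by (simp add: smooth_on_iff_nsmooth nsmooth_const)

lemma smooth_on_add: "open S ==> smooth_on S f ==> smooth_on S g ==> smooth_on S (%x. f x + g x)" by (simp add: smooth_on_iff_nsmooth nsmooth_add)

lemma smooth_on_bounded_linear:
 "open S ==> bounded_linear h ==> smooth_on S f ==> smooth_on S (%x. h (f x))" by (simp add: smooth_on_iff_nsmooth nsmooth_bounded_linear)

lemma smooth_on_bilinear:
 "open S ==> bounded_bilinear h ==> smooth_on S f ==> smooth_on S g ==> smooth_on S (%x. h (f x) (g x))"
 by (simp add: smooth_on_iff_nsmooth nsmooth_bilinear)

lemma smooth_on_sum:
 "open S ==> (!!i. i : I ==> smooth_on S (f i)) ==> smooth_on S (%x. SUM i:I. f i x)"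
 by (cases "finite I") (auto simp: smooth_on_iff_nsmooth nsmooth_const intro!: nsmooth_sum)

lemma smooth_on_compose:
 "open S ==> smooth_on T f ==> smooth_on S g ==> g ` S <= T ==> smooth_on S (%x. f (g x))"
 using nsmooth_compose unfolding smooth_on_iff_nsmooth by blast

lemma nsmooth_ident: "open S ==> nsmooth k S (%x. x)" by (cases k) (auto intro!: nsmooth_const)

lemma smooth_on_ident: "open S ==> smooth_on S (%x. x)" by (simp add: smooth_on_iff_nsmooth nsmooth_ident)

lemma smooth_on_linear: "open S ==> bounded_linear h ==> smooth_on S h" using smooth_on_bounded_linear[of S h "%x. x"] smooth_on_ident by blast

lemma smooth_on_minus: "open S ==> smooth_on S f ==> smooth_on S (%x. - f x)"
 by (rule smooth_on_bounded_linear) (auto intro: bounded_linear_minus bounded_linear_ident)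

lemma smooth_on_diff: "open S ==> smooth_on S f ==> smooth_on S g ==> smooth_on S (%x. f x - g x)"
 using smooth_on_add[OF _ _ smooth_on_minus] by fastforce

lemma smooth_on_scaleR:
 "open S ==> smooth_on S f ==> smooth_on S g ==> smooth_on S (%x. f x *\<^sub>R g x)" by (rule smooth_on_bilinear[OF _ bounded_bilinear_scaleR])

lemma smooth_on_mult:
 fixes f :: "_ => real" shows "open S ==> smooth_on S f ==> smooth_on S g ==> smooth_on S (%x. f x * g x)"
 by (rule smooth_on_bilinear[OF _ bounded_bilinear_mult])

lemma smooth_on_inner:
 "open S ==> smooth_on S f ==> smooth_on S g ==> smooth_on S (%x. f x \<bullet> g x)" by (rule smooth_on_bilinear[OF _ bounded_bilinear_inner])

lemma smooth_on_vec_nth: "open S ==> smooth_on S f ==> smooth_on S (%x. f x $ i)" by (rule smooth_on_bounded_linear[OF _ bounded_linear_vec_nth])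

lemma smooth_on_prod:
 fixes f :: "_ => _ => real"
 assumes "open S" "!!i. i : I ==> smooth_on S (f i)" shows "smooth_on S (%x. PROD i:I. f i x)"
 using assms(2) by (induct I rule: infinite_finite_induct)
  (auto intro: smooth_on_const smooth_on_mult assms(1))

lemma smooth_on_vec_lambda:
 assumes "open S" "!!i. smooth_on S (%x. f x $ i)" shows "smooth_on S (f :: _ => ('b::real_normed_vector)^'n)" proof -
 have axis: "bounded_linear (axis i :: 'b => 'b^'n)" for i by (intro bounded_linear_intro[where K = 1])
   (auto simp: vec_eq_iff axis_def norm_vec_def L2_set_def if_distrib[of norm] if_distrib[of "%x. x ^ 2"] cong: if_cong)
 have "f x = (SUM i:UNIV. axis i (f x $ i))" for x by (simp add: vec_eq_iff axis_def if_distrib[of "%v. v $ _"] cong: if_cong)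
 hence "smooth_on S f \<longleftrightarrow> smooth_on S (%x. SUM i:UNIV. axis i (f x $ i))" by presburger
 thus ?thesis using assms by (auto intro!: smooth_on_sum smooth_on_bounded_linear[OF _ axis])
qed

lemma smooth_on_vec: "open S ==> (!!i. smooth_on S (%x. f x i)) ==> smooth_on S (%x. \<chi> i. f x i)" by (rule smooth_on_vec_lambda) auto

text \<open>\<open>smooth_on_dird\<close> treats a fixed direction; a direction depending on x is
  expanded in the basis, with smooth coefficients.\<close>

lemma smooth_on_dird_field:
 fixes f :: "'a::euclidean_space => 'b::real_normed_vector"
 assumes "open S" "smooth_on S f" "smooth_on S g" shows "smooth_on S (%x. dird f x (g x))" proof -
 have "dird f x (g x) = (SUM b:Basis. (g x \<bullet> b) *\<^sub>R dird f x b)" if "x : S" for x proof -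
  interpret lf: bounded_linear "dird f x" using assms that by (intro has_derivative_bounded_linear[OF smooth_on_has_derivative])
  show ?thesis by (subst (1) euclidean_representation[symmetric]) (simp add: lf.sum lf.scaleR)
 qed
 thus ?thesis by (subst smooth_on_cong[OF assms(1)])
   (auto intro!: smooth_on_sum smooth_on_scaleR smooth_on_inner smooth_on_const smooth_on_dird assms)
qed

text \<open>The derivative of the inverse is a polynomial in the inverse itself, so each order
  follows from the previous one.\<close>

lemma smooth_on_real_inverse: "smooth_on {x::real. x ~= 0} inverse" proof -
 have o: "open {x::real. x ~= 0}" by (simp add: open_Collect_neq)
 have "nsmooth k {x::real. x ~= 0} inverse" for k proof (induct k)
  case 0 thus ?case by (auto intro!: differentiable_inverse[where f = "%x. x"])
 next
  case (Suc k)
  show ?case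
   apply (rule nsmooth_Suc_derivI[OF o])
    apply (rule has_derivative_inverse', simp)
   apply (intro nsmooth_bounded_linear[OF o bounded_linear_minus[OF bounded_linear_ident]]
     nsmooth_bilinear[OF o bounded_bilinear_mult] Suc nsmooth_const)
   done
 qed
 thus ?thesis by (simp add: smooth_on_iff_nsmooth)
qed

lemma smooth_on_inverse:
 fixes f :: "_ => real" shows "open S ==> smooth_on S f ==> (!!x. x : S ==> f x ~= 0) ==> smooth_on S (%x. inverse (f x))"
 by (rule smooth_on_compose[OF _ smooth_on_real_inverse]) auto

lemma smooth_on_divide:
 fixes f :: "_ => real" shows "open S ==> smooth_on S f ==> smooth_on S g ==> (!!x. x : S ==> g x ~= 0) ==> smooth_on S (%x. f x / g x)"
 unfolding divide_inverse by (intro smooth_on_mult smooth_on_inverse)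

text \<open>The derivative of the root is half its inverse: a smooth function composed with the
  root, whose smoothness of the previous order is the induction hypothesis.\<close>

lemma smooth_on_real_sqrt: "smooth_on {0<..} sqrt" proof -
 have o: "open {0::real<..}" by simp
 have "nsmooth k {0<..} sqrt" for k proof (induct k)
  case 0
  have "sqrt differentiable (at x)" if "0 < x" for x using that DERIV_real_sqrt[of x] by (auto simp: has_field_derivative_def differentiable_def)
  thus ?case by auto
 next
  case (Suc k)
  show ?case proof (rule nsmooth_Suc_derivI[OF o])
   show "(sqrt has_derivative (*) (inverse (sqrt x) / 2)) (at x)" if "x : {0<..}" for x
    using that DERIV_real_sqrt[of x] by (auto simp: has_field_derivative_def)
   have "nsmooth k {0<..} (%x. inverse (sqrt x))" proof -
    have "nsmooth k {x::real. x ~= 0} inverse" using smooth_on_real_inverse smooth_on_iff_nsmooth by blast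
    from nsmooth_compose[OF o this Suc] show ?thesis by fastforce
   qed
   hence "nsmooth k {0<..} (%x. (v / 2) * inverse (sqrt x))" for v :: real by (rule nsmooth_bounded_linear[OF o bounded_linear_mult_right])
   thus "nsmooth k {0<..} (%x. inverse (sqrt x) / 2 * v)" for v :: real by (simp add: mult_ac)
  qed
 qed
 thus ?thesis by (simp add: smooth_on_iff_nsmooth)
qed

lemma smooth_on_sqrt:
 "open S ==> smooth_on S f ==> (!!x. x : S ==> 0 < f x) ==> smooth_on S (%x. sqrt (f x))" by (rule smooth_on_compose[OF _ smooth_on_real_sqrt]) auto

text \<open>Near each point f keeps its sign, so the modulus is f or - f there.\<close>

lemma smooth_on_sqrt_abs:
 assumes "open S" "smooth_on S f" "!!x. x : S ==> f x ~= 0" shows "smooth_on S (%x. sqrt \<bar>f x\<bar>)" proof (rule smooth_on_pointwise)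
 fix x assume x: "x : S"
 have cf: "continuous_on S f" using assms smooth_on_continuous_on by blast
 show "EX U. x : U & smooth_on U (%x. sqrt \<bar>f x\<bar>)" proof (cases "f x > 0")
  case True
  have o: "open (S Int f -` {0<..})" using continuous_open_preimage[OF cf assms(1)] by simp
  have "smooth_on (S Int f -` {0<..}) (%x. sqrt (f x))" using assms smooth_on_subset by (intro smooth_on_sqrt o) blast+
  hence "smooth_on (S Int f -` {0<..}) (%x. sqrt \<bar>f x\<bar>)" by (subst smooth_on_cong[OF o, of _ "%x. sqrt (f x)"]) auto
  with True x show ?thesis by (intro exI[of _ "S Int f -` {0<..}"]) auto
 next
  case False
  have o: "open (S Int f -` {..<0})" using continuous_open_preimage[OF cf assms(1)] by simp
  have "smooth_on (S Int f -` {..<0}) (%x. - f x)" using assms smooth_on_subset by (intro smooth_on_minus o) blast+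
  hence "smooth_on (S Int f -` {..<0}) (%x. sqrt (- f x))" by (intro smooth_on_sqrt o) auto
  hence "smooth_on (S Int f -` {..<0}) (%x. sqrt \<bar>f x\<bar>)" by (subst smooth_on_cong[OF o, of _ "%x. sqrt (- f x)"]) auto
  with False x assms(3)[of x] show ?thesis by (intro exI[of _ "S Int f -` {..<0}"]) auto
 qed
qed

lemma smooth_on_det:
 fixes M :: "'a::euclidean_space => real^'n^'n"
 assumes "open S" "!!i j. smooth_on S (%x. M x $ i $ j)" shows "smooth_on S (%x. det (M x))" unfolding det_def
 by (intro smooth_on_sum smooth_on_mult smooth_on_const smooth_on_prod assms)

lemma matrix_inv_right_left:
 fixes B :: "real^'n^'n"
 assumes "invertible B" shows "B ** matrix_inv B = mat 1" "matrix_inv B ** B = mat 1"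
 using someI_ex[of "%B'. B ** B' = mat 1 & B' ** B = mat 1"] assms unfolding invertible_def matrix_inv_def by auto

text \<open>Cramer's rule displays the entries of the inverse as quotients of determinants. This is
  how the inverse metric becomes smooth, also in families.\<close>

lemma matrix_inv_cramer:
 fixes B :: "real^'n^'n"
 assumes "det B ~= 0" shows "matrix_inv B $ k $ j = det (\<chi> i l. if l = k then axis j 1 $ i else B $ i $ l) / det B" proof -
 have inv: "invertible B" using assms invertible_det_nz by blast
 have "B *v (matrix_inv B *v axis j 1) = axis j 1" by (simp add: matrix_vector_mul_assoc matrix_inv_right_left[OF inv])
 hence "matrix_inv B *v axis j 1 = (\<chi> k. det (\<chi> i l. if l = k then axis j 1 $ i else B $ i $ l) / det B)" using cramer[OF assms] by blast
 moreover have "(matrix_inv B *v axis j 1) $ k = matrix_inv B $ k $ j"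
  by (simp add: matrix_vector_mult_def axis_def if_distrib[of "%x. _ * x"] cong: if_cong)
 ultimately show ?thesis by simp
qed

lemma smooth_on_matrix_inv:
 fixes M :: "'a::euclidean_space => real^'n^'n"
 assumes "open S" "!!i j. smooth_on S (%x. M x $ i $ j)" "!!x. x : S ==> det (M x) ~= 0" shows "smooth_on S (%x. matrix_inv (M x) $ i $ j)" proof -
 have "smooth_on S (%x. det (\<chi> a l. if l = i then axis j 1 $ a else M x $ a $ l) / det (M x))"
 proof (intro smooth_on_divide smooth_on_det assms)
  show "smooth_on S (%x. (\<chi> a l. if l = i then axis j 1 $ a else M x $ a $ l) $ ia $ ja)" for ia ja
   by (cases "ja = i") (auto intro: smooth_on_const assms)
 qed
 thus ?thesis by (subst smooth_on_cong[OF assms(1)]) (auto simp: matrix_inv_cramer assms(3))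
qed


section \<open>Symmetry of second derivatives\<close>

lemma second_difference:
 fixes f :: "'a::euclidean_space => real"
 assumes "open S" "smooth_on S f" "0 < h"
  "!!s t. 0 <= s ==> s <= h ==> 0 <= t ==> t <= h ==> x + s *\<^sub>R u + t *\<^sub>R v : S" shows "EX s t. 0 <= s & s <= h & 0 <= t & t <= h \<and>
  f (x + h *\<^sub>R u + h *\<^sub>R v) - f (x + h *\<^sub>R u) - f (x + h *\<^sub>R v) + f x =
  h^2 * dird (%y. dird f y u) (x + s *\<^sub>R u + t *\<^sub>R v) v" proof -
 \<comment> \<open>The second difference over the parallelogram with sides h u and h v is an
   increment of F. The mean value theorem is applied to F along u, and then along v to the
   derivative of f in the direction u.\<close>
 define F where "F s = f (x + s *\<^sub>R u + h *\<^sub>R v) - f (x + s *\<^sub>R u)" for s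
 have line: "((%s. F (a + s *\<^sub>R w)) has_real_derivative dird F (a + s *\<^sub>R w) w) (at s)"
  if "smooth_on S F" "a + s *\<^sub>R w : S" for F :: "'a => real" and a w s proof -
  have d: "(F has_derivative dird F (a + s *\<^sub>R w)) (at (a + s *\<^sub>R w))" using that smooth_on_has_derivative by blast
  interpret bounded_linear "dird F (a + s *\<^sub>R w)" using d has_derivative_bounded_linear by blast
  have "((%s. a + s *\<^sub>R w) has_derivative (%h. h *\<^sub>R w)) (at s)" by (auto intro!: derivative_eq_intros)
  from diff_chain_at[OF this d] have "((%s. F (a + s *\<^sub>R w)) has_derivative (%h. dird F (a + s *\<^sub>R w) (h *\<^sub>R w))) (at s)"
   by (simp add: o_def)
  moreover have "(%h. dird F (a + s *\<^sub>R w) (h *\<^sub>R w)) = (*) (dird F (a + s *\<^sub>R w) w)" by (auto simp: fun_eq_iff scaleR)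
  ultimately show ?thesis unfolding has_field_derivative_def by simp
 qed
 have "(F has_real_derivative dird f (x + s *\<^sub>R u + h *\<^sub>R v) u - dird f (x + s *\<^sub>R u) u) (at s)"
  if "0 <= s" "s <= h" for s unfolding F_def using line[OF assms(2), of "x + h *\<^sub>R v" s u] line[OF assms(2), of "x" s u]
   assms(4)[of s h] assms(4)[of s 0] that assms(3) by (intro DERIV_diff) (auto simp: algebra_simps)
 from MVT2[OF assms(3) this] obtain s where s: "0 < s" "s < h"
  "F h - F 0 = h * (dird f (x + s *\<^sub>R u + h *\<^sub>R v) u - dird f (x + s *\<^sub>R u) u)" by auto
 have "((%t. dird f (x + s *\<^sub>R u + t *\<^sub>R v) u) has_real_derivative
   dird (%y. dird f y u) (x + s *\<^sub>R u + t *\<^sub>R v) v) (at t)" if "0 <= t" "t <= h" for t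
  using line[OF smooth_on_dird[OF assms(2)], of "x + s *\<^sub>R u" t v u] s that assms(4)[of s t] by auto
 from MVT2[OF assms(3) this] obtain t where t: "0 < t" "t < h"
  "dird f (x + s *\<^sub>R u + h *\<^sub>R v) u - dird f (x + s *\<^sub>R u + 0 *\<^sub>R v) u =
    h * dird (%y. dird f y u) (x + s *\<^sub>R u + t *\<^sub>R v) v" by auto
 have "F h - F 0 = h^2 * dird (%y. dird f y u) (x + s *\<^sub>R u + t *\<^sub>R v) v" using s t by (simp add: power2_eq_square)
 moreover have "F h - F 0 = f (x + h *\<^sub>R u + h *\<^sub>R v) - f (x + h *\<^sub>R u) - f (x + h *\<^sub>R v) + f x" by (simp add: F_def)
 ultimately show ?thesis using s t by (intro exI[of _ s] exI[of _ t]) auto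
qed

text \<open>The second difference does not change when u and v are exchanged, so it equals
  \<open>h^2\<close> times either mixed derivative at points close to x; continuity of both
  derivatives at x excludes a gap between them.\<close>

lemma second_dird_symmetric_real:
 fixes f :: "'a::euclidean_space => real"
 assumes S: "open S" and f: "smooth_on S f" and x: "x : S" shows "dird (%y. dird f y u) x v = dird (%y. dird f y v) x u" proof (rule ccontr)
 define a where "a = (%x. dird (%y. dird f y u) x v)"
 define b where "b = (%x. dird (%y. dird f y v) x u)"
 assume "\<not> ?thesis"
 hence ne: "a x ~= b x" by (simp add: a_def b_def)
 \<comment> \<open>Half the gap: a value closer than e to \<open>a x\<close> differs from every
   value closer than e to \<open>b x\<close>.\<close>
 define e where "e = \<bar>a x - b x\<bar> / 2"
 have e: "e > 0" using ne by (simp add: e_def)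
 have c: "isCont a x" "isCont b x" using smooth_on_continuous_on[OF smooth_on_dird[OF smooth_on_dird[OF f]]] S x
  unfolding a_def b_def by (auto simp: continuous_on_eq_continuous_at)
 from c(1) e obtain d1 where d1: "d1 > 0" "!!y. dist y x < d1 ==> dist (a y) (a x) < e" unfolding continuous_at_eps_delta by blast
 from c(2) e obtain d2 where d2: "d2 > 0" "!!y. dist y x < d2 ==> dist (b y) (b x) < e" unfolding continuous_at_eps_delta by blast
 from S x obtain d3 where d3: "d3 > 0" "ball x d3 <= S" using open_contains_ball by blast
 define d where "d = min d1 (min d2 d3)"
 have d: "d > 0" using d1 d2 d3 by (simp add: d_def)
 \<comment> \<open>Keeps the whole parallelogram within distance d of x. The summand 1 keeps the
   denominator positive when both vectors are 0.\<close>
 define h where "h = d / (2 * (norm u + norm v + 1))"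
 have h: "h > 0" using d by (simp add: h_def add_nonneg_pos)
 have hb: "h * (norm u + norm v) < d" proof -
  have "norm u + norm v + 1 > 0" by (simp add: add_nonneg_pos)
  hence "h * (norm u + norm v + 1) = d / 2" unfolding h_def by (simp add: field_simps)
  hence "h * (norm u + norm v) <= d / 2" using h by (simp add: algebra_simps)
  thus ?thesis using d by linarith
 qed
 have near: "dist (x + s *\<^sub>R u + t *\<^sub>R v) x < d" if "0 <= s" "s <= h" "0 <= t" "t <= h" for s t proof -
  have "dist (x + s *\<^sub>R u + t *\<^sub>R v) x = norm (s *\<^sub>R u + t *\<^sub>R v)" by (simp add: dist_norm)
  also have "... <= norm (s *\<^sub>R u) + norm (t *\<^sub>R v)" by (rule norm_triangle_ineq)
  also have "... = s * norm u + t * norm v" using that by simp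
  also have "... <= h * norm u + h * norm v" using that by (intro add_mono mult_right_mono) auto
  finally show ?thesis using hb by (simp add: algebra_simps)
 qed
 have inS: "x + s *\<^sub>R u + t *\<^sub>R v : S" if "0 <= s" "s <= h" "0 <= t" "t <= h" for s t
  using near[OF that] d3 by (auto simp: d_def dist_commute subset_eq)
 from second_difference[OF S f h inS] obtain s t where st: "0 <= s" "s <= h" "0 <= t" "t <= h"
  and A: "f (x + h *\<^sub>R u + h *\<^sub>R v) - f (x + h *\<^sub>R u) - f (x + h *\<^sub>R v) + f x = h^2 * a (x + s *\<^sub>R u + t *\<^sub>R v)"
  unfolding a_def by blast
 have inS': "x + s *\<^sub>R v + t *\<^sub>R u : S" if "0 <= s" "s <= h" "0 <= t" "t <= h" for s t
  using inS[of t s] that by (simp add: algebra_simps)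
 from second_difference[OF S f h inS'] obtain s' t' where st': "0 <= s'" "s' <= h" "0 <= t'" "t' <= h"
  and B: "f (x + h *\<^sub>R v + h *\<^sub>R u) - f (x + h *\<^sub>R v) - f (x + h *\<^sub>R u) + f x = h^2 * b (x + s' *\<^sub>R v + t' *\<^sub>R u)"
  unfolding b_def by blast
 have "h^2 * a (x + s *\<^sub>R u + t *\<^sub>R v) = h^2 * b (x + s' *\<^sub>R v + t' *\<^sub>R u)" using A B by (simp add: algebra_simps)
 hence "a (x + s *\<^sub>R u + t *\<^sub>R v) = b (x + t' *\<^sub>R u + s' *\<^sub>R v)" using h by (simp add: algebra_simps)
 moreover have "dist (a (x + s *\<^sub>R u + t *\<^sub>R v)) (a x) < e" using near[OF st] d1(2) by (simp add: d_def)
 moreover have "dist (b (x + t' *\<^sub>R u + s' *\<^sub>R v)) (b x) < e" using near[of t' s'] st' d2(2) by (simp add: d_def)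
 ultimately show False unfolding e_def dist_real_def by argo
qed

lemma dird_inner:
 assumes "f differentiable (at x)" shows "dird (%x. f x \<bullet> b) x v = dird f x v \<bullet> b"
 by (rule dird_eq) (auto intro!: derivative_eq_intros differentiable_dird assms)

lemma second_dird_symmetric:
 fixes f :: "'a::euclidean_space => 'b::euclidean_space"
 assumes S: "open S" and f: "smooth_on S f" and x: "x : S" shows "dird (%y. dird f y u) x v = dird (%y. dird f y v) x u" proof (rule euclidean_eqI)
 fix b :: 'b assume "b : Basis"
 have fb: "smooth_on S (%x. f x \<bullet> b)" by (intro smooth_on_inner smooth_on_const S f)
 have 1: "dird (%y. dird f y u) x v \<bullet> b = dird (%y. dird (%x. f x \<bullet> b) y u) x v" for u v proof -
  have "dird (%y. dird f y u) x v \<bullet> b = dird (%y. dird f y u \<bullet> b) x v"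
   by (rule dird_inner[symmetric]) (use smooth_on_differentiable[OF smooth_on_dird[OF f] x] in simp)
  also have "... = dird (%y. dird (%x. f x \<bullet> b) y u) x v"
   using smooth_on_differentiable[OF smooth_on_dird[OF f] x] smooth_on_differentiable[OF f]
   by (intro frechet_derivative_transform_within_open[THEN fun_cong, OF _ S x])
    (auto simp: dird_inner intro!: differentiable_inner)
  finally show ?thesis .
 qed
 show "dird (%y. dird f y u) x v \<bullet> b = dird (%y. dird f y v) x u \<bullet> b" unfolding 1 by (rule second_dird_symmetric_real[OF S fb x])
qed

text \<open>The case n = 0 is the classical flat function. The powers are added to close the family
  under differentiation: the derivative of the n-th member combines the members n + 1 and n + 2, so
  one induction over the order treats all of them.\<close>

definition flat_exp :: "nat => real => real" where
 "flat_exp n x = (if 0 < x then inverse x ^ n * exp (- inverse x) else 0)"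

lemma flat_exp_tendsto: "(flat_exp n \<longlongrightarrow> 0) (at 0)" proof -
 have "((%x. inverse x ^ n / exp (inverse x)) \<longlongrightarrow> 0) (at_right (0::real))"
  using filterlim_compose[OF tendsto_power_div_exp_0 filterlim_inverse_at_top_right] .
 hence "(flat_exp n \<longlongrightarrow> 0) (at_right 0)" by (rule Lim_transform_eventually)
   (auto simp: eventually_at_filter flat_exp_def exp_minus divide_inverse)
 moreover have "(flat_exp n \<longlongrightarrow> 0) (at_left 0)" by (rule Lim_transform_eventually[OF tendsto_const])
   (auto simp: eventually_at_filter flat_exp_def)
 ultimately show ?thesis by (intro filterlim_split_at)
qed

lemma flat_exp_derivative:
 "(flat_exp n has_real_derivative flat_exp (n + 2) x - n * flat_exp (n + 1) x) (at x)" proof -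
 consider "x > 0" | "x < 0" | "x = 0" by linarith
 thus ?thesis proof cases
  case 1
  have "((%x. inverse x ^ n) has_real_derivative - (n * inverse x ^ (n + 1))) (at x)"
   using 1 by (cases n) (auto intro!: derivative_eq_intros simp: algebra_simps, metis One_nat_def power_eq_if)
  moreover have "((%x. exp (- inverse x)) has_real_derivative inverse x ^ 2 * exp (- inverse x)) (at x)"
   using 1 by (auto intro!: derivative_eq_intros simp: power2_eq_square)
  ultimately have "((%x. inverse x ^ n * exp (- inverse x)) has_real_derivative
    - (n * inverse x ^ (n + 1)) * exp (- inverse x) + inverse x ^ 2 * exp (- inverse x) * inverse x ^ n) (at x)" by (rule DERIV_mult)
  moreover have "- (n * inverse x ^ (n + 1)) * exp (- inverse x) + inverse x ^ 2 * exp (- inverse x) * inverse x ^ n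
    = flat_exp (n + 2) x - n * flat_exp (n + 1) x" using 1 by (simp add: flat_exp_def power_add power2_eq_square algebra_simps)
  ultimately have "((%x. inverse x ^ n * exp (- inverse x)) has_real_derivative flat_exp (n + 2) x - n * flat_exp (n + 1) x) (at x)" by simp
  thus ?thesis by (rule has_field_derivative_transform_within_open[of _ _ _ "{0<..}"]) (use 1 in \<open>auto simp: flat_exp_def\<close>)
 next
  case 2
  have "((%x. 0) has_real_derivative flat_exp (n + 2) x - n * flat_exp (n + 1) x) (at x)" using 2 by (auto simp: flat_exp_def)
  thus ?thesis by (rule has_field_derivative_transform_within_open[of _ _ _ "{..<0}"]) (use 2 in \<open>auto simp: flat_exp_def\<close>)
 next
  case 3
  \<comment> \<open>The difference quotient of the n-th member at 0 is the member n + 1, which tends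
    to 0.\<close>
  have "((%h. (flat_exp n (0 + h) - flat_exp n 0) / h) \<longlongrightarrow> 0) (at 0)"
   by (rule Lim_transform_eventually[OF flat_exp_tendsto[of "Suc n"]])
    (auto simp: eventually_at_filter flat_exp_def field_simps)
  thus ?thesis unfolding DERIV_def 3 by (simp add: flat_exp_def)
 qed
qed

lemma smooth_on_flat_exp: "smooth_on UNIV (flat_exp n)" proof -
 have "nsmooth k UNIV (flat_exp n)" for k n proof (induct k arbitrary: n)
  case 0
  thus ?case using flat_exp_derivative[of n] by (auto simp: has_field_derivative_def differentiable_def)
 next
  case (Suc k)
  have "nsmooth k UNIV (%x. (flat_exp (n + 2) x + (- real n) * flat_exp (n + 1) x) * v)" for v
   by (intro nsmooth_bilinear[OF _ bounded_bilinear_mult] nsmooth_add nsmooth_const Suc open_UNIV)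
  thus ?case by (intro nsmooth_Suc_derivI[OF _ flat_exp_derivative[unfolded has_field_derivative_def]]) auto
 qed
 thus ?thesis by (simp add: smooth_on_iff_nsmooth)
qed

lemma smooth_bump_euclidean:
 fixes a :: "'a::euclidean_space"
 assumes "0 < r"
 obtains b :: "'a => real" where "smooth_on UNIV b" "!!x. 0 <= b x"
  "!!x. dist x a <= r ==> b x = 1" "!!x. dist x a >= 2 * r ==> b x = 0" proof
 \<comment> \<open>The squared distance is used because the distance itself is not smooth at a.
   Within radius r the value of d is at least 3, and from radius 2 r on it is at most 0, while the
   step function s is 1 from 1 on and 0 up to 0.\<close>
 define d where "d = (%x. 4 - ((x - a) \<bullet> (x - a)) / r^2)"
 define s where "s = (%t. flat_exp 0 t / (flat_exp 0 t + flat_exp 0 (1 - t)))"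
 have dd: "d x = 4 - (dist x a / r)^2" for x by (simp add: d_def power_divide dist_norm dot_square_norm)
 have pos: "flat_exp 0 t + flat_exp 0 (1 - t) > 0" for t by (auto simp: flat_exp_def add_pos_pos)
 have sd: "smooth_on UNIV d" unfolding d_def divide_inverse
  by (intro smooth_on_diff smooth_on_mult smooth_on_inner smooth_on_const smooth_on_ident open_UNIV)
 have ss: "smooth_on UNIV s" unfolding s_def proof (intro smooth_on_divide smooth_on_add open_UNIV smooth_on_flat_exp)
  show "smooth_on UNIV (%x. flat_exp 0 (1 - x))" by (rule smooth_on_compose[OF _ smooth_on_flat_exp])
    (auto intro!: smooth_on_diff smooth_on_const smooth_on_ident)
 qed (use pos in \<open>auto simp: less_imp_neq[symmetric]\<close>)
 show "smooth_on UNIV (%x. s (d x))" by (rule smooth_on_compose[OF _ ss sd]) auto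
 show "0 <= s (d x)" for x by (auto simp: s_def flat_exp_def)
 show "s (d x) = 1" if "dist x a <= r" for x proof -
  have "(dist x a / r)^2 <= 1" using that assms by (simp add: power_le_one)
  hence "d x > 1" by (simp add: dd)
  thus ?thesis using pos[of "d x"] by (simp add: s_def flat_exp_def)
 qed
 show "s (d x) = 0" if "dist x a >= 2 * r" for x proof -
  have "dist x a / r >= 2" using that assms by (simp add: field_simps)
  hence "(dist x a / r)^2 >= 2^2" by (intro power_mono) auto
  hence "d x <= 0" by (simp add: dd)
  thus ?thesis by (simp add: s_def flat_exp_def)
 qed
qed

section \<open>Charts, smooth functions and vector fields\<close>

locale smooth_mfd =
 fixes A :: "('m::{t2_space, second_countable_topology}, 'n::finite) chart set"
 assumes atlas: "smooth_atlas A"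
begin

lemma chart_facts:
 assumes "c : A" shows open_dom: "open (fst c)" and open_chart_image: "open (chart_image c)"
  and chart_homeo: "homeomorphism (fst c) (chart_image c) (snd c) (chart_inv c)" using atlas assms unfolding smooth_atlas_def is_chart_def by auto

lemma inv_snd [simp]: "c : A ==> p : fst c ==> chart_inv c (snd c p) = p" using chart_homeo unfolding homeomorphism_def by blast

lemma snd_inv [simp]: "c : A ==> x : chart_image c ==> snd c (chart_inv c x) = x" using chart_homeo unfolding homeomorphism_def by blast

lemma inv_in_dom [simp]: "c : A ==> x : chart_image c ==> chart_inv c x : fst c" using chart_homeo unfolding homeomorphism_def by blast

lemma snd_in_image [simp]: "p : fst c ==> snd c p : chart_image c" by (simp add: chart_image_def)

lemma continuous_on_chart: "c : A ==> continuous_on (fst c) (snd c)" using chart_homeo unfolding homeomorphism_def by blast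

lemma continuous_on_chart_inv: "c : A ==> continuous_on (chart_image c) (chart_inv c)" using chart_homeo unfolding homeomorphism_def by blast

lemma chart_img_eq:
 assumes "c : A" shows "snd c ` (U Int fst c) = chart_image c Int chart_inv c -` U" using assms by (force simp: chart_image_def)

lemma open_chart_img: "c : A ==> open U ==> open (snd c ` (U Int fst c))" unfolding chart_img_eq
 by (rule continuous_open_preimage[OF continuous_on_chart_inv open_chart_image])

lemma open_chart_img': "c : A ==> open U ==> U <= fst c ==> open (snd c ` U)" using open_chart_img[of c U] by (simp add: inf.absorb1)

lemma open_chart_preimg: "c : A ==> open V ==> open {p : fst c. snd c p : V}"
 using continuous_open_preimage[OF continuous_on_chart open_dom, of c V] by (simp add: vimage_def Int_def)

lemma chart_at_in [simp]: "chart_at A p : A" and in_chart_at [simp]: "p : fst (chart_at A p)" proof -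
 have "EX c. c : A & p : fst c" using atlas unfolding smooth_atlas_def by blast
 hence "chart_at A p : A & p : fst (chart_at A p)" unfolding chart_at_def by (rule someI_ex)
 thus "chart_at A p : A" "p : fst (chart_at A p)" by auto
qed

lemma transition_smooth:
 "c : A ==> d : A ==> smooth_on (snd c ` (fst c Int fst d)) (%x. snd d (chart_inv c x))" using atlas unfolding smooth_atlas_def o_def by blast

lemma transition_has_derivative:
 assumes "c : A" "d : A" "p : fst c" "p : fst d" shows "((%x. snd d (chart_inv c x)) has_derivative transition_deriv c d p) (at (snd c p))"
 using smooth_on_has_derivative[OF transition_smooth[OF assms(1,2)]] assms unfolding transition_deriv_def o_def by auto

lemma transition_deriv_linear:
 assumes "c : A" "d : A" "p : fst c" "p : fst d" shows "linear (transition_deriv c d p)"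
 using transition_has_derivative[OF assms] has_derivative_linear by blast

lemma has_derivative_chart_change:
 assumes c: "c : A" and d: "d : A" and p: "p : fst c" "p : fst d" and h: "((%x. h (chart_inv d x)) has_derivative h') (at (snd d p))"
 shows "((%x. h (chart_inv c x)) has_derivative (%v. h' (transition_deriv c d p v))) (at (snd c p))" proof -
 have t: "((%x. snd d (chart_inv c x)) has_derivative transition_deriv c d p) (at (snd c p))" using transition_has_derivative[OF c d p] .
 have e: "snd d (chart_inv c (snd c p)) = snd d p" using c p by simp
 have "((%x. h (chart_inv d (snd d (chart_inv c x)))) has_derivative (%v. h' (transition_deriv c d p v))) (at (snd c p))"
  using diff_chain_at[OF t h[folded e]] by (simp add: o_def)
 thus ?thesis by (rule has_derivative_transform_within_open[of _ _ _ _ "snd c ` (fst d Int fst c)"])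
   (use c d p open_chart_img open_dom in auto)
qed

lemma transition_deriv_chain:
 assumes c: "c : A" and d: "d : A" and e: "e : A" and p: "p : fst c" "p : fst d" "p : fst e"
 shows "transition_deriv d e p (transition_deriv c d p v) = transition_deriv c e p v" proof -
 have "((%x. snd e (chart_inv c x)) has_derivative (%v. transition_deriv d e p (transition_deriv c d p v))) (at (snd c p))"
  by (rule has_derivative_chart_change[OF c d p(1,2)]) (rule transition_has_derivative[OF d e p(2,3)])
 thus ?thesis using transition_has_derivative[OF c e p(1,3)] has_derivative_unique by metis
qed

lemma transition_deriv_id:
 assumes c: "c : A" and p: "p : fst c" shows "transition_deriv c c p v = v" proof -
 have "((%x. x) has_derivative (%v. v)) (at (snd c p))" by simp
 hence "((%x. snd c (chart_inv c x)) has_derivative (%v. v)) (at (snd c p))"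
  by (rule has_derivative_transform_within_open[of _ _ _ _ "chart_image c"])
   (use c p open_chart_image in auto)
 thus ?thesis using transition_has_derivative[OF c c p p] has_derivative_unique by metis
qed

abbreviation cc :: "('m, 'n) chart => 'm => real^'n => real^'n" where
 "cc \<equiv> chart_components A"

text \<open>Inverse of \<open>chart_components\<close> at p, see \<open>cc_ci\<close> and
  \<open>ci_cc\<close>. Coordinate formulas are turned back into tangent vectors by it.\<close>

definition ci :: "('m, 'n) chart => 'm => real^'n => real^'n" where
 "ci c p v = transition_deriv c (chart_at A p) p v"

lemma coord_vec_eq: "coord_vec A c i p = ci c p (axis i 1)" by (simp add: coord_vec_def ci_def)

lemma cc_ci [simp]: "c : A ==> p : fst c ==> cc c p (ci c p v) = v"
 by (simp add: chart_components_def ci_def transition_deriv_chain transition_deriv_id)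

lemma ci_cc [simp]: "c : A ==> p : fst c ==> ci c p (cc c p v) = v"
 by (simp add: chart_components_def ci_def transition_deriv_chain transition_deriv_id)

lemma linear_cc: "c : A ==> p : fst c ==> linear (cc c p)" unfolding chart_components_def by (rule transition_deriv_linear) auto

lemma linear_ci: "c : A ==> p : fst c ==> linear (ci c p)" unfolding ci_def by (rule transition_deriv_linear) auto

lemma cc_simps:
 assumes "c : A" "p : fst c" shows "cc c p (u + v) = cc c p u + cc c p v" "cc c p (u - v) = cc c p u - cc c p v"
  "cc c p (r *\<^sub>R v) = r *\<^sub>R cc c p v" "cc c p 0 = 0" "cc c p (- v) = - cc c p v"
  "cc c p (SUM i:I. w i) = (SUM i:I. cc c p (w i))" using linear_cc[OF assms]
 by (simp_all add: linear_add linear_diff linear_cmul linear_0 linear_neg linear_sum)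

lemma ci_simps:
 assumes "c : A" "p : fst c" shows "ci c p (u + v) = ci c p u + ci c p v" "ci c p (u - v) = ci c p u - ci c p v"
  "ci c p (r *\<^sub>R v) = r *\<^sub>R ci c p v" "ci c p 0 = 0" "ci c p (- v) = - ci c p v"
  "ci c p (SUM i:I. w i) = (SUM i:I. ci c p (w i))" using linear_ci[OF assms]
 by (simp_all add: linear_add linear_diff linear_cmul linear_0 linear_neg linear_sum)

lemma cc_inject: "c : A ==> p : fst c ==> cc c p u = cc c p v \<longleftrightarrow> u = v" by (metis ci_cc)

lemma cc_change:
 "c : A ==> d : A ==> p : fst c ==> p : fst d ==> cc d p v = transition_deriv c d p (cc c p v)"
 unfolding chart_components_def by (simp add: transition_deriv_chain)

lemma vec_coord_expand:
 assumes "c : A" "p : fst c" shows "v = (SUM i:UNIV. cc c p v $ i *\<^sub>R coord_vec A c i p)" proof -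
 have "v = ci c p (SUM i:UNIV. cc c p v $ i *\<^sub>R axis i 1)" using assms basis_expansion[of "cc c p v"] by (simp add: scalar_mult_eq_scaleR)
 thus ?thesis using assms by (simp add: ci_simps coord_vec_eq)
qed

section \<open>Smooth functions and vector fields on subsets\<close>

definition vrep :: "('m, 'n) chart => ('m => real^'n) => real^'n => real^'n" where
 "vrep c X x = cc c (chart_inv c x) (X (chart_inv c x))"

definition sfun :: "'m set => ('m => real) => bool" where
 "sfun U f \<longleftrightarrow> (ALL c:A. smooth_on (snd c ` (U Int fst c)) (%x. f (chart_inv c x)))"

definition svf :: "'m set => ('m => real^'n) => bool" where
 "svf U X \<longleftrightarrow> (ALL c:A. smooth_on (snd c ` (U Int fst c)) (vrep c X))"

lemma smooth_fun_sfun: "smooth_fun A f \<longleftrightarrow> sfun UNIV f" by (simp add: smooth_fun_def sfun_def chart_image_def o_def)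

lemma smooth_vfield_svf: "smooth_vfield A X \<longleftrightarrow> svf UNIV X"
 by (simp add: smooth_vfield_def svf_def chart_image_def vrep_def[abs_def])

lemma sfunD: "sfun U f ==> c : A ==> smooth_on (snd c ` (U Int fst c)) (%x. f (chart_inv c x))" by (simp add: sfun_def)

lemma svfD: "svf U X ==> c : A ==> smooth_on (snd c ` (U Int fst c)) (vrep c X)" by (simp add: svf_def)

lemma sfun_chartI:
 "(!!c. c : A ==> smooth_on (snd c ` (U Int fst c)) (%x. f (chart_inv c x))) ==> sfun U f" unfolding sfun_def by blast

lemma svf_chartI:
 "(!!c. c : A ==> smooth_on (snd c ` (U Int fst c)) (vrep c X)) ==> svf U X" unfolding svf_def by blast

lemma sfun_subset: "sfun U f ==> V <= U ==> sfun V f" by (rule sfun_chartI, rule smooth_on_subset, rule sfunD, assumption+, blast)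

lemma svf_subset: "svf U f ==> V <= U ==> svf V f" by (rule svf_chartI, rule smooth_on_subset, rule svfD, assumption+, blast)

lemma chart_change_img:
 assumes "c : A" "d : A" "W <= fst c" shows "(%y. snd c (chart_inv d y)) ` (snd d ` (W Int fst d)) <= snd c ` W"
 using assms by (auto simp: image_iff)

text \<open>One chart near each point is enough, because any other coordinate expression arises by
  composition with a transition map.\<close>

lemma sfunI:
 assumes "!!p. p : U ==> EX c:A. EX W. open W & p : W & W <= fst c & smooth_on (snd c ` W) (%x. f (chart_inv c x))" shows "sfun U f"
 unfolding sfun_def proof (intro ballI smooth_on_pointwise)
 fix d x assume d: "d : A" and x: "x : snd d ` (U Int fst d)" then obtain p where p: "p : U" "p : fst d" "x = snd d p" by auto
 from assms[OF p(1)] obtain c W where c: "c : A" "open W" "p : W" "W <= fst c" "smooth_on (snd c ` W) (%x. f (chart_inv c x))" by blast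
 let ?V = "snd d ` (W Int fst d)"
 have o: "open ?V" using d c open_chart_img by blast
 have "smooth_on ?V (%y. snd c (chart_inv d y))" by (rule smooth_on_subset[OF transition_smooth[OF d c(1)]]) (use c in auto)
 hence "smooth_on ?V (%y. f (chart_inv c (snd c (chart_inv d y))))" using smooth_on_compose[OF o c(5)] chart_change_img[OF c(1) d c(4)] by blast
 hence "smooth_on ?V (%y. f (chart_inv d y))" by (subst smooth_on_cong[OF o, of _ "%y. f (chart_inv c (snd c (chart_inv d y)))"])
   (use c d in \<open>auto simp: subset_eq\<close>)
 thus "EX V. x : V & smooth_on V (%y. f (chart_inv d y))" using p c by (intro exI[of _ ?V]) auto
qed

text \<open>As for functions, except that the components also change: the new ones are the
  derivative of the transition map in the direction of the old ones, which is smooth by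
  \<open>smooth_on_dird_field\<close>.\<close>

lemma svfI:
 assumes "!!p. p : U ==> EX c:A. EX W. open W & p : W & W <= fst c & smooth_on (snd c ` W) (vrep c X)" shows "svf U X" unfolding svf_def
proof (intro ballI smooth_on_pointwise)
 fix d x assume d: "d : A" and x: "x : snd d ` (U Int fst d)" then obtain p where p: "p : U" "p : fst d" "x = snd d p" by auto
 from assms[OF p(1)] obtain c W where c: "c : A" "open W" "p : W" "W <= fst c" "smooth_on (snd c ` W) (vrep c X)" by blast
 let ?V = "snd d ` (W Int fst d)"
 let ?W = "snd c ` (W Int fst d)"
 have o: "open ?V" using d c open_chart_img by blast
 have oW: "open ?W" using c d open_chart_img'[of c "W Int fst d"] open_dom by blast
 have 1: "smooth_on ?V (%y. snd c (chart_inv d y))" by (rule smooth_on_subset[OF transition_smooth[OF d c(1)]]) (use c in auto)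
 have "smooth_on ?W (%x. dird (%x. snd d (chart_inv c x)) x (vrep c X x))"
  by (intro smooth_on_dird_field oW smooth_on_subset[OF transition_smooth[OF c(1) d]] smooth_on_subset[OF c(5)])
   (use c in auto)
 hence "smooth_on ?V (%y. dird (%x. snd d (chart_inv c x)) (snd c (chart_inv d y)) (vrep c X (snd c (chart_inv d y))))"
  by (rule smooth_on_compose[OF o _ 1]) (use c d in auto)
 moreover have "dird (%x. snd d (chart_inv c x)) (snd c (chart_inv d y)) (vrep c X (snd c (chart_inv d y))) = vrep d X y"
  if "y : ?V" for y using that c d by (auto simp: vrep_def subset_eq cc_change[of c d] transition_deriv_def o_def)
 ultimately have "smooth_on ?V (vrep d X)" using smooth_on_cong[OF o] by (metis (no_types, lifting))
 thus "EX V. x : V & smooth_on V (vrep d X)" using p c by (intro exI[of _ ?V]) auto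
qed

lemma sfun_cong: "open U ==> (!!p. p : U ==> f p = g p) ==> sfun U f \<longleftrightarrow> sfun U g" unfolding sfun_def
proof (intro ball_cong refl smooth_on_cong open_chart_img)
 fix c x assume "c : A" "x : snd c ` (U Int fst c)" "!!p. p : U ==> f p = g p"
 thus "f (chart_inv c x) = g (chart_inv c x)" by auto
qed

lemma svf_cong: "open U ==> (!!p. p : U ==> X p = Y p) ==> svf U X \<longleftrightarrow> svf U Y" unfolding svf_def
proof (intro ball_cong refl smooth_on_cong open_chart_img)
 fix c x assume "c : A" "x : snd c ` (U Int fst c)" "!!p. p : U ==> X p = Y p"
 thus "vrep c X x = vrep c Y x" by (auto simp: vrep_def)
qed

lemma sfun_pointwise: "(!!p. p : U ==> EX V. p : V & sfun V f) ==> sfun U f" proof (rule sfun_chartI, rule smooth_on_pointwise)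
 fix c x assume h: "!!p. p : U ==> EX V. p : V & sfun V f" and c: "c : A" and x: "x : snd c ` (U Int fst c)"
 from x obtain p where p: "p : U" "p : fst c" "x = snd c p" by blast
 from h[OF p(1)] obtain V where V: "p : V" "sfun V f" by blast
 have "x : snd c ` (V Int fst c)" using V p by blast
 with sfunD[OF V(2) c] show "EX V. x : V & smooth_on V (%x. f (chart_inv c x))" by (intro exI conjI)
qed

lemma svf_pointwise: "(!!p. p : U ==> EX V. p : V & svf V f) ==> svf U f" proof (rule svf_chartI, rule smooth_on_pointwise)
 fix c x assume h: "!!p. p : U ==> EX V. p : V & svf V f" and c: "c : A" and x: "x : snd c ` (U Int fst c)"
 from x obtain p where p: "p : U" "p : fst c" "x = snd c p" by blast
 from h[OF p(1)] obtain V where V: "p : V" "svf V f" by blast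
 have "x : snd c ` (V Int fst c)" using V p by blast
 with svfD[OF V(2) c] show "EX V. x : V & smooth_on V (vrep c f)" by (intro exI conjI)
qed

lemma sfun_Un: "sfun U f ==> sfun V f ==> sfun (U Un V) f" by (rule sfun_pointwise) auto

lemma svf_Un: "svf U f ==> svf V f ==> svf (U Un V) f" by (rule svf_pointwise) auto

lemma sfun_const: "sfun U (%p. k)" by (simp add: sfun_def smooth_on_const)

lemma sfun_add: "open U ==> sfun U f ==> sfun U g ==> sfun U (%p. f p + g p)"
 by (rule sfun_chartI, rule smooth_on_add) ((rule open_chart_img; assumption) | (rule sfunD; assumption))+

lemma sfun_diff: "open U ==> sfun U f ==> sfun U g ==> sfun U (%p. f p - g p)"
 by (rule sfun_chartI, rule smooth_on_diff) ((rule open_chart_img; assumption) | (rule sfunD; assumption))+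

lemma sfun_mult: "open U ==> sfun U f ==> sfun U g ==> sfun U (%p. f p * g p)"
 by (rule sfun_chartI, rule smooth_on_mult) ((rule open_chart_img; assumption) | (rule sfunD; assumption))+

lemma sfun_sum: "open U ==> (!!i. i : I ==> sfun U (f i)) ==> sfun U (%p. SUM i:I. f i p)"
 by (rule sfun_chartI, rule smooth_on_sum) ((rule open_chart_img; assumption), (rule sfunD; blast))

lemma sfun_inverse:
 "open U ==> sfun U f ==> (!!p. p : U ==> f p ~= 0) ==> sfun U (%p. inverse (f p))" proof (rule sfun_chartI)
 fix c assume a: "open U" "sfun U f" "!!p. p : U ==> f p ~= 0" and c: "c : A"
 have "f (chart_inv c x) ~= 0" if "x : snd c ` (U Int fst c)" for x proof -
  from that obtain q where "q : U" "q : fst c" "x = snd c q" by blast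
  thus ?thesis using a(3)[of q] inv_snd[OF c] by simp
 qed
 from smooth_on_inverse[OF open_chart_img[OF c a(1)] sfunD[OF a(2) c] this]
 show "smooth_on (snd c ` (U Int fst c)) (%x. inverse (f (chart_inv c x)))" .
qed

lemma sfun_sqrt_abs:
 "open U ==> sfun U f ==> (!!p. p : U ==> f p ~= 0) ==> sfun U (%p. sqrt \<bar>f p\<bar>)" proof (rule sfun_chartI)
 fix c assume a: "open U" "sfun U f" "!!p. p : U ==> f p ~= 0" and c: "c : A"
 have "f (chart_inv c x) ~= 0" if "x : snd c ` (U Int fst c)" for x proof -
  from that obtain q where "q : U" "q : fst c" "x = snd c q" by blast
  thus ?thesis using a(3)[of q] inv_snd[OF c] by simp
 qed
 from smooth_on_sqrt_abs[OF open_chart_img[OF c a(1)] sfunD[OF a(2) c] this]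
 show "smooth_on (snd c ` (U Int fst c)) (%x. sqrt \<bar>f (chart_inv c x)\<bar>)" .
qed

lemma svf_zero: "svf U (%p. 0)" proof (rule svf_subset)
 show "svf UNIV (%p. 0)" proof (rule svf_chartI)
  fix c assume c: "c : A"
  have "smooth_on (chart_image c) (vrep c (%p. 0))" by (subst smooth_on_cong[OF open_chart_image[OF c], of _ "%x. 0"])
    (use c in \<open>auto simp: vrep_def cc_simps smooth_on_const\<close>)
  thus "smooth_on (snd c ` (UNIV Int fst c)) (vrep c (%p. 0))" by (simp add: chart_image_def)
 qed
qed auto

lemma svf_add:
 assumes "open U" "svf U X" "svf U Y" shows "svf U (%p. X p + Y p)" unfolding svf_def proof
 fix c assume c: "c : A"
 have "smooth_on (snd c ` (U Int fst c)) (%x. vrep c X x + vrep c Y x)" using assms c by (intro smooth_on_add svfD open_chart_img)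
 thus "smooth_on (snd c ` (U Int fst c)) (vrep c (%p. X p + Y p))"
  by (subst smooth_on_cong[OF open_chart_img[OF c assms(1)]]) (use c in \<open>auto simp: vrep_def cc_simps\<close>)
qed

lemma svf_scale:
 assumes "open U" "sfun U f" "svf U X" shows "svf U (%p. f p *\<^sub>R X p)" unfolding svf_def proof
 fix c assume c: "c : A"
 have "smooth_on (snd c ` (U Int fst c)) (%x. f (chart_inv c x) *\<^sub>R vrep c X x)"
  using assms c by (intro smooth_on_scaleR svfD sfunD open_chart_img)
 thus "smooth_on (snd c ` (U Int fst c)) (vrep c (%p. f p *\<^sub>R X p))"
  by (subst smooth_on_cong[OF open_chart_img[OF c assms(1)]]) (use c in \<open>auto simp: vrep_def cc_simps\<close>)
qed

lemma svf_scale_const: "open U ==> svf U X ==> svf U (%p. r *\<^sub>R X p)" using svf_scale[OF _ sfun_const] .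

lemma svf_minus: "open U ==> svf U X ==> svf U (%p. - X p)" using svf_scale_const[of U X "-1"] by simp

lemma svf_diff: "open U ==> svf U X ==> svf U Y ==> svf U (%p. X p - Y p)" using svf_add[OF _ _ svf_minus, of U X Y] by simp

lemma svf_sum: "open U ==> (!!i. i : I ==> svf U (X i)) ==> svf U (%p. SUM i:I. X i p)"
 by (induct I rule: infinite_finite_induct) (auto intro: svf_zero svf_add)

lemma vrep_snd: "c : A ==> p : fst c ==> vrep c X (snd c p) = cc c p (X p)" by (simp add: vrep_def)

lemma svf_local_frame:
 assumes c: "c : A" shows "svf (fst c) (%p. ci c p v)" proof (rule svfI)
 fix p assume "p : fst c"
 have "smooth_on (chart_image c) (vrep c (%p. ci c p v))" by (subst smooth_on_cong[OF open_chart_image[OF c], of _ "%x. v"])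
   (use c in \<open>auto simp: vrep_def smooth_on_const\<close>)
 with \<open>p : fst c\<close> show "EX d:A. EX W. open W & p : W & W <= fst d & smooth_on (snd d ` W) (vrep d (%p. ci c p v))"
  using c open_dom by (intro bexI[of _ c] exI[of _ "fst c"]) (auto simp: chart_image_def)
qed

lemma sfun_chart_coord:
 assumes c: "c : A" and that: "smooth_on (chart_image c) h" shows "sfun (fst c) (%p. h (snd c p))" proof (rule sfunI)
 fix p assume "p : fst c"
 have "smooth_on (chart_image c) (%x. h (snd c (chart_inv c x)))" by (subst smooth_on_cong[OF open_chart_image[OF c], of _ h]) (use c that in auto)
 with \<open>p : fst c\<close> show "EX d:A. EX W. open W & p : W & W <= fst d & smooth_on (snd d ` W) (%x. h (snd c (chart_inv d x)))"
  using c open_dom by (intro bexI[of _ c] exI[of _ "fst c"]) (auto simp: chart_image_def)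
qed

lemma continuous_on_sfun:
 assumes "open U" "sfun U f" shows "continuous_on U f" proof -
 have "isCont f p" if p: "p : U" for p proof -
  let ?c = "chart_at A p"
  have o: "open (snd ?c ` (U Int fst ?c))" by (rule open_chart_img) (use assms in auto)
  have 1: "isCont (%x. f (chart_inv ?c x)) (snd ?c p)" using smooth_on_continuous_on[OF sfunD[OF assms(2), of ?c]] o p
   by (auto simp: continuous_on_eq_continuous_at)
  have 2: "isCont (snd ?c) p" using continuous_on_chart[of ?c] open_dom[of ?c] by (auto simp: continuous_on_eq_continuous_at)
  have "isCont (%q. f (chart_inv ?c (snd ?c q))) p" using isCont_o2[OF 2 1] .
  moreover have "\<forall>\<^sub>F q in nhds p. f (chart_inv ?c (snd ?c q)) = f q"
   unfolding eventually_nhds by (intro exI[of _ "fst ?c"]) (simp add: open_dom)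
  ultimately show ?thesis using isCont_cong[of "%q. f (chart_inv ?c (snd ?c q))" f p] by simp
 qed
 thus ?thesis by (simp add: continuous_at_imp_continuous_on)
qed

section \<open>Vector fields as derivations\<close>

lemma vf_deriv_chart:
 assumes c: "c : A" and p: "p : fst c" "p : U" and U: "open U" and f: "sfun U f"
 shows "vf_deriv A X f p = dird (%x. f (chart_inv c x)) (snd c p) (cc c p (X p))" proof -
 let ?d = "chart_at A p"
 have "((%x. f (chart_inv c x)) has_derivative dird (%x. f (chart_inv c x)) (snd c p)) (at (snd c p))"
  by (rule smooth_on_has_derivative[OF sfunD[OF f c]]) (use p in auto)
 from has_derivative_chart_change[OF _ c _ p(1) this, of ?d]
 have "((%x. f (chart_inv ?d x)) has_derivative (%v. dird (%x. f (chart_inv c x)) (snd c p) (transition_deriv ?d c p v))) (at (snd ?d p))" by simp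
 thus ?thesis unfolding vf_deriv_def o_def chart_components_def by (rule dird_eq)
qed

lemma vf_deriv_smooth:
 assumes U: "open U" and X: "svf U X" and f: "sfun U f" shows "sfun U (vf_deriv A X f)" unfolding sfun_def proof
 fix c assume c: "c : A"
 let ?V = "snd c ` (U Int fst c)"
 have "smooth_on ?V (%x. dird (%x. f (chart_inv c x)) x (vrep c X x))" using assms c by (intro smooth_on_dird_field open_chart_img sfunD svfD)
 thus "smooth_on ?V (%x. vf_deriv A X f (chart_inv c x))" by (subst smooth_on_cong[OF open_chart_img[OF c U]])
   (use c in \<open>auto simp: vf_deriv_chart[OF c _ _ U f] vrep_def\<close>)
qed

lemma vf_deriv_rules:
 assumes U: "open U" "p : U" and f: "sfun U f" and g: "sfun U g" shows "vf_deriv A X (%q. f q + g q) p = vf_deriv A X f p + vf_deriv A X g p"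
  and "vf_deriv A X (%q. f q * g q) p = f p * vf_deriv A X g p + vf_deriv A X f p * g p" proof -
 let ?c = "chart_at A p"
 have d: "((%x. f (chart_inv ?c x)) has_derivative dird (%x. f (chart_inv ?c x)) (snd ?c p)) (at (snd ?c p))"
  "((%x. g (chart_inv ?c x)) has_derivative dird (%x. g (chart_inv ?c x)) (snd ?c p)) (at (snd ?c p))"
  by (rule smooth_on_has_derivative[OF sfunD]; use U f g in auto)+
 show "vf_deriv A X (%q. f q + g q) p = vf_deriv A X f p + vf_deriv A X g p"
  unfolding vf_deriv_def o_def using dird_eq[OF has_derivative_add[OF d]] by simp
 show "vf_deriv A X (%q. f q * g q) p = f p * vf_deriv A X g p + vf_deriv A X f p * g p"
  unfolding vf_deriv_def o_def using dird_eq[OF has_derivative_mult[OF d]] by simp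
qed

lemma vf_deriv_cong:
 assumes U: "open U" "p : U" and eq: "!!q. q : U ==> f q = g q" "X p = Y p" shows "vf_deriv A X f p = vf_deriv A Y g p" proof -
 let ?c = "chart_at A p"
 have "frechet_derivative (f \<circ> chart_inv ?c) (at (snd ?c p)) = frechet_derivative (g \<circ> chart_inv ?c) (at (snd ?c p))" (is "?F = ?G")
 proof -
  have o: "open (snd ?c ` (U Int fst ?c))" and i: "snd ?c p : snd ?c ` (U Int fst ?c)" using U open_chart_img[of ?c U] by auto
  have e: "(f \<circ> chart_inv ?c) x = (g \<circ> chart_inv ?c) x" if "x : snd ?c ` (U Int fst ?c)" for x using that eq by auto
  \<comment> \<open>No derivative needs to exist here. Functions that agree near the point have the
    same derivatives, so the choice hidden in \<open>frechet_derivative\<close> is the same for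
    both.\<close>
  have "((f \<circ> chart_inv ?c) has_derivative D) (at (snd ?c p)) \<longleftrightarrow> ((g \<circ> chart_inv ?c) has_derivative D) (at (snd ?c p))" for D
   using has_derivative_transform_within_open[OF _ o i, of "f \<circ> chart_inv ?c" D UNIV "g \<circ> chart_inv ?c"]
    has_derivative_transform_within_open[OF _ o i, of "g \<circ> chart_inv ?c" D UNIV "f \<circ> chart_inv ?c"] e by metis
  thus ?thesis unfolding frechet_derivative_def by simp
 qed
 thus ?thesis using eq by (simp add: vf_deriv_def)
qed

section \<open>Bump functions and extension to the whole manifold\<close>

lemma manifold_bump:
 assumes c: "c : A" and p: "p : fst c" and U: "open U" "p : U"
 obtains \<phi> V K where "sfun UNIV \<phi>" "ALL q. 0 <= \<phi> q" "open V" "p : V" "V <= K" "compact K" "K <= U Int fst c"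
  "ALL q:V. \<phi> q = 1" "ALL q. q ~: K --> \<phi> q = 0" proof -
 have "open (snd c ` (U Int fst c))" by (rule open_chart_img[OF c U(1)])
 moreover have "snd c p : snd c ` (U Int fst c)" using p U by auto
 ultimately obtain e where e: "e > 0" "cball (snd c p) e <= snd c ` (U Int fst c)" using open_contains_cball by blast
 obtain b where b: "smooth_on UNIV b" "!!x. 0 <= b x"
  "!!x. dist x (snd c p) <= e / 2 ==> b x = (1::real)" "!!x. dist x (snd c p) >= 2 * (e / 2) ==> b x = 0"
  using smooth_bump_euclidean[of "e / 2" "snd c p"] e by auto
 define K where "K = chart_inv c ` cball (snd c p) e"
 define V where "V = {q : fst c. snd c q : ball (snd c p) (e / 2)}"
 define \<phi> where "\<phi> = (%q. if q : fst c then b (snd c q) else 0)"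
 have sub: "cball (snd c p) e <= chart_image c" using e by (auto simp: chart_image_def)
 have K: "compact K" unfolding K_def by (rule compact_continuous_image[OF continuous_on_subset[OF continuous_on_chart_inv[OF c] sub]]) simp
 have KU: "K <= U Int fst c" unfolding K_def using e(2) c by (force simp: subset_eq)
 have out: "\<phi> q = 0" if "q ~: K" for q proof (cases "q : fst c")
  case True
  have "snd c q ~: cball (snd c p) e" using that True c unfolding K_def by (metis image_eqI inv_snd)
  thus ?thesis using True b(4) by (simp add: \<phi>_def dist_commute)
 qed (simp add: \<phi>_def)
 \<comment> \<open>Two open sets cover the manifold: the chart domain, where the coordinate formula
   is smooth, and the complement of K, where the function vanishes. K is closed because it is
   compact in a Hausdorff space.\<close>
 have s1: "sfun (fst c) \<phi>" by (subst sfun_cong[OF open_dom[OF c], of _ "%q. b (snd c q)"])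
   (auto simp: \<phi>_def intro!: sfun_chart_coord[OF c] smooth_on_subset[OF b(1)])
 have s2: "sfun (- K) \<phi>" by (subst sfun_cong[of _ _ "%q. 0"]) (use K in \<open>auto simp: out sfun_const compact_imp_closed\<close>)
 have "fst c Un - K = UNIV" using KU by auto
 hence s: "sfun UNIV \<phi>" using sfun_Un[OF s1 s2] by simp
 show thesis proof (rule that[OF s _ _ _ _ K KU])
  show "ALL q. 0 <= \<phi> q" by (simp add: \<phi>_def b)
  show "open V" unfolding V_def by (rule open_chart_preimg[OF c]) simp
  show "p : V" using p e by (simp add: V_def)
  show "V <= K" proof
   fix q assume "q : V"
   hence "q = chart_inv c (snd c q)" "snd c q : cball (snd c p) e" using c e by (auto simp: V_def)
   thus "q : K" unfolding K_def by (metis image_eqI)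
  qed
  show "ALL q:V. \<phi> q = 1" using b(3) by (auto simp: \<phi>_def V_def dist_commute)
 qed (use out in auto)
qed

lemma svf_cutoff:
 assumes "open U" "svf U X" "sfun UNIV \<phi>" "closed K" "K <= U" "!!q. q ~: K ==> \<phi> q = 0" shows "svf UNIV (%q. \<phi> q *\<^sub>R X q)"
proof -
 have 1: "svf U (%q. \<phi> q *\<^sub>R X q)" using assms by (intro svf_scale) (auto intro: sfun_subset)
 have 2: "svf (- K) (%q. \<phi> q *\<^sub>R X q)" by (subst svf_cong[of _ _ "%q. 0"]) (use assms in \<open>auto simp: svf_zero\<close>)
 have "U Un - K = UNIV" using assms by auto
 thus ?thesis using svf_Un[OF 1 2] by simp
qed

lemma sfun_cutoff:
 assumes "open U" "sfun U f" "sfun UNIV \<phi>" "closed K" "K <= U" "!!q. q ~: K ==> \<phi> q = 0" shows "sfun UNIV (%q. \<phi> q * f q)" proof -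
 have 1: "sfun U (%q. \<phi> q * f q)" using assms by (intro sfun_mult) (auto intro: sfun_subset)
 have 2: "sfun (- K) (%q. \<phi> q * f q)" by (subst sfun_cong[of _ _ "%q. 0"]) (use assms in \<open>auto simp: sfun_const\<close>)
 have "U Un - K = UNIV" using assms by auto
 thus ?thesis using sfun_Un[OF 1 2] by simp
qed

text \<open>That Y is pointwise a multiple of X is recorded because it keeps Y in every distribution
  that contains X. With it, local frames of a distribution become global sections.\<close>

lemma extend_vfield:
 assumes U: "open U" "p : U" and X: "svf U X"
 obtains Y V where "svf UNIV Y" "open V" "p : V" "V <= U" "!!q. q : V ==> Y q = X q"
  "!!q. EX r. Y q = r *\<^sub>R X q" "!!q. q ~: U ==> Y q = 0" proof -
 obtain \<phi> V K where b: "sfun UNIV \<phi>" "ALL q. 0 <= \<phi> q" "open V" "p : V" "V <= K" "compact K" "K <= U Int fst (chart_at A p)"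
  "ALL q:V. \<phi> q = 1" "ALL q. q ~: K --> \<phi> q = 0" by (rule manifold_bump[OF chart_at_in in_chart_at U])
 show thesis proof (rule that[of "%q. \<phi> q *\<^sub>R X q" V])
  show "svf UNIV (%q. \<phi> q *\<^sub>R X q)" by (rule svf_cutoff[OF U(1) X b(1) compact_imp_closed[OF b(6)]]) (use b(7) b(9) in blast)+
  show "\<phi> q *\<^sub>R X q = 0" if "q ~: U" for q proof -
   have "q ~: K" using that b(7) by blast
   thus ?thesis using b(9) by simp
  qed
  show "V <= U" using b(5,7) by blast
 qed (use b(3,4,8) in auto)
qed

lemma extend_fun:
 assumes U: "open U" "p : U" and X: "sfun U f"
 obtains h V where "sfun UNIV h" "open V" "p : V" "V <= U" "!!q. q : V ==> h q = f q" proof -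
 obtain \<phi> V K where b: "sfun UNIV \<phi>" "ALL q. 0 <= \<phi> q" "open V" "p : V" "V <= K" "compact K" "K <= U Int fst (chart_at A p)"
  "ALL q:V. \<phi> q = 1" "ALL q. q ~: K --> \<phi> q = 0" by (rule manifold_bump[OF chart_at_in in_chart_at U])
 show thesis proof (rule that[of "%q. \<phi> q * f q" V])
  show "sfun UNIV (%q. \<phi> q * f q)" by (rule sfun_cutoff[OF U(1) X b(1) compact_imp_closed[OF b(6)]]) (use b(7) b(9) in blast)+
  show "V <= U" using b(5,7) by blast
 qed (use b(3,4,8) in simp_all)
qed

lemma field_through:
 obtains Y where "svf UNIV Y" "Y p = v" proof -
 let ?c = "chart_at A p"
 obtain Y V where "svf UNIV Y" "open V" "p : V" "!!q. q : V ==> Y q = ci ?c q (cc ?c p v)"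
  using extend_vfield[OF open_dom in_chart_at svf_local_frame] by (metis chart_at_in)
 thus thesis using that by force
qed

text \<open>Coordinate functions, cut off to global ones, read off the components of a vector. The
  Lie bracket is identified by means of this, without transforming second derivatives between
  charts.\<close>

lemma tangent_separation:
 assumes "!!f. sfun UNIV f ==> vf_deriv A X f p = vf_deriv A Y f p" shows "X p = Y p" proof -
 let ?c = "chart_at A p"
 have "cc ?c p (X p) $ i = cc ?c p (Y p) $ i" for i proof -
  have s: "sfun (fst ?c) (%q. snd ?c q $ i)" by (rule sfun_chart_coord) (auto intro!: smooth_on_vec_nth smooth_on_ident open_chart_image)
  obtain h V where h: "sfun UNIV h" "open V" "p : V" "V <= fst ?c" "!!q. q : V ==> h q = snd ?c q $ i"
   using extend_fun[OF open_dom in_chart_at s] by (metis chart_at_in)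
  have "vf_deriv A Z h p = cc ?c p (Z p) $ i" for Z proof -
   have "vf_deriv A Z h p = vf_deriv A Z (%q. snd ?c q $ i) p" by (rule vf_deriv_cong) (use h in auto)
   also have "... = dird (%x. snd ?c (chart_inv ?c x) $ i) (snd ?c p) (cc ?c p (Z p))" by (rule vf_deriv_chart[OF _ _ _ _ s]) (auto simp: open_dom)
   also have "... = dird (%x. x $ i) (snd ?c p) (cc ?c p (Z p))"
    by (rule frechet_derivative_transform_within_open[THEN fun_cong, of _ _ "chart_image ?c"])
     (auto simp: open_chart_image intro: smooth_on_differentiable[OF sfunD[OF s, of ?c]])
   also have "... = cc ?c p (Z p) $ i" by (rule dird_eq[OF bounded_linear_imp_has_derivative[OF bounded_linear_vec_nth]])
   finally show ?thesis .
  qed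
  thus ?thesis using assms[OF h(1)] by simp
 qed
 hence "cc ?c p (X p) = cc ?c p (Y p)" by (simp add: vec_eq_iff)
 thus ?thesis by (simp add: cc_inject)
qed

end

section \<open>Change of variables over an arbitrary finite index type\<close>

text \<open>The library proves the change of variables theorem for \<open>real ^ 'n\<close> only when the index
 type carries a well-order. A copy of the index type with a well-order obtained from an
 enumeration removes that restriction.\<close>

typedef 'a windex = "UNIV :: 'a set" morphisms of_windex to_windex ..

instantiation windex :: (finite) wellorder
begin

definition less_eq_windex :: "'a windex => 'a windex => bool" where
 "less_eq_windex x y \<longleftrightarrow> to_nat_on UNIV (of_windex x) <= to_nat_on UNIV (of_windex y)"

definition less_windex :: "'a windex => 'a windex => bool" where
 "less_windex x y \<longleftrightarrow> to_nat_on UNIV (of_windex x) < to_nat_on UNIV (of_windex y)"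

instance proof
 have inj: "inj (to_nat_on (UNIV :: 'a set))" by (rule inj_on_to_nat_on) (simp add: uncountable_infinite countable_finite)
 fix x y z :: "'a windex"
 show "x < y \<longleftrightarrow> x <= y & \<not> y <= x" by (auto simp: less_windex_def less_eq_windex_def)
 show "x <= x" by (simp add: less_eq_windex_def)
 show "x <= y ==> y <= z ==> x <= z" by (simp add: less_eq_windex_def)
 show "x <= y ==> y <= x ==> x = y" using injD[OF inj] by (simp add: less_eq_windex_def of_windex_inject)
 show "x <= y | y <= x" by (auto simp: less_eq_windex_def)
 fix P :: "'a windex => bool" and a
 assume step: "!!x. (!!y. y < x ==> P y) ==> P x"
 show "P a" proof (induct a rule: measure_induct_rule[of "%x. to_nat_on UNIV (of_windex x)"])
  case (less x) thus ?case using step by (simp add: less_windex_def)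
 qed
qed

end

instance windex :: (finite) finite proof
 have "(UNIV :: 'a windex set) = to_windex ` UNIV" by (metis of_windex_inverse surj_def)
 thus "finite (UNIV :: 'a windex set)" by (metis finite finite_imageI)
qed

lemma bij_of_windex: "bij of_windex" by (metis bijI' of_windex_inject to_windex_inverse UNIV_I)

lemma bij_to_windex: "bij to_windex" by (metis bijI' of_windex_inverse to_windex_inverse UNIV_I)

definition wvec :: "'a^'n => 'a^('n::finite) windex" where
 "wvec x = (\<chi> i. x $ of_windex i)"

definition unwvec :: "'a^('n::finite) windex => 'a^'n" where
 "unwvec x = (\<chi> i. x $ to_windex i)"

lemma unwvec_wvec [simp]: "unwvec (wvec x) = x" by (simp add: wvec_def unwvec_def vec_eq_iff to_windex_inverse)

lemma wvec_unwvec [simp]: "wvec (unwvec x) = x" by (simp add: wvec_def unwvec_def vec_eq_iff of_windex_inverse)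

lemma prod_windex: "(PROD i:(UNIV :: 'n::finite windex set). f (of_windex i)) = (PROD i:UNIV. f i)" by (rule prod.reindex_bij_betw[OF bij_of_windex])

lemma sum_windex: "(SUM i:(UNIV :: 'n::finite windex set). f (of_windex i)) = (SUM i:UNIV. f i)" by (rule sum.reindex_bij_betw[OF bij_of_windex])

lemma norm_wvec: "norm (wvec x) = norm (x :: real^'n)"
 using sum_windex[of "%i. (norm (x $ i))\<^sup>2"] by (simp add: norm_vec_def L2_set_def wvec_def)

lemma bounded_linear_wvec: "bounded_linear (wvec :: real^'n => _)"
 by (rule bounded_linear_intro[where K = 1]) (auto simp: norm_wvec, auto simp: wvec_def vec_eq_iff)

lemma norm_unwvec: "norm (unwvec x) = norm (x :: real^('n::finite) windex)" using norm_wvec[of "unwvec x"] by simp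

lemma bounded_linear_unwvec: "bounded_linear (unwvec :: real^('n::finite) windex => _)"
 by (rule bounded_linear_intro[where K = 1]) (auto simp: norm_unwvec, auto simp: unwvec_def vec_eq_iff)

text \<open>Relabelling conjugates the permutations in the Leibniz formula; this keeps their signs
  and only reorders the factors of each product.\<close>

lemma det_windex:
 fixes M :: "real^'n^'n" shows "det (\<chi> i j. M $ of_windex i $ of_windex j) = det M" proof -
 let ?f = "map_permutation UNIV (of_windex :: 'n windex => 'n)"
 have inj: "inj (of_windex :: 'n windex => 'n)" by (rule bij_is_inj[OF bij_of_windex])
 have im: "range (of_windex :: 'n windex => 'n) = UNIV" by (rule bij_is_surj[OF bij_of_windex])
 have app: "?f p (of_windex i) = of_windex (p i)" if "p permutes UNIV" for p i using that inj by (simp add: map_permutation_def restrict_id_def im)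
 have "bij_betw ?f {p. p permutes UNIV} {p. p permutes (UNIV :: 'n set)}" proof (rule bij_betwI')
  fix p q assume "p : {p. p permutes (UNIV :: 'n windex set)}" "q : {p. p permutes (UNIV :: 'n windex set)}"
  thus "?f p = ?f q \<longleftrightarrow> p = q" using app injD[OF inj] by (metis ext mem_Collect_eq)
 next
  fix p assume "p : {p. p permutes (UNIV :: 'n windex set)}"
  thus "?f p : {p. p permutes (UNIV :: 'n set)}" using map_permutation_permutes[OF bij_of_windex] by simp
 next
  fix q assume "q : {p. p permutes (UNIV :: 'n set)}"
  hence q: "bij q" by (simp add: permutes_bij)
  let ?p = "%i. to_windex (q (of_windex i))"
  have "bij ?p" using bij_comp[OF bij_comp[OF bij_of_windex q] bij_to_windex] by (simp add: o_def)
  hence p: "?p permutes UNIV" by (rule bij_imp_permutes) simp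
  have "?f ?p (of_windex i) = q (of_windex i)" for i using app[OF p] by (simp add: to_windex_inverse)
  hence "?f ?p = q" by (metis ext to_windex_inverse UNIV_I)
  thus "EX x:{p. p permutes UNIV}. q = ?f x" using p by (intro bexI[of _ ?p]) simp_all
 qed
 hence "det M = (SUM p:{p. p permutes UNIV}. of_int (sign (?f p)) * (PROD i:UNIV. M $ i $ ?f p i))"
  unfolding det_def by (rule sum.reindex_bij_betw[symmetric])
 also have "... = (SUM p:{p. p permutes UNIV}. of_int (sign p) * (PROD i:UNIV. M $ of_windex i $ of_windex (p i)))" proof (rule sum.cong[OF refl])
  fix p assume "p : {p. p permutes (UNIV :: 'n windex set)}"
  hence p: "p permutes UNIV" by simp
  have "sign (?f p) = sign p" by (rule sign_map_permutation) (use p inj in auto)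
  moreover have "(PROD i:UNIV. M $ i $ ?f p i) = (PROD i:UNIV. M $ of_windex i $ of_windex (p i))"
   using prod_windex[of "%i. M $ i $ ?f p i"] by (simp add: app[OF p])
  ultimately show "of_int (sign (?f p)) * (PROD i:UNIV. M $ i $ ?f p i) =
    of_int (sign p) * (PROD i:UNIV. M $ of_windex i $ of_windex (p i))" by simp
 qed
 finally show ?thesis by (simp add: det_def)
qed

text \<open>Lebesgue measure is determined by its values on boxes, and relabelling merely permutes
  the edges of a box.\<close>

lemma lborel_wvec: "distr lborel borel wvec = (lborel :: (real^('n::finite) windex) measure)" proof (rule lborel_eqI[symmetric])
 fix l u :: "real^('n::finite) windex" assume lu: "!!b. b : Basis ==> l \<bullet> b <= u \<bullet> b"
 have m: "wvec : borel_measurable (borel :: (real^'n) measure)"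
  using bounded_linear_wvec by (intro borel_measurable_continuous_onI linear_continuous_on)
 have lu': "l $ i <= u $ i" for i using lu[of "axis i 1"] by (simp add: cart_eq_inner_axis)
 have "wvec x : box l u \<longleftrightarrow> x : box (unwvec l) (unwvec u)" for x
  unfolding mem_box_cart wvec_def unwvec_def by simp (metis of_windex_inverse to_windex_inverse UNIV_I)
 hence "wvec -` box l u = box (unwvec l) (unwvec u)" by auto
 hence "emeasure (distr lborel borel wvec) (box l u) = emeasure lborel (box (unwvec l) (unwvec u))" using m by (simp add: emeasure_distr)
 also have "... = (PROD b:Basis. (unwvec u - unwvec l) \<bullet> b)" proof (rule emeasure_lborel_box)
  fix b :: "real^'n" assume "b : Basis" then obtain i where "b = axis i 1" by (auto simp: Basis_vec_def)
  thus "unwvec l \<bullet> b <= unwvec u \<bullet> b" using lu' by (simp add: cart_eq_inner_axis[symmetric] unwvec_def)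
 qed
 also have "(PROD b:Basis. (unwvec u - unwvec l) \<bullet> b) = (PROD i:UNIV. (unwvec u - unwvec l) $ i)"
  by (simp add: Basis_vec_def prod.UNION_disjoint axis_eq_axis cart_eq_inner_axis[symmetric])
 also have "... = (PROD i:UNIV. (u - l) $ i)" by (subst prod_windex[symmetric]) (simp add: unwvec_def of_windex_inverse)
 also have "... = (PROD b:Basis. (u - l) \<bullet> b)" by (simp add: Basis_vec_def prod.UNION_disjoint axis_eq_axis cart_eq_inner_axis[symmetric])
 finally show "emeasure (distr lborel borel wvec) (box l u) = (PROD b:Basis. (u - l) \<bullet> b)" .
qed simp

text \<open>Bridge between absolute integrability, the language of the change of variables theorem,
  and the nonnegative integral, in which the volume is defined.\<close>

lemma absolutely_integrable_nonneg_iff: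
 fixes h :: "'a::euclidean_space => real"
 assumes m: "(%x. indicator S x * h x) : borel_measurable borel" and pos: "!!x. x : S ==> 0 <= h x"
 shows "h absolutely_integrable_on S \<longleftrightarrow> (\<integral>\<^sup>+x. ennreal (indicator S x * h x) \<partial>lborel) < \<infinity>"
  and "h absolutely_integrable_on S ==> integral S h = enn2real (\<integral>\<^sup>+x. ennreal (indicator S x * h x) \<partial>lborel)" proof -
 have m': "(%x. indicator S x * h x) : borel_measurable lborel" using m by simp
 have pos': "0 <= indicator S x * h x" for x using pos by (auto simp: indicator_def)
 have "h absolutely_integrable_on S \<longleftrightarrow> integrable lborel (%x. indicator S x * h x)"
  unfolding set_integrable_def using integrable_completion[OF m'] by simp
 also have "... \<longleftrightarrow> (\<integral>\<^sup>+x. ennreal (indicator S x * h x) \<partial>lborel) < \<infinity>"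
  unfolding integrable_iff_bounded using m pos' by simp
 finally show "h absolutely_integrable_on S \<longleftrightarrow> (\<integral>\<^sup>+x. ennreal (indicator S x * h x) \<partial>lborel) < \<infinity>" .
 assume "h absolutely_integrable_on S"
 hence "integral S h = (LINT x:S | lebesgue. h x)" by (rule set_lebesgue_integral_eq_integral(2)[symmetric])
 also have "... = integral\<^sup>L lborel (%x. indicator S x * h x)" unfolding set_lebesgue_integral_def using integral_completion[OF m'] by simp
 also have "... = enn2real (\<integral>\<^sup>+x. ennreal (indicator S x * h x) \<partial>lborel)"
  by (rule integral_eq_nn_integral) (use m pos' in auto)
 finally show "integral S h = enn2real (\<integral>\<^sup>+x. ennreal (indicator S x * h x) \<partial>lborel)" .
qed

text \<open>The theorem for absolutely integrable functions is vector-valued, so f is fed in as a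
  vector of length 1. It also says that one side is integrable exactly if the other one is, which
  settles the case of infinite integrals.\<close>

lemma nn_integral_change_of_variables_wo:
 fixes g :: "real^'m::{finite,wellorder} => real^'m::_" and f :: "real^'m::_ => real"
 assumes S: "S : sets borel" and der: "!!x. x : S ==> (g has_derivative g' x) (at x within S)" and inj: "inj_on g S"
  and pos: "!!x. x : S ==> 0 <= f (g x)" and mf: "(%x. indicator (g ` S) x * f x) : borel_measurable borel"
  and mF: "(%x. indicator S x * (\<bar>det (matrix (g' x))\<bar> * f (g x))) : borel_measurable borel"
 shows "(\<integral>\<^sup>+x. ennreal (indicator (g ` S) x * f x) \<partial>lborel) =
  (\<integral>\<^sup>+x. ennreal (indicator S x * (\<bar>det (matrix (g' x))\<bar> * f (g x))) \<partial>lborel)" (is "?I = ?J") proof -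
 let ?F = "%x. \<bar>det (matrix (g' x))\<bar> * f (g x)"
 have Sl: "S : sets lebesgue" using S by simp
 have vec: "(%x. (vec (h x) :: real^1)) absolutely_integrable_on T \<longleftrightarrow> h absolutely_integrable_on T"
  for h :: "real^'m::_ => real" and T by (subst absolutely_integrable_componentwise_iff)
   (simp add: Basis_vec_def inner_axis)
 have ivec: "integral T (%x. (vec (h x) :: real^1)) = vec (integral T h)"
  if "h absolutely_integrable_on T" for h :: "real^'m::_ => real" and T proof -
  have "(%x. (vec (h x) :: real^1)) integrable_on T" using that vec set_lebesgue_integral_eq_integral(1) by blast
  from integral_component_eq[OF this, of "axis 1 1"]
  have "integral T (%x. (vec (h x) :: real^1)) $ 1 = integral T h" by (simp add: inner_axis)
  thus ?thesis by (simp add: vec_eq_iff)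
 qed
 have cov: "?F absolutely_integrable_on S & integral S ?F = b \<longleftrightarrow> f absolutely_integrable_on g ` S & integral (g ` S) f = b" for b
 proof -
  have "(%x. \<bar>det (matrix (g' x))\<bar> *\<^sub>R (vec (f (g x)) :: real^1)) = (%x. vec (?F x))" by (simp add: vec_eq_iff fun_eq_iff)
  hence A: "(%x. (vec (?F x) :: real^1)) absolutely_integrable_on S & integral S (%x. vec (?F x) :: real^1) = vec b
   \<longleftrightarrow> (%x. (vec (f x) :: real^1)) absolutely_integrable_on g ` S & integral (g ` S) (%x. vec (f x) :: real^1) = vec b"
   using has_absolute_integral_change_of_variables[OF Sl der inj, of "%x. vec (f x) :: real^1" "vec b"] by simp
  have B: "(X & i' = b \<longleftrightarrow> Y & j' = b)"
   if "(X & i = vec b \<longleftrightarrow> Y & j = vec b)" "X ==> i = vec i'" "Y ==> j = vec j'"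
   for X Y and i j :: "real^1" and i' j' :: real using that by (cases X; cases Y) (simp_all add: vec_eq_iff)
  show ?thesis by (rule B[OF A[unfolded vec] ivec ivec])
 qed
 have F: "?F absolutely_integrable_on S \<longleftrightarrow> ?J < \<infinity>"
  "?F absolutely_integrable_on S ==> integral S ?F = enn2real ?J" using absolutely_integrable_nonneg_iff[OF mF] pos by auto
 have f: "f absolutely_integrable_on g ` S \<longleftrightarrow> ?I < \<infinity>"
  "f absolutely_integrable_on g ` S ==> integral (g ` S) f = enn2real ?I" using absolutely_integrable_nonneg_iff[OF mf] pos by auto
 show ?thesis proof (cases "?J < \<infinity>")
  case True
  have fi: "f absolutely_integrable_on g ` S & integral (g ` S) f = enn2real ?J" using cov[of "enn2real ?J"] F True by blast
  hence I: "?I < \<infinity>" "enn2real ?I = enn2real ?J" using f by metis+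
  have "?I = ennreal (enn2real ?I)" using I(1) by simp
  also have "... = ennreal (enn2real ?J)" by (simp only: I(2))
  also have "... = ?J" using True by simp
  finally show ?thesis .
 next
  case False
  hence "\<not> ?I < \<infinity>" using cov F(1) f(1) by blast
  with False have "?I = top" "?J = top" using \<open>\<not> ?I < \<infinity>\<close>
   unfolding infinity_ennreal_def less_top[symmetric] by blast+
  thus ?thesis by (simp only:)
 qed
qed

lemma nn_integral_change_of_variables:
 fixes g :: "real^'n => real^'n" and f :: "real^'n => real"
 assumes S: "S : sets borel" and der: "!!x. x : S ==> (g has_derivative g' x) (at x)" and inj: "inj_on g S" and pos: "!!x. x : S ==> 0 <= f (g x)"
  and mf: "(%x. indicator (g ` S) x * f x) : borel_measurable borel"
  and mF: "(%x. indicator S x * (\<bar>det (matrix (g' x))\<bar> * f (g x))) : borel_measurable borel"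
 shows "(\<integral>\<^sup>+x. ennreal (indicator (g ` S) x * f x) \<partial>lborel) =
  (\<integral>\<^sup>+x. ennreal (indicator S x * (\<bar>det (matrix (g' x))\<bar> * f (g x))) \<partial>lborel)" proof -
 have mw: "wvec : borel_measurable (borel :: (real^'n) measure)"
  using bounded_linear_wvec by (intro borel_measurable_continuous_onI linear_continuous_on)
 have mu: "unwvec : borel_measurable (borel :: (real^('n::finite) windex) measure)"
  using bounded_linear_unwvec by (intro borel_measurable_continuous_onI linear_continuous_on)
 \<comment> \<open>Lebesgue measure on the relabelled space is an image measure, so every
   nonnegative integral can be moved there.\<close>
 have tr: "(\<integral>\<^sup>+x. h x \<partial>lborel) = (\<integral>\<^sup>+x. h (unwvec x) \<partial>(lborel :: (real^('n::finite) windex) measure))"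
  if "h : borel_measurable borel" for h :: "real^'n => ennreal" using mw mu that by (subst lborel_wvec[symmetric], subst nn_integral_distr) auto
 let ?S = "wvec ` S"
 let ?g = "%x. wvec (g (unwvec x))"
 let ?g' = "%x v. wvec (g' (unwvec x) (unwvec v))"
 have Seq: "?S = unwvec -` S" by force
 have gSeq: "?g ` ?S = unwvec -` (g ` S)" by (auto simp: image_iff) (metis unwvec_wvec wvec_unwvec)
 have det: "det (matrix (?g' x)) = det (matrix (g' (unwvec x)))" for x proof -
  have ax: "unwvec (axis j 1) = axis (of_windex j) (1::real)" for j :: "('n::finite) windex"
   by (auto simp: unwvec_def axis_def vec_eq_iff of_windex_inverse to_windex_inverse)
  have "matrix (?g' x) = (\<chi> i j. matrix (g' (unwvec x)) $ of_windex i $ of_windex j)"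
   by (simp add: matrix_def vec_eq_iff ax) (simp add: wvec_def)
  thus ?thesis by (simp add: det_windex)
 qed
 have iS: "indicator ?S x = (indicator S (unwvec x) :: real)" for x by (simp add: Seq indicator_def)
 have igS: "indicator (?g ` ?S) x = (indicator (g ` S) (unwvec x) :: real)" for x by (simp add: gSeq indicator_def)
 have "(\<integral>\<^sup>+x. ennreal (indicator (?g ` ?S) x * f (unwvec x)) \<partial>lborel) =
  (\<integral>\<^sup>+x. ennreal (indicator ?S x * (\<bar>det (matrix (?g' x))\<bar> * f (unwvec (?g x)))) \<partial>lborel)"
 proof (rule nn_integral_change_of_variables_wo)
  show "?S : sets borel" unfolding Seq using measurable_sets[OF mu S] by simp
  show "(?g has_derivative ?g' x) (at x within ?S)" if "x : ?S" for x proof (rule has_derivative_at_withinI)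
   have "(g has_derivative g' (unwvec x)) (at (unwvec x))" using der that by (auto simp: Seq)
   from diff_chain_at[OF bounded_linear_imp_has_derivative[OF bounded_linear_unwvec] this]
   have "((%x. g (unwvec x)) has_derivative (%v. g' (unwvec x) (unwvec v))) (at x)" by (simp add: o_def)
   from bounded_linear.has_derivative[OF bounded_linear_wvec this] show "(?g has_derivative ?g' x) (at x)" .
  qed
  show "inj_on ?g ?S" using inj by (auto simp: inj_on_def) (metis unwvec_wvec)
  show "0 <= f (unwvec (?g x))" if "x : ?S" for x using that pos by auto
  show "(%x. indicator (?g ` ?S) x * f (unwvec x)) : borel_measurable borel" unfolding igS using measurable_compose[OF mu mf] by simp
  show "(%x. indicator ?S x * (\<bar>det (matrix (?g' x))\<bar> * f (unwvec (?g x)))) : borel_measurable borel"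
   unfolding iS det using measurable_compose[OF mu mF] by simp
 qed
 thus ?thesis unfolding igS iS det using mf mF by (subst (1 2) tr) simp_all
qed

section \<open>Measures with given densities in charts\<close>

lemma suminf_swap_ennreal:
 fixes f :: "nat => nat => ennreal" shows "(\<Sum>i. \<Sum>j. f i j) = (\<Sum>j. \<Sum>i. f i j)" proof -
 have "(\<Sum>i. \<Sum>j. f i j) = (\<integral>\<^sup>+i. (\<Sum>j. f i j) \<partial>count_space UNIV)"
  by (rule nn_integral_count_space_nat[symmetric])
 also have "... = (\<Sum>j. \<integral>\<^sup>+i. f i j \<partial>count_space UNIV)" by (rule nn_integral_suminf) simp
 also have "... = (\<Sum>j. \<Sum>i. f i j)" by (simp add: nn_integral_count_space_nat)
 finally show ?thesis .
qed

text \<open>Gluing a measure from charts uses nothing about a metric beyond the transformation law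
  of its density, so the construction is carried out for an arbitrary family of densities.\<close>

locale chart_density = smooth_mfd A
 for A :: "('m::{t2_space, second_countable_topology}, 'n::finite) chart set" +
 fixes \<rho> :: "('m, 'n) chart => real^'n => real"
 assumes density_cont: "c : A ==> continuous_on (chart_image c) (\<rho> c)" and density_nonneg: "c : A ==> x : chart_image c ==> 0 <= \<rho> c x"
  and density_trans: "c : A ==> d : A ==> p : fst c ==> p : fst d ==>
   \<rho> c (snd c p) = \<bar>det (matrix (transition_deriv c d p))\<bar> * \<rho> d (snd d p)"
begin

definition chart_vol :: "('m, 'n) chart => 'm set => ennreal" where
 "chart_vol c S = (\<integral>\<^sup>+x. ennreal (indicator (snd c ` S) x * \<rho> c x) \<partial>lborel)"

definition has_density :: "'m measure => bool" where
 "has_density M \<longleftrightarrow> sets M = sets borel \<and>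
  (ALL c:A. ALL S:sets borel. S <= fst c --> emeasure M S = chart_vol c S)"

lemma borel_chart_image:
 assumes c: "c : A" and S: "S : sets borel" "S <= fst c" shows "snd c ` S : sets borel" proof -
 have "chart_inv c : borel_measurable (restrict_space borel (chart_image c))"
  by (rule borel_measurable_continuous_on_restrict[OF continuous_on_chart_inv[OF c]])
 from measurable_sets[OF this S(1)]
 have "chart_inv c -` S Int chart_image c : sets (restrict_space borel (chart_image c))" by (simp add: space_restrict_space)
 moreover have "chart_image c : sets borel" using open_chart_image[OF c] by simp
 ultimately have "chart_inv c -` S Int chart_image c : sets borel" by (subst (asm) sets_restrict_space_iff) auto
 moreover have "snd c ` S = chart_inv c -` S Int chart_image c" using chart_img_eq[OF c, of S] S(2) by (auto simp: Int_absorb2)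
 ultimately show ?thesis by simp
qed

lemma density_measurable:
 assumes c: "c : A" and S: "S : sets borel" "S <= chart_image c" shows "(%x. indicator S x * \<rho> c x) : borel_measurable borel"
 using borel_measurable_continuous_on_indicator[OF S(1) continuous_on_subset[OF density_cont[OF c] S(2)]] by simp

text \<open>Here the transformation law of the density meets the change of variables formula: the
  Jacobian produced by the one is absorbed by the other.\<close>

lemma chart_vol_cong:
 assumes c: "c : A" and d: "d : A" and S: "S : sets borel" "S <= fst c" "S <= fst d" shows "chart_vol c S = chart_vol d S" proof -
 let ?g = "%x. snd d (chart_inv c x)"
 let ?g' = "%x. transition_deriv c d (chart_inv c x)"
 have im: "?g ` (snd c ` S) = snd d ` S" using S c by (force simp: subset_eq)
 have sub: "snd c ` S <= chart_image c" "snd d ` S <= chart_image d" using S by (auto simp: chart_image_def)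
 have F: "indicator (snd c ` S) x * (\<bar>det (matrix (?g' x))\<bar> * \<rho> d (?g x)) = indicator (snd c ` S) x * \<rho> c x" for x
 proof (cases "x : snd c ` S")
  case True then obtain p where p: "p : S" "x = snd c p" by blast
  thus ?thesis using density_trans[OF c d, of p] S c by (auto simp: subset_eq)
 qed simp
 have "(\<integral>\<^sup>+x. ennreal (indicator (?g ` (snd c ` S)) x * \<rho> d x) \<partial>lborel) =
  (\<integral>\<^sup>+x. ennreal (indicator (snd c ` S) x * (\<bar>det (matrix (?g' x))\<bar> * \<rho> d (?g x))) \<partial>lborel)"
 proof (rule nn_integral_change_of_variables)
  show "snd c ` S : sets borel" by (rule borel_chart_image[OF c S(1,2)])
  fix x assume "x : snd c ` S" then obtain p where p: "p : S" "x = snd c p" by blast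
  hence pc: "p : fst c" "p : fst d" using S by auto
  show "(?g has_derivative ?g' x) (at x)" using transition_has_derivative[OF c d pc] p pc c by simp
  show "0 <= \<rho> d (?g x)" using density_nonneg[OF d, of "snd d p"] p pc c by simp
 next
  show "inj_on ?g (snd c ` S)" proof (rule inj_onI)
   fix x y assume "x : snd c ` S" "y : snd c ` S" "?g x = ?g y" then obtain p q where "p : S" "x = snd c p" "q : S" "y = snd c q" by blast
   moreover have "inj_on (snd d) (fst d)" by (metis d inj_on_inverseI inv_snd)
   ultimately show "x = y" using \<open>?g x = ?g y\<close> S c by (auto simp: subset_eq dest: inj_onD)
  qed
  show "(%x. indicator (?g ` (snd c ` S)) x * \<rho> d x) : borel_measurable borel"
   unfolding im by (rule density_measurable[OF d borel_chart_image[OF d S(1,3)] sub(2)])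
  show "(%x. indicator (snd c ` S) x * (\<bar>det (matrix (?g' x))\<bar> * \<rho> d (?g x))) : borel_measurable borel"
   unfolding F by (rule density_measurable[OF c borel_chart_image[OF c S(1,2)] sub(1)])
 qed
 thus ?thesis unfolding chart_vol_def im F by simp
qed

lemma chart_vol_suminf:
 assumes c: "c : A" and F: "!!j. F j : sets borel" "!!j. F j <= fst c" "disjoint_family F"
 shows "(\<Sum>j. chart_vol c (F j)) = chart_vol c (\<Union>j. F j)" proof -
 have inj: "inj_on (snd c) (fst c)" by (metis c inj_on_inverseI inv_snd)
 have ind: "(\<Sum>j. ennreal (indicator (snd c ` F j) x * \<rho> c x)) = ennreal (indicator (snd c ` (\<Union>j. F j)) x * \<rho> c x)" for x
 proof (cases "x : snd c ` (\<Union>j. F j)")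
  case True then obtain i p where p: "p : F i" "x = snd c p" by blast
  have "x ~: snd c ` F j" if "j ~= i" for j proof
   assume "x : snd c ` F j" then obtain q where q: "q : F j" "x = snd c q" by blast
   hence "p = q" using p F(2) inj by (metis inj_onD subsetD)
   thus False using p q F(3) that unfolding disjoint_family_on_def by blast
  qed
  hence "(\<Sum>j. ennreal (indicator (snd c ` F j) x * \<rho> c x)) = (SUM j:{i}. ennreal (indicator (snd c ` F j) x * \<rho> c x))"
   by (intro suminf_finite) auto
  thus ?thesis using p True by (simp add: indicator_def)
 next
  case False
  hence "x ~: snd c ` F j" for j by blast
  with False show ?thesis by simp
 qed
 have "(\<Sum>j. chart_vol c (F j)) = (\<integral>\<^sup>+x. (\<Sum>j. ennreal (indicator (snd c ` F j) x * \<rho> c x)) \<partial>lborel)"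
  unfolding chart_vol_def proof (rule nn_integral_suminf[symmetric])
  fix j
  have "snd c ` F j <= chart_image c" using F(2) by (auto simp: chart_image_def)
  from density_measurable[OF c borel_chart_image[OF c F(1,2)] this]
  show "(%x. ennreal (indicator (snd c ` F j) x * \<rho> c x)) : borel_measurable lborel" by simp
 qed
 thus ?thesis unfolding ind chart_vol_def .
qed

text \<open>Second countability yields a countable subcover (Lindelof). A measure can be summed over
  these charts, but not over an arbitrary atlas.\<close>

lemma countable_charts:
 obtains C :: "nat => ('m, 'n) chart" where "!!i. C i : A" "(\<Union>i. fst (C i)) = UNIV" proof -
 have o: "!!S. S : fst ` A ==> open S" using open_dom by blast
 obtain F where F: "F <= fst ` A" "countable F" "\<Union>F = \<Union>(fst ` A)" using Lindelof[of "fst ` A"] o by metis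
 have cov: "\<Union>F = UNIV" using F(3) atlas unfolding smooth_atlas_def by auto
 hence "F ~= {}" by auto
 obtain B where B: "B <= A" "countable B" "F = fst ` B" using countable_subset_image[THEN iffD1, OF conjI[OF F(2,1)]] by blast
 have "B ~= {}" using B \<open>F ~= {}\<close> by auto
 show thesis proof (rule that[of "from_nat_into B"])
  show "from_nat_into B i : A" for i using from_nat_into[OF \<open>B ~= {}\<close>] B by blast
  have "(\<Union>i. fst (from_nat_into B i)) = \<Union>(fst ` B)" using range_from_nat_into[OF \<open>B ~= {}\<close> B(2)] by (metis image_image)
  thus "(\<Union>i. fst (from_nat_into B i)) = UNIV" using cov B by simp
 qed
qed

text \<open>The countable cover is cut into disjoint Borel pieces, each inside one chart, and the
  volumes of a set in the pieces are added up. That every other chart gives the same value is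
  \<open>chart_vol_cong\<close>.\<close>

lemma has_density_exists: "EX M. has_density M" proof -
 obtain C :: "nat => ('m, 'n) chart" where C: "!!i. C i : A" "(\<Union>i. fst (C i)) = UNIV" using countable_charts by blast
 define B where "B = disjointed (%i. fst (C i))"
 have Bb: "B i : sets borel" for i unfolding B_def disjointed_def using open_dom[OF C(1)] by (intro sets.Diff sets.finite_UN) auto
 have Bs: "B i <= fst (C i)" for i unfolding B_def by (rule disjointed_subset)
 have Bd: "disjoint_family B" unfolding B_def by (rule disjoint_family_disjointed)
 have BU: "(\<Union>i. B i) = UNIV" unfolding B_def UN_disjointed_eq by (rule C(2))
 define \<mu> where "\<mu> = (%S. \<Sum>i. chart_vol (C i) (S Int B i))"
 define M where "M = measure_of UNIV (sets borel) \<mu>"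
 \<comment> \<open>Countable additivity is an exchange of two series of nonnegative terms.\<close>
 have ca: "countably_additive (sets borel) \<mu>" unfolding countably_additive_def proof (intro allI impI)
  fix F :: "nat => 'm set" assume F: "range F <= sets borel" "disjoint_family F"
  have "(\<Sum>j. \<mu> (F j)) = (\<Sum>i. \<Sum>j. chart_vol (C i) (F j Int B i))" unfolding \<mu>_def by (rule suminf_swap_ennreal)
  also have "... = (\<Sum>i. chart_vol (C i) (\<Union>j. F j Int B i))" proof (intro suminf_cong chart_vol_suminf C)
   fix i j show "F j Int B i : sets borel" "F j Int B i <= fst (C i)" using F Bb Bs by auto
   show "disjoint_family (%j. F j Int B i)" using F(2) unfolding disjoint_family_on_def by auto
  qed
  also have "... = \<mu> (\<Union>j. F j)" unfolding \<mu>_def by (simp add: Int_UN_distrib2)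
  finally show "(\<Sum>j. \<mu> (F j)) = \<mu> (\<Union>j. F j)" .
 qed
 have sa: "sigma_algebra UNIV (sets borel)" using sets.sigma_algebra_axioms[of borel] by simp
 have pos: "positive (sets borel) \<mu>" by (simp add: positive_def \<mu>_def chart_vol_def)
 have em: "emeasure M S = \<mu> S" if "S : sets borel" for S unfolding M_def by (rule emeasure_measure_of_sigma[OF sa pos ca that])
 have "emeasure M S = chart_vol c S" if c: "c : A" and S: "S : sets borel" "S <= fst c" for c S proof -
  have "emeasure M S = (\<Sum>i. chart_vol (C i) (S Int B i))" using em[OF S(1)] by (simp add: \<mu>_def)
  also have "... = (\<Sum>i. chart_vol c (S Int B i))" by (intro suminf_cong chart_vol_cong C c) (use S Bb Bs in auto)
  also have "... = chart_vol c (\<Union>i. S Int B i)"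
   by (intro chart_vol_suminf c) (use S Bb Bd in \<open>auto simp: disjoint_family_on_def, blast\<close>)
  also have "(\<Union>i. S Int B i) = S" using BU by auto
  finally show ?thesis .
 qed
 moreover have "sets M = sets borel" unfolding M_def using sigma_algebra.sets_measure_of_eq[OF sa] by simp
 ultimately show ?thesis unfolding has_density_def by blast
qed

text \<open>The same disjoint pieces cut any Borel set into parts on which the measure is
  prescribed; countable additivity does the rest.\<close>

lemma has_density_unique:
 assumes M: "has_density M" and N: "has_density N" shows "M = N" proof (rule measure_eqI)
 show "sets M = sets N" using M N by (simp add: has_density_def)
 fix S assume "S : sets M"
 hence S: "S : sets borel" using M by (simp add: has_density_def)
 obtain C :: "nat => ('m, 'n) chart" where C: "!!i. C i : A" "(\<Union>i. fst (C i)) = UNIV" using countable_charts by blast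
 define B where "B = disjointed (%i. fst (C i))"
 have Bb: "B i : sets borel" for i unfolding B_def disjointed_def using open_dom[OF C(1)] by (intro sets.Diff sets.finite_UN) auto
 have Bs: "B i <= fst (C i)" for i unfolding B_def by (rule disjointed_subset)
 have Bd: "disjoint_family (%i. S Int B i)" using disjoint_family_disjointed[of "%i. fst (C i)"] unfolding B_def disjoint_family_on_def by auto
 have "(\<Union>i. B i) = UNIV" unfolding B_def UN_disjointed_eq by (rule C(2))
 hence U: "(\<Union>i. S Int B i) = S" by auto
 have "emeasure K S = (\<Sum>i. chart_vol (C i) (S Int B i))" if K: "has_density K" for K proof -
  have "emeasure K (\<Union>i. S Int B i) = (\<Sum>i. emeasure K (S Int B i))"
   by (rule suminf_emeasure[symmetric]) (use K S Bb Bd in \<open>auto simp: has_density_def\<close>)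
  also have "... = (\<Sum>i. chart_vol (C i) (S Int B i))"
   using K S Bb Bs C(1) unfolding has_density_def by (intro suminf_cong) (meson inf.coboundedI2 sets.Int)
  finally show ?thesis using U by simp
 qed
 thus "emeasure M S = emeasure N S" using M N by simp
qed

lemma has_density_the: "has_density (THE M. has_density M)" using theI'[of has_density] has_density_exists has_density_unique by blast

text \<open>Over a chart domain the measure is an image of Lebesgue measure with a density. The
  transfer rules for such measures then turn integrals on the manifold into integrals over
  coordinates.\<close>

lemma has_density_nn_restrict:
 assumes M: "has_density M" and c: "c : A"
 shows "restrict_space M (fst c) = distr (density (restrict_space lborel (chart_image c)) (%x. ennreal (\<rho> c x)))
  (restrict_space borel (fst c)) (chart_inv c)" (is "?L = ?R") proof -
 have fc: "fst c : sets borel" using open_dom[OF c] by simp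
 have ci: "chart_image c : sets borel" using open_chart_image[OF c] by simp
 have sM: "sets M = sets borel" using M by (simp add: has_density_def)
 have spM: "space M = UNIV" using sets_eq_imp_space_eq[OF sM] by simp
 have m: "chart_inv c : measurable (restrict_space borel (chart_image c)) (restrict_space borel (fst c))" by (rule measurable_restrict_space2)
   (use c in \<open>auto intro: borel_measurable_continuous_on_restrict[OF continuous_on_chart_inv] simp: space_restrict_space\<close>)
 have m': "chart_inv c : measurable (density (restrict_space lborel (chart_image c)) (%x. ennreal (\<rho> c x))) (restrict_space borel (fst c))"
  using m by (simp cong: measurable_cong_sets add: sets_restrict_space)
 have r: "(%x. ennreal (\<rho> c x)) : borel_measurable (restrict_space lborel (chart_image c))"
  using borel_measurable_continuous_on_restrict[OF density_cont[OF c]] by (simp cong: measurable_cong_sets add: sets_restrict_space)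
 show ?thesis proof (rule measure_eqI)
  show "sets ?L = sets ?R" by (simp add: sets_restrict_space sM)
  fix S assume "S : sets ?L"
  hence S: "S : sets borel" "S <= fst c" using fc sM spM by (auto simp: sets_restrict_space_iff)
  have sp: "space (density (restrict_space lborel (chart_image c)) (%x. ennreal (\<rho> c x))) = chart_image c" by (simp add: space_restrict_space)
  have pre: "chart_inv c -` S Int chart_image c = snd c ` S" using chart_img_eq[OF c, of S] S(2) by (auto simp: Int_absorb2)
  have "emeasure ?L S = chart_vol c S" using M S c fc sM spM by (subst emeasure_restrict_space) (auto simp: has_density_def)
  moreover have "emeasure ?R S = emeasure (density (restrict_space lborel (chart_image c)) (%x. ennreal (\<rho> c x))) (snd c ` S)"
   using m' S fc by (subst emeasure_distr) (auto simp: sp[simplified] pre sets_restrict_space_iff)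
  moreover have "... = (\<integral>\<^sup>+x. ennreal (\<rho> c x) * indicator (snd c ` S) x \<partial>restrict_space lborel (chart_image c))"
   using borel_chart_image[OF c S] S ci r by (subst emeasure_density) (auto simp: sets_restrict_space_iff chart_image_def)
  moreover have "... = (\<integral>\<^sup>+x. ennreal (\<rho> c x) * indicator (snd c ` S) x * indicator (chart_image c) x \<partial>lborel)"
   using ci by (subst nn_integral_restrict_space) auto
  moreover have "... = chart_vol c S" unfolding chart_vol_def using S density_nonneg[OF c]
   by (intro nn_integral_cong) (auto simp: indicator_def chart_image_def)
  ultimately show "emeasure ?L S = emeasure ?R S" by simp
 qed
qed

lemma has_density_integral:
 fixes f :: "'m => real"
 assumes M: "has_density M" and c: "c : A" and S: "S : sets borel" "S <= fst c" and f: "f : borel_measurable borel"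
 shows "set_integrable M S f \<longleftrightarrow> integrable lborel (%x. indicator (snd c ` S) x * (f (chart_inv c x) * \<rho> c x))" (is ?I)
  and "set_lebesgue_integral M S f = (\<integral>x. indicator (snd c ` S) x * (f (chart_inv c x) * \<rho> c x) \<partial>lborel)" (is ?E) proof -
 let ?h = "%p. indicator S p * f p"
 let ?K = "restrict_space lborel (chart_image c)"
 have fc: "fst c : sets borel" using open_dom[OF c] by simp
 have ci: "chart_image c : sets borel" using open_chart_image[OF c] by simp
 have sM: "sets M = sets borel" using M by (simp add: has_density_def)
 have h: "?h : borel_measurable borel" using f S by simp
 hence h': "?h : borel_measurable (restrict_space borel (fst c))" by (rule measurable_restrict_space1)
 have m: "chart_inv c : measurable (restrict_space borel (chart_image c)) (restrict_space borel (fst c))" by (rule measurable_restrict_space2)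
   (use c in \<open>auto intro: borel_measurable_continuous_on_restrict[OF continuous_on_chart_inv] simp: space_restrict_space\<close>)
 hence mK: "chart_inv c : measurable ?K (restrict_space borel (fst c))" by (simp cong: measurable_cong_sets add: sets_restrict_space)
 hence m': "chart_inv c : measurable (density ?K (%x. ennreal (\<rho> c x))) (restrict_space borel (fst c))" by (simp cong: measurable_cong_sets)
 have r: "\<rho> c : borel_measurable ?K" using borel_measurable_continuous_on_restrict[OF density_cont[OF c]]
  by (simp cong: measurable_cong_sets add: sets_restrict_space)
 have hK: "(%x. ?h (chart_inv c x)) : borel_measurable ?K" using measurable_compose[OF mK h'] .
 have pos: "AE x in ?K. 0 <= \<rho> c x" using density_nonneg[OF c] by (intro AE_I2) (simp add: space_restrict_space)
 have hS: "indicator (fst c) p *\<^sub>R ?h p = indicator S p *\<^sub>R f p" for p using S by (auto simp: indicator_def)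
 have hx: "indicator (chart_image c) x *\<^sub>R (\<rho> c x *\<^sub>R ?h (chart_inv c x)) = indicator (snd c ` S) x * (f (chart_inv c x) * \<rho> c x)" for x
 proof (cases "x : chart_image c")
  case True
  hence "chart_inv c x : S \<longleftrightarrow> x : snd c ` S" using chart_img_eq[OF c, of S] S(2) by (auto simp: Int_absorb2)
  thus ?thesis using True by (simp add: indicator_def)
 next
  case False
  hence "x ~: snd c ` S" using S(2) by (auto simp: chart_image_def)
  with False show ?thesis by simp
 qed
 have "set_integrable M S f \<longleftrightarrow> integrable (restrict_space M (fst c)) ?h"
  unfolding set_integrable_def using fc sM by (subst integrable_restrict_space) (auto simp: hS simp del: real_scaleR_def)
 also have "... \<longleftrightarrow> integrable (density ?K (%x. ennreal (\<rho> c x))) (%x. ?h (chart_inv c x))"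
  unfolding has_density_nn_restrict[OF M c] by (rule integrable_distr_eq[OF m' h'])
 also have "... \<longleftrightarrow> integrable ?K (%x. \<rho> c x *\<^sub>R ?h (chart_inv c x))" by (rule integrable_density[OF hK r pos])
 also have "... \<longleftrightarrow> integrable lborel (%x. indicator (snd c ` S) x * (f (chart_inv c x) * \<rho> c x))"
  using ci by (subst integrable_restrict_space) (auto simp: hx simp del: real_scaleR_def scaleR_scaleR)
 finally show ?I .
 have "set_lebesgue_integral M S f = integral\<^sup>L (restrict_space M (fst c)) ?h"
  unfolding set_lebesgue_integral_def using fc sM by (subst integral_restrict_space) (auto simp: hS simp del: real_scaleR_def)
 also have "... = integral\<^sup>L (density ?K (%x. ennreal (\<rho> c x))) (%x. ?h (chart_inv c x))"
  unfolding has_density_nn_restrict[OF M c] by (rule integral_distr[OF m' h'])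
 also have "... = integral\<^sup>L ?K (%x. \<rho> c x *\<^sub>R ?h (chart_inv c x))" by (rule integral_density[OF hK r pos])
 also have "... = (\<integral>x. indicator (snd c ` S) x * (f (chart_inv c x) * \<rho> c x) \<partial>lborel)"
  using ci by (subst integral_restrict_space) (auto simp: hx simp del: real_scaleR_def scaleR_scaleR)
 finally show ?E .
qed

end

section \<open>The volume measure of a metric\<close>

context smooth_mfd
begin

definition gram :: "('m, 'n) metric => ('m, 'n) chart => real^'n => real^'n^'n" where
 "gram g c x = (\<chi> i j. metric_comp A c g i j (chart_inv c x))"

definition vol_density :: "('m, 'n) metric => ('m, 'n) chart => real^'n => real" where
 "vol_density g c x = sqrt \<bar>det (gram g c x)\<bar>"

lemma metric_sym: "pseudo_riemannian_metric A g ==> g p u v = g p v u" unfolding pseudo_riemannian_metric_def by blast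

lemma metric_facts:
 assumes "pseudo_riemannian_metric A g" shows metric_add: "g p (u + w) v = g p u v + g p w v" "g p v (u + w) = g p v u + g p v w"
  and metric_scale: "g p (r *\<^sub>R u) v = r * g p u v" "g p v (r *\<^sub>R u) = r * g p v u"
  and metric_diff: "g p (u - w) v = g p u v - g p w v" "g p v (u - w) = g p v u - g p v w"
  and metric_minus: "g p (- u) v = - g p u v" "g p v (- u) = - g p v u" and metric_zero: "g p 0 v = 0" "g p v 0 = 0"
  and metric_sum: "g p (SUM i:I. f i) v = (SUM i:I. g p (f i) v)" "g p v (SUM i:I. f i) = (SUM i:I. g p v (f i))" proof -
 have bl: "bilinear (g p)" for p using assms by (simp add: pseudo_riemannian_metric_def)
 have l: "linear (%u. g p u v)" "linear (g p v)" for v using bl[of p] unfolding bilinear_def by auto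
 show "g p (u + w) v = g p u v + g p w v" "g p v (u + w) = g p v u + g p v w"
  "g p (u - w) v = g p u v - g p w v" "g p v (u - w) = g p v u - g p v w"
  "g p (- u) v = - g p u v" "g p v (- u) = - g p v u"
  "g p 0 v = 0" "g p v 0 = 0"
  "g p (SUM i:I. f i) v = (SUM i:I. g p (f i) v)" "g p v (SUM i:I. f i) = (SUM i:I. g p v (f i))"
  using linear_add[OF l(1)[of v]] linear_add[OF l(2)[of v]] linear_diff[OF l(1)[of v]] linear_diff[OF l(2)[of v]]
   linear_neg[OF l(1)[of v]] linear_neg[OF l(2)[of v]] linear_0[OF l(1)[of v]] linear_0[OF l(2)[of v]]
   linear_sum[OF l(1)[of v], of f I] linear_sum[OF l(2)[of v], of f I] by (simp_all add: o_def)
 show "g p (r *\<^sub>R u) v = r * g p u v" "g p v (r *\<^sub>R u) = r * g p v u"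
  using linear_cmul[OF l(1)[of v]] linear_cmul[OF l(2)[of v]] by simp_all
qed

lemma metric_nondeg: "pseudo_riemannian_metric A g ==> (!!v. g p u v = 0) ==> u = 0" unfolding pseudo_riemannian_metric_def by blast

lemma metric_nondeg_eq:
 assumes "pseudo_riemannian_metric A g" "!!w. g p u w = g p v w" shows "u = v"
 using metric_nondeg[OF assms(1), of p "u - v"] assms by (simp add: metric_diff)

lemma metric_coords:
 assumes g: "pseudo_riemannian_metric A g" and c: "c : A" "p : fst c"
 shows "g p u v = (SUM i:UNIV. SUM j:UNIV. cc c p u $ i * cc c p v $ j * gram g c (snd c p) $ i $ j)" proof -
 have "g p u v = g p (SUM i:UNIV. cc c p u $ i *\<^sub>R coord_vec A c i p) (SUM j:UNIV. cc c p v $ j *\<^sub>R coord_vec A c j p)"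
  using vec_coord_expand[OF c] by metis
 thus ?thesis using c by (simp add: metric_facts[OF g] gram_def metric_comp_def sum_distrib_left mult_ac) (rule sum.swap)
qed

lemma metric_coords_inner:
 assumes g: "pseudo_riemannian_metric A g" and c: "c : A" "p : fst c" shows "g p u v = cc c p u \<bullet> (gram g c (snd c p) *v cc c p v)"
 unfolding metric_coords[OF assms] by (simp add: inner_vec_def matrix_vector_mult_def sum_distrib_left mult_ac)

lemma gram_sym:
 assumes g: "pseudo_riemannian_metric A g" shows "gram g c x $ i $ j = gram g c x $ j $ i" by (simp add: gram_def metric_comp_def metric_sym[OF g])

text \<open>A kernel vector of the Gram matrix would be orthogonal to the whole tangent
  space.\<close>

lemma det_gram_nz:
 assumes g: "pseudo_riemannian_metric A g" and c: "c : A" "x : chart_image c" shows "det (gram g c x) ~= 0" proof -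
 let ?p = "chart_inv c x"
 have p: "?p : fst c" "snd c ?p = x" using c by simp_all
 have "ALL v. gram g c x *v v = 0 --> v = 0" proof (intro allI impI)
  fix v assume v: "gram g c x *v v = 0"
  have "g ?p (ci c ?p v) u = 0" for u using metric_coords_inner[OF g c(1) p(1), of u "ci c ?p v"] p c v metric_sym[OF g] by simp
  hence "ci c ?p v = 0" using metric_nondeg[OF g] by blast
  hence "cc c ?p (ci c ?p v) = 0" using c p by (simp add: cc_simps)
  thus "v = 0" using c p by simp
 qed
 hence "EX B. B ** gram g c x = mat 1" unfolding matrix_left_invertible_ker .
 thus ?thesis unfolding invertible_left_inverse[symmetric] invertible_det_nz .
qed

lemma gram_smooth:
 assumes g: "pseudo_riemannian_metric A g" and c: "c : A" shows "smooth_on (chart_image c) (%x. gram g c x $ i $ j)"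
 using g c by (simp add: pseudo_riemannian_metric_def gram_def o_def)

text \<open>Taking determinants, the Jacobian occurs squared; the root of the modulus therefore
  transforms as \<open>chart_density\<close> demands.\<close>

lemma gram_trans:
 assumes g: "pseudo_riemannian_metric A g" and c: "c : A" "d : A" "p : fst c" "p : fst d"
 defines "J \<equiv> matrix (transition_deriv c d p)" shows "gram g c (snd c p) = transpose J ** gram g d (snd d p) ** J" proof -
 have J: "cc d p u = J *v cc c p u" for u unfolding J_def cc_change[OF c(1,2) c(3,4)]
  using matrix_works[OF linear_matrix_vector_mul_eq[THEN iffD2, OF transition_deriv_linear[OF c]]] by simp
 have tr: "(J *v a) \<bullet> y = a \<bullet> (transpose J *v y)" for a y
  using dot_lmul_matrix[of a "transpose J" y] by (simp add: vector_transpose_matrix)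
 have "gram g c (snd c p) $ i $ j = (transpose J ** gram g d (snd d p) ** J) $ i $ j" for i j proof -
  have "gram g c (snd c p) $ i $ j = g p (ci c p (axis i 1)) (ci c p (axis j 1))" using c by (simp add: gram_def metric_comp_def coord_vec_eq)
  also have "... = (J *v axis i 1) \<bullet> (gram g d (snd d p) *v (J *v axis j 1))" unfolding metric_coords_inner[OF g c(2,4)] J using c by simp
  also have "... = axis i 1 \<bullet> ((transpose J ** gram g d (snd d p) ** J) *v axis j 1)"
   unfolding tr by (simp add: matrix_vector_mul_assoc matrix_mul_assoc)
  finally show ?thesis by (simp add: inner_axis' matrix_vector_mult_basis column_def)
 qed
 thus ?thesis by (simp add: vec_eq_iff)
qed

lemma vol_density_pos:
 "pseudo_riemannian_metric A g ==> c : A ==> x : chart_image c ==> 0 < vol_density g c x" using det_gram_nz by (simp add: vol_density_def)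

lemma vol_density_smooth:
 assumes g: "pseudo_riemannian_metric A g" and c: "c : A" shows "smooth_on (chart_image c) (vol_density g c)" unfolding vol_density_def
 by (intro smooth_on_sqrt_abs smooth_on_det gram_smooth open_chart_image det_gram_nz g c)

lemma chart_density_metric:
 assumes g: "pseudo_riemannian_metric A g" shows "chart_density A (vol_density g)" proof
 show "continuous_on (chart_image c) (vol_density g c)" if "c : A" for c by (rule smooth_on_continuous_on[OF vol_density_smooth[OF g that]])
 show "0 <= vol_density g c x" for c x by (simp add: vol_density_def)
 fix c d p assume c: "c : A" "d : A" "p : fst c" "p : fst d"
 show "vol_density g c (snd c p) = \<bar>det (matrix (transition_deriv c d p))\<bar> * vol_density g d (snd d p)"
  unfolding vol_density_def gram_trans[OF g c] det_mul det_transpose by (simp add: abs_mult real_sqrt_mult mult_ac flip: power2_eq_square)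
qed

lemma volume_measure_has_density:
 assumes g: "pseudo_riemannian_metric A g" shows "chart_density.has_density A (vol_density g) (volume_measure A g)" proof -
 interpret chart_density A "vol_density g" by (rule chart_density_metric[OF g])
 have "(sets M = sets borel \<and>
   (ALL c:A. ALL S:sets borel. S <= fst c -->
    emeasure M S = (\<integral>\<^sup>+x\<in>snd c ` S.
     ennreal (sqrt \<bar>det (\<chi> i j. metric_comp A c g i j (chart_inv c x))\<bar>) \<partial>lborel))) \<longleftrightarrow> has_density M" for M
  unfolding has_density_def chart_vol_def vol_density_def gram_def
  by (intro conj_cong refl ball_cong imp_cong arg_cong2[of _ _ _ _ "(=)"] nn_integral_cong) (simp add: indicator_def)
 hence "volume_measure A g = (THE M. has_density M)" unfolding volume_measure_def by simp
 thus ?thesis using has_density_the by simp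
qed

lemma sets_volume_measure: "pseudo_riemannian_metric A g ==> sets (volume_measure A g) = sets borel"
 using volume_measure_has_density chart_density.has_density_def chart_density_metric by blast

lemma volume_integral:
 fixes f :: "'m => real"
 assumes g: "pseudo_riemannian_metric A g" and c: "c : A" and S: "S : sets borel" "S <= fst c" and f: "f : borel_measurable borel"
 shows "set_integrable (volume_measure A g) S f \<longleftrightarrow>
   integrable lborel (%x. indicator (snd c ` S) x * (f (chart_inv c x) * vol_density g c x))" and "set_lebesgue_integral (volume_measure A g) S f =
   (\<integral>x. indicator (snd c ` S) x * (f (chart_inv c x) * vol_density g c x) \<partial>lborel)"
 using chart_density.has_density_integral[OF chart_density_metric[OF g] volume_measure_has_density[OF g] c S f] by blast+

end

section \<open>Connections in coordinates\<close>

text \<open>The bilinear map with prescribed values on pairs of basis vectors. Christoffel symbols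
  and components of the contorsion are both kept in this form, so that they can be added and
  differentiated together.\<close>

definition bl :: "('n::finite => 'n => real^'n) => real^'n => real^'n => real^'n" where
 "bl B u v = (SUM i:UNIV. SUM j:UNIV. (u $ i * v $ j) *\<^sub>R B i j)"

lemma bl_simps:
 "bl B (u + w) v = bl B u v + bl B w v" "bl B u (v + w) = bl B u v + bl B u w"
 "bl B (u - w) v = bl B u v - bl B w v" "bl B u (v - w) = bl B u v - bl B u w"
 "bl B (- u) v = - bl B u v" "bl B u (- v) = - bl B u v"
 "bl B (r *\<^sub>R u) v = r *\<^sub>R bl B u v" "bl B u (r *\<^sub>R v) = r *\<^sub>R bl B u v"
 "bl B 0 v = 0" "bl B u 0 = 0"
 "bl (%i j. B i j + C i j) u v = bl B u v + bl C u v" by (simp_all add: bl_def algebra_simps sum.distrib sum_subtractf sum_negf scaleR_sum_right)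

lemma bl_axis [simp]: "bl B (axis i 1) (axis j 1) = B i j" proof -
 have "(SUM l:UNIV. (axis i 1 $ k * axis j 1 $ l) *\<^sub>R B k l) = (if k = i then B k j else 0)" for k proof -
  have "(SUM l:UNIV. (axis i 1 $ k * axis j 1 $ l) *\<^sub>R B k l) = (SUM l:UNIV. if l = j then axis i 1 $ k *\<^sub>R B k l else 0)"
   by (intro sum.cong) (auto simp: axis_def)
  thus ?thesis by (simp add: axis_def)
 qed
 thus ?thesis unfolding bl_def by simp
qed

lemma bl_of_bilinear:
 assumes "bilinear h" shows "h u v = bl (%i j. h (axis i 1) (axis j 1)) u v" proof -
 have l: "linear (%u. h u v)" "linear (h u)" for u v using assms unfolding bilinear_def by auto
 have e1: "h u v = (SUM i:UNIV. u $ i *\<^sub>R h (axis i 1) v)" for u v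
  using basis_expansion[of u] linear_sum[OF l(1)[of v], of "%i. u $ i *\<^sub>R axis i 1" UNIV]
  by (simp add: scalar_mult_eq_scaleR linear_cmul[OF l(1)])
 have e2: "h u v = (SUM j:UNIV. v $ j *\<^sub>R h u (axis j 1))" for u v
  using basis_expansion[of v] linear_sum[OF l(2)[of u], of "%i. v $ i *\<^sub>R axis i 1" UNIV]
  by (simp add: scalar_mult_eq_scaleR linear_cmul[OF l(2)])
 show ?thesis unfolding bl_def by (subst e1, subst e2[of _ v]) (simp add: scaleR_sum_right)
qed

definition dbl :: "('a::real_normed_vector => 'n => 'n => real^'n::finite) => 'a => 'a => 'n => 'n => real^'n" where
 "dbl \<Gamma> x v i j = dird (%y. \<Gamma> y i j) x v"

lemma bl_has_derivative:
 fixes X Z :: "'a::real_normed_vector => real^'n"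
 assumes "!!i j. ((%y. \<Gamma> y i j) has_derivative (%v. dbl \<Gamma> x v i j)) (at x)"
  and "(X has_derivative dX) (at x)" "(Z has_derivative dZ) (at x)" shows "((%y. bl (\<Gamma> y) (X y) (Z y)) has_derivative
  (%v. bl (dbl \<Gamma> x v) (X x) (Z x) + bl (\<Gamma> x) (dX v) (Z x) + bl (\<Gamma> x) (X x) (dZ v))) (at x)" proof -
 have "((%y. bl (\<Gamma> y) (X y) (Z y)) has_derivative
  (%v. SUM i:UNIV. SUM j:UNIV. (X x $ i * Z x $ j) *\<^sub>R dbl \<Gamma> x v i j + (X x $ i * dZ v $ j + dX v $ i * Z x $ j) *\<^sub>R \<Gamma> x i j)) (at x)"
  unfolding bl_def by (intro has_derivative_sum has_derivative_scaleR has_derivative_mult assms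
    bounded_linear.has_derivative[OF bounded_linear_vec_nth])
 moreover have "(SUM i:UNIV. SUM j:UNIV. (X x $ i * Z x $ j) *\<^sub>R dbl \<Gamma> x v i j + (X x $ i * dZ v $ j + dX v $ i * Z x $ j) *\<^sub>R \<Gamma> x i j)
  = bl (dbl \<Gamma> x v) (X x) (Z x) + bl (\<Gamma> x) (dX v) (Z x) + bl (\<Gamma> x) (X x) (dZ v)" for v
  by (simp add: bl_def sum.distrib scaleR_add_left)
 ultimately show ?thesis by simp
qed

text \<open>Separates the second derivative of F in two fixed directions, to which symmetry applies,
  from the term in which the direction field Y is differentiated.\<close>

lemma dird_dird_field:
 fixes F :: "'a::euclidean_space => 'b::real_normed_vector"
 assumes S: "open S" "x : S" and F: "smooth_on S F" and Y: "smooth_on S Y" shows "((%y. dird F y (Y y)) has_derivative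
  (%u. dird (%y. dird F y (Y x)) x u + dird F x (dird Y x u))) (at x)" proof -
 have e: "dird F y w = (SUM b:Basis. (w \<bullet> b) *\<^sub>R dird F y b)" if "y : S" for y w proof -
  interpret lf: bounded_linear "dird F y" using F that by (intro has_derivative_bounded_linear[OF smooth_on_has_derivative])
  show ?thesis by (subst (1) euclidean_representation[symmetric]) (simp add: lf.sum lf.scaleR)
 qed
 have dF: "((%y. dird F y b) has_derivative dird (%y. dird F y b) x) (at x)" for b by (rule smooth_on_has_derivative[OF smooth_on_dird[OF F] S(2)])
 have dY: "(Y has_derivative dird Y x) (at x)" by (rule smooth_on_has_derivative[OF Y S(2)])
 have "((%y. SUM b:Basis. (Y y \<bullet> b) *\<^sub>R dird F y b) has_derivative
  (%u. SUM b:Basis. (Y x \<bullet> b) *\<^sub>R dird (%y. dird F y b) x u + (dird Y x u \<bullet> b) *\<^sub>R dird F x b)) (at x)"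
  by (intro has_derivative_sum has_derivative_scaleR has_derivative_inner_left dF dY)
 hence 1: "((%y. dird F y (Y y)) has_derivative
  (%u. SUM b:Basis. (Y x \<bullet> b) *\<^sub>R dird (%y. dird F y b) x u + (dird Y x u \<bullet> b) *\<^sub>R dird F x b)) (at x)"
  by (rule has_derivative_transform_within_open[OF _ S]) (simp add: e)
 have "((%y. SUM b:Basis. (Y x \<bullet> b) *\<^sub>R dird F y b) has_derivative
  (%u. SUM b:Basis. (Y x \<bullet> b) *\<^sub>R dird (%y. dird F y b) x u)) (at x)" by (intro has_derivative_sum has_derivative_scaleR_right dF)
 hence "((%y. dird F y (Y x)) has_derivative
  (%u. SUM b:Basis. (Y x \<bullet> b) *\<^sub>R dird (%y. dird F y b) x u)) (at x)"
  by (rule has_derivative_transform_within_open[OF _ S]) (simp add: e[of _ "Y x"])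
 from dird_eq[OF this]
 have 2: "dird (%y. dird F y (Y x)) x u = (SUM b:Basis. (Y x \<bullet> b) *\<^sub>R dird (%y. dird F y b) x u)" for u .
 have 3: "dird F x (dird Y x u) = (SUM b:Basis. (dird Y x u \<bullet> b) *\<^sub>R dird F x b)" for u by (rule e[OF S(2)])
 show ?thesis using 1 unfolding 2 3 by (simp add: sum.distrib)
qed

text \<open>The bracket, the covariant derivative and the curvature (in the sign convention of \<open>curvature\<close>) of
 a connection with Christoffel symbols \<open>\<Gamma> x i j\<close>, in coordinates.\<close>

definition br :: "(real^'n => real^'n) => (real^'n => real^'n) => real^'n => real^'n::finite" where
 "br X Y x = dird Y x (X x) - dird X x (Y x)"

definition nb :: "(real^'n => 'n => 'n => real^'n::finite) => (real^'n => real^'n) => (real^'n => real^'n) => real^'n => real^'n" where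
 "nb \<Gamma> X Y x = dird Y x (X x) + bl (\<Gamma> x) (X x) (Y x)"

definition rc :: "(real^'n => 'n => 'n => real^'n::finite) => real^'n => real^'n => real^'n => real^'n => real^'n" where
 "rc \<Gamma> x u v w = bl (dbl \<Gamma> x v) u w - bl (dbl \<Gamma> x u) v w + bl (\<Gamma> x) v (bl (\<Gamma> x) u w) - bl (\<Gamma> x) u (bl (\<Gamma> x) v w)"

lemma smooth_on_bl:
 assumes "open S" "!!i j. smooth_on S (%x. \<Gamma> x i j)" "smooth_on S X" "smooth_on S Y" shows "smooth_on S (%x. bl (\<Gamma> x) (X x) (Y x))"
 unfolding bl_def by (intro smooth_on_sum smooth_on_scaleR smooth_on_mult smooth_on_vec_nth assms)

lemma smooth_on_nb:
 assumes "open S" "!!i j. smooth_on S (%x. \<Gamma> x i j)" "smooth_on S X" "smooth_on S Y" shows "smooth_on S (nb \<Gamma> X Y)"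
 unfolding nb_def by (intro smooth_on_add smooth_on_bl smooth_on_dird_field assms)

lemma smooth_on_br:
 assumes "open S" "smooth_on S X" "smooth_on S Y" shows "smooth_on S (br X Y)" unfolding br_def by (intro smooth_on_diff smooth_on_dird_field assms)

lemma dbl_has_derivative:
 "[|!!i j. smooth_on S (%x. \<Gamma> x i j); x : S|] ==> ((%y. \<Gamma> y i j) has_derivative (%v. dbl \<Gamma> x v i j)) (at x)"
 unfolding dbl_def using smooth_on_has_derivative[of S "%x. \<Gamma> x i j" x] by (simp add: eta_contract_eq)

lemma dird_nb:
 assumes S: "open S" "x : S" and G: "!!i j. smooth_on S (%x. \<Gamma> x i j)" and X: "smooth_on S X" and Z: "smooth_on S Z"
 shows "dird (nb \<Gamma> X Z) x u = dird (%y. dird Z y (X x)) x u + dird Z x (dird X x u) +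
  (bl (dbl \<Gamma> x u) (X x) (Z x) + bl (\<Gamma> x) (dird X x u) (Z x) + bl (\<Gamma> x) (X x) (dird Z x u))" proof -
 have "((%y. dird Z y (X y) + bl (\<Gamma> y) (X y) (Z y)) has_derivative
  (%u. dird (%y. dird Z y (X x)) x u + dird Z x (dird X x u) +
  (bl (dbl \<Gamma> x u) (X x) (Z x) + bl (\<Gamma> x) (dird X x u) (Z x) + bl (\<Gamma> x) (X x) (dird Z x u)))) (at x)"
  by (intro has_derivative_add dird_dird_field[OF S Z X] bl_has_derivative dbl_has_derivative[OF G S(2)]
    smooth_on_has_derivative[OF X S(2)] smooth_on_has_derivative[OF Z S(2)])
 from dird_eq[OF this] show ?thesis by (simp add: nb_def[abs_def])
qed

text \<open>All derivatives of the fields cancel: second derivatives of Z by symmetry, first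
  derivatives of X and Y against the bracket, and first derivatives of Z between the two iterated
  terms. So the curvature depends only on the values of the fields at the point.\<close>

lemma curvature_nb:
 fixes X Y Z :: "real^'n => real^'n"
 assumes S: "open S" "x : S" and G: "!!i j. smooth_on S (%x. \<Gamma> x i j)" and X: "smooth_on S X" and Y: "smooth_on S Y" and Z: "smooth_on S Z"
 shows "nb \<Gamma> Y (nb \<Gamma> X Z) x - nb \<Gamma> X (nb \<Gamma> Y Z) x + nb \<Gamma> (br X Y) Z x = rc \<Gamma> x (X x) (Y x) (Z x)" proof -
 have sym: "dird (%y. dird Z y (X x)) x (Y x) = dird (%y. dird Z y (Y x)) x (X x)" by (rule second_dird_symmetric[OF S(1) Z S(2)])
 have lin: "dird Z x (u - v) = dird Z x u - dird Z x v" for u v using linear_diff[OF has_derivative_linear[OF smooth_on_has_derivative[OF Z S(2)]]] .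
 show ?thesis unfolding nb_def[of \<Gamma> _ _ x] dird_nb[OF S G X Z] dird_nb[OF S G Y Z] sym br_def rc_def lin bl_simps by (simp add: algebra_simps)
qed

text \<open>The vector in parentheses holds the Christoffel symbols of the first kind; the inverse
  matrix raises their last index.\<close>

definition christ :: "(real^'n => real^'n^'n) => real^'n => 'n => 'n => real^'n::finite" where
 "christ G x i j = matrix_inv (G x) *v (\<chi> l. (1/2) * (dird (%y. G y $ j $ l) x (axis i 1) +
   dird (%y. G y $ i $ l) x (axis j 1) - dird (%y. G y $ i $ j) x (axis l 1)))"

text \<open>Two symbols of the first kind add up to one derivative of the matrix, as the other terms
  cancel by symmetry. This is compatibility with the metric, tested on coordinate fields.\<close>

lemma christ_metric:
 fixes G :: "real^'n => real^'n^'n"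
 assumes "det (G x) ~= 0" and sym: "!!y i j. G y $ i $ j = G y $ j $ i"
 shows "dird (%y. G y $ i $ j) x (axis k 1) = (G x *v christ G x k i) $ j + (G x *v christ G x k j) $ i" proof -
 have "invertible (G x)" using assms invertible_det_nz by blast
 hence 1: "G x *v christ G x a b = (\<chi> l. (1/2) * (dird (%y. G y $ b $ l) x (axis a 1) +
   dird (%y. G y $ a $ l) x (axis b 1) - dird (%y. G y $ a $ b) x (axis l 1)))" for a b
  unfolding christ_def matrix_vector_mul_assoc by (simp add: matrix_inv_right_left)
 have s: "(%y. G y $ b $ a) = (%y. G y $ a $ b)" for a b using sym by blast
 show ?thesis unfolding 1 using s[of k i] s[of k j] s[of i j] by (simp, simp add: field_simps)
qed

lemma christ_sym:
 assumes sym: "!!y i j. G y $ i $ j = G y $ j $ i" shows "christ G x i j = christ G x j i" proof -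
 have s: "(%y. G y $ i $ j) = (%y. G y $ j $ i)" using sym by blast
 show ?thesis unfolding christ_def s by (simp add: add.commute)
qed

lemma bl_commute: "(!!i j. B i j = B j i) ==> bl B u v = bl B v u" unfolding bl_def by (subst sum.swap) (simp add: mult.commute)

text \<open>By the product rule only the term that differentiates the matrix needs an argument. It
  is linear in the direction, and for coordinate directions it is
  \<open>christ_metric\<close>.\<close>

lemma christ_compat:
 fixes G :: "real^'n => real^'n^'n"
 assumes S: "x : S" and G: "!!i j. smooth_on S (%y. G y $ i $ j)" and d: "det (G x) ~= 0" and sym: "!!y i j. G y $ i $ j = G y $ j $ i"
  and Y: "smooth_on S Y" and W: "smooth_on S W" shows "dird (%y. Y y \<bullet> (G y *v W y)) x (X x) =
  nb (christ G) X Y x \<bullet> (G x *v W x) + Y x \<bullet> (G x *v nb (christ G) X W x)" proof -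
 let ?u = "X x"
 have dG: "((%y. G y $ i $ j) has_derivative dird (%y. G y $ i $ j) x) (at x)" for i j by (rule smooth_on_has_derivative[OF G S])
 have dY: "(Y has_derivative dird Y x) (at x)" by (rule smooth_on_has_derivative[OF Y S])
 have dW: "(W has_derivative dird W x) (at x)" by (rule smooth_on_has_derivative[OF W S])
 have eq: "(Y y \<bullet> (G y *v W y)) = (SUM i:UNIV. SUM j:UNIV. Y y $ i * (G y $ i $ j * W y $ j))" for y
  by (simp add: inner_vec_def matrix_vector_mult_def sum_distrib_left)
 have "((%y. SUM i:UNIV. SUM j:UNIV. Y y $ i * (G y $ i $ j * W y $ j)) has_derivative
  (%v. SUM i:UNIV. SUM j:UNIV. Y x $ i * (G x $ i $ j * dird W x v $ j + dird (%y. G y $ i $ j) x v * W x $ j) +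
    dird Y x v $ i * (G x $ i $ j * W x $ j))) (at x)"
  by (intro has_derivative_sum has_derivative_mult dG dY dW bounded_linear.has_derivative[OF bounded_linear_vec_nth])
 from dird_eq[OF this, of ?u]
 have L: "dird (%y. Y y \<bullet> (G y *v W y)) x ?u =
   Y x \<bullet> (G x *v dird W x ?u) + dird Y x ?u \<bullet> (G x *v W x) +
   (SUM i:UNIV. SUM j:UNIV. Y x $ i * dird (%y. G y $ i $ j) x ?u * W x $ j)" unfolding eq[abs_def]
  by (simp add: inner_vec_def matrix_vector_mult_def sum_distrib_left sum.distrib algebra_simps)
 have lin: "dird (%y. G y $ i $ j) x ?u = (SUM k:UNIV. ?u $ k * dird (%y. G y $ i $ j) x (axis k 1))" for i j proof -
  interpret l: bounded_linear "dird (%y. G y $ i $ j) x" using dG has_derivative_bounded_linear by blast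
  have "?u = (SUM k:UNIV. ?u $ k *\<^sub>R axis k 1)" using basis_expansion[of ?u] by (simp add: scalar_mult_eq_scaleR)
  thus ?thesis by (metis (mono_tags, lifting) l.scaleR l.sum real_scaleR_def sum.cong)
 qed
 have sy: "a \<bullet> (G x *v b) = (G x *v a) \<bullet> b" for a b
  by (simp add: inner_vec_def matrix_vector_mult_def sum_distrib_left sum_distrib_right, subst sum.swap)
   (simp add: sym[of x] mult_ac)
 have blY: "Y x \<bullet> (G x *v bl (christ G x) ?u (W x)) =
  (SUM i:UNIV. SUM k:UNIV. SUM j:UNIV. Y x $ i * (?u $ k * W x $ j * (G x *v christ G x k j) $ i))"
  by (simp add: bl_def linear_sum[OF matrix_vector_mul_linear] linear_cmul[OF matrix_vector_mul_linear] inner_vec_def sum_distrib_left)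
 have blW: "bl (christ G x) ?u (Y x) \<bullet> (G x *v W x) =
  (SUM j:UNIV. SUM k:UNIV. SUM i:UNIV. W x $ j * (?u $ k * Y x $ i * (G x *v christ G x k i) $ j))" unfolding sy
  by (simp add: bl_def linear_sum[OF matrix_vector_mul_linear] linear_cmul[OF matrix_vector_mul_linear] inner_vec_def sum_distrib_left mult_ac)
 have "(SUM i:UNIV. SUM j:UNIV. Y x $ i * dird (%y. G y $ i $ j) x ?u * W x $ j) =
   (SUM i:UNIV. SUM j:UNIV. SUM k:UNIV. Y x $ i * (?u $ k * W x $ j * (G x *v christ G x k j) $ i) +
    W x $ j * (?u $ k * Y x $ i * (G x *v christ G x k i) $ j))" unfolding lin christ_metric[of G x, OF d sym]
  by (simp add: sum_distrib_left sum_distrib_right algebra_simps)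
 also have "... = Y x \<bullet> (G x *v bl (christ G x) ?u (W x)) + bl (christ G x) ?u (Y x) \<bullet> (G x *v W x)" unfolding blY blW sum.distrib
 proof (rule arg_cong2[of _ _ _ _ "(+)"])
  show "(SUM i:UNIV. SUM j:UNIV. SUM k:UNIV. Y x $ i * (?u $ k * W x $ j * (G x *v christ G x k j) $ i)) =
   (SUM i:UNIV. SUM k:UNIV. SUM j:UNIV. Y x $ i * (?u $ k * W x $ j * (G x *v christ G x k j) $ i))" by (rule sum.cong[OF refl], rule sum.swap)
  show "(SUM i:UNIV. SUM j:UNIV. SUM k:UNIV. W x $ j * (?u $ k * Y x $ i * (G x *v christ G x k i) $ j)) =
   (SUM j:UNIV. SUM k:UNIV. SUM i:UNIV. W x $ j * (?u $ k * Y x $ i * (G x *v christ G x k i) $ j))"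
   by (subst sum.swap, rule sum.cong[OF refl], rule sum.swap)
 qed
 finally show ?thesis unfolding L nb_def by (simp add: inner_add_left matrix_vector_right_distrib inner_add_right)
qed

lemma smooth_on_christ:
 fixes G :: "real^'n => real^'n^'n"
 assumes S: "open S" and G: "!!i j. smooth_on S (%y. G y $ i $ j)" and d: "!!x. x : S ==> det (G x) ~= 0" shows "smooth_on S (%x. christ G x i j)"
proof (rule smooth_on_vec_lambda[OF S])
 show "smooth_on S (%x. christ G x i j $ k)" for k unfolding christ_def matrix_vector_mult_def
  by (simp, intro smooth_on_sum smooth_on_mult smooth_on_matrix_inv smooth_on_const smooth_on_add smooth_on_diff
    smooth_on_divide smooth_on_dird S G d) simp_all
qed

section \<open>The Lie bracket and the Levi-Civita connection\<close>

context smooth_mfd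
begin

lemma vrep_smooth: "svf UNIV X ==> c : A ==> smooth_on (chart_image c) (vrep c X)" using svfD[of UNIV X c] by (simp add: chart_image_def)

lemma sfun_smooth: "sfun UNIV f ==> c : A ==> smooth_on (chart_image c) (%x. f (chart_inv c x))"
 using sfunD[of UNIV f c] by (simp add: chart_image_def)

lemma bracket_chart:
 assumes c: "c : A" "p : fst c" and X: "svf UNIV X" and Y: "svf UNIV Y" and f: "sfun UNIV f"
 shows "vf_deriv A X (vf_deriv A Y f) p - vf_deriv A Y (vf_deriv A X f) p =
  dird (%x. f (chart_inv c x)) (snd c p) (br (vrep c X) (vrep c Y) (snd c p))" proof -
 let ?x = "snd c p" and ?F = "%x. f (chart_inv c x)" and ?S = "chart_image c"
 have S: "open ?S" "?x : ?S" using c open_chart_image by auto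
 have F: "smooth_on ?S ?F" by (rule sfun_smooth[OF f c(1)])
 have XY: "smooth_on ?S (vrep c X)" "smooth_on ?S (vrep c Y)" using vrep_smooth X Y c by auto
 have 1: "vf_deriv A X (vf_deriv A Y f) p = dird (%y. dird ?F y (vrep c Y ?x)) ?x (vrep c X ?x) + dird ?F ?x (dird (vrep c Y) ?x (vrep c X ?x))"
  if X: "svf UNIV X" and Y: "svf UNIV Y" for X Y proof -
  have "vf_deriv A X (vf_deriv A Y f) p = dird (%x. vf_deriv A Y f (chart_inv c x)) ?x (vrep c X ?x)"
   using vf_deriv_chart[OF c _ _ vf_deriv_smooth[OF _ Y f]] c by (simp add: vrep_snd)
  also have "... = dird (%y. dird ?F y (vrep c Y y)) ?x (vrep c X ?x)" proof (rule frechet_derivative_transform_within_open[THEN fun_cong, OF _ S])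
   show "(%x. vf_deriv A Y f (chart_inv c x)) differentiable at ?x"
    using smooth_on_differentiable[OF sfun_smooth[OF vf_deriv_smooth[OF _ Y f] c(1)] S(2)] by simp
   show "vf_deriv A Y f (chart_inv c y) = dird ?F y (vrep c Y y)" if "y : ?S" for y
    using vf_deriv_chart[OF c(1) _ _ _ f, of "chart_inv c y" Y] that c by (simp add: vrep_def)
  qed
  also have "... = dird (%y. dird ?F y (vrep c Y ?x)) ?x (vrep c X ?x) + dird ?F ?x (dird (vrep c Y) ?x (vrep c X ?x))"
   by (rule dird_eq[OF dird_dird_field[OF S F vrep_smooth[OF Y c(1)]]])
  finally show ?thesis .
 qed
 have lin: "dird ?F ?x (u - v) = dird ?F ?x u - dird ?F ?x v" for u v
  using linear_diff[OF has_derivative_linear[OF smooth_on_has_derivative[OF F S(2)]]] .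
 show ?thesis unfolding 1[OF X Y] 1[OF Y X] br_def lin using second_dird_symmetric[OF S(1) F S(2), of "vrep c Y ?x" "vrep c X ?x"] by simp
qed

text \<open>Both sides act on functions as the commutator of X and Y, and a tangent vector is
  determined by its action.\<close>

lemma bracket_chart_indep:
 assumes c: "c : A" "p : fst c" and d: "d : A" "p : fst d" and X: "svf UNIV X" and Y: "svf UNIV Y"
 shows "ci c p (br (vrep c X) (vrep c Y) (snd c p)) = ci d p (br (vrep d X) (vrep d Y) (snd d p))" proof -
 have "vf_deriv A (%q. ci c p (br (vrep c X) (vrep c Y) (snd c p))) f p = vf_deriv A (%q. ci d p (br (vrep d X) (vrep d Y) (snd d p))) f p"
  if f: "sfun UNIV f" for f using bracket_chart[OF c X Y f] bracket_chart[OF d X Y f]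
   vf_deriv_chart[OF c _ _ f, of "%q. ci c p (br (vrep c X) (vrep c Y) (snd c p))"]
   vf_deriv_chart[OF d _ _ f, of "%q. ci d p (br (vrep d X) (vrep d Y) (snd d p))"] c d by simp
 from tangent_separation[OF this] show ?thesis .
qed

text \<open>A coordinate formula for the bracket, which \<open>lie_bracket\<close> only
  characterises by its action on functions. Its smoothness and its action prove that the
  characterised field exists.\<close>

definition lb :: "('m, 'n) vfield => ('m, 'n) vfield => ('m, 'n) vfield" where
 "lb X Y p = (let c = chart_at A p in ci c p (br (vrep c X) (vrep c Y) (snd c p)))"

lemma lb_chart:
 assumes c: "c : A" "p : fst c" and X: "svf UNIV X" and Y: "svf UNIV Y" shows "cc c p (lb X Y p) = br (vrep c X) (vrep c Y) (snd c p)"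
 using bracket_chart_indep[OF c chart_at_in in_chart_at X Y] c by (metis cc_ci lb_def)

lemma svf_UNIV_I:
 assumes "!!c. c : A ==> smooth_on (chart_image c) (F c)" and "!!c p. c : A ==> p : fst c ==> cc c p (X p) = F c (snd c p)" shows "svf UNIV X"
proof (rule svf_chartI)
 fix c assume c: "c : A"
 have "smooth_on (chart_image c) (vrep c X)" proof (subst smooth_on_cong[OF open_chart_image[OF c]])
  fix x assume "x : chart_image c"
  thus "vrep c X x = F c x" using assms(2)[OF c, of "chart_inv c x"] c by (simp add: vrep_def)
 qed (rule assms(1)[OF c])
 thus "smooth_on (snd c ` (UNIV Int fst c)) (vrep c X)" by (simp add: chart_image_def)
qed

lemma sfun_UNIV_I:
 assumes "!!c. c : A ==> smooth_on (chart_image c) (F c)" and "!!c p. c : A ==> p : fst c ==> f p = F c (snd c p)" shows "sfun UNIV f"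
proof (rule sfun_chartI)
 fix c assume c: "c : A"
 have "smooth_on (chart_image c) (%x. f (chart_inv c x))" proof (subst smooth_on_cong[OF open_chart_image[OF c]])
  fix x assume "x : chart_image c"
  thus "f (chart_inv c x) = F c x" using assms(2)[OF c, of "chart_inv c x"] c by simp
 qed (rule assms(1)[OF c])
 thus "smooth_on (snd c ` (UNIV Int fst c)) (%x. f (chart_inv c x))" by (simp add: chart_image_def)
qed

lemma svf_lb: "svf UNIV X ==> svf UNIV Y ==> svf UNIV (lb X Y)" by (rule svf_UNIV_I[of "%c. br (vrep c X) (vrep c Y)"])
  (auto intro: smooth_on_br open_chart_image vrep_smooth lb_chart)

lemma lb_deriv:
 assumes X: "svf UNIV X" and Y: "svf UNIV Y" and f: "sfun UNIV f"
 shows "vf_deriv A (lb X Y) f p = vf_deriv A X (vf_deriv A Y f) p - vf_deriv A Y (vf_deriv A X f) p"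
 using bracket_chart[OF chart_at_in in_chart_at X Y f, of p]
  vf_deriv_chart[OF chart_at_in in_chart_at _ _ f, of p "lb X Y"] lb_chart[OF chart_at_in in_chart_at X Y, of p] by simp

lemma lie_bracket_eq:
 assumes X: "svf UNIV X" and Y: "svf UNIV Y" shows "lie_bracket A X Y = lb X Y" unfolding lie_bracket_def smooth_vfield_svf smooth_fun_sfun
proof (rule the_equality)
 show "svf UNIV (lb X Y) & (ALL f. sfun UNIV f --> (ALL p. vf_deriv A (lb X Y) f p =
    vf_deriv A X (vf_deriv A Y f) p - vf_deriv A Y (vf_deriv A X f) p))" using svf_lb[OF X Y] lb_deriv[OF X Y] by blast
 fix Z assume Z: "svf UNIV Z & (ALL f. sfun UNIV f --> (ALL p. vf_deriv A Z f p =
    vf_deriv A X (vf_deriv A Y f) p - vf_deriv A Y (vf_deriv A X f) p))"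
 show "Z = lb X Y" proof
  fix p show "Z p = lb X Y p" proof (rule tangent_separation)
   fix f assume "sfun UNIV f"
   thus "vf_deriv A Z f p = vf_deriv A (lb X Y) f p" using Z lb_deriv[OF X Y, of f p] by simp
  qed
 qed
qed

lemma metric_field_chart:
 assumes g: "pseudo_riemannian_metric A g" and c: "c : A" "x : chart_image c"
 shows "g (chart_inv c x) (X (chart_inv c x)) (Y (chart_inv c x)) = vrep c X x \<bullet> (gram g c x *v vrep c Y x)"
 using metric_coords_inner[OF g c(1), of "chart_inv c x"] c by (simp add: vrep_def)

lemma smooth_on_quadratic:
 fixes G :: "'a::euclidean_space => real^'n^'n"
 assumes "open S" "!!i j. smooth_on S (%x. G x $ i $ j)" "smooth_on S X" "smooth_on S Y" shows "smooth_on S (%x. X x \<bullet> (G x *v Y x))"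
 unfolding inner_vec_def matrix_vector_mult_def by (simp, intro smooth_on_sum smooth_on_mult smooth_on_vec_nth assms)

lemma sfun_metric_local:
 assumes g: "pseudo_riemannian_metric A g" and U: "open U" and X: "svf U X" and Y: "svf U Y" shows "sfun U (%p. g p (X p) (Y p))"
proof (rule sfun_chartI)
 fix c assume c: "c : A"
 let ?V = "snd c ` (U Int fst c)"
 have V: "open ?V" "?V <= chart_image c" using open_chart_img[OF c U] by (auto simp: chart_image_def)
 have "smooth_on ?V (%x. vrep c X x \<bullet> (gram g c x *v vrep c Y x))"
  by (intro smooth_on_quadratic V smooth_on_subset[OF gram_smooth[OF g c]] svfD[OF X c] svfD[OF Y c])
 thus "smooth_on ?V (%x. g (chart_inv c x) (X (chart_inv c x)) (Y (chart_inv c x)))"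
  by (subst smooth_on_cong[OF V(1)]) (use V(2) in \<open>auto simp: metric_field_chart[OF g c]\<close>)
qed

lemma sfun_metric:
 "pseudo_riemannian_metric A g ==> svf UNIV X ==> svf UNIV Y ==> sfun UNIV (%p. g p (X p) (Y p))" by (rule sfun_metric_local) auto

definition lcc :: "('m, 'n) metric => ('m, 'n) chart => ('m, 'n) vfield => ('m, 'n) vfield => 'm => real^'n" where
 "lcc g c X Y p = ci c p (nb (christ (gram g c)) (vrep c X) (vrep c Y) (snd c p))"

lemma lcc_torsion:
 assumes g: "pseudo_riemannian_metric A g" and c: "c : A" "p : fst c" and X: "svf UNIV X" and Y: "svf UNIV Y"
 shows "lcc g c X Y p - lcc g c Y X p = lb X Y p" proof -
 have "bl (christ (gram g c) x) u v = bl (christ (gram g c) x) v u" for x u v by (rule bl_commute, rule christ_sym) (rule gram_sym[OF g])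
 hence "nb (christ (gram g c)) (vrep c X) (vrep c Y) (snd c p) - nb (christ (gram g c)) (vrep c Y) (vrep c X) (snd c p)
   = br (vrep c X) (vrep c Y) (snd c p)" by (simp add: nb_def br_def)
 hence "cc c p (lcc g c X Y p - lcc g c Y X p) = cc c p (lb X Y p)" unfolding lb_chart[OF c X Y] using c by (simp add: lcc_def cc_simps)
 thus ?thesis using c by (simp add: cc_inject)
qed

lemma lcc_metric:
 assumes g: "pseudo_riemannian_metric A g" and c: "c : A" "p : fst c" and X: "svf UNIV X" and Y: "svf UNIV Y" and Z: "svf UNIV Z"
 shows "vf_deriv A X (%q. g q (Y q) (Z q)) p = g p (lcc g c X Y p) (Z p) + g p (Y p) (lcc g c X Z p)" proof -
 let ?x = "snd c p" and ?S = "chart_image c"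
 have S: "open ?S" "?x : ?S" using c open_chart_image by auto
 have "vf_deriv A X (%q. g q (Y q) (Z q)) p = dird (%x. g (chart_inv c x) (Y (chart_inv c x)) (Z (chart_inv c x))) ?x (vrep c X ?x)"
  using vf_deriv_chart[OF c _ _ sfun_metric[OF g Y Z]] c by (simp add: vrep_snd)
 also have "... = dird (%x. vrep c Y x \<bullet> (gram g c x *v vrep c Z x)) ?x (vrep c X ?x)"
  by (rule frechet_derivative_transform_within_open[THEN fun_cong, OF _ S])
   (use smooth_on_differentiable[OF sfun_smooth[OF sfun_metric[OF g Y Z] c(1)] S(2)] metric_field_chart[OF g c(1)] in auto)
 also have "... = nb (christ (gram g c)) (vrep c X) (vrep c Y) ?x \<bullet> (gram g c ?x *v vrep c Z ?x) +
   vrep c Y ?x \<bullet> (gram g c ?x *v nb (christ (gram g c)) (vrep c X) (vrep c Z) ?x)"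
  by (rule christ_compat[OF S(2) gram_smooth[OF g c(1)] det_gram_nz[OF g c(1) S(2)] gram_sym[OF g]
    vrep_smooth[OF Y c(1)] vrep_smooth[OF Z c(1)]])
 also have "... = g p (lcc g c X Y p) (Z p) + g p (Y p) (lcc g c X Z p)"
  unfolding metric_coords_inner[OF g c] using c by (simp add: lcc_def vrep_snd)
 finally show ?thesis .
qed

text \<open>The difference of two candidates is symmetric in its first two slots and skew in its
  last two, hence zero. N and N' are bare maps of fields at one point because the lemma is first
  applied to coordinate expressions in two charts, before any global connection is
  available.\<close>

lemma lc_unique:
 assumes g: "pseudo_riemannian_metric A g" and t: "!!X Y. svf UNIV X ==> svf UNIV Y ==> N X Y - N Y X = lb X Y p"
   "!!X Y. svf UNIV X ==> svf UNIV Y ==> N' X Y - N' Y X = lb X Y p" and m: "!!X Y Z. svf UNIV X ==> svf UNIV Y ==> svf UNIV Z ==>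
    vf_deriv A X (%q. g q (Y q) (Z q)) p = g p (N X Y) (Z p) + g p (Y p) (N X Z)"
   "!!X Y Z. svf UNIV X ==> svf UNIV Y ==> svf UNIV Z ==>
    vf_deriv A X (%q. g q (Y q) (Z q)) p = g p (N' X Y) (Z p) + g p (Y p) (N' X Z)" and X: "svf UNIV X" and Y: "svf UNIV Y" shows "N X Y = N' X Y"
proof (rule metric_nondeg_eq[OF g])
 fix w
 obtain Z where Z: "svf UNIV Z" "Z p = w" by (rule field_through)
 define a where "a = (%X Y Z. g p (N X Y) (Z p) - g p (N' X Y) (Z p))"
 have s: "a X Y Z = a Y X Z" if "svf UNIV X" "svf UNIV Y" for X Y Z proof -
  have "N X Y - N Y X = N' X Y - N' Y X" using t that by simp
  hence "g p (N X Y - N Y X) (Z p) = g p (N' X Y - N' Y X) (Z p)" by simp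
  thus ?thesis by (simp add: a_def metric_facts[OF g])
 qed
 have k: "a X Y Z = - a X Z Y" if "svf UNIV X" "svf UNIV Y" "svf UNIV Z" for X Y Z
  using m(1)[OF that] m(2)[OF that] metric_sym[OF g, of p "Y p"] by (simp add: a_def)
 have "a X Y Z = - a X Y Z" using s[OF X Y, of Z] k[OF Y X Z(1)] s[OF Y Z(1), of X] k[OF Z(1) Y X] s[OF Z(1) X, of Y] k[OF X Z(1) Y] by simp
 thus "g p (N X Y) w = g p (N' X Y) w" using Z by (simp add: a_def)
qed

text \<open>Uniqueness takes the place of the transformation law of the Christoffel symbols.\<close>

lemma lcc_indep:
 assumes g: "pseudo_riemannian_metric A g" and c: "c : A" "p : fst c" and d: "d : A" "p : fst d" and X: "svf UNIV X" and Y: "svf UNIV Y"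
 shows "lcc g c X Y p = lcc g d X Y p" by (rule lc_unique[OF g, of "%X Y. lcc g c X Y p" p "%X Y. lcc g d X Y p"])
  ((rule lcc_torsion[OF g c] lcc_torsion[OF g d] lcc_metric[OF g c] lcc_metric[OF g d] X Y; assumption?)+)

definition lcf :: "('m, 'n) metric => ('m, 'n) connection" where
 "lcf g X Y p = lcc g (chart_at A p) X Y p"

lemma lcf_chart:
 assumes g: "pseudo_riemannian_metric A g" and c: "c : A" "p : fst c" and X: "svf UNIV X" and Y: "svf UNIV Y"
 shows "cc c p (lcf g X Y p) = nb (christ (gram g c)) (vrep c X) (vrep c Y) (snd c p)"
 unfolding lcf_def lcc_indep[OF g chart_at_in in_chart_at c X Y] using c by (simp add: lcc_def)

lemma christ_smooth:
 "pseudo_riemannian_metric A g ==> c : A ==> smooth_on (chart_image c) (%x. christ (gram g c) x i j)"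
 by (intro smooth_on_christ open_chart_image gram_smooth det_gram_nz)

lemma svf_lcf:
 assumes g: "pseudo_riemannian_metric A g" and X: "svf UNIV X" and Y: "svf UNIV Y" shows "svf UNIV (lcf g X Y)"
 by (rule svf_UNIV_I[of "%c. nb (christ (gram g c)) (vrep c X) (vrep c Y)"])
  (auto intro: smooth_on_nb open_chart_image vrep_smooth christ_smooth lcf_chart g X Y)

lemma vrep_add: "c : A ==> x : chart_image c ==> vrep c (%q. X q + Y q) x = vrep c X x + vrep c Y x"
 and vrep_scale: "c : A ==> x : chart_image c ==> vrep c (%q. f q *\<^sub>R X q) x = f (chart_inv c x) *\<^sub>R vrep c X x"
 by (simp_all add: vrep_def cc_simps)

lemma dird_vrep_add:
 assumes c: "c : A" "x : chart_image c" and X: "svf UNIV X" and Y: "svf UNIV Y"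
 shows "dird (vrep c (%q. X q + Y q)) x v = dird (vrep c X) x v + dird (vrep c Y) x v" proof (rule dird_eq)
 have "((%x. vrep c X x + vrep c Y x) has_derivative (%v. dird (vrep c X) x v + dird (vrep c Y) x v)) (at x)"
  by (intro has_derivative_add smooth_on_has_derivative[OF vrep_smooth c(2)] X Y c)
 thus "(vrep c (%q. X q + Y q) has_derivative (%v. dird (vrep c X) x v + dird (vrep c Y) x v)) (at x)"
  by (rule has_derivative_transform_within_open[OF _ open_chart_image[OF c(1)] c(2)]) (simp add: vrep_add c)
qed

lemma dird_vrep_scale:
 assumes c: "c : A" "x : chart_image c" and X: "svf UNIV X" and f: "sfun UNIV f" shows "dird (vrep c (%q. f q *\<^sub>R X q)) x v =
  f (chart_inv c x) *\<^sub>R dird (vrep c X) x v + dird (%x. f (chart_inv c x)) x v *\<^sub>R vrep c X x" proof (rule dird_eq)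
 have "((%x. f (chart_inv c x) *\<^sub>R vrep c X x) has_derivative (%v. f (chart_inv c x) *\<^sub>R dird (vrep c X) x v + dird (%x. f (chart_inv c x)) x v *\<^sub>R vrep c X x)) (at x)"
  by (intro has_derivative_scaleR smooth_on_has_derivative[OF vrep_smooth c(2)] smooth_on_has_derivative[OF sfun_smooth c(2)] X f c)
 thus "(vrep c (%q. f q *\<^sub>R X q) has_derivative (%v. f (chart_inv c x) *\<^sub>R dird (vrep c X) x v + dird (%x. f (chart_inv c x)) x v *\<^sub>R vrep c X x)) (at x)"
  by (rule has_derivative_transform_within_open[OF _ open_chart_image[OF c(1)] c(2)]) (simp add: vrep_scale c)
qed

lemma lcf_is_levi_civita:
 assumes g: "pseudo_riemannian_metric A g" shows "is_levi_civita A g (lcf g)" proof -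
 have dl: "linear (dird (vrep c Y) x)" if "c : A" "x : chart_image c" "svf UNIV Y" for c x Y
  using has_derivative_linear[OF smooth_on_has_derivative[OF vrep_smooth[OF that(3,1)] that(2)]] .
 have add1: "lcf g (%q. X q + Y q) Z p = lcf g X Z p + lcf g Y Z p"
  if X: "svf UNIV X" and Y: "svf UNIV Y" and Z: "svf UNIV Z" for X Y Z p proof -
  let ?c = "chart_at A p"
  have "cc ?c p (lcf g (%q. X q + Y q) Z p) = cc ?c p (lcf g X Z p + lcf g Y Z p)" using dl[of ?c "snd ?c p" Z] that
   by (simp add: lcf_chart[OF g] svf_add nb_def cc_simps vrep_add bl_simps linear_add)
  thus ?thesis by (simp add: cc_inject)
 qed
 have add2: "lcf g X (%q. Y q + Z q) p = lcf g X Y p + lcf g X Z p"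
  if X: "svf UNIV X" and Y: "svf UNIV Y" and Z: "svf UNIV Z" for X Y Z p proof -
  let ?c = "chart_at A p"
  have "cc ?c p (lcf g X (%q. Y q + Z q) p) = cc ?c p (lcf g X Y p + lcf g X Z p)"
   using that by (simp add: lcf_chart[OF g] svf_add nb_def cc_simps vrep_add bl_simps dird_vrep_add)
  thus ?thesis by (simp add: cc_inject)
 qed
 have sc1: "lcf g (%q. f q *\<^sub>R X q) Y p = f p *\<^sub>R lcf g X Y p"
  if X: "svf UNIV X" and Y: "svf UNIV Y" and f: "sfun UNIV f" for X Y f p proof -
  let ?c = "chart_at A p"
  have "cc ?c p (lcf g (%q. f q *\<^sub>R X q) Y p) = cc ?c p (f p *\<^sub>R lcf g X Y p)" using dl[of ?c "snd ?c p" Y] that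
   by (simp add: lcf_chart[OF g] svf_scale nb_def cc_simps vrep_scale bl_simps linear_cmul scaleR_add_right)
  thus ?thesis by (simp add: cc_inject)
 qed
 have sc2: "lcf g X (%q. f q *\<^sub>R Y q) p = vf_deriv A X f p *\<^sub>R Y p + f p *\<^sub>R lcf g X Y p"
  if X: "svf UNIV X" and Y: "svf UNIV Y" and f: "sfun UNIV f" for X Y f p proof -
  let ?c = "chart_at A p"
  have "vf_deriv A X f p = dird (%x. f (chart_inv ?c x)) (snd ?c p) (vrep ?c X (snd ?c p))"
   using vf_deriv_chart[OF chart_at_in in_chart_at _ _ f] by (simp add: vrep_snd)
  hence "cc ?c p (lcf g X (%q. f q *\<^sub>R Y q) p) = cc ?c p (vf_deriv A X f p *\<^sub>R Y p + f p *\<^sub>R lcf g X Y p)"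
   using that by (simp add: lcf_chart[OF g] svf_scale nb_def cc_simps vrep_scale bl_simps dird_vrep_scale vrep_snd scaleR_add_right)
  thus ?thesis by (simp add: cc_inject)
 qed
 show ?thesis unfolding is_levi_civita_def affine_connection_def smooth_vfield_svf smooth_fun_sfun
  using svf_lcf[OF g] add1 add2 sc1 sc2 lcc_torsion[OF g chart_at_in in_chart_at] lcc_metric[OF g chart_at_in in_chart_at]
  by (auto simp: lie_bracket_eq lcf_def)
qed

lemma levi_civita_is:
 "pseudo_riemannian_metric A g ==> is_levi_civita A g (levi_civita A g)"
 unfolding levi_civita_def by (rule someI[of "is_levi_civita A g", OF lcf_is_levi_civita])

lemma levi_civita_eq:
 assumes g: "pseudo_riemannian_metric A g" and X: "svf UNIV X" and Y: "svf UNIV Y" shows "levi_civita A g X Y p = lcf g X Y p" proof -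
 have L: "is_levi_civita A g N ==> svf UNIV X ==> svf UNIV Y ==> N X Y p - N Y X p = lb X Y p"
  "is_levi_civita A g N ==> svf UNIV X ==> svf UNIV Y ==> svf UNIV Z ==>
    vf_deriv A X (%q. g q (Y q) (Z q)) p = g p (N X Y p) (Z p) + g p (Y p) (N X Z p)" for N X Y Z
  unfolding is_levi_civita_def smooth_vfield_svf using lie_bracket_eq by metis+
 show ?thesis by (rule lc_unique[OF g, of "%X Y. levi_civita A g X Y p" p "%X Y. lcf g X Y p"])
   (rule L[OF levi_civita_is[OF g]] L[OF lcf_is_levi_civita[OF g]] X Y; assumption)+
qed

lemma levi_civita_chart:
 assumes g: "pseudo_riemannian_metric A g" and c: "c : A" "p : fst c" and X: "svf UNIV X" and Y: "svf UNIV Y"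
 shows "cc c p (levi_civita A g X Y p) = nb (christ (gram g c)) (vrep c X) (vrep c Y) (snd c p)"
 using lcf_chart[OF assms] levi_civita_eq[OF g X Y] by simp

lemma levi_civita_rules:
 assumes g: "pseudo_riemannian_metric A g" shows levi_civita_smooth: "svf UNIV X ==> svf UNIV Y ==> svf UNIV (levi_civita A g X Y)"
  and levi_civita_torsion: "svf UNIV X ==> svf UNIV Y ==> levi_civita A g X Y p - levi_civita A g Y X p = lie_bracket A X Y p"
  and levi_civita_metric: "svf UNIV X ==> svf UNIV Y ==> svf UNIV Z ==>
   vf_deriv A X (%q. g q (Y q) (Z q)) p = g p (levi_civita A g X Y p) (Z p) + g p (Y p) (levi_civita A g X Z p)"
  and levi_civita_add1: "svf UNIV X ==> svf UNIV Y ==> svf UNIV Z ==>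
   levi_civita A g (%q. X q + Y q) Z p = levi_civita A g X Z p + levi_civita A g Y Z p"
  and levi_civita_add2: "svf UNIV X ==> svf UNIV Y ==> svf UNIV Z ==>
   levi_civita A g X (%q. Y q + Z q) p = levi_civita A g X Y p + levi_civita A g X Z p"
  and levi_civita_scale1: "sfun UNIV f ==> svf UNIV X ==> svf UNIV Y ==>
   levi_civita A g (%q. f q *\<^sub>R X q) Y p = f p *\<^sub>R levi_civita A g X Y p"
  and levi_civita_scale2: "sfun UNIV f ==> svf UNIV X ==> svf UNIV Y ==>
   levi_civita A g X (%q. f q *\<^sub>R Y q) p = vf_deriv A X f p *\<^sub>R Y p + f p *\<^sub>R levi_civita A g X Y p" proof -
 have L: "affine_connection A (levi_civita A g)"
  "ALL X Y. svf UNIV X & svf UNIV Y --> (ALL p. levi_civita A g X Y p - levi_civita A g Y X p = lie_bracket A X Y p)"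
  "ALL X Y Z. svf UNIV X & svf UNIV Y & svf UNIV Z --> (ALL p. vf_deriv A X (%q. g q (Y q) (Z q)) p =
    g p (levi_civita A g X Y p) (Z p) + g p (Y p) (levi_civita A g X Z p))"
  using levi_civita_is[OF g] unfolding is_levi_civita_def smooth_vfield_svf by - ((elim conjE, assumption)+)
 have a: "ALL X Y. svf UNIV X & svf UNIV Y --> svf UNIV (levi_civita A g X Y)"
  "ALL X Y Z. svf UNIV X & svf UNIV Y & svf UNIV Z -->
    (ALL p. levi_civita A g (%q. X q + Y q) Z p = levi_civita A g X Z p + levi_civita A g Y Z p) \<and>
    (ALL p. levi_civita A g X (%q. Y q + Z q) p = levi_civita A g X Y p + levi_civita A g X Z p)"
  "ALL f X Y. sfun UNIV f & svf UNIV X & svf UNIV Y -->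
    (ALL p. levi_civita A g (%q. f q *\<^sub>R X q) Y p = f p *\<^sub>R levi_civita A g X Y p) \<and>
    (ALL p. levi_civita A g X (%q. f q *\<^sub>R Y q) p = vf_deriv A X f p *\<^sub>R Y p + f p *\<^sub>R levi_civita A g X Y p)"
  using L(1) unfolding affine_connection_def smooth_vfield_svf smooth_fun_sfun by - ((elim conjE, assumption)+)
 show "svf UNIV X ==> svf UNIV Y ==> svf UNIV (levi_civita A g X Y)" using a(1) by metis
 show "svf UNIV X ==> svf UNIV Y ==> levi_civita A g X Y p - levi_civita A g Y X p = lie_bracket A X Y p" using L(2) by metis
 show "svf UNIV X ==> svf UNIV Y ==> svf UNIV Z ==>
   vf_deriv A X (%q. g q (Y q) (Z q)) p = g p (levi_civita A g X Y p) (Z p) + g p (Y p) (levi_civita A g X Z p)" using L(3) by metis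
 show "svf UNIV X ==> svf UNIV Y ==> svf UNIV Z ==>
   levi_civita A g (%q. X q + Y q) Z p = levi_civita A g X Z p + levi_civita A g Y Z p"
  "svf UNIV X ==> svf UNIV Y ==> svf UNIV Z ==>
   levi_civita A g X (%q. Y q + Z q) p = levi_civita A g X Y p + levi_civita A g X Z p"
  using a(2)[THEN spec[of _ X], THEN spec[of _ Y], THEN spec[of _ Z]] by blast+
 show "sfun UNIV f ==> svf UNIV X ==> svf UNIV Y ==>
   levi_civita A g (%q. f q *\<^sub>R X q) Y p = f p *\<^sub>R levi_civita A g X Y p"
  "sfun UNIV f ==> svf UNIV X ==> svf UNIV Y ==>
   levi_civita A g X (%q. f q *\<^sub>R Y q) p = vf_deriv A X f p *\<^sub>R Y p + f p *\<^sub>R levi_civita A g X Y p"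
  using a(3)[THEN spec[of _ f], THEN spec[of _ X], THEN spec[of _ Y]] by blast+
qed

lemma svf_lie_bracket: "svf UNIV X ==> svf UNIV Y ==> svf UNIV (lie_bracket A X Y)" using svf_lb lie_bracket_eq by simp

lemma dird_vrep_cong:
 assumes c: "c : A" "p : fst c" and U: "open U" "p : U" and eq: "!!q. q : U ==> Y q = Y' q" and Y: "svf UNIV Y"
 shows "dird (vrep c Y) (snd c p) = dird (vrep c Y') (snd c p)" proof (rule frechet_derivative_transform_within_open)
 show "vrep c Y differentiable at (snd c p)" using smooth_on_differentiable[OF vrep_smooth[OF Y c(1)]] c by simp
 show "open (snd c ` (U Int fst c))" by (rule open_chart_img[OF c(1) U(1)])
 show "snd c p : snd c ` (U Int fst c)" using c U by auto
 show "vrep c Y x = vrep c Y' x" if "x : snd c ` (U Int fst c)" for x using that eq c by (auto simp: vrep_def)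
qed

lemma levi_civita_cong:
 assumes g: "pseudo_riemannian_metric A g" and sm: "svf UNIV X" "svf UNIV Y" "svf UNIV X'" "svf UNIV Y'"
  and U: "open U" "p : U" and X: "X p = X' p" and Y: "!!q. q : U ==> Y q = Y' q" shows "levi_civita A g X Y p = levi_civita A g X' Y' p" proof -
 let ?c = "chart_at A p"
 have "cc ?c p (levi_civita A g X Y p) = cc ?c p (levi_civita A g X' Y' p)" using dird_vrep_cong[OF chart_at_in in_chart_at U Y sm(2)] U X Y
  by (simp add: levi_civita_chart[OF g] sm nb_def vrep_snd)
 thus ?thesis by (simp add: cc_inject)
qed

end

section \<open>Orthonormal frames\<close>

lemma span_image_sum:
 assumes "finite I" "w : span (f ` I)" shows "EX u. w = (SUM i:I. u i *\<^sub>R (f i :: 'a::real_vector))" using assms(2)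
proof (induct rule: span_induct_alt)
 case base show ?case by (intro exI[of _ "%_. 0"]) simp
next
 case (step c x y) then obtain i u where i: "i : I" "x = f i" and u: "y = (SUM i:I. u i *\<^sub>R f i)" by blast
 have "(SUM j:I. (u j + (if j = i then c else 0)) *\<^sub>R f j) = (SUM j:I. u j *\<^sub>R f j + (if j = i then c *\<^sub>R f j else 0))"
  by (rule sum.cong) (auto simp: algebra_simps)
 also have "... = (SUM j:I. u j *\<^sub>R f j) + c *\<^sub>R f i" unfolding sum.distrib using i(1) assms(1) by simp
 finally have "c *\<^sub>R x + y = (SUM j:I. (u j + (if j = i then c else 0)) *\<^sub>R f j)" unfolding i(2) u by (simp only: add.commute)
 thus ?case by (intro exI[of _ "%j. u j + (if j = i then c else 0)"])
qed

context smooth_mfd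
begin

text \<open>No span is prescribed: squares of \<plusminus>1 already force linear independence, and
  the span is stated separately wherever it is used.\<close>

definition onb :: "('m, 'n) metric => 'm => 'i set => ('i => real^'n) => bool" where
 "onb g p I e \<longleftrightarrow> finite I & (ALL i:I. g p (e i) (e i) : {1, -1}) \<and>
   (ALL i:I. ALL j:I. i ~= j --> g p (e i) (e j) = 0)"

lemma onb_finite: "onb g p I e ==> finite I" unfolding onb_def by (elim conjE)

lemma onb_sign: "onb g p I e ==> i : I ==> g p (e i) (e i) : {1, -1}" unfolding onb_def by (elim conjE, drule bspec)

lemma onb_orth: "onb g p I e ==> i : I ==> j : I ==> i ~= j ==> g p (e i) (e j) = 0"
 unfolding onb_def by (elim conjE, drule (1) bspec, drule (1) bspec, drule (1) bspec, drule (1) mp)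

lemma onb_sq: "onb g p I e ==> i : I ==> g p (e i) (e i) * g p (e i) (e i) = 1" proof -
 have *: "x : {1, -1} ==> x * x = 1" for x :: real by auto
 show "onb g p I e ==> i : I ==> ?thesis" by (rule *[OF onb_sign])
qed

lemma onbI:
 assumes "finite I" "!!i. i : I ==> g p (e i) (e i) : {1, -1}"
  "!!i j. i : I ==> j : I ==> i ~= j ==> g p (e i) (e j) = 0" shows "onb g p I e" unfolding onb_def by (intro conjI ballI impI assms)

lemma onb_subset:
 assumes "onb g p I e" "J <= I" shows "onb g p J e"
 by (rule onbI) (use onb_finite[OF assms(1)] onb_sign[OF assms(1)] onb_orth[OF assms(1)] assms(2) finite_subset in
  \<open>(metis | meson subsetD)+\<close>)

lemma onb_delta:
 assumes "onb g p I e" "i : I" "j : I" shows "g p (e i) (e j) = (if i = j then g p (e i) (e i) else 0)" using onb_orth[OF assms] by simp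

lemma onb_coeff:
 assumes g: "pseudo_riemannian_metric A g" and e: "onb g p I e" and i: "i : I" shows "g p (SUM j:I. f j *\<^sub>R e j) (e i) = f i * g p (e i) (e i)"
proof -
 have fin: "finite I" using e by (simp add: onb_def)
 have "g p (SUM j:I. f j *\<^sub>R e j) (e i) = (SUM j:I. if j = i then f i * g p (e i) (e i) else 0)"
  unfolding metric_facts[OF g] by (rule sum.cong) (use onb_delta[OF e _ i] in auto)
 also have "... = f i * g p (e i) (e i)" using fin i by simp
 finally show ?thesis .
qed

lemma onb_expand:
 assumes g: "pseudo_riemannian_metric A g" and e: "onb g p I e" and w: "w : span (e ` I)"
 shows "w = (SUM i:I. (g p (e i) (e i) * g p w (e i)) *\<^sub>R e i)" using w proof (induct rule: span_induct_alt)
 case base show ?case by (simp add: metric_facts[OF g])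
next
 case (step c x y) then obtain i where i: "i : I" "x = e i" by blast
 have fin: "finite I" using e by (simp add: onb_def)
 have "(SUM j:I. (g p (e j) (e j) * g p (c *\<^sub>R e i + y) (e j)) *\<^sub>R e j) =
  (SUM j:I. (c * (g p (e j) (e j) * g p (e i) (e j))) *\<^sub>R e j) + (SUM j:I. (g p (e j) (e j) * g p y (e j)) *\<^sub>R e j)"
  by (simp add: metric_facts[OF g] algebra_simps sum.distrib)
 also have "(SUM j:I. (c * (g p (e j) (e j) * g p (e i) (e j))) *\<^sub>R e j) = (SUM j:I. if j = i then c *\<^sub>R e j else 0)"
  by (rule sum.cong) (use onb_delta[OF e i(1)] onb_sq[OF e] in auto)
 also have "... = c *\<^sub>R e i" using fin i by simp
 finally show ?case using step i by simp
qed

lemma onb_independent: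
 assumes g: "pseudo_riemannian_metric A g" and e: "onb g p I e" shows "inj_on e I" "independent (e ` I)" proof -
 have nz: "g p (e i) (e i) ~= 0" if "i : I" for i using onb_sq[OF e that] by auto
 show inj: "inj_on e I" proof (rule inj_onI, rule ccontr)
  fix i j assume "i : I" "j : I" "e i = e j" "i ~= j"
  thus False using onb_delta[OF e, of i j] nz by simp
 qed
 show "independent (e ` I)" proof
  have fin: "finite (e ` I)" using onb_finite[OF e] by (rule finite_imageI)
  assume "dependent (e ` I)"
  hence "EX u. (EX v:e ` I. u v ~= 0) & (SUM v:e ` I. u v *\<^sub>R v) = 0" by (simp only: dependent_finite[OF fin])
  then obtain u where ex: "EX v:e ` I. u v ~= 0" and s: "(SUM v:e ` I. u v *\<^sub>R v) = 0" by (elim exE conjE)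
  from ex obtain v where v: "v : e ` I" "u v ~= 0" by (elim bexE) then obtain i where i: "i : I" "v = e i" by blast
  have "(SUM j:I. u (e j) *\<^sub>R e j) = 0" using s by (simp add: sum.reindex[OF inj])
  from arg_cong[OF this, of "%w. g p w (e i)"]
  have "u (e i) * g p (e i) (e i) = 0" using onb_coeff[OF g e i(1), of "%j. u (e j)"] by (simp add: metric_facts[OF g])
  thus False using nz[OF i(1)] v i by simp
 qed
qed

text \<open>Each basis is expanded in the other one. The inner products
  \<open>g p (e i) (f j)\<close> serve as coefficients in both directions, so both traces equal the
  same double sum.\<close>

lemma onb_trace_indep:
 fixes \<beta> :: "real^'n => real^'n => 'b::real_vector"
 assumes g: "pseudo_riemannian_metric A g" and e: "onb g p I e" and f: "onb g p J f" and sp: "span (e ` I) = span (f ` J)"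
  and lin: "!!u. linear (\<beta> u)" "!!v. linear (%u. \<beta> u v)"
 shows "(SUM i:I. g p (e i) (e i) *\<^sub>R \<beta> (e i) (e i)) = (SUM j:J. g p (f j) (f j) *\<^sub>R \<beta> (f j) (f j))" proof -
 have ei: "e i = (SUM j:J. (g p (f j) (f j) * g p (e i) (f j)) *\<^sub>R f j)" if "i : I" for i proof (rule onb_expand[OF g f])
  show "e i : span (f ` J)" unfolding sp[symmetric] by (intro span_base imageI that)
 qed
 have fj: "f j = (SUM i:I. (g p (e i) (e i) * g p (f j) (e i)) *\<^sub>R e i)" if "j : J" for j proof (rule onb_expand[OF g e])
  show "f j : span (e ` I)" unfolding sp by (intro span_base imageI that)
 qed
 have "(SUM i:I. g p (e i) (e i) *\<^sub>R \<beta> (e i) (e i)) =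
  (SUM i:I. SUM j:J. (g p (e i) (e i) * g p (f j) (f j) * g p (e i) (f j)) *\<^sub>R \<beta> (e i) (f j))" proof (rule sum.cong[OF refl])
  fix i assume i: "i : I"
  have "\<beta> (e i) (e i) = (SUM j:J. (g p (f j) (f j) * g p (e i) (f j)) *\<^sub>R \<beta> (e i) (f j))"
   using arg_cong[OF ei[OF i], of "\<beta> (e i)"] by (simp only: linear_sum[OF lin(1)] linear_cmul[OF lin(1)])
  from arg_cong[OF this, of "%v. g p (e i) (e i) *\<^sub>R v"]
  show "g p (e i) (e i) *\<^sub>R \<beta> (e i) (e i) = (SUM j:J. (g p (e i) (e i) * g p (f j) (f j) * g p (e i) (f j)) *\<^sub>R \<beta> (e i) (f j))"
   by (simp only: scaleR_sum_right scaleR_scaleR mult.assoc)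
 qed
 also have "... = (SUM j:J. SUM i:I. (g p (f j) (f j) * (g p (e i) (e i) * g p (f j) (e i))) *\<^sub>R \<beta> (e i) (f j))"
 proof (subst sum.swap, intro sum.cong refl)
  fix j i
  show "(g p (e i) (e i) * g p (f j) (f j) * g p (e i) (f j)) *\<^sub>R \<beta> (e i) (f j) =
    (g p (f j) (f j) * (g p (e i) (e i) * g p (f j) (e i))) *\<^sub>R \<beta> (e i) (f j)" by (simp add: metric_sym[OF g, of p "f j" "e i"])
 qed
 also have "... = (SUM j:J. g p (f j) (f j) *\<^sub>R \<beta> (f j) (f j))" proof (rule sum.cong[OF refl])
  fix j assume j: "j : J"
  have "\<beta> (f j) (f j) = (SUM i:I. (g p (e i) (e i) * g p (f j) (e i)) *\<^sub>R \<beta> (e i) (f j))"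
   using arg_cong[OF fj[OF j], of "%u. \<beta> u (f j)"] by (simp only: linear_sum[OF lin(2)] linear_cmul[OF lin(2)])
  from arg_cong[OF this, of "%v. g p (f j) (f j) *\<^sub>R v"]
  show "(SUM i:I. (g p (f j) (f j) * (g p (e i) (e i) * g p (f j) (e i))) *\<^sub>R \<beta> (e i) (f j)) = g p (f j) (f j) *\<^sub>R \<beta> (f j) (f j)"
   by (simp only: scaleR_sum_right scaleR_scaleR)
 qed
 finally show ?thesis .
qed

lemma extend_vfield_ex:
 assumes U: "open U" "p : U" and X: "svf U X" shows "EX Y V. svf UNIV Y & open V & p : V & V <= U & (ALL q:V. Y q = X q) \<and>
  (ALL q. EX r. Y q = r *\<^sub>R X q) & (ALL q. q ~: U --> Y q = 0)" proof (rule extend_vfield[OF U X])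
 fix Y V assume a: "svf UNIV Y" "open V" "p : V" "V <= U" "!!q. q : V ==> Y q = X q"
  "!!q. EX r. Y q = r *\<^sub>R X q" "!!q. q ~: U ==> Y q = 0"
 show ?thesis by (intro exI[of _ Y] exI[of _ V] conjI allI ballI impI a)
qed

text \<open>A combination of the local frame with constant coefficients is cut off. The result is a
  multiple of a vector of W on U and zero elsewhere, so it never leaves W.\<close>

lemma distribution_section:
 assumes W: "smooth_distribution A r W" and w: "w : W p"
 obtains Y where "svf UNIV Y" "Y p = w" "ALL q. Y q : W q" proof -
 note W1 = W[unfolded smooth_distribution_def smooth_vfield_svf, THEN conjunct1, THEN spec]
 note W2 = W[unfolded smooth_distribution_def smooth_vfield_svf, THEN conjunct2, THEN spec]
 have sub: "subspace (W q)" for q by (rule W1[THEN conjunct1])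
 from W2[of p] obtain U E where U: "open U" "p : U" "ALL a<r. svf UNIV (E a)" "ALL q:U. W q = span ((%a. E a q) ` {..<r})" by (elim exE conjE)
 obtain u where u: "w = (\<Sum>a<r. u a *\<^sub>R E a p)" using span_image_sum[of "{..<r}" w "%a. E a p"] U(2,4) w by auto
 have X: "svf UNIV (%q. \<Sum>a<r. u a *\<^sub>R E a q)" using U(3) by (intro svf_sum svf_scale_const) auto
 from extend_vfield_ex[OF U(1,2) svf_subset[OF X subset_UNIV]]
 obtain Y V where Y: "svf UNIV Y" "open V" "p : V" "V <= U" "ALL q:V. Y q = (\<Sum>a<r. u a *\<^sub>R E a q)"
  "ALL q. EX s. Y q = s *\<^sub>R (\<Sum>a<r. u a *\<^sub>R E a q)" "ALL q. q ~: U --> Y q = 0" by (elim exE conjE)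
 have "Y q : W q" for q proof (cases "q : U")
  case True
  have "(\<Sum>a<r. u a *\<^sub>R E a q) : W q" proof (intro subspace_sum[OF sub] subspace_scale[OF sub])
   fix a assume "a : {..<r}"
   hence "E a q : span ((%a. E a q) ` {..<r})" by (intro span_base imageI)
   thus "E a q : W q" using U(4) True by simp
  qed
  moreover from Y(6) obtain s where "Y q = s *\<^sub>R (\<Sum>a<r. u a *\<^sub>R E a q)" by (elim allE[of _ q] exE)
  ultimately show ?thesis using subspace_scale[OF sub, of _ q s] by simp
 next
  case False
  thus ?thesis using Y(7) subspace_0[OF sub] by simp
 qed
 moreover have "Y p = w" using Y(3,5) u by simp
 ultimately show thesis using that[of Y] Y(1) by blast
qed

text \<open>Gram--Schmidt for an indefinite metric: at each step a non-isotropic vector is chosen in the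
 orthogonal complement, inside the distribution, of the vectors found so far.\<close>

lemma orthonormal_frame_exists:
 assumes g: "pseudo_riemannian_metric A g" and W: "smooth_distribution A r W" and nd: "!!u. u : W p ==> (!!v. v : W p ==> g p u v = 0) ==> u = 0"
 shows "EX E U. open U & p : U & (ALL a<r. svf UNIV (E a) & (ALL q. E a q : W q)) \<and>
  (ALL q:U. onb g q {..<r} (%a. E a q))" proof -
 note W1 = W[unfolded smooth_distribution_def smooth_vfield_svf, THEN conjunct1, THEN spec]
 have sub: "subspace (W q)" for q by (rule W1[THEN conjunct1])
 have dim: "dim (W q) = r" for q by (rule W1[THEN conjunct2])
 have "EX E U. open U & p : U & (ALL a<m. svf UNIV (E a) & (ALL q. E a q : W q)) \<and>
  (ALL q:U. onb g q {..<m} (%a. E a q))" if "m <= r" for m using that proof (induct m)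
  case 0
  show ?case by (intro exI[of _ "%_ _. 0"] exI[of _ UNIV]) (simp add: onb_def)
 next
  case (Suc m)
  hence "m <= r" by simp
  from Suc(1)[OF this] obtain E U where U: "open U" "p : U"
   and E: "ALL a<m. svf UNIV (E a) & (ALL q. E a q : W q)" and on: "ALL q:U. onb g q {..<m} (%a. E a q)" by (elim exE conjE)
  have onq: "onb g q {..<m} (%a. E a q)" if "q : U" for q using on that by (rule bspec)
  have Esm: "svf UNIV (E a)" and EW: "E a q : W q" if "a < m" for a q using E that by simp_all
  define pr where "pr = (%q v. v - (\<Sum>a<m. (g q (E a q) (E a q) * g q v (E a q)) *\<^sub>R E a q))"
  have pr_orth: "g q (pr q v) (E a q) = 0" if "q : U" "a < m" for q v a proof -
   have "g q (\<Sum>a<m. (g q (E a q) (E a q) * g q v (E a q)) *\<^sub>R E a q) (E a q) =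
     (g q (E a q) (E a q) * g q v (E a q)) * g q (E a q) (E a q)" by (rule onb_coeff[OF g onq[OF that(1)]]) (use that in simp)
   also have "... = (g q (E a q) (E a q) * g q (E a q) (E a q)) * g q v (E a q)" by simp
   also have "... = g q v (E a q)" using onb_sq[OF onq[OF that(1)], of a] that by simp
   finally show ?thesis by (simp add: pr_def metric_facts[OF g])
  qed
  have prW: "pr q v : W q" if "v : W q" for q v
   unfolding pr_def by (intro subspace_diff[OF sub] subspace_sum[OF sub] subspace_scale[OF sub] that EW) simp
  \<comment> \<open>A dimension count: at most m < r vectors cannot span a space of dimension
    r.\<close>
  have "EX v:W p. v ~: span ((%a. E a p) ` {..<m})" proof (rule ccontr)
   assume "\<not> ?thesis"
   hence "W p <= span ((%a. E a p) ` {..<m})" by auto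
   hence "dim (W p) <= card ((%a. E a p) ` {..<m})" by (rule dim_le_card) simp
   also have "... <= m" using card_image_le[of "{..<m}" "%a. E a p"] by simp
   finally show False using dim Suc(2) by simp
  qed
  then obtain v where v: "v : W p" "v ~: span ((%a. E a p) ` {..<m})" by (elim bexE)
  have v0: "pr p v ~= 0" proof
   assume "pr p v = 0"
   hence "v = (\<Sum>a<m. (g p (E a p) (E a p) * g p v (E a p)) *\<^sub>R E a p)" by (simp add: pr_def)
   also have "... : span ((%a. E a p) ` {..<m})" by (intro span_sum span_scale span_base imageI) simp
   finally show False using v by simp
  qed
  \<comment> \<open>If all projections were isotropic, polarisation would make \<open>pr p v\<close>
    orthogonal to every projection and hence to all of \<open>W p\<close>, although it is a nonzero
    vector of this non-degenerate space.\<close>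
  have "EX w:W p. g p (pr p w) (pr p w) ~= 0" proof (rule ccontr)
   assume "\<not> ?thesis"
   hence z: "g p (pr p w) (pr p w) = 0" if "w : W p" for w using that by simp
   have pr_add: "pr p (u + w) = pr p u + pr p w" for u w by (simp add: pr_def metric_facts[OF g] algebra_simps sum.distrib)
   have zz: "g p (pr p u) (pr p w) = 0" if "u : W p" "w : W p" for u w
    using z[OF subspace_add[OF sub that]] z[OF that(1)] z[OF that(2)] metric_sym[OF g, of p "pr p w" "pr p u"]
    by (simp add: pr_add metric_facts[OF g])
   have "pr p v = 0" proof (rule nd[OF prW[OF v(1)]])
    fix w assume w: "w : W p"
    have "w = pr p w + (\<Sum>a<m. (g p (E a p) (E a p) * g p w (E a p)) *\<^sub>R E a p)" by (simp add: pr_def)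
    hence "g p (pr p v) w = g p (pr p v) (pr p w + (\<Sum>a<m. (g p (E a p) (E a p) * g p w (E a p)) *\<^sub>R E a p))" by simp
    also have "... = 0" using zz[OF v(1) w] pr_orth[OF U(2)] by (simp add: metric_facts[OF g])
    finally show "g p (pr p v) w = 0" .
   qed
   thus False using v0 by simp
  qed
  then obtain w where w: "w : W p" "g p (pr p w) (pr p w) ~= 0" by (elim bexE)
  obtain Y where Y: "svf UNIV Y" "Y p = w" "ALL q. Y q : W q" by (rule distribution_section[OF W w(1)])
  define Z where "Z = (%q. pr q (Y q))"
  have Z: "svf UNIV Z" unfolding Z_def pr_def by (intro svf_diff svf_sum svf_scale sfun_mult sfun_metric[OF g] Y Esm open_UNIV) simp_all
  define h where "h = (%q. g q (Z q) (Z q))"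
  have h: "sfun UNIV h" unfolding h_def by (rule sfun_metric[OF g Z Z])
  define V where "V = U Int {q. h q ~= 0}"
  have V: "open V" proof -
   have "open {q. h q ~= 0}" by (rule open_Collect_neq[OF continuous_on_sfun[OF open_UNIV h] continuous_on_const])
   thus ?thesis unfolding V_def by (intro open_Int U(1))
  qed
  have pV: "p : V" using w U(2) Y(2) by (simp add: V_def h_def Z_def)
  have hV: "h q ~= 0" if "q : V" for q using that by (simp add: V_def)
  have N: "svf V (%q. inverse (sqrt \<bar>h q\<bar>) *\<^sub>R Z q)"
   using hV by (intro svf_scale sfun_inverse sfun_sqrt_abs V sfun_subset[OF h] svf_subset[OF Z]) auto
  from extend_vfield_ex[OF V pV N]
  obtain X V' where X: "svf UNIV X" and V': "open V'" "p : V'" "V' <= V" and Xe: "ALL q:V'. X q = inverse (sqrt \<bar>h q\<bar>) *\<^sub>R Z q"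
   and Xs: "ALL q. EX s. X q = s *\<^sub>R (inverse (sqrt \<bar>h q\<bar>) *\<^sub>R Z q)" by (elim exE conjE)
  define F where "F = (%a. if a = m then X else E a)"
  have XW: "X q : W q" for q proof -
   from Xs obtain s where "X q = s *\<^sub>R (inverse (sqrt \<bar>h q\<bar>) *\<^sub>R Z q)" by (elim allE[of _ q] exE)
   moreover have "Z q : W q" using prW[of "Y q" q] Y(3) by (simp add: Z_def)
   ultimately show ?thesis using subspace_scale[OF sub] by simp
  qed
  have onF: "onb g q {..<Suc m} (%a. F a q)" if q: "q : V'" for q proof (rule onbI)
   have qU: "q : U" and hq: "h q ~= 0" using q V'(3) by (auto simp: V_def)
   have Xq: "X q = inverse (sqrt \<bar>h q\<bar>) *\<^sub>R Z q" using Xe q by simp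
   have XE: "g q (X q) (E a q) = 0" if "a < m" for a using pr_orth[OF qU that, of "Y q"] by (simp add: Xq Z_def metric_facts[OF g])
   have "g q (X q) (X q) = h q / \<bar>h q\<bar>" by (simp add: Xq metric_facts[OF g] h_def divide_inverse flip: inverse_mult_distrib)
   also have "... = (if h q > 0 then 1 else -1)" using hq by (cases "h q > 0") (simp_all add: abs_of_neg)
   finally have XX: "g q (X q) (X q) : {1, -1}" by simp
   show "finite {..<Suc m}" by simp
   fix a assume a: "a : {..<Suc m}"
   show "g q (F a q) (F a q) : {1, -1}" using XX onb_sign[OF onq[OF qU], of a] a by (cases "a = m") (simp_all add: F_def)
   fix b assume b: "b : {..<Suc m}" "a ~= b"
   consider "a = m" "b < m" | "a < m" "b = m" | "a < m" "b < m" using a b by fastforce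
   thus "g q (F a q) (F b q) = 0" proof cases
    case 1 thus ?thesis using XE by (simp add: F_def)
   next
    case 2 thus ?thesis using XE metric_sym[OF g] by (simp add: F_def)
   next
    case 3 thus ?thesis using onb_orth[OF onq[OF qU], of a b] b(2) by (simp add: F_def)
   qed
  qed
  show ?case proof (intro exI[of _ F] exI[of _ V'] conjI allI impI ballI V'(1,2) onF)
   fix a q assume "a < Suc m"
   show "svf UNIV (F a)" using X Esm \<open>a < Suc m\<close> by (auto simp: F_def less_Suc_eq)
   show "F a q : W q" using XW EW \<open>a < Suc m\<close> by (auto simp: F_def less_Suc_eq)
  qed
 qed
 thus ?thesis by simp
qed

end

section \<open>Curvature of contorted connections\<close>

context smooth_mfd
begin

definition tcomp :: "('m, 'n) chart => ('m, 'n) tensor12 => real^'n => 'n => 'n => real^'n" where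
 "tcomp c T x i j = tensor12_comp A c T i j (chart_inv c x)"

definition ccomp :: "('m, 'n) metric => ('m, 'n) tensor12 => ('m, 'n) chart => real^'n => 'n => 'n => real^'n" where
 "ccomp g T c x i j = christ (gram g c) x i j + tcomp c T x i j"

lemma tensor_bilinear: "smooth_tensor12 A T ==> bilinear (T p)" by (simp add: smooth_tensor12_def)

lemma tensor_facts:
 assumes "bilinear B" shows tensor_add: "B (u + w) v = B u v + B w v" "B v (u + w) = B v u + B v w"
  and tensor_scale: "B (r *\<^sub>R u) v = r *\<^sub>R B u v" "B v (r *\<^sub>R u) = r *\<^sub>R B v u" and tensor_zero: "B 0 v = 0" "B v 0 = 0"
  and tensor_diff: "B (u - w) v = B u v - B w v" "B v (u - w) = B v u - B v w"
  and tensor_sum: "B (SUM i:I. f i) v = (SUM i:I. B (f i) v)" "B v (SUM i:I. f i) = (SUM i:I. B v (f i))" proof -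
 have l: "linear (%u. B u v)" "linear (B v)" for v using assms unfolding bilinear_def by auto
 show "B (u + w) v = B u v + B w v" "B v (u + w) = B v u + B v w"
  "B (r *\<^sub>R u) v = r *\<^sub>R B u v" "B v (r *\<^sub>R u) = r *\<^sub>R B v u"
  "B 0 v = 0" "B v 0 = 0"
  "B (u - w) v = B u v - B w v" "B v (u - w) = B v u - B v w"
  "B (SUM i:I. f i) v = (SUM i:I. B (f i) v)" "B v (SUM i:I. f i) = (SUM i:I. B v (f i))"
  using linear_add[OF l(1)[of v]] linear_add[OF l(2)[of v]] linear_diff[OF l(1)[of v]] linear_diff[OF l(2)[of v]]
   linear_cmul[OF l(1)[of v]] linear_cmul[OF l(2)[of v]] linear_0[OF l(1)[of v]] linear_0[OF l(2)[of v]]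
   linear_sum[OF l(1)[of v], of f I] linear_sum[OF l(2)[of v], of f I] by (simp_all add: o_def)
qed

lemma tensor_chart:
 assumes sT: "smooth_tensor12 A T" and c: "c : A" "p : fst c" shows "cc c p (T p u v) = bl (tcomp c T (snd c p)) (cc c p u) (cc c p v)" proof -
 have T: "bilinear (T p)" by (rule tensor_bilinear[OF sT])
 have l: "linear (%u. cc c p (T p (ci c p u) (ci c p v)))" "linear (%u. cc c p (T p (ci c p v) (ci c p u)))" for v
  by (rule linearI; simp add: tensor_facts[OF T] ci_simps[OF c] cc_simps[OF c])+
 hence b: "bilinear (%u v. cc c p (T p (ci c p u) (ci c p v)))" unfolding bilinear_def by simp
 show ?thesis using bl_of_bilinear[OF b, of "cc c p u" "cc c p v"] c by (simp add: tcomp_def[abs_def] tensor12_comp_def coord_vec_eq)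
qed

lemma tcomp_smooth: "smooth_tensor12 A T ==> c : A ==> smooth_on (chart_image c) (%x. tcomp c T x i j)"
 by (simp add: smooth_tensor12_def tcomp_def o_def)

lemma svf_tensor:
 assumes T: "smooth_tensor12 A T" and X: "svf UNIV X" and Y: "svf UNIV Y" shows "svf UNIV (%p. T p (X p) (Y p))"
proof (rule svf_UNIV_I[of "%c x. bl (tcomp c T x) (vrep c X x) (vrep c Y x)"])
 fix c assume "c : A"
 thus "smooth_on (chart_image c) (%x. bl (tcomp c T x) (vrep c X x) (vrep c Y x))"
  by (intro smooth_on_bl open_chart_image tcomp_smooth T vrep_smooth X Y)
qed (simp add: tensor_chart[OF T] vrep_snd)

lemma ccomp_smooth:
 "pseudo_riemannian_metric A g ==> smooth_tensor12 A T ==> c : A ==> smooth_on (chart_image c) (%x. ccomp g T c x i j)"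
 unfolding ccomp_def by (intro smooth_on_add open_chart_image christ_smooth tcomp_smooth)

lemma contorted_chart:
 assumes g: "pseudo_riemannian_metric A g" and T: "smooth_tensor12 A T" and c: "c : A" "p : fst c" and X: "svf UNIV X" and Y: "svf UNIV Y"
 shows "cc c p (contorted_connection A g T X Y p) = nb (ccomp g T c) (vrep c X) (vrep c Y) (snd c p)" proof -
 have "bl (ccomp g T c x) u v = bl (christ (gram g c) x) u v + bl (tcomp c T x) u v" for x u v by (simp add: ccomp_def[abs_def] bl_simps)
 thus ?thesis by (simp add: contorted_connection_def cc_simps[OF c] levi_civita_chart[OF g c X Y]
    tensor_chart[OF T c] nb_def vrep_snd[OF c])
qed

lemma svf_contorted:
 assumes g: "pseudo_riemannian_metric A g" and T: "smooth_tensor12 A T" and X: "svf UNIV X" and Y: "svf UNIV Y"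
 shows "svf UNIV (contorted_connection A g T X Y)" unfolding contorted_connection_def
 by (intro svf_add open_UNIV levi_civita_smooth[OF g X Y] svf_tensor[OF T X Y])

lemma nb_cong:
 assumes "open S" "x : S" "!!y. y : S ==> Z y = Z' y" "Z differentiable (at x)" "X x = X' x" shows "nb \<Gamma> X Z x = nb \<Gamma> X' Z' x"
 using frechet_derivative_transform_within_open[of Z x S Z'] assms by (simp add: nb_def)

lemma curvature_chart:
 assumes g: "pseudo_riemannian_metric A g" and T: "smooth_tensor12 A T" and c: "c : A" "p : fst c"
  and X: "svf UNIV X" and Y: "svf UNIV Y" and Z: "svf UNIV Z" shows "cc c p (curvature A (contorted_connection A g T) X Y Z p) =
  rc (ccomp g T c) (snd c p) (cc c p (X p)) (cc c p (Y p)) (cc c p (Z p))" proof -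
 let ?N = "contorted_connection A g T" and ?S = "chart_image c" and ?x = "snd c p" and ?G = "ccomp g T c"
 have S: "open ?S" "?x : ?S" using c open_chart_image by auto
 have 1: "cc c p (?N Y (?N X Z) p) = nb ?G (vrep c Y) (nb ?G (vrep c X) (vrep c Z)) ?x"
  if X: "svf UNIV X" and Y: "svf UNIV Y" for X Y proof -
  have "cc c p (?N Y (?N X Z) p) = nb ?G (vrep c Y) (vrep c (?N X Z)) ?x" by (rule contorted_chart[OF g T c Y svf_contorted[OF g T X Z]])
  also have "... = nb ?G (vrep c Y) (nb ?G (vrep c X) (vrep c Z)) ?x" proof (rule nb_cong[OF S])
   fix y assume "y : ?S"
   thus "vrep c (?N X Z) y = nb ?G (vrep c X) (vrep c Z) y"
    using contorted_chart[OF g T c(1) _ X Z, of "chart_inv c y"] c(1) by (simp add: vrep_def)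
  next
   show "vrep c (?N X Z) differentiable at ?x" by (rule smooth_on_differentiable[OF vrep_smooth[OF svf_contorted[OF g T X Z] c(1)] S(2)])
  qed simp
  finally show ?thesis .
 qed
 have lbs: "lie_bracket A X Y = lb X Y" by (rule lie_bracket_eq[OF X Y])
 have 2: "cc c p (?N (lie_bracket A X Y) Z p) = nb ?G (br (vrep c X) (vrep c Y)) (vrep c Z) ?x"
  unfolding lbs contorted_chart[OF g T c svf_lb[OF X Y] Z] by (simp add: nb_def vrep_snd[OF c] lb_chart[OF c X Y])
 have "cc c p (curvature A ?N X Y Z p) = nb ?G (vrep c Y) (nb ?G (vrep c X) (vrep c Z)) ?x
   - nb ?G (vrep c X) (nb ?G (vrep c Y) (vrep c Z)) ?x + nb ?G (br (vrep c X) (vrep c Y)) (vrep c Z) ?x"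
  unfolding curvature_def cc_simps[OF c] 1[OF X Y] 1[OF Y X] 2 by simp
 also have "... = rc ?G ?x (vrep c X ?x) (vrep c Y ?x) (vrep c Z ?x)"
  by (rule curvature_nb[OF S ccomp_smooth[OF g T c(1)] vrep_smooth[OF X c(1)] vrep_smooth[OF Y c(1)] vrep_smooth[OF Z c(1)]])
 finally show ?thesis by (simp add: vrep_snd[OF c])
qed

text \<open>The curvature as a map of tangent vectors, read in the chart chosen at p; by
  \<open>Rm_chart\<close> every other chart gives the same map.\<close>

definition Rm :: "('m, 'n) metric => ('m, 'n) tensor12 => 'm => real^'n => real^'n => real^'n => real^'n" where
 "Rm g T p u v w = (let c = chart_at A p in ci c p (rc (ccomp g T c) (snd c p) (cc c p u) (cc c p v) (cc c p w)))"

lemma Rm_curvature: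
 assumes g: "pseudo_riemannian_metric A g" and T: "smooth_tensor12 A T" and X: "svf UNIV X" and Y: "svf UNIV Y" and Z: "svf UNIV Z"
 shows "curvature A (contorted_connection A g T) X Y Z p = Rm g T p (X p) (Y p) (Z p)"
 using curvature_chart[OF g T chart_at_in in_chart_at X Y Z, of p] unfolding Rm_def Let_def by (metis ci_cc chart_at_in in_chart_at)

lemma Rm_chart:
 assumes g: "pseudo_riemannian_metric A g" and T: "smooth_tensor12 A T" and c: "c : A" "p : fst c"
 shows "cc c p (Rm g T p u v w) = rc (ccomp g T c) (snd c p) (cc c p u) (cc c p v) (cc c p w)" proof -
 obtain X where X: "svf UNIV X" "X p = u" by (rule field_through)
 obtain Y where Y: "svf UNIV Y" "Y p = v" by (rule field_through)
 obtain Z where Z: "svf UNIV Z" "Z p = w" by (rule field_through)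
 show ?thesis using curvature_chart[OF g T c X(1) Y(1) Z(1)] Rm_curvature[OF g T X(1) Y(1) Z(1), of p] X Y Z by simp
qed

lemma dbl_linear:
 assumes "!!i j. smooth_on S (%x. \<Gamma> x i j)" "x : S"
 shows "bl (dbl \<Gamma> x (u + v)) a b = bl (dbl \<Gamma> x u) a b + bl (dbl \<Gamma> x v) a b"
  and "bl (dbl \<Gamma> x (r *\<^sub>R u)) a b = r *\<^sub>R bl (dbl \<Gamma> x u) a b" proof -
 have l: "linear (dird (%y. \<Gamma> y i j) x)" for i j using has_derivative_linear[OF smooth_on_has_derivative[OF assms(1) assms(2)]] .
 show "bl (dbl \<Gamma> x (u + v)) a b = bl (dbl \<Gamma> x u) a b + bl (dbl \<Gamma> x v) a b"
  by (simp add: bl_def dbl_def linear_add[OF l] scaleR_add_right sum.distrib)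
 show "bl (dbl \<Gamma> x (r *\<^sub>R u)) a b = r *\<^sub>R bl (dbl \<Gamma> x u) a b"
  by (simp add: bl_def dbl_def linear_cmul[OF l] scaleR_sum_right mult_ac)
qed

lemma rc_linear:
 assumes "!!i j. smooth_on S (%x. \<Gamma> x i j)" "x : S"
 shows "linear (%u. rc \<Gamma> x u v w)" "linear (%v. rc \<Gamma> x u v w)" "linear (%w. rc \<Gamma> x u v w)"
 by (rule linearI; simp add: rc_def bl_simps dbl_linear[OF assms] algebra_simps)+

lemma Rm_linear:
 assumes g: "pseudo_riemannian_metric A g" and T: "smooth_tensor12 A T"
 shows "linear (%u. Rm g T p u v w)" "linear (%v. Rm g T p u v w)" "linear (%w. Rm g T p u v w)" proof -
 let ?c = "chart_at A p"
 have S: "snd ?c p : chart_image ?c" by simp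
 note r = rc_linear[OF ccomp_smooth[OF g T chart_at_in[of p]] S]
 note l = linear_cc[OF chart_at_in[of p] in_chart_at] and li = linear_ci[OF chart_at_in[of p] in_chart_at]
 show "linear (%u. Rm g T p u v w)" "linear (%v. Rm g T p u v w)" "linear (%w. Rm g T p u v w)" unfolding Rm_def Let_def
  using linear_compose[OF linear_compose[OF l r(1)] li] linear_compose[OF linear_compose[OF l r(2)] li]
   linear_compose[OF linear_compose[OF l r(3)] li] by (simp_all add: o_def)
qed

end

section \<open>Almost multi-product structures\<close>

locale multi_product = smooth_mfd A
 for A :: "('m::{t2_space, second_countable_topology}, 'n::finite) chart set" +
 fixes k :: nat and n :: "nat => nat" and D :: "nat => ('m, 'n) distribution"
 assumes amp: "almost_multi_product A k n D"
begin

lemma D_distribution: "\<mu> : {1..k} ==> smooth_distribution A (n \<mu>) (D \<mu>)"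
 using amp unfolding almost_multi_product_def by (elim conjE bspec)

lemma D_subspace: "\<mu> : {1..k} ==> subspace (D \<mu> p)" and D_dim: "\<mu> : {1..k} ==> dim (D \<mu> p) = n \<mu>" proof -
 assume \<mu>: "\<mu> : {1..k}"
 note d = D_distribution[OF \<mu>, unfolded smooth_distribution_def, THEN conjunct1, THEN spec[of _ p]]
 show "subspace (D \<mu> p)" "dim (D \<mu> p) = n \<mu>" using d by auto
qed

text \<open>Indices of an adapted frame: the number of a distribution and a position in it. Two
  frame vectors belong to different distributions exactly if the first components of their indices
  differ.\<close>

definition Ix :: "(nat \<times> nat) set" where "Ix = Sigma {1..k} (%\<mu>. {..<n \<mu>})"

lemma finite_Ix [simp]: "finite Ix" by (simp add: Ix_def)

lemma fst_Ix: "i : Ix ==> fst i : {1..k}" by (auto simp: Ix_def)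

definition Blk :: "nat => (nat \<times> nat) set" where "Blk \<mu> = {i : Ix. fst i = \<mu>}"

lemma Blk_subset: "Blk \<mu> <= Ix" and finite_Blk [simp]: "finite (Blk \<mu>)" by (auto simp: Blk_def)

lemma Blk_eq: "\<mu> : {1..k} ==> Blk \<mu> = Pair \<mu> ` {..<n \<mu>}" by (auto simp: Blk_def Ix_def)

lemma card_Blk: "\<mu> : {1..k} ==> card (Blk \<mu>) = n \<mu>" by (simp add: Blk_eq card_image inj_on_def)

lemma sum_Blk: "\<mu> : {1..k} ==> (SUM i:Blk \<mu>. f i) = (\<Sum>a<n \<mu>. f (\<mu>, a))"
 unfolding Blk_eq by (subst sum.reindex) (auto simp: inj_on_def)

lemma sum_Ix: "(SUM i:Ix. f i) = (\<Sum>\<mu>=1..k. SUM i:Blk \<mu>. f i)" proof -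
 have "(\<Sum>\<mu>=1..k. SUM i:Blk \<mu>. f i) = (\<Sum>\<mu>=1..k. \<Sum>a<n \<mu>. f (\<mu>, a))" by (rule sum.cong[OF refl]) (rule sum_Blk)
 also have "... = (SUM i:Ix. f i)" unfolding Ix_def by (subst sum.Sigma) auto
 finally show ?thesis by simp
qed

definition aonb :: "('m, 'n) metric => 'm => (nat \<times> nat => real^'n) => bool" where
 "aonb g p e \<longleftrightarrow> onb g p Ix e & (ALL i:Ix. e i : D (fst i) p)"

lemma aonb_onb: "aonb g p e ==> onb g p Ix e" by (simp add: aonb_def)

lemma aonb_D: "aonb g p e ==> i : Ix ==> e i : D (fst i) p" by (simp add: aonb_def)

lemma adapted_metric_pr: "adapted_metric A k D g ==> pseudo_riemannian_metric A g" by (simp add: adapted_metric_def)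

lemma adapted_orth:
 assumes g: "adapted_metric A k D g" and "\<mu> : {1..k}" "\<nu> : {1..k}" "\<mu> ~= \<nu>" "u : D \<mu> p" "v : D \<nu> p" shows "g p u v = 0"
 using assms unfolding adapted_metric_def by blast

lemma adapted_nondeg:
 assumes g: "adapted_metric A k D g" and "\<mu> : {1..k}" "u : D \<mu> p" "!!v. v : D \<mu> p ==> g p u v = 0" shows "u = 0"
 using assms unfolding adapted_metric_def by blast

lemma aonb_span:
 assumes g: "adapted_metric A k D g" and e: "aonb g p e" and \<mu>: "\<mu> : {1..k}" shows "span (e ` Blk \<mu>) = D \<mu> p"
proof (rule subspace_dim_equal[OF subspace_span D_subspace[OF \<mu>]])
 note o = onb_subset[OF aonb_onb[OF e] Blk_subset[of \<mu>]]
 note i = onb_independent[OF adapted_metric_pr[OF g] o]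
 have "dim (span (e ` Blk \<mu>)) = n \<mu>" using dim_eq_card_independent[OF i(2)] card_image[OF i(1)] card_Blk[OF \<mu>] by simp
 thus "dim (D \<mu> p) <= dim (span (e ` Blk \<mu>))" using D_dim[OF \<mu>] by simp
 show "span (e ` Blk \<mu>) <= D \<mu> p" by (rule span_minimal[OF _ D_subspace[OF \<mu>]]) (use aonb_D[OF e] in \<open>auto simp: Blk_def\<close>)
qed

lemma D_decompose:
 obtains x where "ALL \<mu>:{1..k}. x \<mu> : D \<mu> p" "v = (\<Sum>\<mu>=1..k. x \<mu>)" proof -
 have "\<exists>!x. (ALL \<mu>:{1..k}. x \<mu> : D \<mu> p) & (ALL \<mu>. \<mu> ~: {1..k} --> x \<mu> = 0) & v = (\<Sum>\<mu>=1..k. x \<mu>)"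
  using amp unfolding almost_multi_product_def by (elim conjE allE)
 thus thesis using that by (elim ex1E conjE)
qed

lemma aonb_span_UNIV:
 assumes g: "adapted_metric A k D g" and e: "aonb g p e" shows "v : span (e ` Ix)" proof -
 obtain x where x: "ALL \<mu>:{1..k}. x \<mu> : D \<mu> p" "v = (\<Sum>\<mu>=1..k. x \<mu>)" by (rule D_decompose)
 have "x \<mu> : span (e ` Ix)" if \<mu>: "\<mu> : {1..k}" for \<mu> proof -
  have "x \<mu> : span (e ` Blk \<mu>)" using aonb_span[OF g e \<mu>] x(1) \<mu> by simp
  thus ?thesis using span_mono[OF image_mono[OF Blk_subset[of \<mu>], of e]] by (rule subsetD[rotated])
 qed
 thus ?thesis unfolding x(2) by (intro span_sum)
qed

lemma aonb_expand:
 assumes g: "adapted_metric A k D g" and e: "aonb g p e" shows "v = (SUM i:Ix. (g p (e i) (e i) * g p v (e i)) *\<^sub>R e i)"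
 by (rule onb_expand[OF adapted_metric_pr[OF g] aonb_onb[OF e] aonb_span_UNIV[OF g e]])

text \<open>The projection along the other distributions. It is determined by the splitting alone,
  so it stays fixed while the metric varies, and yet \<open>Pr_frame\<close> computes it from a
  frame of any adapted metric.\<close>

definition Pr :: "'m => nat => real^'n => real^'n" where
 "Pr p \<mu> v = (THE x. (ALL \<mu>:{1..k}. x \<mu> : D \<mu> p) & (ALL \<mu>. \<mu> ~: {1..k} --> x \<mu> = 0) & v = (\<Sum>\<mu>=1..k. x \<mu>)) \<mu>"

lemma Pr_unique:
 assumes x: "ALL \<mu>:{1..k}. x \<mu> : D \<mu> p" "v = (\<Sum>\<mu>=1..k. x \<mu>)" and \<mu>: "\<mu> : {1..k}" shows "Pr p \<mu> v = x \<mu>"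
proof -
 let ?y = "%\<nu>. if \<nu> : {1..k} then x \<nu> else 0"
 let ?P = "%x. (ALL \<mu>:{1..k}. x \<mu> : D \<mu> p) & (ALL \<mu>. \<mu> ~: {1..k} --> x \<mu> = 0) & v = (\<Sum>\<mu>=1..k. x \<mu>)"
 have ex1: "\<exists>!x. ?P x" using amp unfolding almost_multi_product_def by (elim conjE allE)
 have "?P ?y" using x by simp
 hence "(THE x. ?P x) = ?y" by (rule the1_equality[OF ex1])
 thus ?thesis unfolding Pr_def using \<mu> by simp
qed

lemma Pr_frame:
 assumes g: "adapted_metric A k D g" and e: "aonb g p e" and \<mu>: "\<mu> : {1..k}"
 shows "Pr p \<mu> v = (SUM i:Blk \<mu>. (g p (e i) (e i) * g p v (e i)) *\<^sub>R e i)" proof (rule Pr_unique[OF _ _ \<mu>])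
 show "ALL \<mu>:{1..k}. (SUM i:Blk \<mu>. (g p (e i) (e i) * g p v (e i)) *\<^sub>R e i) : D \<mu> p"
  by (intro ballI subspace_sum[OF D_subspace] subspace_scale[OF D_subspace]) (use aonb_D[OF e] in \<open>auto simp: Blk_def\<close>)
 show "v = (\<Sum>\<mu>=1..k. SUM i:Blk \<mu>. (g p (e i) (e i) * g p v (e i)) *\<^sub>R e i)"
  unfolding sum_Ix[symmetric] by (rule aonb_expand[OF g e])
qed

lemma adapted_frame_exists:
 assumes g: "adapted_metric A k D g"
 shows "EX e U. open U & p : U & (ALL i:Ix. svf UNIV (e i) & (ALL q. e i q : D (fst i) q)) & (ALL q:U. aonb g q (%i. e i q))" proof -
 have "EX E U. open U & p : U & (ALL a<n \<mu>. svf UNIV (E a) & (ALL q. E a q : D \<mu> q)) \<and>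
  (ALL q:U. onb g q {..<n \<mu>} (%a. E a q))" if "\<mu> : {1..k}" for \<mu>
  by (rule orthonormal_frame_exists[OF adapted_metric_pr[OF g] D_distribution[OF that]])
   (rule adapted_nondeg[OF g that])
 hence "ALL \<mu>:{1..k}. EX EU. open (snd EU) & p : snd EU & (ALL a<n \<mu>. svf UNIV (fst EU a) & (ALL q. fst EU a q : D \<mu> q)) \<and>
  (ALL q:snd EU. onb g q {..<n \<mu>} (%a. fst EU a q))" by simp
 from bchoice[OF this] obtain F where F: "ALL \<mu>:{1..k}. open (snd (F \<mu>)) & p : snd (F \<mu>) \<and>
  (ALL a<n \<mu>. svf UNIV (fst (F \<mu>) a) & (ALL q. fst (F \<mu>) a q : D \<mu> q)) \<and>
  (ALL q:snd (F \<mu>). onb g q {..<n \<mu>} (%a. fst (F \<mu>) a q))" by (elim exE)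
 define e where "e = (%i. fst (F (fst i)) (snd i))"
 define U where "U = (INT \<mu>:{1..k}. snd (F \<mu>))"
 have eD: "svf UNIV (e i) & (ALL q. e i q : D (fst i) q)" if "i : Ix" for i using F that unfolding e_def Ix_def by (cases i) simp
 have "aonb g q (%i. e i q)" if q: "q : U" for q unfolding aonb_def proof (intro conjI ballI onbI finite_Ix)
  have on: "onb g q {..<n \<mu>} (%a. fst (F \<mu>) a q)" if "\<mu> : {1..k}" for \<mu> using F q that unfolding U_def by simp
  fix i assume i: "i : Ix"
  hence i': "fst i : {1..k}" "snd i : {..<n (fst i)}" by (auto simp: Ix_def)
  show "g q (e i q) (e i q) : {1, -1}" unfolding e_def by (rule onb_sign[OF on[OF i'(1)] i'(2)])
  fix j assume j: "j : Ix" "i ~= j"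
  hence j': "fst j : {1..k}" "snd j : {..<n (fst j)}" by (auto simp: Ix_def)
  show "g q (e i q) (e j q) = 0" proof (cases "fst i = fst j")
   case True
   hence "snd i ~= snd j" using j(2) by (metis prod.expand)
   thus ?thesis using onb_orth[OF on[OF i'(1)] i'(2), of "snd j"] j' True by (simp add: e_def)
  next
   case False
   show ?thesis by (rule adapted_orth[OF g i'(1) j'(1) False]) (use eD[OF i] eD[OF j(1)] in simp_all)
  qed
 next
  fix i assume "i : Ix" thus "e i q : D (fst i) q" using eD by simp
 qed
 moreover have "open U" unfolding U_def using F by (intro open_INT) auto
 moreover have "p : U" unfolding U_def using F by simp
 ultimately show ?thesis using eD by (intro exI[of _ e] exI[of _ U]) simp
qed

end

section \<open>The mixed scalar curvature in coordinates\<close>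

context multi_product
begin

lemma distribution_frame_at:
 assumes g: "adapted_metric A k D g" and \<mu>: "\<mu> : {1..k}" shows "EX E. orthonormal_frame_at A g (D \<mu>) p E" proof -
 from adapted_frame_exists[OF g, of p] obtain e U where U: "open U" "p : U"
  and e: "ALL i:Ix. svf UNIV (e i) & (ALL q. e i q : D (fst i) q)" and o: "ALL q:U. aonb g q (%i. e i q)" by (elim exE conjE)
 have mem: "(\<mu>, a) : Ix" if "a < n \<mu>" for a using that \<mu> by (simp add: Ix_def)
 show ?thesis unfolding orthonormal_frame_at_def D_dim[OF \<mu>] smooth_vfield_svf
 proof (intro exI[of _ "%a. e (\<mu>, a)"] exI[of _ U] conjI allI impI ballI U)
  fix a assume a: "a < n \<mu>"
  show "svf UNIV (e (\<mu>, a))" using e mem[OF a] by simp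
  fix q assume "q : U"
  hence q: "aonb g q (%i. e i q)" using o by simp
  show "g q (e (\<mu>, a) q) (e (\<mu>, a) q) : {1, - 1}" by (rule onb_sign[OF aonb_onb[OF q] mem[OF a]])
  fix b assume "b < n \<mu>" "a ~= b"
  thus "g q (e (\<mu>, a) q) (e (\<mu>, b) q) = 0" using onb_orth[OF aonb_onb[OF q] mem[OF a] mem, of b] by simp
 next
  fix q assume "q : U"
  hence q: "aonb g q (%i. e i q)" using o by simp
  show "D \<mu> q = span ((%a. e (\<mu>, a) q) ` {..<n \<mu>})" using aonb_span[OF g q \<mu>] by (simp add: Blk_eq[OF \<mu>] image_image)
 qed
qed

text \<open>The frames chosen inside the definition of the mixed scalar curvature, evaluated at
  their base point and assembled into one adapted basis.\<close>

definition oe :: "('m, 'n) metric => 'm => nat \<times> nat => real^'n" where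
 "oe g p i = onframe A g (D (fst i)) p (snd i) p"

lemma onframe_D:
 assumes g: "adapted_metric A k D g" and \<mu>: "\<mu> : {1..k}" shows "orthonormal_frame_at A g (D \<mu>) p (onframe A g (D \<mu>) p)"
 unfolding onframe_def by (rule someI_ex[OF distribution_frame_at[OF g \<mu>]])

lemma onframe_D_facts:
 assumes g: "adapted_metric A k D g" and \<mu>: "\<mu> : {1..k}" and a: "a < n \<mu>"
 shows "svf UNIV (onframe A g (D \<mu>) p a)" "onframe A g (D \<mu>) p a p : D \<mu> p"
  "g p (onframe A g (D \<mu>) p a p) (onframe A g (D \<mu>) p a p) : {1, -1}"
  "b < n \<mu> ==> a ~= b ==> g p (onframe A g (D \<mu>) p a p) (onframe A g (D \<mu>) p b p) = 0" proof -
 note o = onframe_D[OF g \<mu>, of p, unfolded orthonormal_frame_at_def D_dim[OF \<mu>] smooth_vfield_svf]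
 show "svf UNIV (onframe A g (D \<mu>) p a)" using o[THEN conjunct1] a by simp
 from o[THEN conjunct2] obtain U where "p : U" and U: "ALL q:U.
    D \<mu> q = span ((%a. onframe A g (D \<mu>) p a q) ` {..<n \<mu>}) \<and>
    (ALL a<n \<mu>. g q (onframe A g (D \<mu>) p a q) (onframe A g (D \<mu>) p a q) : {1, -1}) \<and>
    (ALL a<n \<mu>. ALL b<n \<mu>. a ~= b --> g q (onframe A g (D \<mu>) p a q) (onframe A g (D \<mu>) p b q) = 0)" by (elim exE conjE)
 note p = bspec[OF U \<open>p : U\<close>]
 have "onframe A g (D \<mu>) p a p : span ((%a. onframe A g (D \<mu>) p a p) ` {..<n \<mu>})" using a by (intro span_base imageI) simp
 thus "onframe A g (D \<mu>) p a p : D \<mu> p" using p[THEN conjunct1] by simp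
 show "g p (onframe A g (D \<mu>) p a p) (onframe A g (D \<mu>) p a p) : {1, -1}" using p[THEN conjunct2, THEN conjunct1] a by blast
 show "b < n \<mu> ==> a ~= b ==> g p (onframe A g (D \<mu>) p a p) (onframe A g (D \<mu>) p b p) = 0"
  using p[THEN conjunct2, THEN conjunct2] a by blast
qed

lemma oe_aonb:
 assumes g: "adapted_metric A k D g" shows "aonb g p (oe g p)" unfolding aonb_def oe_def proof (intro conjI ballI onbI finite_Ix)
 fix i assume "i : Ix"
 hence i: "fst i : {1..k}" "snd i < n (fst i)" by (auto simp: Ix_def)
 show "g p (onframe A g (D (fst i)) p (snd i) p) (onframe A g (D (fst i)) p (snd i) p) : {1, -1}"
  "onframe A g (D (fst i)) p (snd i) p : D (fst i) p" by (rule onframe_D_facts[OF g i])+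
 fix j assume "j : Ix" "i ~= j"
 hence j: "fst j : {1..k}" "snd j < n (fst j)" by (auto simp: Ix_def)
 show "g p (onframe A g (D (fst i)) p (snd i) p) (onframe A g (D (fst j)) p (snd j) p) = 0" proof (cases "fst i = fst j")
  case True
  hence "snd i ~= snd j" using \<open>i ~= j\<close> by (metis prod.expand)
  thus ?thesis using onframe_D_facts(4)[OF g i, of "snd j"] j True by simp
 next
  case False
  show ?thesis by (rule adapted_orth[OF g i(1) j(1) False]; rule onframe_D_facts(2)[OF g]; fact i j)
 qed
qed

text \<open>The contraction behind the mixed scalar curvature for an arbitrary trilinear map Q,
  because it is needed for the curvature as well as for its variation.\<close>

definition fctr :: "('m, 'n) metric => 'm => (nat \<times> nat => real^'n) => (real^'n => real^'n => real^'n => real^'n) => real" where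
 "fctr g p e Q = 1/2 * (SUM \<mu>:{1..k}. SUM \<nu>:{1..k}-{\<mu>}. SUM i:Blk \<nu>. SUM j:Blk \<mu>.
   g p (e i) (e i) * g p (e j) (e j) * g p (Q (e i) (e j) (e i)) (e j))"

text \<open>The mixed scalar curvature adds both orders over unordered pairs of distributions; sums
  over ordered pairs are easier to rename and to split.\<close>

lemma sum_off_diagonal:
 fixes B :: "nat => nat => real"
 shows "(\<Sum>\<mu>=1..k. \<Sum>\<nu>=1..<\<mu>. B \<nu> \<mu> + B \<mu> \<nu>) = (SUM \<mu>:{1..k}. SUM \<nu>:{1..k}-{\<mu>}. B \<nu> \<mu>)"
proof (induct k)
 case (Suc k)
 have 1: "{1..Suc k} = insert (Suc k) {1..k}" by auto
 have 2: "{1..Suc k} - {\<mu>} = insert (Suc k) ({1..k} - {\<mu>})" if "\<mu> : {1..k}" for \<mu> using that by auto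
 have 3: "{1..Suc k} - {Suc k} = {1..k}" "{1..<Suc k} = {1..k}" by auto
 have ex: "sum f {1..Suc k} = f (Suc k) + sum f {1..k}" for f :: "nat => real" unfolding 1 by (rule sum.insert) auto
 have "(SUM \<mu>:{1..Suc k}. SUM \<nu>:{1..Suc k}-{\<mu>}. B \<nu> \<mu>) =
   (SUM \<nu>:{1..k}. B \<nu> (Suc k)) + (SUM \<mu>:{1..k}. SUM \<nu>:{1..Suc k}-{\<mu>}. B \<nu> \<mu>)" proof -
  from ex[of "%\<mu>. SUM \<nu>:{1..Suc k}-{\<mu>}. B \<nu> \<mu>"] show ?thesis unfolding 3 .
 qed
 also have "(SUM \<mu>:{1..k}. SUM \<nu>:{1..Suc k}-{\<mu>}. B \<nu> \<mu>) = (SUM \<mu>:{1..k}. B (Suc k) \<mu> + (SUM \<nu>:{1..k}-{\<mu>}. B \<nu> \<mu>))"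
 proof (rule sum.cong[OF refl])
  fix \<mu> assume "\<mu> : {1..k}"
  thus "(SUM \<nu>:{1..Suc k}-{\<mu>}. B \<nu> \<mu>) = B (Suc k) \<mu> + (SUM \<nu>:{1..k}-{\<mu>}. B \<nu> \<mu>)"
   unfolding 2[OF \<open>\<mu> : {1..k}\<close>] by (subst sum.insert) auto
 qed
 finally have "(SUM \<mu>:{1..Suc k}. SUM \<nu>:{1..Suc k}-{\<mu>}. B \<nu> \<mu>) =
   (SUM \<nu>:{1..k}. B \<nu> (Suc k) + B (Suc k) \<nu>) + (\<Sum>\<mu>=1..k. \<Sum>\<nu>=1..<\<mu>. B \<nu> \<mu> + B \<mu> \<nu>)"
  unfolding Suc unfolding sum.distrib by linarith
 also have "... = (\<Sum>\<mu>=1..Suc k. \<Sum>\<nu>=1..<\<mu>. B \<nu> \<mu> + B \<mu> \<nu>)"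
  using ex[of "%\<mu>. \<Sum>\<nu>=1..<\<mu>. B \<nu> \<mu> + B \<mu> \<nu>"] unfolding 3 by (rule sym)
 finally show ?case by (rule sym)
qed simp

lemma mixed_scalar_fctr:
 assumes g: "adapted_metric A k D g" and T: "smooth_tensor12 A T" shows "mixed_scalar_curvature A k D g T p = fctr g p (oe g p) (Rm g T p)"
 unfolding mixed_scalar_curvature_def Let_def fctr_def sum_off_diagonal[symmetric]
proof (rule arg_cong[of _ _ "%x. 1/2 * x"], rule sum.cong[OF refl], rule sum.cong[OF refl], goal_cases)
 case (1 \<mu> \<nu>)
 hence m: "\<mu> : {1..k}" "\<nu> : {1..k}" by auto
 let ?E = "%\<mu>. onframe A g (D \<mu>) p" and ?R = "curvature A (contorted_connection A g T)"
 let ?F = "%\<nu> a \<mu> b. g p (?E \<nu> a p) (?E \<nu> a p) * g p (?E \<mu> b p) (?E \<mu> b p) * g p (Rm g T p (?E \<nu> a p) (?E \<mu> b p) (?E \<nu> a p)) (?E \<mu> b p)"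
 have "g p (?E \<nu> a p) (?E \<nu> a p) * g p (?E \<mu> b p) (?E \<mu> b p) *
    (g p (?R (?E \<nu> a) (?E \<mu> b) (?E \<nu> a) p) (?E \<mu> b p) + g p (?R (?E \<mu> b) (?E \<nu> a) (?E \<mu> b) p) (?E \<nu> a p)) = ?F \<nu> a \<mu> b + ?F \<mu> b \<nu> a"
  if "a < n \<nu>" "b < n \<mu>" for a b proof -
  note s = onframe_D_facts(1)[OF g m(2) that(1), of p] onframe_D_facts(1)[OF g m(1) that(2), of p]
  note R = Rm_curvature[OF adapted_metric_pr[OF g] T]
  show ?thesis unfolding R[OF s s(1)] R[OF s(2,1) s(2)] by (simp add: algebra_simps)
 qed
 hence "(\<Sum>a<n \<nu>. \<Sum>b<n \<mu>. g p (?E \<nu> a p) (?E \<nu> a p) * g p (?E \<mu> b p) (?E \<mu> b p) *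
    (g p (?R (?E \<nu> a) (?E \<mu> b) (?E \<nu> a) p) (?E \<mu> b p) + g p (?R (?E \<mu> b) (?E \<nu> a) (?E \<mu> b) p) (?E \<nu> a p))) =
   (\<Sum>a<n \<nu>. \<Sum>b<n \<mu>. ?F \<nu> a \<mu> b + ?F \<mu> b \<nu> a)" by (intro sum.cong refl) auto
 also have "... = (\<Sum>a<n \<nu>. \<Sum>b<n \<mu>. ?F \<nu> a \<mu> b) + (\<Sum>b<n \<mu>. \<Sum>a<n \<nu>. ?F \<mu> b \<nu> a)"
  unfolding sum.distrib by (subst (4) sum.swap) simp
 finally show ?case unfolding D_dim[OF m(1)] D_dim[OF m(2)] sum_Blk[OF m(1)] sum_Blk[OF m(2)] oe_def fst_conv snd_conv .
qed

text \<open>The matrices of the projection onto \<open>D \<mu>\<close> and of the inverse metric of \<open>D \<nu>\<close>. They replace the sums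
 over orthonormal frames, which cannot be chosen smoothly in a family of metrics in an obvious way.\<close>

definition Pm :: "('m, 'n) chart => nat => real^'n => real^'n^'n" where
 "Pm c \<mu> x = (\<chi> a b. cc c (chart_inv c x) (Pr (chart_inv c x) \<mu> (ci c (chart_inv c x) (axis b 1))) $ a)"

lemma Pm_frame:
 assumes g: "adapted_metric A k D g" and e: "aonb g p e" and \<mu>: "\<mu> : {1..k}" and c: "c : A" "p : fst c"
 shows "Pm c \<mu> (snd c p) $ a $ b = (SUM i:Blk \<mu>. g p (e i) (e i) * (cc c p (e i) $ a * (gram g c (snd c p) *v cc c p (e i)) $ b))" proof -
 have "g p (ci c p (axis b 1)) (e i) = (gram g c (snd c p) *v cc c p (e i)) $ b" for i
  unfolding metric_coords_inner[OF adapted_metric_pr[OF g] c] using c by (simp add: inner_axis')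
 thus ?thesis unfolding Pm_def using c by (simp add: Pr_frame[OF g e \<mu>] cc_simps mult_ac)
qed

definition Hm :: "('m, 'n) metric => ('m, 'n) chart => nat => real^'n => real^'n^'n" where
 "Hm g c \<nu> x = matrix_inv (gram g c x) ** transpose (Pm c \<nu> x)"

lemma Hm_frame:
 assumes g: "adapted_metric A k D g" and e: "aonb g p e" and \<nu>: "\<nu> : {1..k}" and c: "c : A" "p : fst c"
 shows "Hm g c \<nu> (snd c p) $ a $ b = (SUM i:Blk \<nu>. g p (e i) (e i) * (cc c p (e i) $ a * cc c p (e i) $ b))" proof -
 let ?G = "gram g c (snd c p)"
 have "invertible ?G" using det_gram_nz[OF adapted_metric_pr[OF g] c(1), of "snd c p"] c unfolding invertible_det_nz by simp
 hence "matrix_inv ?G *v (?G *v u) = u" for u by (simp add: matrix_vector_mul_assoc matrix_inv_right_left)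
 moreover have "(SUM m:UNIV. M $ a $ m * v $ m) = (M *v v) $ a" for M :: "real^'n^'n" and v by (simp add: matrix_vector_mult_def)
 ultimately have inv: "(SUM m:UNIV. matrix_inv ?G $ a $ m * (?G *v u) $ m) = u $ a" for u by metis
 have "Hm g c \<nu> (snd c p) $ a $ b = (SUM m:UNIV. matrix_inv ?G $ a $ m * Pm c \<nu> (snd c p) $ b $ m)"
  by (simp add: Hm_def matrix_matrix_mult_def transpose_def)
 also have "... = (SUM m:UNIV. SUM i:Blk \<nu>. g p (e i) (e i) * cc c p (e i) $ b * (matrix_inv ?G $ a $ m * (?G *v cc c p (e i)) $ m))"
  unfolding Pm_frame[OF g e \<nu> c] by (simp add: sum_distrib_left mult_ac)
 also have "... = (SUM i:Blk \<nu>. g p (e i) (e i) * cc c p (e i) $ b * (SUM m:UNIV. matrix_inv ?G $ a $ m * (?G *v cc c p (e i)) $ m))"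
  by (subst sum.swap) (simp add: sum_distrib_left)
 finally show ?thesis unfolding inv by (simp add: mult_ac)
qed

text \<open>Summing \<epsilon> e \<otimes> e over a block gives \<open>Hm\<close>, and summing
  \<epsilon> e \<otimes> \<langle>e, \<cdot>\<rangle> gives the projection \<open>Pm\<close>. After
  both substitutions no frame is left in the contraction.\<close>

lemma SC_frame:
 assumes g: "adapted_metric A k D g" and e: "aonb g p e" and m: "\<mu> : {1..k}" "\<nu> : {1..k}" and c: "c : A" "p : fst c"
  and lin: "!!u w. linear (%v. Q u v w)" "!!v w. linear (%u. Q u v w)" "!!u v. linear (%w. Q u v w)"
 shows "(SUM a:UNIV. SUM b:UNIV. SUM m:UNIV. Hm g c \<nu> (snd c p) $ a $ b * Q (axis a 1) (column m (Pm c \<mu> (snd c p))) (axis b 1) $ m) =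
  (SUM i:Blk \<nu>. SUM j:Blk \<mu>. g p (e i) (e i) * g p (e j) (e j) * g p (ci c p (Q (cc c p (e i)) (cc c p (e j)) (cc c p (e i)))) (e j))"
proof -
 let ?G = "gram g c (snd c p)" and ?u = "%i. cc c p (e i)" and ?s = "%i. g p (e i) (e i)"
 have col: "column m (Pm c \<mu> (snd c p)) = (SUM j:Blk \<mu>. (?s j * (?G *v ?u j) $ m) *\<^sub>R ?u j)" for m
  by (simp add: vec_eq_iff column_def Pm_frame[OF g e m(1) c] mult_ac)
 have ax: "w = (SUM a:UNIV. w $ a *\<^sub>R axis a 1)" for w :: "real^'n" using basis_expansion[of w] by (simp add: scalar_mult_eq_scaleR)
 have two: "Q w v w = (SUM a:UNIV. SUM b:UNIV. (w $ a * w $ b) *\<^sub>R Q (axis a 1) v (axis b 1))" for w v proof -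
  have e1: "Q w v w' = (SUM a:UNIV. w $ a *\<^sub>R Q (axis a 1) v w')" for w'
   using arg_cong[OF ax[of w], of "%u. Q u v w'"] by (simp only: linear_sum[OF lin(2)] linear_cmul[OF lin(2)])
  have e2: "Q u v w = (SUM b:UNIV. w $ b *\<^sub>R Q u v (axis b 1))" for u
   using arg_cong[OF ax[of w], of "%w. Q u v w"] by (simp only: linear_sum[OF lin(3)] linear_cmul[OF lin(3)])
  show ?thesis by (subst e1, subst e2) (simp add: scaleR_sum_right)
 qed
 have tr: "(SUM m:UNIV. Q u (column m (Pm c \<mu> (snd c p))) w $ m) = (SUM j:Blk \<mu>. ?s j * g p (ci c p (Q u (?u j) w)) (e j))" for u w proof -
  have "(SUM m:UNIV. Q u (column m (Pm c \<mu> (snd c p))) w $ m) = (SUM m:UNIV. SUM j:Blk \<mu>. ?s j * (Q u (?u j) w $ m * (?G *v ?u j) $ m))"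
   unfolding col linear_sum[OF lin(1)] linear_cmul[OF lin(1)] by (simp add: mult_ac)
  also have "... = (SUM j:Blk \<mu>. ?s j * (Q u (?u j) w \<bullet> (?G *v ?u j)))" by (subst sum.swap) (simp add: inner_vec_def sum_distrib_left)
  finally show ?thesis unfolding metric_coords_inner[OF adapted_metric_pr[OF g] c] using c by simp
 qed
 have "(SUM a:UNIV. SUM b:UNIV. SUM m:UNIV. Hm g c \<nu> (snd c p) $ a $ b * Q (axis a 1) (column m (Pm c \<mu> (snd c p))) (axis b 1) $ m) =
  (SUM a:UNIV. SUM b:UNIV. Hm g c \<nu> (snd c p) $ a $ b * (SUM j:Blk \<mu>. ?s j * g p (ci c p (Q (axis a 1) (?u j) (axis b 1))) (e j)))"
  unfolding sum_distrib_left[symmetric] tr ..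
 also have "... = (SUM a:UNIV. SUM b:UNIV. SUM i:Blk \<nu>. SUM j:Blk \<mu>. ?s i * ?s j * (?u i $ a * ?u i $ b * g p (ci c p (Q (axis a 1) (?u j) (axis b 1))) (e j)))"
  unfolding Hm_frame[OF g e m(2) c] sum_product by (intro sum.cong refl) (simp only: mult_ac)
 also have "... = (SUM a:UNIV. SUM i:Blk \<nu>. SUM j:Blk \<mu>. SUM b:UNIV. ?s i * ?s j * (?u i $ a * ?u i $ b * g p (ci c p (Q (axis a 1) (?u j) (axis b 1))) (e j)))"
  by (rule sum.cong[OF refl], subst sum.swap, rule sum.cong[OF refl], rule sum.swap)
 also have "... = (SUM i:Blk \<nu>. SUM j:Blk \<mu>. SUM a:UNIV. SUM b:UNIV. ?s i * ?s j * (?u i $ a * ?u i $ b * g p (ci c p (Q (axis a 1) (?u j) (axis b 1))) (e j)))"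
  by (subst sum.swap, rule sum.cong[OF refl], rule sum.swap)
 also have "... = (SUM i:Blk \<nu>. SUM j:Blk \<mu>. ?s i * ?s j * g p (ci c p (Q (?u i) (?u j) (?u i))) (e j))"
  unfolding two[of "?u _"] by (simp add: ci_simps[OF c] metric_facts[OF adapted_metric_pr[OF g]] sum_distrib_left)
 finally show ?thesis .
qed

text \<open>The matrix does not depend on a frame, so near each point it may be computed from a
  smooth local one.\<close>

lemma smooth_Pm:
 assumes g: "adapted_metric A k D g" and c: "c : A" and \<mu>: "\<mu> : {1..k}" shows "smooth_on (chart_image c) (%x. Pm c \<mu> x $ a $ b)"
proof (rule smooth_on_pointwise)
 note pg = adapted_metric_pr[OF g]
 fix x assume x: "x : chart_image c"
 let ?p = "chart_inv c x"
 from adapted_frame_exists[OF g, of ?p] obtain e U where U: "open U" "?p : U"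
  and e: "ALL i:Ix. svf UNIV (e i) & (ALL q. e i q : D (fst i) q)" and o: "ALL q:U. aonb g q (%i. e i q)" by (elim exE conjE)
 let ?V = "snd c ` (U Int fst c)"
 have V: "open ?V" by (rule open_chart_img[OF c U(1)])
 have Vc: "?V <= chart_image c" by (auto simp: chart_image_def)
 have xV: "x : ?V" using x U(2) c by (metis IntI image_eqI inv_in_dom snd_inv)
 have es: "smooth_on ?V (vrep c (e i))" if "i : Blk \<mu>" for i using smooth_on_subset[OF vrep_smooth[OF _ c] Vc] e that by (simp add: Blk_def)
 have gs: "smooth_on ?V (%x. gram g c x $ i $ j)" for i j by (rule smooth_on_subset[OF gram_smooth[OF pg c] Vc])
 have "smooth_on ?V (%x. SUM i:Blk \<mu>. (vrep c (e i) x \<bullet> (gram g c x *v vrep c (e i) x)) *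
   (vrep c (e i) x $ a * (SUM j:UNIV. gram g c x $ b $ j * vrep c (e i) x $ j)))"
  by (intro smooth_on_sum smooth_on_mult smooth_on_vec_nth smooth_on_quadratic V es gs)
 moreover have "Pm c \<mu> y $ a $ b = (SUM i:Blk \<mu>. (vrep c (e i) y \<bullet> (gram g c y *v vrep c (e i) y)) *
   (vrep c (e i) y $ a * (SUM j:UNIV. gram g c y $ b $ j * vrep c (e i) y $ j)))" if "y : ?V" for y proof -
  from that obtain q where q: "q : U" "q : fst c" "y = snd c q" by blast
  have "aonb g q (%i. e i q)" using o q(1) by simp
  from Pm_frame[OF g this \<mu> c q(2), of a b] show ?thesis unfolding q(3) vrep_snd[OF c q(2)] metric_coords_inner[OF pg c q(2)]
   by (simp add: matrix_vector_mult_def)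
 qed
 ultimately have "smooth_on ?V (%x. Pm c \<mu> x $ a $ b)" by (subst smooth_on_cong[OF V])
 thus "EX U. x : U & smooth_on U (%x. Pm c \<mu> x $ a $ b)" using xV by (intro exI[of _ ?V] conjI)
qed

end

section \<open>Differentiation under the integral sign\<close>

text \<open>A family is treated as one function of the pair (time, point). Its partial derivatives
  are total derivatives in the directions (r, 0) and (0, v), so that mixed ones can be exchanged by
  \<open>second_dird_symmetric\<close>.\<close>

lemma partial_dird:
 fixes F :: "real \<times> 'a::euclidean_space => 'b::real_normed_vector"
 assumes "smooth_on S F" "(t, x) : S" shows "((%y. F (t, y)) has_derivative (%v. dird F (t, x) (0, v))) (at x)"
  and "((%s. F (s, x)) has_derivative (%r. dird F (t, x) (r, 0))) (at t)" proof -
 have F: "(F has_derivative dird F (t, x)) (at (t, x))" by (rule smooth_on_has_derivative[OF assms])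
 have "((%y. (t, y)) has_derivative (%v. (0, v))) (at x)" by (intro has_derivative_Pair has_derivative_const has_derivative_ident)
 from diff_chain_at[OF this F] show "((%y. F (t, y)) has_derivative (%v. dird F (t, x) (0, v))) (at x)" by (simp add: o_def)
 have "((%s. (s, x)) has_derivative (%r. (r, 0))) (at t)" by (intro has_derivative_Pair has_derivative_const has_derivative_ident)
 from diff_chain_at[OF this F] show "((%s. F (s, x)) has_derivative (%r. dird F (t, x) (r, 0))) (at t)" by (simp add: o_def)
qed

lemma partial_dird_eq:
 fixes F :: "real \<times> 'a::euclidean_space => 'b::real_normed_vector"
 assumes "smooth_on S F" "(t, x) : S" shows "dird (%y. F (t, y)) x v = dird F (t, x) (0, v)" by (rule dird_eq[OF partial_dird(1)[OF assms]])

lemma partial_time_derivative: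
 fixes F :: "real \<times> 'a::euclidean_space => real"
 assumes "smooth_on S F" "(t, x) : S" shows "((%s. F (s, x)) has_real_derivative dird F (t, x) (1, 0)) (at t)" proof -
 have lin: "linear (dird F (t, x))" by (rule has_derivative_linear[OF smooth_on_has_derivative[OF assms]])
 have "(%r. dird F (t, x) (r, 0)) = (*) (dird F (t, x) (1, 0))" proof
  fix r
  have "dird F (t, x) (r, 0) = dird F (t, x) (r *\<^sub>R (1, 0))" by simp
  also have "... = r *\<^sub>R dird F (t, x) (1, 0)" by (rule linear_cmul[OF lin])
  finally show "dird F (t, x) (r, 0) = dird F (t, x) (1, 0) * r" by simp
 qed
 thus ?thesis unfolding has_field_derivative_def using partial_dird(2)[OF assms] by simp
qed

text \<open>Dominated convergence along sequences of times: on a compact neighbourhood the time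
  derivative is bounded by M, hence so are the difference quotients on B. B is merely Borel, since
  it will be a piece of the domain cut out by charts.\<close>

lemma leibniz_compact:
 fixes F :: "real \<times> (real^'n) => real"
 assumes \<epsilon>: "0 < \<epsilon>" and S: "open S" and F: "smooth_on ({-\<epsilon><..<\<epsilon>} \<times> S) F"
  and B: "B : sets borel" "B <= K" and K: "compact K" "K <= S"
 shows "t : {-\<epsilon><..<\<epsilon>} ==> integrable lborel (%x. indicator B x * F (t, x))"
  and "integrable lborel (%x. indicator B x * dird F (0, x) (1, 0))"
  and "((%t. \<integral>x. indicator B x * F (t, x) \<partial>lborel) has_real_derivative
   (\<integral>x. indicator B x * dird F (0, x) (1, 0) \<partial>lborel)) (at 0)" proof -
 let ?I = "{-\<epsilon><..<\<epsilon>}"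
 have cF: "continuous_on (?I \<times> S) F" by (rule smooth_on_continuous_on[OF F])
 have cD: "continuous_on (?I \<times> S) (%z. dird F z (1, 0))" by (rule smooth_on_continuous_on[OF smooth_on_dird[OF F]])
 have slice: "continuous_on K (%x. h (t, x))" if "continuous_on (?I \<times> S) h" "t : ?I" for h :: "real \<times> (real^'n) => real" and t
 proof (rule continuous_on_compose2[OF that(1), of K "%x. (t, x)"])
  show "continuous_on K (%x. (t, x))" by (intro continuous_intros)
  show "(%x. (t, x)) ` K <= ?I \<times> S" using K that(2) by auto
 qed
 have Bm: "emeasure lborel B < \<infinity>" proof -
  have "bounded B" using B K compact_imp_bounded bounded_subset by blast
  thus ?thesis by (rule emeasure_bounded_finite)
 qed
 have meas: "(%x. indicator B x * h x) : borel_measurable borel" if "continuous_on K h" for h :: "real^'n => real"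
  using borel_measurable_continuous_on_indicator[OF B(1) continuous_on_subset[OF that B(2)]] by simp
 have int: "integrable lborel (%x. indicator B x * h x)" if c: "continuous_on K h" for h :: "real^'n => real" proof -
  obtain M where M: "!!x. x : K ==> norm (h x) <= M" using compact_imp_bounded[OF compact_continuous_image[OF c K(1)]] unfolding bounded_iff by auto
  have "integrable lborel (%x. indicator B x *\<^sub>R M)" using B(1) Bm by (intro integrable_indicator) auto
  hence "integrable lborel (%x. indicator B x * M)" by simp
  thus ?thesis proof (rule Bochner_Integration.integrable_bound)
   show "(%x. indicator B x * h x) : borel_measurable lborel" using meas[OF c] by simp
   show "AE x in lborel. norm (indicator B x * h x) <= norm (indicator B x * M)"
    using M B(2) by (intro AE_I2) (auto simp: indicator_def intro: order_trans[OF _ abs_ge_self])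
  qed
 qed
 show "integrable lborel (%x. indicator B x * F (t, x))" if "t : ?I" for t by (rule int[OF slice[OF cF that]])
 have zI: "0 : ?I" using \<epsilon> by simp
 show int0: "integrable lborel (%x. indicator B x * dird F (0, x) (1, 0))" by (rule int[OF slice[OF cD zI]])
 let ?J = "%t. \<integral>x. indicator B x * F (t, x) \<partial>lborel"
 let ?L = "\<integral>x. indicator B x * dird F (0, x) (1, 0) \<partial>lborel"
 \<comment> \<open>A closed interval inside the open one gives a compact set on which the derivative
   is bounded.\<close>
 define \<delta> where "\<delta> = \<epsilon> / 2"
 have \<delta>: "0 < \<delta>" "{-\<delta>..\<delta>} <= ?I" using \<epsilon> by (auto simp: \<delta>_def)
 have "compact ({-\<delta>..\<delta>} \<times> K)" using K by (intro compact_Times) auto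
 moreover have "continuous_on ({-\<delta>..\<delta>} \<times> K) (%z. dird F z (1, 0))"
  by (rule continuous_on_subset[OF cD]) (use \<delta> K in auto)
 ultimately have "bounded ((%z. dird F z (1, 0)) ` ({-\<delta>..\<delta>} \<times> K))" by (intro compact_imp_bounded compact_continuous_image)
 then obtain M where "ALL y:(%z. dird F z (1, 0)) ` ({-\<delta>..\<delta>} \<times> K). norm y <= M" unfolding bounded_iff by (elim exE)
 hence M: "norm (dird F z (1, 0)) <= M" if "z : {-\<delta>..\<delta>} \<times> K" for z using imageI[OF that] by (rule bspec)
 have lip: "\<bar>F (t, x) - F (0, x)\<bar> <= M * \<bar>t\<bar>" if t: "t : {-\<delta>..\<delta>}" and x: "x : K" for t x proof -
  have "norm (F (t, x) - F (0, x)) <= M * norm (t - 0)"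
  proof (rule field_differentiable_bound[of "{-\<delta>..\<delta>}" "%s. F (s, x)" "%s. dird F (s, x) (1, 0)" M t 0])
   fix s assume s: "s : {-\<delta>..\<delta>}"
   show "((%s. F (s, x)) has_field_derivative dird F (s, x) (1, 0)) (at s within {-\<delta>..\<delta>})"
    by (rule has_field_derivative_at_within[OF partial_time_derivative[OF F]]) (use s x \<delta> K in auto)
   show "norm (dird F (s, x) (1, 0)) <= M" using M[of "(s, x)"] s x by simp
  qed (use t \<delta> in auto)
  thus ?thesis by simp
 qed
 have "((%h. (?J h - ?J 0) / h) \<longlongrightarrow> ?L) (at 0)" unfolding tendsto_at_iff_sequentially comp_def proof (intro allI impI)
  fix X :: "nat => real" assume X: "ALL i. X i : UNIV - {0}" "X \<longlonglongrightarrow> 0"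
  hence "\<forall>\<^sub>F i in sequentially. \<bar>X i\<bar> < \<delta>"
   using order_tendstoD(2)[OF tendsto_rabs[OF X(2)], of \<delta>] \<delta> by simp
  then obtain N where N: "!!i. i >= N ==> \<bar>X i\<bar> < \<delta>" unfolding eventually_sequentially by auto
  define Y where "Y = (%i. X (i + N))"
  have Y0: "Y i ~= 0" and Yd: "Y i : {-\<delta>..\<delta>}" for i using X(1) N[of "i + N"] by (auto simp: Y_def)
  have Yl: "Y \<longlonglongrightarrow> 0" unfolding Y_def by (rule LIMSEQ_ignore_initial_segment[OF X(2)])
  have YI: "Y i : ?I" for i using Yd \<delta>(2) by blast
  let ?s = "%i x. indicator B x * ((F (Y i, x) - F (0, x)) / Y i)"
  have s_eq: "?s i x = (indicator B x * F (Y i, x) - indicator B x * F (0, x)) / Y i" for i x by (simp add: algebra_simps diff_divide_distrib)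
  have "(%i. \<integral>x. ?s i x \<partial>lborel) \<longlonglongrightarrow> ?L"
  proof (rule integral_dominated_convergence[where w = "%x. indicator B x * M"])
   show "(%x. indicator B x * dird F (0, x) (1, 0)) : borel_measurable lborel" using meas[OF slice[OF cD zI]] by simp
   show "?s i : borel_measurable lborel" for i unfolding s_eq using meas[OF slice[OF cF YI]] meas[OF slice[OF cF zI]] by simp
   show "integrable lborel (%x. indicator B x * M)" by (rule int) simp
   show "AE x in lborel. (%i. ?s i x) \<longlonglongrightarrow> indicator B x * dird F (0, x) (1, 0)" proof (intro AE_I2)
    fix x
    show "(%i. ?s i x) \<longlonglongrightarrow> indicator B x * dird F (0, x) (1, 0)" proof (cases "x : B")
     case True
     hence "((%s. F (s, x)) has_real_derivative dird F (0, x) (1, 0)) (at 0)" using partial_time_derivative[OF F, of 0 x] B K zI by auto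
     hence "((%h. (F (0 + h, x) - F (0, x)) / h) \<longlongrightarrow> dird F (0, x) (1, 0)) (at 0)" unfolding DERIV_def .
     hence "(%i. (F (Y i, x) - F (0, x)) / Y i) \<longlonglongrightarrow> dird F (0, x) (1, 0)"
      unfolding tendsto_at_iff_sequentially comp_def using Y0 Yl by simp
     thus ?thesis using True by simp
    qed simp
   qed
   show "AE x in lborel. norm (?s i x) <= indicator B x * M" for i proof (intro AE_I2)
    fix x
    show "norm (?s i x) <= indicator B x * M" proof (cases "x : B")
     case True
     hence "\<bar>F (Y i, x) - F (0, x)\<bar> <= M * \<bar>Y i\<bar>" using lip[OF Yd] B by blast
     thus ?thesis using True Y0[of i] by (simp add: abs_divide divide_le_eq)
    qed simp
   qed
  qed
  moreover have "(\<integral>x. ?s i x \<partial>lborel) = (?J (Y i) - ?J 0) / Y i" for i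
   unfolding s_eq using int[OF slice[OF cF YI]] int[OF slice[OF cF zI]] by simp
  ultimately have "(%i. (?J (Y i) - ?J 0) / Y i) \<longlonglongrightarrow> ?L" by (simp only:)
  hence "(%i. (?J (X (i + N)) - ?J 0) / X (i + N)) \<longlonglongrightarrow> ?L" unfolding Y_def .
  thus "(%i. (?J (X i) - ?J 0) / X i) \<longlonglongrightarrow> ?L" by (rule LIMSEQ_offset)
 qed
 thus "(?J has_real_derivative ?L) (at 0)" unfolding DERIV_def by simp
qed

context smooth_mfd
begin

text \<open>Each z is a triple of a chart, an open set and a compact set between that open set and
  the chart domain. The compact set supplies the bounds for \<open>leibniz_compact\<close>.\<close>

lemma compact_chart_cover:
 assumes K: "compact K"
 obtains P where "finite P" "K <= (UN z:P. fst (snd z))"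
  "!!z. z : P ==> fst z : A & open (fst (snd z)) & fst (snd z) <= snd (snd z) & compact (snd (snd z)) & snd (snd z) <= fst (fst z)" proof -
 have "EX z. p : fst (snd z) & fst z : A & open (fst (snd z)) & fst (snd z) <= snd (snd z) & compact (snd (snd z)) & snd (snd z) <= fst (fst z)" for p
 proof -
  obtain \<phi> V C where b: "open V" "p : V" "V <= C" "compact C" "C <= UNIV Int fst (chart_at A p)"
   using manifold_bump[OF chart_at_in in_chart_at open_UNIV UNIV_I, of p] by metis
  thus ?thesis by (intro exI[of _ "(chart_at A p, V, C)"]) simp
 qed
 then obtain Z where Z: "!!p. p : fst (snd (Z p)) & fst (Z p) : A & open (fst (snd (Z p))) & fst (snd (Z p)) <= snd (snd (Z p)) & compact (snd (snd (Z p))) & snd (snd (Z p)) <= fst (fst (Z p))"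
  by metis
 have "\<exists>D\<subseteq>K. finite D & K <= (UN p:D. fst (snd (Z p)))" by (rule compactE_image[OF K, of K "%p. fst (snd (Z p))"]) (use Z in auto)
 then obtain D where D: "D <= K" "finite D" "K <= (UN p:D. fst (snd (Z p)))" by blast
 show thesis proof (rule that[of "Z ` D"])
  show "finite (Z ` D)" using D by simp
  show "K <= (UN z:Z ` D. fst (snd z))" using D by simp
  show "fst z : A & open (fst (snd z)) & fst (snd z) <= snd (snd z) & compact (snd (snd z)) & snd (snd z) <= fst (fst z)"
   if "z : Z ` D" for z using that Z by auto
 qed
qed

text \<open>The claim is additive over disjoint Borel sets. So the domain is split along a finite
  cover into Borel pieces that lie in single charts: the part of B inside one open set, and the rest
  of B, which the remaining sets cover.\<close>

lemma volume_integral_derivative: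
 fixes f :: "real => 'm => real"
 assumes \<epsilon>: "0 < \<epsilon>" and g: "!!t. t : {-\<epsilon><..<\<epsilon>} ==> pseudo_riemannian_metric A (g t)"
  and f: "!!t. t : {-\<epsilon><..<\<epsilon>} ==> f t : borel_measurable borel" and q: "q : borel_measurable borel"
  and F: "!!c. c : A ==> smooth_on ({-\<epsilon><..<\<epsilon>} \<times> chart_image c) (F c)"
  and Feq: "!!c t x. c : A ==> t : {-\<epsilon><..<\<epsilon>} ==> x : chart_image c ==>
    F c (t, x) = f t (chart_inv c x) * vol_density (g t) c x" and Fq: "!!c x. c : A ==> x : chart_image c ==>
    dird (F c) (0, x) (1, 0) = q (chart_inv c x) * vol_density (g 0) c x" and \<Omega>: "\<Omega> : sets borel" "\<Omega> <= K" "compact K"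
 shows "((%t. set_lebesgue_integral (volume_measure A (g t)) \<Omega> (f t)) has_real_derivative
   set_lebesgue_integral (volume_measure A (g 0)) \<Omega> q) (at 0)" and "set_integrable (volume_measure A (g 0)) \<Omega> q" proof -
 let ?I = "{-\<epsilon><..<\<epsilon>}"
 let ?J = "%B t. set_lebesgue_integral (volume_measure A (g t)) B (f t)"
 let ?L = "%B. set_lebesgue_integral (volume_measure A (g 0)) B q"
 let ?P = "%B. (ALL t:?I. set_integrable (volume_measure A (g t)) B (f t)) & set_integrable (volume_measure A (g 0)) B q \<and>
  (?J B has_real_derivative ?L B) (at 0)"
 have zI: "0 : ?I" using \<epsilon> by simp
 have single: "?P B" if c: "c : A" and C: "compact C" "C <= fst c" and B: "B : sets borel" "B <= C" for c C B proof -
  let ?B = "snd c ` B" and ?K = "snd c ` C"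
  have Bf: "B <= fst c" using B C by blast
  have K: "compact ?K" by (rule compact_continuous_image[OF continuous_on_subset[OF continuous_on_chart[OF c] C(2)] C(1)])
  have KS: "?K <= chart_image c" using C by (auto simp: chart_image_def)
  have Bb: "?B : sets borel" by (rule chart_density.borel_chart_image[OF chart_density_metric[OF g[OF zI]] c B(1) Bf])
  have BK: "?B <= ?K" using B by blast
  note L = leibniz_compact[OF \<epsilon> open_chart_image[OF c] F[OF c] Bb BK K KS]
  have e: "indicator ?B x * (f t (chart_inv c x) * vol_density (g t) c x) = indicator ?B x * F c (t, x)"
   if "t : ?I" for t x proof (cases "x : ?B")
   case True
   hence "x : chart_image c" using BK KS by blast
   thus ?thesis using Feq[OF c that] by simp
  qed simp
  have eq: "indicator ?B x * (q (chart_inv c x) * vol_density (g 0) c x) = indicator ?B x * dird (F c) (0, x) (1, 0)" for x proof (cases "x : ?B")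
   case True
   hence "x : chart_image c" using BK KS by blast
   thus ?thesis using Fq[OF c] by simp
  qed simp
  have J: "?J B t = (\<integral>x. indicator ?B x * F c (t, x) \<partial>lborel)" if "t : ?I" for t
   unfolding volume_integral(2)[OF g[OF that] c B(1) Bf f[OF that]] e[OF that] ..
  have i: "set_integrable (volume_measure A (g t)) B (f t)" if "t : ?I" for t
   unfolding volume_integral(1)[OF g[OF that] c B(1) Bf f[OF that]] e[OF that] by (rule L(1)[OF that])
  have iq: "set_integrable (volume_measure A (g 0)) B q" unfolding volume_integral(1)[OF g[OF zI] c B(1) Bf q] eq by (rule L(2))
  have Lq: "?L B = (\<integral>x. indicator ?B x * dird (F c) (0, x) (1, 0) \<partial>lborel)"
   unfolding volume_integral(2)[OF g[OF zI] c B(1) Bf q] eq ..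
  have "(?J B has_real_derivative ?L B) (at 0)" unfolding Lq by (rule has_field_derivative_transform_within_open[OF L(3), of ?I]) (use zI J in auto)
  thus ?thesis using i iq by blast
 qed
 obtain P where P: "finite P" "K <= (UN z:P. fst (snd z))"
  and Pz: "!!z. z : P ==> fst z : A & open (fst (snd z)) & fst (snd z) <= snd (snd z) & compact (snd (snd z)) & snd (snd z) <= fst (fst z)"
  using compact_chart_cover[OF \<Omega>(3)] by blast
 have "ALL B. B : sets borel --> B <= (UN z:P. fst (snd z)) --> ?P B" using P(1) Pz proof (induct P)
  case empty
  show ?case by (simp add: set_integrable_def set_lebesgue_integral_def)
 next
  case (insert z P)
  show ?case proof (intro allI impI)
   fix B assume B: "B : sets borel" "B <= (UN z:insert z P. fst (snd z))"
   let ?O = "fst (snd z)"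
   have z: "fst z : A" "open ?O" "?O <= snd (snd z)" "compact (snd (snd z))" "snd (snd z) <= fst (fst z)" using insert(4)[of z] by auto
   have 1: "?P (B Int ?O)" by (rule single[OF z(1,4,5)]) (use B z(2,3) in auto)
   have IH: "ALL B. B : sets borel --> B <= (UN z:P. fst (snd z)) --> ?P B" by (rule insert(3)) (rule insert(4), simp)
   have B2: "B - ?O : sets borel" "B - ?O <= (UN z:P. fst (snd z))" using B z(2) by auto
   have 2: "?P (B - ?O)" using IH B2 by blast
   have U: "B = (B Int ?O) Un (B - ?O)" "(B Int ?O) Int (B - ?O) = {}" by auto
   have m: "X : sets (volume_measure A (g t)) \<longleftrightarrow> X : sets borel" if "t : ?I" for X t
    using sets_volume_measure[OF g[OF that]] by simp
   have i: "set_integrable (volume_measure A (g t)) B (f t)" if "t : ?I" for t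
    by (subst U(1), rule set_integrable_Un) (use 1 2 B z(2) m[OF that] that in auto)
   have iq: "set_integrable (volume_measure A (g 0)) B q" by (subst U(1), rule set_integrable_Un) (use 1 2 B z(2) m[OF zI] in auto)
   have J: "?J B t = ?J (B Int ?O) t + ?J (B - ?O) t" if "t : ?I" for t by (subst U(1), rule set_integral_Un[OF U(2)]) (use 1 2 that in auto)
   have Lq: "?L B = ?L (B Int ?O) + ?L (B - ?O)" by (subst U(1), rule set_integral_Un[OF U(2)]) (use 1 2 in auto)
   have "((%t. ?J (B Int ?O) t + ?J (B - ?O) t) has_real_derivative ?L B) (at 0)" unfolding Lq using 1 2 by (intro DERIV_add) auto
   hence "(?J B has_real_derivative ?L B) (at 0)" by (rule has_field_derivative_transform_within_open[of _ _ _ ?I]) (use zI J in auto)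
   thus "?P B" using i iq by blast
  qed
 qed
 hence "?P \<Omega>" using \<Omega> P(2) by blast
 thus "(?J \<Omega> has_real_derivative ?L \<Omega>) (at 0)" "set_integrable (volume_measure A (g 0)) \<Omega> q" by auto
qed

end

section \<open>Variation of the curvature in coordinates\<close>

text \<open>Formal derivative of \<open>rc\<close> at \<Gamma> in the direction \<Sigma>: the two
  derivative terms are linear in the symbols, and each quadratic term gives two terms by the product
  rule.\<close>

definition drc :: "(real^'n => 'n => 'n => real^'n::finite) => (real^'n => 'n => 'n => real^'n) =>
  real^'n => real^'n => real^'n => real^'n => real^'n" where
 "drc \<Gamma> \<Sigma> x u v w = bl (dbl \<Sigma> x v) u w - bl (dbl \<Sigma> x u) v w + bl (\<Gamma> x) v (bl (\<Sigma> x) u w) + bl (\<Sigma> x) v (bl (\<Gamma> x) u w)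
   - bl (\<Gamma> x) u (bl (\<Sigma> x) v w) - bl (\<Sigma> x) u (bl (\<Gamma> x) v w)"

lemma bl_scale: "bl (%i j. r *\<^sub>R B i j) u v = r *\<^sub>R bl B u v" by (simp add: bl_def scaleR_sum_right mult_ac)

lemma has_vector_derivative_eq: "(f has_vector_derivative a) F ==> a = b ==> (f has_vector_derivative b) F" by simp

lemma bl_has_vector_derivative:
 assumes B: "!!i j. ((%s. B s i j) has_vector_derivative B' i j) (at t)"
  and X: "(X has_vector_derivative X') (at t)" and Z: "(Z has_vector_derivative Z') (at t)" shows "((%s. bl (B s) (X s) (Z s)) has_vector_derivative
  bl B' (X t) (Z t) + bl (B t) X' (Z t) + bl (B t) (X t) Z') (at t)" proof -
 have d: "dbl B t r = (%i j. r *\<^sub>R B' i j)" for r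
  unfolding dbl_def fun_eq_iff by (intro allI dird_eq) (use B in \<open>simp add: has_vector_derivative_def\<close>)
 have "((%s. bl (B s) (X s) (Z s)) has_derivative
  (%r. bl (dbl B t r) (X t) (Z t) + bl (B t) (r *\<^sub>R X') (Z t) + bl (B t) (X t) (r *\<^sub>R Z'))) (at t)"
  by (rule bl_has_derivative) (use B X Z d in \<open>simp_all add: has_vector_derivative_def\<close>)
 thus ?thesis by (simp add: has_vector_derivative_def d bl_scale bl_simps scaleR_add_right)
qed

lemma partial_time_vector_derivative:
 fixes F :: "real \<times> 'a::euclidean_space => 'b::real_normed_vector"
 assumes "smooth_on S F" "(t, x) : S" shows "((%s. F (s, x)) has_vector_derivative dird F (t, x) (1, 0)) (at t)" proof -
 have lin: "linear (dird F (t, x))" by (rule has_derivative_linear[OF smooth_on_has_derivative[OF assms]])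
 have "(%r. dird F (t, x) (r, 0)) = (%r. r *\<^sub>R dird F (t, x) (1, 0))" proof
  fix r
  have "dird F (t, x) (r, 0) = dird F (t, x) (r *\<^sub>R (1, 0))" by simp
  also have "... = r *\<^sub>R dird F (t, x) (1, 0)" by (rule linear_cmul[OF lin])
  finally show "dird F (t, x) (r, 0) = r *\<^sub>R dird F (t, x) (1, 0)" .
 qed
 thus ?thesis unfolding has_vector_derivative_def using partial_dird(2)[OF assms] by simp
qed

lemma smooth_on_slice:
 fixes F :: "real \<times> 'a::euclidean_space => 'b::real_normed_vector"
 assumes "open S" "smooth_on (I \<times> S) F" "t : I" shows "smooth_on S (%x. F (t, x))" proof (rule smooth_on_compose[OF assms(1,2)])
 have "smooth_on S (%x::'a. (t, 0) + (0, x))"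
  by (intro smooth_on_add smooth_on_const smooth_on_linear assms bounded_linear_Pair bounded_linear_zero bounded_linear_ident)
 thus "smooth_on S (%x. (t, x))" by simp
 show "(%x. (t, x)) ` S <= I \<times> S" using assms by auto
qed

lemma smooth_on_snd:
 fixes F :: "'a::euclidean_space => 'b::real_normed_vector"
 assumes "open S" "open I" "smooth_on S F" shows "smooth_on (I \<times> S) (%z::real \<times> 'a. F (snd z))"
 by (rule smooth_on_compose[OF _ assms(3)])
  (auto intro!: open_Times smooth_on_linear assms bounded_linear_snd)

context
 fixes I S and \<Gamma> :: "real \<times> (real^'n) => 'n::finite => 'n => real^'n"
 assumes I: "open I" and S: "open S" and G: "!!i j. smooth_on (I \<times> S) (%z. \<Gamma> z i j)"
begin

lemma dbl_slice:
 assumes "t : I" "x : S" shows "dbl (%y. \<Gamma> (t, y)) x v i j = dird (%z. \<Gamma> z i j) (t, x) (0, v)"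
 unfolding dbl_def by (rule partial_dird_eq[OF G]) (use assms in simp)

lemma smooth_on_rc_family:
 assumes "smooth_on (I \<times> S) u" "smooth_on (I \<times> S) v" "smooth_on (I \<times> S) w"
 shows "smooth_on (I \<times> S) (%z. rc (%y. \<Gamma> (fst z, y)) (snd z) (u z) (v z) (w z))" proof -
 have o: "open (I \<times> S)" by (intro open_Times I S)
 have p: "smooth_on (I \<times> S) (%z. (0::real, h z))" if "smooth_on (I \<times> S) h" for h :: "_ => real^'n"
  by (rule smooth_on_bounded_linear[OF o _ that]) (intro bounded_linear_Pair bounded_linear_zero bounded_linear_ident)
 have "smooth_on (I \<times> S) (%z. bl (%i j. dird (%z. \<Gamma> z i j) z (0, v z)) (u z) (w z) - bl (%i j. dird (%z. \<Gamma> z i j) z (0, u z)) (v z) (w z)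
   + bl (\<Gamma> z) (v z) (bl (\<Gamma> z) (u z) (w z)) - bl (\<Gamma> z) (u z) (bl (\<Gamma> z) (v z) (w z)))"
  by (intro smooth_on_add smooth_on_diff smooth_on_bl smooth_on_dird_field o assms p G)
 moreover have "rc (%y. \<Gamma> (fst z, y)) (snd z) (u z) (v z) (w z) = bl (%i j. dird (%z. \<Gamma> z i j) z (0, v z)) (u z) (w z) - bl (%i j. dird (%z. \<Gamma> z i j) z (0, u z)) (v z) (w z)
   + bl (\<Gamma> z) (v z) (bl (\<Gamma> z) (u z) (w z)) - bl (\<Gamma> z) (u z) (bl (\<Gamma> z) (v z) (w z))" if "z : I \<times> S" for z proof -
  have "dbl (%y. \<Gamma> (fst z, y)) (snd z) a = (%i j. dird (%z. \<Gamma> z i j) z (0, a))" for a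
   unfolding fun_eq_iff using dbl_slice[of "fst z" "snd z" a] that by auto
  thus ?thesis by (simp add: rc_def)
 qed
 ultimately show ?thesis by (subst smooth_on_cong[OF o])
qed

text \<open>The time derivative of a spatial derivative of the symbols is a spatial derivative of
  their time derivative, by symmetry of second derivatives on the product
  \<open>I \<times> S\<close>. Everything else is the product rule.\<close>

lemma rc_has_vector_derivative:
 assumes t: "t : I" and x: "x : S" shows "((%s. rc (%y. \<Gamma> (s, y)) x u v w) has_vector_derivative
  drc (%y. \<Gamma> (t, y)) (%y i j. dird (%z. \<Gamma> z i j) (t, y) (1, 0)) x u v w) (at t)" proof -
 let ?\<Sigma> = "%y i j. dird (%z. \<Gamma> z i j) (t, y) (1, 0)"
 have o: "open (I \<times> S)" by (intro open_Times I S)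
 have tx: "(t, x) : I \<times> S" using t x by simp
 have d0: "((%s. \<Gamma> (s, x) i j) has_vector_derivative ?\<Sigma> x i j) (at t)" for i j by (rule partial_time_vector_derivative[OF G tx])
 have d1: "((%s. dird (%z. \<Gamma> z i j) (s, x) (0, a)) has_vector_derivative dbl ?\<Sigma> x a i j) (at t)" for i j a proof -
  have "((%s. dird (%z. \<Gamma> z i j) (s, x) (0, a)) has_vector_derivative dird (%y. dird (%z. \<Gamma> z i j) y (0, a)) (t, x) (1, 0)) (at t)"
   by (rule partial_time_vector_derivative[OF smooth_on_dird[OF G] tx])
  also have "dird (%y. dird (%z. \<Gamma> z i j) y (0, a)) (t, x) (1, 0) = dird (%y. dird (%z. \<Gamma> z i j) y (1, 0)) (t, x) (0, a)"
   by (rule second_dird_symmetric[OF o G tx])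
  also have "... = dbl ?\<Sigma> x a i j" unfolding dbl_def by (rule partial_dird_eq[OF smooth_on_dird[OF G] tx, symmetric])
  finally show ?thesis .
 qed
 have c: "((%s. a) has_vector_derivative 0) (at t)" for a :: "real^'n" by simp
 have e1: "((%s. bl (%i j. dird (%z. \<Gamma> z i j) (s, x) (0, a)) b w) has_vector_derivative bl (dbl ?\<Sigma> x a) b w) (at t)" for a b
  using bl_has_vector_derivative[OF d1[of _ _ a] c[of b] c[of w]] by (simp add: bl_simps)
 have e2: "((%s. bl (\<Gamma> (s, x)) b w) has_vector_derivative bl (?\<Sigma> x) b w) (at t)" for b
  using bl_has_vector_derivative[OF d0 c[of b] c[of w]] by (simp add: bl_simps)
 have e3: "((%s. bl (\<Gamma> (s, x)) a (bl (\<Gamma> (s, x)) b w)) has_vector_derivative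
   bl (?\<Sigma> x) a (bl (\<Gamma> (t, x)) b w) + bl (\<Gamma> (t, x)) a (bl (?\<Sigma> x) b w)) (at t)" for a b
  using bl_has_vector_derivative[OF d0 c[of a] e2[of b]] by (simp add: bl_simps)
 have "((%s. bl (%i j. dird (%z. \<Gamma> z i j) (s, x) (0, v)) u w - bl (%i j. dird (%z. \<Gamma> z i j) (s, x) (0, u)) v w
   + bl (\<Gamma> (s, x)) v (bl (\<Gamma> (s, x)) u w) - bl (\<Gamma> (s, x)) u (bl (\<Gamma> (s, x)) v w)) has_vector_derivative
  drc (%y. \<Gamma> (t, y)) ?\<Sigma> x u v w) (at t)"
  by (rule has_vector_derivative_eq[OF has_vector_derivative_diff[OF has_vector_derivative_add[OF
     has_vector_derivative_diff[OF e1 e1] e3] e3]])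
   (simp add: drc_def)
 moreover have "bl (%i j. dird (%z. \<Gamma> z i j) (s, x) (0, v)) u w - bl (%i j. dird (%z. \<Gamma> z i j) (s, x) (0, u)) v w
   + bl (\<Gamma> (s, x)) v (bl (\<Gamma> (s, x)) u w) - bl (\<Gamma> (s, x)) u (bl (\<Gamma> (s, x)) v w) = rc (%y. \<Gamma> (s, y)) x u v w" if "s : I" for s
 proof -
  have "dbl (%y. \<Gamma> (s, y)) x a = (%i j. dird (%z. \<Gamma> z i j) (s, x) (0, a))" for a
   unfolding fun_eq_iff using dbl_slice[OF that x] by simp
  thus ?thesis by (simp add: rc_def)
 qed
 ultimately show ?thesis by (rule has_vector_derivative_transform_within_open[OF _ I t])
qed

end


context smooth_mfd
begin

section \<open>The variation of the curvature tensor\<close>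

lemma vrep_tensor:
 assumes "smooth_tensor12 A S" "c : A" "x : chart_image c" shows "vrep c (%q. S q (X q) (Y q)) x = bl (tcomp c S x) (vrep c X x) (vrep c Y x)"
 unfolding vrep_def using tensor_chart[OF assms(1,2) inv_in_dom[OF assms(2,3)]] assms by simp

definition DRm :: "('m, 'n) metric => ('m, 'n) tensor12 => ('m, 'n) tensor12 => 'm => real^'n => real^'n => real^'n => real^'n" where
 "DRm g T S p u v w = (let c = chart_at A p in
   ci c p (drc (ccomp g T c) (tcomp c S) (snd c p) (cc c p u) (cc c p v) (cc c p w)))"

text \<open>The left side is the product rule applied to the terms of the curvature when the
  connection N moves in the direction S. Derivatives of the three fields cancel, which leaves a
  tensor given by the coordinate formula \<open>drc\<close>.\<close>

lemma DR_chart: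
 assumes g: "pseudo_riemannian_metric A g" and T: "smooth_tensor12 A T" and S: "smooth_tensor12 A S" and c: "c : A" "p : fst c"
  and X: "svf UNIV X" and Y: "svf UNIV Y" and Z: "svf UNIV Z"
 defines "N \<equiv> contorted_connection A g T"
 shows "cc c p (N Y (%q. S q (X q) (Z q)) p + S p (Y p) (N X Z p) - N X (%q. S q (Y q) (Z q)) p - S p (X p) (N Y Z p)
   + S p (lie_bracket A X Y p) (Z p)) =
  drc (ccomp g T c) (tcomp c S) (snd c p) (cc c p (X p)) (cc c p (Y p)) (cc c p (Z p))" proof -
 let ?x = "snd c p" let ?O = "chart_image c" let ?G = "ccomp g T c" let ?S = "tcomp c S"
 have x: "?x : ?O" using c by simp
 have O: "open ?O" by (rule open_chart_image[OF c(1)])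
 note sm = vrep_smooth[OF _ c(1)]
 have der: "dird (vrep c (%q. S q (V q) (W q))) ?x a =
   bl (dbl ?S ?x a) (cc c p (V p)) (cc c p (W p)) + bl (?S ?x) (dird (vrep c V) ?x a) (cc c p (W p))
   + bl (?S ?x) (cc c p (V p)) (dird (vrep c W) ?x a)" if V: "svf UNIV V" and W: "svf UNIV W" for V W a proof -
  have "((%y. bl (?S y) (vrep c V y) (vrep c W y)) has_derivative
    (%a. bl (dbl ?S ?x a) (vrep c V ?x) (vrep c W ?x) + bl (?S ?x) (dird (vrep c V) ?x a) (vrep c W ?x)
   + bl (?S ?x) (vrep c V ?x) (dird (vrep c W) ?x a))) (at ?x)" by (intro bl_has_derivative dbl_has_derivative[OF tcomp_smooth[OF S c(1)] x]
     smooth_on_has_derivative[OF sm[OF V] x] smooth_on_has_derivative[OF sm[OF W] x])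
  hence "((vrep c (%q. S q (V q) (W q))) has_derivative
    (%a. bl (dbl ?S ?x a) (vrep c V ?x) (vrep c W ?x) + bl (?S ?x) (dird (vrep c V) ?x a) (vrep c W ?x)
   + bl (?S ?x) (vrep c V ?x) (dird (vrep c W) ?x a))) (at ?x)"
   by (rule has_derivative_transform_within_open[OF _ O x]) (simp add: vrep_tensor[OF S c(1)])
  thus ?thesis by (simp add: dird_eq vrep_snd[OF c])
 qed
 have N: "cc c p (N V W p) = dird (vrep c W) ?x (cc c p (V p)) + bl (?G ?x) (cc c p (V p)) (cc c p (W p))"
  if "svf UNIV V" "svf UNIV W" for V W unfolding N_def contorted_chart[OF g T c that] nb_def vrep_snd[OF c] ..
 show ?thesis by (simp only: cc_simps[OF c] N[OF Y svf_tensor[OF S X Z]] N[OF X svf_tensor[OF S Y Z]] tensor_chart[OF S c] N[OF X Z] N[OF Y Z]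
    lie_bracket_eq[OF X Y] lb_chart[OF c X Y] br_def der[OF X Z] der[OF Y Z] vrep_snd[OF c])
   (simp add: drc_def bl_simps)
qed

lemma DRm_field:
 assumes g: "pseudo_riemannian_metric A g" and T: "smooth_tensor12 A T" and S: "smooth_tensor12 A S"
  and X: "svf UNIV X" and Y: "svf UNIV Y" and Z: "svf UNIV Z"
 defines "N \<equiv> contorted_connection A g T" shows "DRm g T S p (X p) (Y p) (Z p) =
  N Y (%q. S q (X q) (Z q)) p + S p (Y p) (N X Z p) - N X (%q. S q (Y q) (Z q)) p - S p (X p) (N Y Z p)
   + S p (lie_bracket A X Y p) (Z p)" unfolding DRm_def Let_def N_def
  DR_chart[OF g T S chart_at_in in_chart_at X Y Z, symmetric] by simp

lemma DRm_chart:
 assumes g: "pseudo_riemannian_metric A g" and T: "smooth_tensor12 A T" and S: "smooth_tensor12 A S" and c: "c : A" "p : fst c"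
 shows "cc c p (DRm g T S p u v w) = drc (ccomp g T c) (tcomp c S) (snd c p) (cc c p u) (cc c p v) (cc c p w)" proof -
 obtain X where X: "svf UNIV X" "X p = u" by (rule field_through)
 obtain Y where Y: "svf UNIV Y" "Y p = v" by (rule field_through)
 obtain Z where Z: "svf UNIV Z" "Z p = w" by (rule field_through)
 show ?thesis using DRm_field[OF g T S X(1) Y(1) Z(1), of p] DR_chart[OF g T S c X(1) Y(1) Z(1)] X(2) Y(2) Z(2) by simp
qed

lemma drc_linear:
 assumes G: "!!i j. smooth_on S (%x. \<Sigma> x i j)" "x : S"
 shows "linear (%u. drc \<Gamma> \<Sigma> x u v w)" "linear (%v. drc \<Gamma> \<Sigma> x u v w)" "linear (%w. drc \<Gamma> \<Sigma> x u v w)"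
 by (intro linearI; simp add: drc_def bl_simps dbl_linear[OF G] scaleR_diff_right scaleR_add_right)+

end

section \<open>The first variation of the action\<close>

context multi_product
begin

text \<open>Coordinate counterpart of \<open>fctr\<close>; the two agree for every adapted frame by
  \<open>ctr_fctr\<close>.\<close>

definition ctr :: "('m, 'n) metric => ('m, 'n) chart => real^'n => (real^'n => real^'n => real^'n => real^'n) => real" where
 "ctr g c x Q = 1/2 * (SUM \<mu>:{1..k}. SUM \<nu>:{1..k}-{\<mu>}. SUM a:UNIV. SUM b:UNIV. SUM m:UNIV.
   Hm g c \<nu> x $ a $ b * Q (axis a 1) (column m (Pm c \<mu> x)) (axis b 1) $ m)"

lemma ctr_fctr:
 assumes g: "adapted_metric A k D g" and e: "aonb g p e" and c: "c : A" "p : fst c"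
  and lin: "!!u w. linear (%v. Q u v w)" "!!v w. linear (%u. Q u v w)" "!!u v. linear (%w. Q u v w)"
 shows "ctr g c (snd c p) Q = fctr g p e (%u v w. ci c p (Q (cc c p u) (cc c p v) (cc c p w)))" unfolding ctr_def fctr_def
 by (intro arg_cong[of _ _ "(*) (1/2)"] sum.cong refl SC_frame[OF g e _ _ c lin]) auto

text \<open>Places the volume density beside \<open>Hm\<close>, the other factor that moves with the
  metric, so that both are differentiated as one.\<close>

lemma ctr_mult: "ctr g c x Q * r = 1/2 * (SUM \<mu>:{1..k}. SUM \<nu>:{1..k}-{\<mu>}. SUM a:UNIV. SUM b:UNIV. SUM m:UNIV.
   Hm g c \<nu> x $ a $ b * r * Q (axis a 1) (column m (Pm c \<mu> x)) (axis b 1) $ m)"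
 unfolding ctr_def mult.assoc sum_distrib_right by (simp only: mult.commute)

lemma mixed_scalar_ctr:
 assumes g: "adapted_metric A k D g" and T: "smooth_tensor12 A T" and c: "c : A" "p : fst c"
 shows "mixed_scalar_curvature A k D g T p = ctr g c (snd c p) (rc (ccomp g T c) (snd c p))" proof -
 note pg = adapted_metric_pr[OF g]
 have x: "snd c p : chart_image c" using c by simp
 have "ctr g c (snd c p) (rc (ccomp g T c) (snd c p)) =
   fctr g p (oe g p) (%u v w. ci c p (rc (ccomp g T c) (snd c p) (cc c p u) (cc c p v) (cc c p w)))"
  by (rule ctr_fctr[OF g oe_aonb[OF g] c rc_linear(2,1,3)[OF ccomp_smooth[OF pg T c(1)] x]])
 thus ?thesis unfolding mixed_scalar_fctr[OF g T] by (simp only: Rm_chart[OF pg T c, symmetric] ci_cc[OF c])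
qed

text \<open>The integrand of the first variation when the connection moves in the direction S and
  neither frame nor volume contributes.\<close>

definition fv :: "('m, 'n) metric => ('m, 'n) tensor12 => ('m, 'n) tensor12 => 'm => real" where
 "fv g T S p = fctr g p (oe g p) (DRm g T S p)"

lemma ctr_drc:
 assumes g: "adapted_metric A k D g" and T: "smooth_tensor12 A T" and S: "smooth_tensor12 A S" and e: "aonb g p e" and c: "c : A" "p : fst c"
 shows "ctr g c (snd c p) (drc (ccomp g T c) (tcomp c S) (snd c p)) = fctr g p e (DRm g T S p)" proof -
 have x: "snd c p : chart_image c" using c by simp
 have "ctr g c (snd c p) (drc (ccomp g T c) (tcomp c S) (snd c p)) =
   fctr g p e (%u v w. ci c p (drc (ccomp g T c) (tcomp c S) (snd c p) (cc c p u) (cc c p v) (cc c p w)))"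
  by (rule ctr_fctr[OF g e c drc_linear(2,1,3)[OF tcomp_smooth[OF S c(1)] x]])
 thus ?thesis by (simp add: DRm_chart[OF adapted_metric_pr[OF g] T S c, symmetric] c)
qed

lemma fv_frame:
 assumes g: "adapted_metric A k D g" and T: "smooth_tensor12 A T" and S: "smooth_tensor12 A S" and e: "aonb g p e"
 shows "fv g T S p = fctr g p e (DRm g T S p)" unfolding fv_def
 using ctr_drc[OF g T S oe_aonb[OF g] chart_at_in in_chart_at] ctr_drc[OF g T S e chart_at_in in_chart_at] by simp

end

text \<open>Metric and contorsion may vary at once; a variation of only one of them is the case in
  which the other family is constant.\<close>

locale adapted_family = multi_product A k n D
 for A :: "('m::{t2_space, second_countable_topology}, 'n::finite) chart set" and k n D +
 fixes \<epsilon> :: real and gt :: "real => ('m, 'n) metric" and Tt :: "real => ('m, 'n) tensor12"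
 assumes eps: "0 < \<epsilon>" and fam_metric: "!!t. t : {-\<epsilon><..<\<epsilon>} ==> adapted_metric A k D (gt t)"
  and fam_tensor: "!!t. t : {-\<epsilon><..<\<epsilon>} ==> smooth_tensor12 A (Tt t)"
  and gram_joint: "!!c i j. c : A ==> smooth_on ({-\<epsilon><..<\<epsilon>} \<times> chart_image c) (%z. gram (gt (fst z)) c (snd z) $ i $ j)"
  and tcomp_joint: "!!c i j. c : A ==> smooth_on ({-\<epsilon><..<\<epsilon>} \<times> chart_image c) (%z. tcomp c (Tt (fst z)) (snd z) i j)"
begin

abbreviation J :: "real set" where "J \<equiv> {-\<epsilon><..<\<epsilon>}"

lemma zero_J [simp]: "0 : J" using eps by simp

lemma open_J: "open J" by simp

lemma fam_pr: "t : J ==> pseudo_riemannian_metric A (gt t)" by (rule adapted_metric_pr[OF fam_metric])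

definition \<Gamma>f :: "('m, 'n) chart => real \<times> (real^'n) => 'n => 'n => real^'n" where
 "\<Gamma>f c z = ccomp (gt (fst z)) (Tt (fst z)) c (snd z)"

lemma \<Gamma>f_slice: "(%y. \<Gamma>f c (t, y)) = ccomp (gt t) (Tt t) c" by (simp add: \<Gamma>f_def)

lemma open_Jc: "c : A ==> open (J \<times> chart_image c)" by (intro open_Times open_J open_chart_image)

lemma det_joint: "c : A ==> z : J \<times> chart_image c ==> det (gram (gt (fst z)) c (snd z)) ~= 0" by (cases z) (simp add: det_gram_nz[OF fam_pr])

text \<open>The spatial derivatives of the Gram matrix at a fixed time are derivatives of a joint
  function in directions (0, v), so the symbols inherit joint smoothness.\<close>

lemma christ_joint:
 assumes c: "c : A" shows "smooth_on (J \<times> chart_image c) (%z. christ (gram (gt (fst z)) c) (snd z) i j)" proof -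
 let ?O = "J \<times> chart_image c"
 note o = open_Jc[OF c]
 define Dg where "Dg = (%(z::real \<times> (real^'n)) a b l. dird (%z. gram (gt (fst z)) c (snd z) $ a $ b) z (0, axis l 1))"
 have D: "dird (%y. gram (gt (fst z)) c y $ a $ b) (snd z) (axis l 1) = Dg z a b l" if "z : ?O" for z a b l
  unfolding Dg_def using partial_dird_eq[OF gram_joint[OF c], of "fst z" "snd z" a b "axis l 1"] that by simp
 have sD: "smooth_on ?O (%z. Dg z a b l)" for a b l unfolding Dg_def by (rule smooth_on_dird[OF gram_joint[OF c]])
 have "smooth_on ?O (%z. matrix_inv (gram (gt (fst z)) c (snd z)) *v (\<chi> l. (1/2) * (Dg z j l i + Dg z i l j - Dg z i j l)))"
 proof (rule smooth_on_vec_lambda[OF o])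
  show "smooth_on ?O (%z. (matrix_inv (gram (gt (fst z)) c (snd z)) *v (\<chi> l. (1/2) * (Dg z j l i + Dg z i l j - Dg z i j l))) $ m)" for m
   unfolding matrix_vector_mult_def by (simp, intro smooth_on_sum smooth_on_mult smooth_on_matrix_inv smooth_on_const smooth_on_add smooth_on_diff
    smooth_on_divide sD o gram_joint[OF c] det_joint[OF c]) simp_all
 qed
 moreover have "christ (gram (gt (fst z)) c) (snd z) i j = matrix_inv (gram (gt (fst z)) c (snd z)) *v (\<chi> l. (1/2) * (Dg z j l i + Dg z i l j - Dg z i j l))" if "z : ?O" for z
  unfolding christ_def D[OF that] ..
 ultimately show ?thesis by (subst smooth_on_cong[OF o])
qed

lemma \<Gamma>f_smooth: "c : A ==> smooth_on (J \<times> chart_image c) (%z. \<Gamma>f c z i j)"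
 unfolding \<Gamma>f_def ccomp_def by (intro smooth_on_add christ_joint tcomp_joint open_Jc)

lemma vol_joint: "c : A ==> smooth_on (J \<times> chart_image c) (%z. vol_density (gt (fst z)) c (snd z))"
 unfolding vol_density_def by (intro smooth_on_sqrt_abs smooth_on_det open_Jc gram_joint det_joint)

text \<open>The metric at time 0 is enough to prove this, since the projections are the same for all
  metrics of the family.\<close>

lemma Pm_joint: "c : A ==> \<mu> : {1..k} ==> smooth_on (J \<times> chart_image c) (%z. Pm c \<mu> (snd z) $ a $ b)"
 by (rule smooth_on_snd[OF open_chart_image open_J smooth_Pm[OF fam_metric[OF zero_J]]])

lemma Hm_joint: "c : A ==> \<nu> : {1..k} ==> smooth_on (J \<times> chart_image c) (%z. Hm (gt (fst z)) c \<nu> (snd z) $ a $ b)"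
 unfolding Hm_def matrix_matrix_mult_def transpose_def
 by (simp only: vec_lambda_beta, intro smooth_on_sum smooth_on_mult smooth_on_matrix_inv open_Jc gram_joint det_joint Pm_joint)

definition FF :: "('m, 'n) chart => real \<times> (real^'n) => real" where
 "FF c z = ctr (gt (fst z)) c (snd z) (rc (ccomp (gt (fst z)) (Tt (fst z)) c) (snd z)) * vol_density (gt (fst z)) c (snd z)"

lemma ctr_joint:
 assumes c: "c : A" shows "smooth_on (J \<times> chart_image c) (%z. ctr (gt (fst z)) c (snd z) (rc (ccomp (gt (fst z)) (Tt (fst z)) c) (snd z)))"
proof -
 note o = open_Jc[OF c]
 have col: "smooth_on (J \<times> chart_image c) (%z. column m (Pm c \<mu> (snd z)))" if "\<mu> : {1..k}" for m \<mu>
  unfolding column_def by (intro smooth_on_vec o Pm_joint c that)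
 have r: "smooth_on (J \<times> chart_image c) (%z. rc (ccomp (gt (fst z)) (Tt (fst z)) c) (snd z) (axis a 1) (column m (Pm c \<mu> (snd z))) (axis b 1))"
  if "\<mu> : {1..k}" for a b m \<mu> unfolding \<Gamma>f_slice[symmetric]
  by (rule smooth_on_rc_family[OF open_J open_chart_image[OF c] \<Gamma>f_smooth[OF c] smooth_on_const col[OF that] smooth_on_const])
 show ?thesis unfolding ctr_def by (intro smooth_on_mult smooth_on_sum smooth_on_const o smooth_on_vec_nth r Hm_joint c) auto
qed

lemma FF_smooth: "c : A ==> smooth_on (J \<times> chart_image c) (FF c)" unfolding FF_def by (intro smooth_on_mult ctr_joint vol_joint open_Jc)

lemma sfun_mixed_scalar:
 assumes t: "t : J" shows "sfun UNIV (mixed_scalar_curvature A k D (gt t) (Tt t))" proof (rule sfun_UNIV_I)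
 show "smooth_on (chart_image c) (%x. ctr (gt t) c x (rc (ccomp (gt t) (Tt t) c) x))" if "c : A" for c
  using smooth_on_slice[OF open_chart_image[OF that] ctr_joint[OF that] t] by simp
 show "mixed_scalar_curvature A k D (gt t) (Tt t) p = ctr (gt t) c (snd c p) (rc (ccomp (gt t) (Tt t) c) (snd c p))"
  if "c : A" "p : fst c" for c p by (rule mixed_scalar_ctr[OF fam_metric[OF t] fam_tensor[OF t] that])
qed


lemma \<Gamma>f_time:
 assumes c: "c : A" and x: "x : chart_image c"
 shows "((%t. \<Gamma>f c (t, x) i j) has_vector_derivative dird (%z. \<Gamma>f c z i j) (0, x) (1, 0)) (at 0)"
 by (rule partial_time_vector_derivative[OF \<Gamma>f_smooth[OF c]]) (use x zero_J in simp)

text \<open>Christoffel symbols are not a tensor, but for fixed fields the connections of the family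
  take values in one tangent space, so the time derivative makes sense without a chart. It depends
  only on the values of the fields, because the term with the derivative of Y is constant in
  time.\<close>

lemma fam_derivative_tensor_exists:
 "EX S. smooth_tensor12 A S \<and>
  (ALL c:A. ALL x:chart_image c. ALL i j. tcomp c S x i j = dird (%z. \<Gamma>f c z i j) (0, x) (1, 0))" proof -
 define B where "B = (%c x i j. dird (%z. \<Gamma>f c z i j) (0, x) (1, 0))"
 have der: "((%t. contorted_connection A (gt t) (Tt t) X Y p) has_vector_derivative ci c p (bl (B c (snd c p)) (cc c p (X p)) (cc c p (Y p)))) (at 0)"
  if c: "c : A" "p : fst c" and X: "svf UNIV X" and Y: "svf UNIV Y" for c p X Y proof -
  have x: "snd c p : chart_image c" using c by simp
  have con: "((%s. a) has_vector_derivative 0) (at 0)" for a :: "real^'n" by simp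
  have "((%t. dird (vrep c Y) (snd c p) (cc c p (X p)) + bl (\<Gamma>f c (t, snd c p)) (cc c p (X p)) (cc c p (Y p)))
    has_vector_derivative bl (B c (snd c p)) (cc c p (X p)) (cc c p (Y p))) (at 0)"
   using has_vector_derivative_add[OF con bl_has_vector_derivative[OF \<Gamma>f_time[OF c(1) x] con[of "cc c p (X p)"] con[of "cc c p (Y p)"]],
     of "dird (vrep c Y) (snd c p) (cc c p (X p))"] by (simp add: B_def bl_simps)
  hence "((%t. ci c p (dird (vrep c Y) (snd c p) (cc c p (X p)) + bl (\<Gamma>f c (t, snd c p)) (cc c p (X p)) (cc c p (Y p))))
    has_vector_derivative ci c p (bl (B c (snd c p)) (cc c p (X p)) (cc c p (Y p)))) (at 0)"
   by (rule bounded_linear.has_vector_derivative[OF linear_conv_bounded_linear[THEN iffD1, OF linear_ci[OF c]]])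
  thus ?thesis proof (rule has_vector_derivative_transform_within_open[OF _ open_J zero_J])
   fix t assume t: "t : J"
   have "cc c p (contorted_connection A (gt t) (Tt t) X Y p) =
     dird (vrep c Y) (snd c p) (cc c p (X p)) + bl (\<Gamma>f c (t, snd c p)) (cc c p (X p)) (cc c p (Y p))"
    unfolding contorted_chart[OF fam_pr[OF t] fam_tensor[OF t] c X Y] nb_def vrep_snd[OF c] \<Gamma>f_def by simp
   thus "ci c p (dird (vrep c Y) (snd c p) (cc c p (X p)) + bl (\<Gamma>f c (t, snd c p)) (cc c p (X p)) (cc c p (Y p))) =
     contorted_connection A (gt t) (Tt t) X Y p" using ci_cc[OF c] by metis
  qed
 qed
 define S where "S = (%p u v. let c = chart_at A p in ci c p (bl (B c (snd c p)) (cc c p u) (cc c p v)))"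
 have S: "cc c p (S p u v) = bl (B c (snd c p)) (cc c p u) (cc c p v)" if c: "c : A" "p : fst c" for c p u v proof -
  obtain X where X: "svf UNIV X" "X p = u" by (rule field_through)
  obtain Y where Y: "svf UNIV Y" "Y p = v" by (rule field_through)
  have "S p u v = ci c p (bl (B c (snd c p)) (cc c p u) (cc c p v))"
   using vector_derivative_unique_at[OF der[OF chart_at_in in_chart_at X(1) Y(1), of p] der[OF c X(1) Y(1)]] unfolding S_def Let_def X(2) Y(2) .
  thus ?thesis using c by simp
 qed
 have t: "tcomp c S x i j = B c x i j" if c: "c : A" and x: "x : chart_image c" for c x i j
  unfolding tcomp_def tensor12_comp_def coord_vec_eq S[OF c inv_in_dom[OF c x]] using c x by simp
 have "smooth_tensor12 A S" unfolding smooth_tensor12_def proof (intro conjI allI ballI)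
  show "bilinear (S p)" for p unfolding bilinear_def S_def Let_def
   by (intro allI conjI; rule linearI; simp only: cc_simps[OF chart_at_in in_chart_at] bl_simps ci_simps[OF chart_at_in in_chart_at])
  show "smooth_on (chart_image c) (tensor12_comp A c S i j \<circ> chart_inv c)" if c: "c : A" for c i j proof -
   have "smooth_on (chart_image c) (%x. B c x i j)" unfolding B_def
    by (rule smooth_on_slice[OF open_chart_image[OF c] smooth_on_dird[OF \<Gamma>f_smooth[OF c]] zero_J])
   moreover have "(tensor12_comp A c S i j \<circ> chart_inv c) x = B c x i j" if "x : chart_image c" for x
    using t[OF c that, of i j] by (simp add: tcomp_def)
   ultimately show ?thesis by (subst smooth_on_cong[OF open_chart_image[OF c]])
  qed
 qed
 thus ?thesis using t unfolding B_def by (intro exI[of _ S] conjI ballI allI)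
qed

text \<open>The last hypothesis says that the variation of the frame and of the volume does not contribute. It
 holds for a constant metric, and also when the initial curvature preserves all the distributions.\<close>

context
 fixes S
 assumes S: "smooth_tensor12 A S"
  and S_comp: "!!c x i j. c : A ==> x : chart_image c ==> tcomp c S x i j = dird (%z. \<Gamma>f c z i j) (0, x) (1, 0)"
  and conserved: "!!c x t. c : A ==> x : chart_image c ==> t : J ==>
   ctr (gt t) c x (rc (ccomp (gt 0) (Tt 0) c) x) * vol_density (gt t) c x =
   ctr (gt 0) c x (rc (ccomp (gt 0) (Tt 0) c) x) * vol_density (gt 0) c x"
begin

lemma FF_time:
 assumes c: "c : A" and x: "x : chart_image c"
 shows "dird (FF c) (0, x) (1, 0) = ctr (gt 0) c x (drc (ccomp (gt 0) (Tt 0) c) (tcomp c S) x) * vol_density (gt 0) c x" proof -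
 let ?r = "%t. rc (ccomp (gt t) (Tt t) c) x"
 let ?dr = "drc (ccomp (gt 0) (Tt 0) c) (tcomp c S) x"
 have zx: "(0, x) : J \<times> chart_image c" using x zero_J by simp
 have drc_eq: "drc (%y. \<Gamma>f c (0, y)) (%y i j. dird (%z. \<Gamma>f c z i j) (0, y) (1, 0)) x = ?dr" proof -
  have "dbl (%y i j. dird (%z. \<Gamma>f c z i j) (0, y) (1, 0)) x v i j = dbl (tcomp c S) x v i j" for v i j unfolding dbl_def
  proof (rule dird_eq[OF has_derivative_transform_within_open[OF _ open_chart_image[OF c] x]])
   show "((%y. tcomp c S y i j) has_derivative dird (%y. tcomp c S y i j) x) (at x)" by (rule smooth_on_has_derivative[OF tcomp_smooth[OF S c] x])
  qed (simp add: S_comp[OF c])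
  hence "dbl (%y i j. dird (%z. \<Gamma>f c z i j) (0, y) (1, 0)) x = dbl (tcomp c S) x" by (simp add: fun_eq_iff)
  moreover have "(%i j. dird (%z. \<Gamma>f c z i j) (0, x) (1, 0)) = tcomp c S x" by (simp add: fun_eq_iff S_comp[OF c x])
  ultimately show ?thesis unfolding drc_def \<Gamma>f_slice by (simp only:)
 qed
 have r: "((%t. ?r t u v w $ m) has_real_derivative ?dr u v w $ m) (at 0)" for u v w m proof -
  have "((%t. rc (%y. \<Gamma>f c (t, y)) x u v w) has_vector_derivative ?dr u v w) (at 0)"
   using rc_has_vector_derivative[where \<Gamma> = "\<Gamma>f c", OF open_J open_chart_image[OF c] \<Gamma>f_smooth[OF c] zero_J x] unfolding drc_eq .
  hence "((%t. ?r t u v w) has_vector_derivative ?dr u v w) (at 0)" unfolding \<Gamma>f_slice .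
  from bounded_linear.has_vector_derivative[OF bounded_linear_vec_nth[of m] this] show ?thesis
   by (simp add: has_real_derivative_iff_has_vector_derivative)
 qed
 have h: "EX h'. ((%t. Hm (gt t) c \<nu> x $ a $ b * vol_density (gt t) c x) has_real_derivative h') (at 0)" if "\<nu> : {1..k}" for a b \<nu>
  using partial_time_derivative[OF smooth_on_mult[OF open_Jc[OF c] Hm_joint[OF c that] vol_joint[OF c]] zx] by auto
 have summand: "((%t. (Hm (gt t) c \<nu> x $ a $ b * vol_density (gt t) c x) * (?r t u v w $ m - ?r 0 u v w $ m)) has_real_derivative
   (Hm (gt 0) c \<nu> x $ a $ b * vol_density (gt 0) c x) * ?dr u v w $ m) (at 0)" if nu: "\<nu> : {1..k}" for a b m u v w \<nu> proof -
  obtain h' where h': "((%t. Hm (gt t) c \<nu> x $ a $ b * vol_density (gt t) c x) has_real_derivative h') (at 0)"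
   using h[OF nu, of a b] by (elim exE)
  from DERIV_mult[OF h' DERIV_diff[OF r[of u v w m] DERIV_const[of "?r 0 u v w $ m"]]] show ?thesis by (simp add: mult_ac)
 qed
 \<comment> \<open>The curvature at time 0 is subtracted. The derivative of the factor made of
   \<open>Hm\<close> and the density then meets a difference that vanishes at t = 0, so its value is
   irrelevant; the subtracted part is constant by \<open>conserved\<close>.\<close>
 define \<Phi> where "\<Phi> = (%t. 1/2 * (SUM \<mu>:{1..k}. SUM \<nu>:{1..k}-{\<mu>}. SUM a:UNIV. SUM b:UNIV. SUM m:UNIV.
   (Hm (gt t) c \<nu> x $ a $ b * vol_density (gt t) c x) * (?r t (axis a 1) (column m (Pm c \<mu> x)) (axis b 1) $ m - ?r 0 (axis a 1) (column m (Pm c \<mu> x)) (axis b 1) $ m)))"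
 define \<Phi>' where "\<Phi>' = 1/2 * (SUM \<mu>:{1..k}. SUM \<nu>:{1..k}-{\<mu>}. SUM a:UNIV. SUM b:UNIV. SUM m:UNIV.
   (Hm (gt 0) c \<nu> x $ a $ b * vol_density (gt 0) c x) * ?dr (axis a 1) (column m (Pm c \<mu> x)) (axis b 1) $ m)"
 have \<Phi>: "(\<Phi> has_real_derivative \<Phi>') (at 0)" unfolding \<Phi>_def \<Phi>'_def by (intro DERIV_cmult DERIV_sum summand) auto
 have \<Phi>_eq: "\<Phi> t = ctr (gt t) c x (?r t) * vol_density (gt t) c x - ctr (gt t) c x (?r 0) * vol_density (gt t) c x" for t
  unfolding ctr_mult \<Phi>_def by (simp only: right_diff_distrib sum_subtractf)
 have \<Phi>'_eq: "\<Phi>' = ctr (gt 0) c x ?dr * vol_density (gt 0) c x" unfolding \<Phi>'_def ctr_mult ..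
 have "((%t. \<Phi> t + ctr (gt 0) c x (?r 0) * vol_density (gt 0) c x) has_real_derivative \<Phi>') (at 0)"
  using DERIV_add[OF \<Phi> DERIV_const] by simp
 hence "((%t. FF c (t, x)) has_real_derivative \<Phi>') (at 0)" proof (rule has_field_derivative_transform_within_open[OF _ open_J zero_J])
  fix t assume "t : J"
  thus "\<Phi> t + ctr (gt 0) c x (?r 0) * vol_density (gt 0) c x = FF c (t, x)"
   unfolding \<Phi>_eq FF_def fst_conv snd_conv by (subst conserved[OF c x]) (assumption, simp)
 qed
 moreover have "((%t. FF c (t, x)) has_real_derivative dird (FF c) (0, x) (1, 0)) (at 0)" by (rule partial_time_derivative[OF FF_smooth[OF c] zx])
 ultimately show ?thesis unfolding \<Phi>'_eq by (rule DERIV_unique[THEN sym])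
qed

lemma fv_chart:
 assumes "c : A" "p : fst c" shows "fv (gt 0) (Tt 0) S p = dird (FF c) (0, snd c p) (1, 0) / vol_density (gt 0) c (snd c p)"
 using FF_time[OF assms(1), of "snd c p"] assms vol_density_pos[OF fam_pr[OF zero_J] assms(1), of "snd c p"]
 unfolding fv_def ctr_drc[OF fam_metric[OF zero_J] fam_tensor[OF zero_J] S oe_aonb[OF fam_metric[OF zero_J]] assms, symmetric] by simp

lemma sfun_fv: "sfun UNIV (fv (gt 0) (Tt 0) S)" proof (rule sfun_UNIV_I[of "%c x. dird (FF c) (0, x) (1, 0) / vol_density (gt 0) c x"])
 show "fv (gt 0) (Tt 0) S p = dird (FF c) (0, snd c p) (1, 0) / vol_density (gt 0) c (snd c p)" if "c : A" "p : fst c" for c p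
  by (rule fv_chart[OF that])
 show "smooth_on (chart_image c) (%x. dird (FF c) (0, x) (1, 0) / vol_density (gt 0) c x)" if c: "c : A" for c
  by (intro smooth_on_divide open_chart_image c vol_density_smooth fam_pr zero_J
    smooth_on_slice[OF open_chart_image[OF c] smooth_on_dird[OF FF_smooth[OF c]] zero_J])
   (use vol_density_pos[OF fam_pr[OF zero_J] c] in \<open>force\<close>)
qed

theorem first_variation:
 assumes \<Omega>: "\<Omega> : sets borel" "\<Omega> <= K" "compact K" shows "((%t. action A k D \<Omega> (gt t) (Tt t)) has_real_derivative
   set_lebesgue_integral (volume_measure A (gt 0)) \<Omega> (fv (gt 0) (Tt 0) S)) (at 0)"
  and "set_integrable (volume_measure A (gt 0)) \<Omega> (fv (gt 0) (Tt 0) S)" proof -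
 have meas: "f : borel_measurable borel" if "sfun UNIV f" for f using continuous_on_sfun[OF open_UNIV that] by (rule borel_measurable_continuous_onI)
 have 1: "FF c (t, x) = mixed_scalar_curvature A k D (gt t) (Tt t) (chart_inv c x) * vol_density (gt t) c x"
  if "c : A" "t : J" "x : chart_image c" for c t x
  unfolding mixed_scalar_ctr[OF fam_metric[OF that(2)] fam_tensor[OF that(2)] that(1) inv_in_dom[OF that(1,3)]] using that by (simp add: FF_def)
 have 2: "dird (FF c) (0, x) (1, 0) = fv (gt 0) (Tt 0) S (chart_inv c x) * vol_density (gt 0) c x"
  if "c : A" "x : chart_image c" for c x using fv_chart[OF that(1) inv_in_dom[OF that]] vol_density_pos[OF fam_pr[OF zero_J] that] that by simp
 note v = volume_integral_derivative[of \<epsilon> gt "%t. mixed_scalar_curvature A k D (gt t) (Tt t)" "fv (gt 0) (Tt 0) S" FF,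
   OF eps fam_pr meas[OF sfun_mixed_scalar] meas[OF sfun_fv] FF_smooth 1 2 \<Omega>]
 show "((%t. action A k D \<Omega> (gt t) (Tt t)) has_real_derivative
   set_lebesgue_integral (volume_measure A (gt 0)) \<Omega> (fv (gt 0) (Tt 0) S)) (at 0)" unfolding action_def by (rule v(1))
 show "set_integrable (volume_measure A (gt 0)) \<Omega> (fv (gt 0) (Tt 0) S)" by (rule v(2))
qed

end

end

section \<open>The divergence theorem\<close>

text \<open>Jacobi's formula at the identity. A permutation other than the identity moves at least
  two indices, so after one factor has been differentiated an off-diagonal zero is still
  left.\<close>

lemma det_has_derivative_at_one:
 fixes M :: "'a::real_normed_vector => real^'n^'n"
 assumes M: "!!i j. ((%y. M y $ i $ j) has_derivative M' i j) (at x)" and one: "M x = mat 1"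
 shows "((%y. det (M y)) has_derivative (%v. SUM i:UNIV. M' i i v)) (at x)" proof -
 have e: "M x $ i $ j = (if i = j then 1 else 0)" for i j by (simp add: one mat_def)
 have z: "(PROD j:UNIV-{i}. M x $ j $ p j) = (if p = id then 1 else 0)" if p: "p permutes UNIV" for p and i :: 'n proof (cases "p = id")
  case False then obtain a where a: "p a ~= a" by (auto simp: fun_eq_iff)
  have "p (p a) ~= p a" using a permutes_inj[OF p] by (metis injD) then obtain j where "j ~= i" "p j ~= j" using a by metis
  hence "EX j:UNIV-{i}. M x $ j $ p j = 0" by (intro bexI[of _ j]) (auto simp: e)
  hence "(PROD j:UNIV-{i}. M x $ j $ p j) = 0" by (intro prod_zero) auto
  thus ?thesis using False by simp
 qed (simp add: e)
 have "((%y. SUM p:{p. p permutes UNIV}. of_int (sign p) * (PROD i:UNIV. M y $ i $ p i)) has_derivative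
   (%v. SUM p:{p. p permutes UNIV}. of_int (sign p) * (SUM i:UNIV. M' i (p i) v * (PROD j:UNIV-{i}. M x $ j $ p j)))) (at x)"
  by (intro has_derivative_sum has_derivative_mult_right has_derivative_prod M)
 moreover have "(SUM p:{p. p permutes UNIV}. of_int (sign p) * (SUM i:UNIV. M' i (p i) v * (PROD j:UNIV-{i}. M x $ j $ p j))) = (SUM i:UNIV. M' i i v)" for v
 proof -
  have "(SUM p:{p. p permutes UNIV}. of_int (sign p) * (SUM i:UNIV. M' i (p i) v * (PROD j:UNIV-{i}. M x $ j $ p j)))
   = (SUM p:{p. p permutes (UNIV::'n set)}. if p = id then (SUM i:UNIV. M' i i v) else 0)" by (rule sum.cong[OF refl]) (simp add: z sign_id)
  also have "... = (SUM i:UNIV. M' i i v)" by (subst sum.delta) (simp_all add: permutes_id)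
  finally show ?thesis .
 qed
 ultimately show ?thesis unfolding det_def by simp
qed

text \<open>Multiplication by the inverse of \<open>G x\<close> moves the base point to the identity
  matrix. Near x the quotient of the determinants is positive, so the modulus does no harm.\<close>

lemma sqrt_abs_det_has_derivative:
 fixes G :: "'a::real_normed_vector => real^'n^'n"
 assumes G: "!!i j. ((%y. G y $ i $ j) has_derivative G' i j) (at x)" and nz: "det (G x) ~= 0"
 shows "((%y. sqrt \<bar>det (G y)\<bar>) has_derivative
  (%v. sqrt \<bar>det (G x)\<bar> * (1/2 * (SUM i:UNIV. SUM l:UNIV. matrix_inv (G x) $ i $ l * G' l i v)))) (at x)" proof -
 let ?H = "matrix_inv (G x)" and ?t = "%v. SUM i:UNIV. SUM l:UNIV. matrix_inv (G x) $ i $ l * G' l i v"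
 have inv: "?H ** G x = mat 1" using nz by (simp add: matrix_inv_right_left invertible_det_nz)
 have "((%y. (?H ** G y) $ i $ j) has_derivative (%v. SUM l:UNIV. ?H $ i $ l * G' l j v)) (at x)" for i j
  unfolding matrix_matrix_mult_def vec_lambda_beta by (intro has_derivative_sum has_derivative_mult_right G)
 hence "((%y. det (?H ** G y)) has_derivative ?t) (at x)" by (rule det_has_derivative_at_one[where M = "%y. ?H ** G y", OF _ inv])
 moreover have "det (?H ** G y) = det (G y) / det (G x)" for y proof -
  have "det ?H * det (G x) = 1" using arg_cong[OF inv, of det] by (simp add: det_mul det_I)
  thus ?thesis using nz by (simp add: det_mul field_simps)
 qed
 ultimately have "((%y. det (G y) / det (G x)) has_derivative ?t) (at x)" by simp
 hence s: "((%y. sqrt (det (G y) / det (G x))) has_derivative (%v. ?t v * (inverse (sqrt (det (G x) / det (G x))) / 2))) (at x)"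
  by (rule has_derivative_real_sqrt[rotated]) (use nz in simp)
 from has_derivative_continuous[OF \<open>((%y. det (G y) / det (G x)) has_derivative ?t) (at x)\<close>]
 have "(%y. det (G y) / det (G x)) \<midarrow>x\<rightarrow> 1" using nz by (simp add: continuous_at)
 hence "\<forall>\<^sub>F y in at x. 0 < det (G y) / det (G x)" by (rule order_tendstoD) simp
 hence ev: "\<forall>\<^sub>F y in at x. sqrt \<bar>det (G x)\<bar> * sqrt (det (G y) / det (G x)) = sqrt \<bar>det (G y)\<bar>"
 proof (rule eventually_mono)
  fix y assume r: "0 < det (G y) / det (G x)"
  have "\<bar>det (G y)\<bar> = \<bar>det (G x) * (det (G y) / det (G x))\<bar>" using nz by simp
  also have "... = \<bar>det (G x)\<bar> * (det (G y) / det (G x))" unfolding abs_mult abs_of_pos[OF r] ..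
  finally have "\<bar>det (G y)\<bar> = \<bar>det (G x)\<bar> * (det (G y) / det (G x))" .
  thus "sqrt \<bar>det (G x)\<bar> * sqrt (det (G y) / det (G x)) = sqrt \<bar>det (G y)\<bar>" by (simp only: real_sqrt_mult)
 qed
 have "((%y. sqrt \<bar>det (G x)\<bar> * sqrt (det (G y) / det (G x))) has_derivative
   (%v. sqrt \<bar>det (G x)\<bar> * (?t v * (inverse (sqrt (det (G x) / det (G x))) / 2)))) (at x)" by (rule has_derivative_mult_right[OF s])
 hence "((%y. sqrt \<bar>det (G y)\<bar>) has_derivative
   (%v. sqrt \<bar>det (G x)\<bar> * (?t v * (inverse (sqrt (det (G x) / det (G x))) / 2)))) (at x)"
  by (rule has_derivative_transform_eventually[OF _ ev]) (use nz in simp_all)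
 thus ?thesis using nz by (simp add: field_simps)
qed

text \<open>Translation invariance does the work: the integral of \<open>h (x + t v)\<close> does
  not depend on t, and its derivative at t = 0 is the integral of the directional
  derivative.\<close>

lemma integral_dird_eq_0:
 fixes h :: "real^'n => real"
 assumes h: "smooth_on UNIV h" and K: "compact K" and supp: "!!x. x ~: K ==> h x = 0"
 shows "integrable lborel (%x. dird h x v)" "(\<integral>x. dird h x v \<partial>lborel) = 0" proof -
 define F where "F = (%z::real \<times> (real^'n). h (snd z + fst z *\<^sub>R v))"
 \<comment> \<open>All points that a translation by t v with t between -1 and 1 can carry into K.
   Off this compact set the translated functions vanish, so one set serves for all these t.\<close>
 define B where "B = (%z. fst z - snd z *\<^sub>R v) ` (K \<times> {-1..1::real})"
 have cB: "compact B" unfolding B_def by (intro compact_continuous_image compact_Times K compact_Icc continuous_intros)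
 have o: "open ({-1<..<1::real} \<times> (UNIV::(real^'n) set))" by (intro open_Times) auto
 have F: "smooth_on ({-1<..<1} \<times> UNIV) F" unfolding F_def
  by (rule smooth_on_compose[OF o h], intro smooth_on_add[OF o] smooth_on_scaleR[OF o] smooth_on_const smooth_on_linear[OF o]
    bounded_linear_fst bounded_linear_snd, simp)
 have dF: "dird F (0, x) (1, 0) = dird h x v" for x proof (rule dird_eq[THEN trans])
  have "((%z::real \<times> (real^'n). snd z + fst z *\<^sub>R v) has_derivative (%z. snd z + fst z *\<^sub>R v)) (at (0, x))"
   by (auto intro!: derivative_eq_intros)
  moreover have "(h has_derivative dird h x) (at (snd (0::real, x) + fst (0::real, x) *\<^sub>R v))"
   using smooth_on_has_derivative[OF h UNIV_I, of x] by simp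
  ultimately have "((h \<circ> (%z::real \<times> (real^'n). snd z + fst z *\<^sub>R v)) has_derivative (dird h x \<circ> (%z. snd z + fst z *\<^sub>R v))) (at (0, x))"
   by (rule diff_chain_at)
  thus "(F has_derivative (dird h x \<circ> (%z. snd z + fst z *\<^sub>R v))) (at (0, x))" by (simp add: F_def o_def)
 qed simp
 have B0: "h (x + t *\<^sub>R v) = 0" if "t : {-1<..<1}" "x ~: B" for x t proof (rule supp, rule notI)
  assume "x + t *\<^sub>R v : K"
  hence "x : B" unfolding B_def using that by (intro image_eqI[of _ _ "(x + t *\<^sub>R v, t)"]) auto
  thus False using that by simp
 qed
 have Bd: "dird h x v = 0" if "x ~: B" for x proof -
  have "((%s. F (s, x)) has_real_derivative dird F (0, x) (1, 0)) (at 0)" by (rule partial_time_derivative[OF F]) simp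
  moreover have "((%s. F (s, x)) has_real_derivative 0) (at 0)"
   by (rule has_field_derivative_transform_within_open[OF DERIV_const[of 0], of "{-1<..<1}"]) (use B0 that in \<open>auto simp: F_def\<close>)
  ultimately show ?thesis unfolding dF by (rule DERIV_unique)
 qed
 have bB: "B : sets borel" using cB by (simp add: borel_closed compact_imp_closed)
 note L = leibniz_compact[OF zero_less_one open_UNIV F bB order_refl cB subset_UNIV]
 have iB: "indicator B x * dird h x v = dird h x v" for x using Bd[of x] by (cases "x : B") auto
 show "integrable lborel (%x. dird h x v)" using L(2) unfolding dF iB .
 have JF: "(\<integral>x. indicator B x * F (t, x) \<partial>lborel) = (\<integral>x. h x \<partial>lborel)" if "t : {-1<..<1}" for t proof -
  have "indicator B x * F (t, x) = h (x + t *\<^sub>R v)" for x using B0[OF that, of x] by (cases "x : B") (auto simp: F_def)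
  hence "(\<integral>x. indicator B x * F (t, x) \<partial>lborel) = (\<integral>x. h (t *\<^sub>R v + x) \<partial>lborel)" by (simp add: add.commute)
  also have "... = (\<integral>x. h x \<partial>distr lborel borel ((+) (t *\<^sub>R v)))"
   using smooth_on_continuous_on[OF h] by (subst integral_distr) (auto intro: borel_measurable_continuous_onI)
  also have "... = (\<integral>x. h x \<partial>lborel)" by (simp only: lborel_distr_plus)
  finally show ?thesis .
 qed
 have "((%t. \<integral>x. indicator B x * F (t, x) \<partial>lborel) has_real_derivative 0) (at 0)"
  by (rule has_field_derivative_transform_within_open[OF DERIV_const[of "\<integral>x. h x \<partial>lborel"], of "{-1<..<1}"]) (use JF in auto)
 from DERIV_unique[OF L(3) this] show "(\<integral>x. dird h x v \<partial>lborel) = 0" unfolding dF iB .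
qed


context smooth_mfd
begin


text \<open>The Levi-Civita connection depends on its first field only through the value at p, so it
  applies to a single vector; the field with constant components stands in for an extension.\<close>

definition cov :: "('m, 'n) metric => real^'n => ('m, 'n) vfield => 'm => real^'n" where
 "cov g v Z p = (let c = chart_at A p in ci c p (nb (christ (gram g c)) (%y. cc c p v) (vrep c Z) (snd c p)))"

lemma nb_pointwise: "X x = X' x ==> nb \<Gamma> X Z x = nb \<Gamma> X' Z x" by (simp add: nb_def)

lemma cov_levi_civita:
 assumes "pseudo_riemannian_metric A g" "svf UNIV X" "svf UNIV Z" shows "levi_civita A g X Z p = cov g (X p) Z p" proof -
 let ?c = "chart_at A p"
 have "levi_civita A g X Z p = ci ?c p (nb (christ (gram g ?c)) (vrep ?c X) (vrep ?c Z) (snd ?c p))"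
  using levi_civita_chart[OF assms(1) chart_at_in in_chart_at assms(2,3), of p] by (metis ci_cc chart_at_in in_chart_at)
 also have "nb (christ (gram g ?c)) (vrep ?c X) (vrep ?c Z) (snd ?c p) = nb (christ (gram g ?c)) (%y. cc ?c p (X p)) (vrep ?c Z) (snd ?c p)"
  by (rule nb_pointwise) (simp add: vrep_snd)
 finally show ?thesis by (simp add: cov_def Let_def)
qed

lemma cov_chart:
 assumes g: "pseudo_riemannian_metric A g" and Z: "svf UNIV Z" and c: "c : A" "p : fst c"
 shows "cc c p (cov g v Z p) = nb (christ (gram g c)) (%y. cc c p v) (vrep c Z) (snd c p)" proof -
 obtain X where X: "svf UNIV X" "X p = v" by (rule field_through)
 have "cc c p (cov g v Z p) = nb (christ (gram g c)) (vrep c X) (vrep c Z) (snd c p)"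
  using cov_levi_civita[OF g X(1) Z, of p] levi_civita_chart[OF g c X(1) Z] X(2) by simp
 also have "... = nb (christ (gram g c)) (%y. cc c p v) (vrep c Z) (snd c p)" by (rule nb_pointwise) (simp add: vrep_snd[OF c] X(2))
 finally show ?thesis .
qed

text \<open>The contracted symbols are the logarithmic derivative of the volume density. This turns
  the trace of a covariant derivative into a coordinate divergence of the field multiplied by the
  density.\<close>

lemma christ_divergence:
 assumes g: "pseudo_riemannian_metric A g" and c: "c : A" and x: "x : chart_image c"
 shows "dird (vol_density g c) x (axis j 1) = vol_density g c x * (SUM m:UNIV. christ (gram g c) x m j $ m)" proof -
 let ?G = "gram g c" let ?H = "matrix_inv (?G x)"
 have nz: "det (?G x) ~= 0" by (rule det_gram_nz[OF g c x])
 have sH: "?H $ i $ l = ?H $ l $ i" for i l proof -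
  have i: "?G x ** ?H = mat 1" using nz by (simp add: matrix_inv_right_left invertible_det_nz)
  have "transpose (?G x) = ?G x" by (simp add: transpose_def vec_eq_iff gram_sym[OF g])
  moreover have "transpose (?G x ** ?H) = mat 1" unfolding i by (simp add: transpose_mat)
  ultimately have "transpose ?H ** ?G x = mat 1" by (simp only: matrix_transpose_mul)
  hence "(transpose ?H ** ?G x) ** ?H = ?H" by simp
  hence "transpose ?H = ?H" unfolding matrix_mul_assoc[symmetric] i by simp
  thus ?thesis by (simp add: transpose_def vec_eq_iff)
 qed
 have inv: "(SUM l:UNIV. ?H $ i $ l * (?G x *v u) $ l) = u $ i" for i u proof -
  have "(SUM l:UNIV. ?H $ i $ l * (?G x *v u) $ l) = (?H *v (?G x *v u)) $ i" by (simp add: matrix_vector_mult_def)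
  also have "... = u $ i" using nz by (simp add: matrix_vector_mul_assoc matrix_inv_right_left invertible_det_nz)
  finally show ?thesis .
 qed
 have cm: "dird (%y. ?G y $ l $ i) x (axis j 1) = (?G x *v christ ?G x j l) $ i + (?G x *v christ ?G x j i) $ l" for l i
  by (rule christ_metric[where G = ?G and x = x, OF nz gram_sym[OF g]])
 have "(vol_density g c has_derivative (%v. vol_density g c x * (1/2 * (SUM i:UNIV. SUM l:UNIV. ?H $ i $ l * dird (%y. ?G y $ l $ i) x v)))) (at x)"
  using sqrt_abs_det_has_derivative[OF smooth_on_has_derivative[OF gram_smooth[OF g c] x] nz] by (simp add: vol_density_def[abs_def])
 hence "dird (vol_density g c) x (axis j 1) = vol_density g c x * (1/2 * (SUM i:UNIV. SUM l:UNIV. ?H $ i $ l * dird (%y. ?G y $ l $ i) x (axis j 1)))"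
  by (rule dird_eq)
 also have "(SUM i:UNIV. SUM l:UNIV. ?H $ i $ l * dird (%y. ?G y $ l $ i) x (axis j 1)) =
   (SUM i:UNIV. SUM l:UNIV. ?H $ i $ l * (?G x *v christ ?G x j l) $ i) + (SUM i:UNIV. SUM l:UNIV. ?H $ i $ l * (?G x *v christ ?G x j i) $ l)"
  unfolding cm by (simp add: distrib_left sum.distrib)
 also have "(SUM i:UNIV. SUM l:UNIV. ?H $ i $ l * (?G x *v christ ?G x j l) $ i) = (SUM l:UNIV. SUM i:UNIV. ?H $ l $ i * (?G x *v christ ?G x j l) $ i)"
  by (subst sum.swap) (intro sum.cong refl arg_cong2[of _ _ _ _ "(*)"] sH)
 finally have e: "dird (vol_density g c) x (axis j 1) = vol_density g c x * (1/2 * ((SUM l:UNIV. christ ?G x j l $ l) + (SUM i:UNIV. christ ?G x j i $ i)))"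
  unfolding inv .
 have "christ ?G x m j = christ ?G x j m" for m by (rule christ_sym[OF gram_sym[OF g]])
 thus ?thesis unfolding e by simp
qed

lemma linear_cov:
 assumes g: "pseudo_riemannian_metric A g" and Z: "svf UNIV Z" shows "linear (%v. cov g v Z p)" proof -
 let ?c = "chart_at A p"
 have l: "linear (dird (vrep ?c Z) (snd ?c p))" by (rule has_derivative_linear[OF smooth_on_has_derivative[OF vrep_smooth[OF Z chart_at_in]]]) simp
 show ?thesis unfolding cov_def Let_def nb_def
  by (rule linearI; simp only: cc_simps[OF chart_at_in in_chart_at] bl_simps linear_add[OF l] linear_cmul[OF l]
    ci_simps[OF chart_at_in in_chart_at] scaleR_add_right[symmetric] add_ac)
qed

lemma dird_vrep_zero:
 assumes c: "c : A" "p : fst c" and U: "open U" "p : U" and z: "!!q. q : U ==> Z q = 0" shows "dird (vrep c Z) (snd c p) v = 0"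
proof (rule dird_eq[OF has_derivative_transform_within_open[OF has_derivative_const[of 0]]])
 show "open (snd c ` (U Int fst c))" by (rule open_chart_img[OF c(1) U(1)])
 show "snd c p : snd c ` (U Int fst c)" using c U by simp
 show "0 = vrep c Z x" if "x : snd c ` (U Int fst c)" for x proof -
  from that obtain q where "q : U" "q : fst c" "x = snd c q" by blast
  thus ?thesis by (simp add: vrep_snd[OF c(1)] z cc_simps[OF c(1)])
 qed
qed

end

context multi_product
begin

text \<open>Both sides are the trace of L, once by orthonormal duality and once by coordinates;
  hence the divergence does not depend on the frame.\<close>

lemma trace_frame:
 assumes g: "adapted_metric A k D g" and e: "aonb g p e" and L: "linear L" and c: "c : A" "p : fst c"
 shows "(SUM i:Ix. g p (e i) (e i) * g p (L (e i)) (e i)) = (SUM m:UNIV. cc c p (L (ci c p (axis m 1))) $ m)" proof -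
 note pg = adapted_metric_pr[OF g]
 have "cc c p (L (ci c p (axis m 1))) $ m = (SUM i:Ix. g p (e i) (e i) * g p (cc c p (L (e i)) $ m *\<^sub>R ci c p (axis m 1)) (e i))" for m
  by (subst aonb_expand[OF g e, of "ci c p (axis m 1)"])
   (simp add: linear_sum[OF L] linear_cmul[OF L] cc_simps[OF c] metric_scale[OF pg] mult_ac)
 hence "(SUM m:UNIV. cc c p (L (ci c p (axis m 1))) $ m) = (SUM i:Ix. g p (e i) (e i) * g p (SUM m:UNIV. cc c p (L (e i)) $ m *\<^sub>R ci c p (axis m 1)) (e i))"
  by (simp only: metric_sum[OF pg] sum_distrib_left) (rule sum.swap)
 thus ?thesis unfolding vec_coord_expand[OF c, of "L (e _)", unfolded coord_vec_eq, symmetric] by simp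
qed

definition dv :: "('m, 'n) metric => ('m, 'n) vfield => 'm => real" where
 "dv g Z p = (SUM i:Ix. g p (oe g p i) (oe g p i) * g p (cov g (oe g p i) Z p) (oe g p i))"

lemma dv_frame:
 assumes g: "adapted_metric A k D g" and e: "aonb g p e" and Z: "svf UNIV Z"
 shows "dv g Z p = (SUM i:Ix. g p (e i) (e i) * g p (cov g (e i) Z p) (e i))" unfolding dv_def
  trace_frame[OF g oe_aonb[OF g] linear_cov[OF adapted_metric_pr[OF g] Z] chart_at_in in_chart_at]
  trace_frame[OF g e linear_cov[OF adapted_metric_pr[OF g] Z] chart_at_in in_chart_at] ..

lemma dv_chart:
 assumes g: "adapted_metric A k D g" and Z: "svf UNIV Z" and c: "c : A" "p : fst c" shows "dv g Z p * vol_density g c (snd c p) =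
  (SUM m:UNIV. dird (%y. vol_density g c y * vrep c Z y $ m) (snd c p) (axis m 1))" proof -
 note pg = adapted_metric_pr[OF g]
 let ?x = "snd c p" let ?v = "vol_density g c" and ?\<Gamma> = "christ (gram g c)"
 have x: "?x : chart_image c" using c by simp
 have Zx: "(vrep c Z has_derivative dird (vrep c Z) ?x) (at ?x)" by (rule smooth_on_has_derivative[OF vrep_smooth[OF Z c(1)] x])
 have vx: "(?v has_derivative dird ?v ?x) (at ?x)" by (rule smooth_on_has_derivative[OF vol_density_smooth[OF pg c(1)] x])
 have bl: "bl (?\<Gamma> ?x) (axis m 1) (cc c p (Z p)) = (SUM j:UNIV. cc c p (Z p) $ j *\<^sub>R ?\<Gamma> ?x m j)" for m
  unfolding bl_def by (subst sum.swap) (simp add: axis_def if_distrib[of "%t. (t * _) *\<^sub>R _"] cong: if_cong)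
 have "dv g Z p = (SUM m:UNIV. (dird (vrep c Z) ?x (axis m 1) + bl (?\<Gamma> ?x) (axis m 1) (cc c p (Z p))) $ m)"
  unfolding dv_def trace_frame[OF g oe_aonb[OF g] linear_cov[OF pg Z] c] cov_chart[OF pg Z c] nb_def using c by (simp add: vrep_snd)
 also have "... = (SUM m:UNIV. dird (vrep c Z) ?x (axis m 1) $ m) + (SUM m:UNIV. SUM j:UNIV. cc c p (Z p) $ j * ?\<Gamma> ?x m j $ m)"
  by (simp add: sum.distrib bl)
 also have "(SUM m:UNIV. SUM j:UNIV. cc c p (Z p) $ j * ?\<Gamma> ?x m j $ m) = (SUM j:UNIV. cc c p (Z p) $ j * (SUM m:UNIV. ?\<Gamma> ?x m j $ m))"
  by (subst sum.swap) (simp add: sum_distrib_left)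
 finally have dv: "dv g Z p * ?v ?x = (SUM m:UNIV. ?v ?x * dird (vrep c Z) ?x (axis m 1) $ m) + (SUM j:UNIV. cc c p (Z p) $ j * dird ?v ?x (axis j 1))"
  by (simp add: christ_divergence[OF pg c(1) x] distrib_left sum_distrib_left mult_ac)
 have "dird (%y. ?v y * vrep c Z y $ m) ?x u = ?v ?x * dird (vrep c Z) ?x u $ m + dird ?v ?x u * cc c p (Z p) $ m" for m u
  using has_derivative_mult[OF vx bounded_linear.has_derivative[OF bounded_linear_vec_nth[of m] Zx]] by (simp add: dird_eq vrep_snd[OF c])
 thus ?thesis unfolding dv by (simp add: sum.distrib mult_ac)
qed

lemma dv_smooth:
 assumes g: "adapted_metric A k D g" and Z: "svf UNIV Z" shows "sfun UNIV (dv g Z)"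
proof (rule sfun_UNIV_I[of "%c x. (SUM m:UNIV. dird (%y. vol_density g c y * vrep c Z y $ m) x (axis m 1)) / vol_density g c x"])
 note pg = adapted_metric_pr[OF g]
 show "smooth_on (chart_image c) (%x. (SUM m:UNIV. dird (%y. vol_density g c y * vrep c Z y $ m) x (axis m 1)) / vol_density g c x)"
  if c: "c : A" for c
  by (intro smooth_on_divide smooth_on_sum smooth_on_dird smooth_on_mult smooth_on_vec_nth open_chart_image c vol_density_smooth[OF pg] vrep_smooth[OF Z])
   (use vol_density_pos[OF pg c] in force)
 show "dv g Z p = (SUM m:UNIV. dird (%y. vol_density g c y * vrep c Z y $ m) (snd c p) (axis m 1)) / vol_density g c (snd c p)"
  if "c : A" "p : fst c" for c p unfolding dv_chart[OF g Z that, symmetric] using vol_density_pos[OF pg that(1), of "snd c p"] that by simp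
qed

lemma dv_zero:
 assumes g: "adapted_metric A k D g" and Z: "svf UNIV Z" and U: "open U" "p : U" "!!q. q : U ==> Z q = 0" shows "dv g Z p = 0" proof -
 have "dird (vrep (chart_at A p) Z) (snd (chart_at A p) p) v = 0" for v by (rule dird_vrep_zero[OF chart_at_in in_chart_at U])
 thus ?thesis unfolding dv_def cov_def Let_def nb_def
 by (simp add: vrep_snd U(2,3) cc_simps[OF chart_at_in in_chart_at] bl_simps ci_simps[OF chart_at_in in_chart_at] metric_zero[OF adapted_metric_pr[OF g]])
qed

lemma dv_add:
 assumes g: "adapted_metric A k D g" and X: "svf UNIV X" and Y: "svf UNIV Y" shows "dv g (%q. X q + Y q) p = dv g X p + dv g Y p" proof -
 let ?c = "chart_at A p"
 have "cov g v (%q. X q + Y q) p = cov g v X p + cov g v Y p" for v unfolding cov_def Let_def nb_def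
  by (simp add: dird_vrep_add[OF chart_at_in _ X Y] vrep_add[OF chart_at_in] bl_simps ci_simps[OF chart_at_in in_chart_at, symmetric] add_ac)
 thus ?thesis by (simp add: dv_def metric_add[OF adapted_metric_pr[OF g]] distrib_left sum.distrib)
qed

text \<open>For a field supported in one chart, density times component, extended by 0, is a
  compactly supported smooth function on the whole coordinate space, and its partial derivatives
  integrate to 0.\<close>

lemma divergence_chart_integral:
 assumes g: "adapted_metric A k D g" and Z: "svf UNIV Z" and c: "c : A"
  and K: "compact K" "K <= fst c" "!!q. q ~: K ==> Z q = 0" and \<Omega>: "K <= \<Omega>"
 shows "set_integrable (volume_measure A g) \<Omega> (dv g Z)" and "set_lebesgue_integral (volume_measure A g) \<Omega> (dv g Z) = 0" proof -
 note pg = adapted_metric_pr[OF g]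
 let ?O = "chart_image c" and ?K = "snd c ` K"
 define h where "h = (%m x. if x : ?O then vol_density g c x * vrep c Z x $ m else 0)"
 have O: "open ?O" by (rule open_chart_image[OF c])
 have KO: "?K <= ?O" using K(2) by auto
 have cK: "compact ?K" by (rule compact_continuous_image[OF continuous_on_subset[OF continuous_on_chart[OF c] K(2)] K(1)])
 have clK: "closed K" "closed ?K" using K(1) cK by (auto intro: compact_imp_closed)
 have h0: "h m x = 0" if "x ~: ?K" for m x proof (cases "x : ?O")
  case True
  hence "chart_inv c x ~: K" using that c by (metis imageI snd_inv)
  hence "vrep c Z x = 0" using True K(3) cc_simps(4)[OF c inv_in_dom[OF c True]] by (simp add: vrep_def)
  thus ?thesis by (simp add: h_def)
 qed (simp add: h_def)
 have sm: "smooth_on UNIV (h m)" for m proof (rule smooth_on_pointwise)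
  fix x :: "real^'n"
  show "EX U. x : U & smooth_on U (h m)" proof (cases "x : ?O")
   case True
   have "smooth_on ?O (%x. vol_density g c x * vrep c Z x $ m)" by (intro smooth_on_mult smooth_on_vec_nth O vol_density_smooth pg c vrep_smooth Z)
   hence "smooth_on ?O (h m)" by (subst smooth_on_cong[OF O]) (simp add: h_def)
   thus ?thesis using True by (intro exI[of _ ?O] conjI)
  next
   case False
   have "smooth_on (- ?K) (h m)" by (subst smooth_on_cong[of _ _ "%x. 0"]) (use clK h0 in \<open>auto simp: open_Compl smooth_on_const\<close>)
   thus ?thesis using False KO by (intro exI[of _ "- ?K"] conjI) auto
  qed
 qed
 have dh: "indicator ?O x * (dv g Z (chart_inv c x) * vol_density g c x) = (SUM m:UNIV. dird (h m) x (axis m 1))" for x proof (cases "x : ?O")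
  case True
  have "dird (h m) x v = dird (%y. vol_density g c y * vrep c Z y $ m) x v" for m v
  proof (rule dird_eq[OF has_derivative_transform_within_open[OF _ O True]])
   show "((%y. vol_density g c y * vrep c Z y $ m) has_derivative dird (%y. vol_density g c y * vrep c Z y $ m) x) (at x)"
    by (rule smooth_on_has_derivative[OF _ True])
     (intro smooth_on_mult smooth_on_vec_nth O vol_density_smooth pg c vrep_smooth Z)
  qed (simp add: h_def)
  thus ?thesis using dv_chart[OF g Z c inv_in_dom[OF c True]] True c by simp
 next
  case False
  have "dird (h m) x v = 0" for m v by (rule dird_eq[OF has_derivative_transform_within_open[OF has_derivative_const[of 0], of "- ?K"]])
    (use False KO clK h0 in auto)
  thus ?thesis using False by simp
 qed
 have d0: "dv g Z q = 0" if "q ~: K" for q by (rule dv_zero[OF g Z, of "- K"]) (use clK that K(3) in auto)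
 have ind: "indicator \<Omega> q *\<^sub>R dv g Z q = indicator (fst c) q *\<^sub>R dv g Z q" for q
  using d0[of q] \<Omega> K(2) by (cases "q : K") (auto simp: indicator_def)
 have meas: "dv g Z : borel_measurable borel" using continuous_on_sfun[OF open_UNIV dv_smooth[OF g Z]] by (rule borel_measurable_continuous_onI)
 have bc: "fst c : sets borel" using open_dom[OF c] by simp
 have I: "integrable lborel (%x. dird (h m) x v)" "(\<integral>x. dird (h m) x v \<partial>lborel) = 0" for m v
  using integral_dird_eq_0[OF sm cK h0] by auto
 show "set_integrable (volume_measure A g) \<Omega> (dv g Z)" unfolding set_integrable_def ind
  unfolding set_integrable_def[symmetric] volume_integral(1)[OF pg c bc order_refl meas] chart_image_def[symmetric] dh
  by (intro Bochner_Integration.integrable_sum I)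
 show "set_lebesgue_integral (volume_measure A g) \<Omega> (dv g Z) = 0" unfolding set_lebesgue_integral_def ind
  unfolding set_lebesgue_integral_def[symmetric] volume_integral(2)[OF pg c bc order_refl meas] chart_image_def[symmetric] dh
  by (simp add: Bochner_Integration.integral_sum I)
qed

text \<open>Induction on a finite cover of the support. A bump function equal to 1 on one of the
  sets splits Z into a part inside a chart and a part that vanishes on this set, so the remaining
  sets cover the second part.\<close>

theorem divergence_theorem:
 assumes g: "adapted_metric A k D g" and Z: "svf UNIV Z" and K: "compact K" "!!q. q ~: K ==> Z q = 0" and \<Omega>: "K <= \<Omega>"
 shows "set_integrable (volume_measure A g) \<Omega> (dv g Z)" and "set_lebesgue_integral (volume_measure A g) \<Omega> (dv g Z) = 0" proof -
 have "EX z. p : fst (snd z) & open (fst (snd z)) & sfun UNIV (fst z) & compact (snd (snd z)) \<and>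
   (EX c:A. snd (snd z) <= fst c) & (ALL q:fst (snd z). fst z q = 1) & (ALL q. q ~: snd (snd z) --> fst z q = 0)" for p proof -
  obtain \<phi> V C where b: "sfun UNIV \<phi>" "open V" "p : V" "compact C" "C <= UNIV Int fst (chart_at A p)" "ALL q:V. \<phi> q = 1" "ALL q. q ~: C --> \<phi> q = 0"
   using manifold_bump[OF chart_at_in in_chart_at open_UNIV UNIV_I, of p] by metis
  thus ?thesis by (intro exI[of _ "(\<phi>, V, C)"] conjI bexI[of _ "chart_at A p"]) simp_all
 qed
 then obtain W where W: "!!p. p : fst (snd (W p)) & open (fst (snd (W p))) & sfun UNIV (fst (W p)) & compact (snd (snd (W p))) \<and>
   (EX c:A. snd (snd (W p)) <= fst c) & (ALL q:fst (snd (W p)). fst (W p) q = 1) & (ALL q. q ~: snd (snd (W p)) --> fst (W p) q = 0)" by metis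
 have "\<exists>P\<subseteq>K. finite P & K <= (UN p:P. fst (snd (W p)))"
  by (rule compactE_image[OF K(1), of K "%p. fst (snd (W p))"]) (use W in auto)
 then obtain P where P: "P <= K" "finite P" "K <= (UN p:P. fst (snd (W p)))" by blast
 have "ALL Z. svf UNIV Z --> (ALL q. q ~: K --> Z q = 0) --> (ALL q. q ~: (UN p:P. fst (snd (W p))) --> Z q = 0) -->
   set_integrable (volume_measure A g) \<Omega> (dv g Z) & set_lebesgue_integral (volume_measure A g) \<Omega> (dv g Z) = 0" using P(2)
 proof (induct P)
  case empty
  show ?case proof (intro allI impI)
   fix Z assume "svf UNIV Z" "ALL q. q ~: (UN p:{}. fst (snd (W p))) --> Z q = 0"
   hence "dv g Z = (%p. 0)" by (intro ext dv_zero[OF g, of _ UNIV]) auto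
   thus "set_integrable (volume_measure A g) \<Omega> (dv g Z) & set_lebesgue_integral (volume_measure A g) \<Omega> (dv g Z) = 0"
    by (simp add: set_integrable_def set_lebesgue_integral_def)
  qed
 next
  case (insert p P)
  show ?case proof (intro allI impI)
   fix Z assume Z: "svf UNIV Z" and ZK: "ALL q. q ~: K --> Z q = 0" and ZP: "ALL q. q ~: (UN p:insert p P. fst (snd (W p))) --> Z q = 0"
   let ?\<phi> = "fst (W p)" and ?C = "snd (snd (W p))"
   from W obtain c where c: "c : A" "?C <= fst c" by blast
   have \<phi>: "sfun UNIV ?\<phi>" and one: "ALL q:fst (snd (W p)). ?\<phi> q = 1" and C: "compact ?C" "ALL q. q ~: ?C --> ?\<phi> q = 0"
    using W[of p] by auto
   define Z1 where "Z1 = (%q. ?\<phi> q *\<^sub>R Z q)"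
   define Z2 where "Z2 = (%q. (1 - ?\<phi> q) *\<^sub>R Z q)"
   have sZ1: "svf UNIV Z1" unfolding Z1_def by (rule svf_scale[OF open_UNIV \<phi> Z])
   have sZ2: "svf UNIV Z2" unfolding Z2_def by (rule svf_scale[OF open_UNIV sfun_diff[OF open_UNIV sfun_const \<phi>] Z])
   have CK: "compact (K Int ?C)" by (rule compact_Int[OF K(1) C(1)])
   have i1: "set_integrable (volume_measure A g) \<Omega> (dv g Z1)" "set_lebesgue_integral (volume_measure A g) \<Omega> (dv g Z1) = 0"
    by (rule divergence_chart_integral[OF g sZ1 c(1) CK]; use c \<Omega> C ZK in \<open>auto simp: Z1_def\<close>)+
   have i2: "set_integrable (volume_measure A g) \<Omega> (dv g Z2) & set_lebesgue_integral (volume_measure A g) \<Omega> (dv g Z2) = 0"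
    using insert(3) proof (elim allE[of _ Z2] impE)
    show "svf UNIV Z2" by (rule sZ2)
    show "ALL q. q ~: K --> Z2 q = 0" using ZK by (simp add: Z2_def)
    show "ALL q. q ~: (UN p:P. fst (snd (W p))) --> Z2 q = 0" proof (intro allI impI)
     fix q assume "q ~: (UN p:P. fst (snd (W p)))"
     thus "Z2 q = 0" using one ZP by (cases "q : fst (snd (W p))") (simp_all add: Z2_def)
    qed
   qed
   have eq: "dv g Z = (%q. dv g Z1 q + dv g Z2 q)" proof
    fix q
    have "Z = (%q. Z1 q + Z2 q)" by (simp add: Z1_def Z2_def algebra_simps)
    thus "dv g Z q = dv g Z1 q + dv g Z2 q" using dv_add[OF g sZ1 sZ2] by simp
   qed
   show "set_integrable (volume_measure A g) \<Omega> (dv g Z) & set_lebesgue_integral (volume_measure A g) \<Omega> (dv g Z) = 0"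
    unfolding eq using i1 i2 by (simp add: set_integral_add)
  qed
 qed
 hence "set_integrable (volume_measure A g) \<Omega> (dv g Z) & set_lebesgue_integral (volume_measure A g) \<Omega> (dv g Z) = 0"
  using Z K(2) P(3) by blast
 thus "set_integrable (volume_measure A g) \<Omega> (dv g Z)" "set_lebesgue_integral (volume_measure A g) \<Omega> (dv g Z) = 0" by simp_all
qed

end

section \<open>The first variation as a divergence plus an algebraic term\<close>

context smooth_mfd
begin

lemma vf_deriv_const: "vf_deriv A X (%q. r) p = 0"
 by (simp add: vf_deriv_chart[OF chart_at_in in_chart_at UNIV_I open_UNIV sfun_const] dird_eq[OF has_derivative_const])

lemma vf_deriv_scale: "sfun UNIV h ==> vf_deriv A X (%q. r * h q) p = r * vf_deriv A X h p"
 by (simp add: vf_deriv_rules(2)[OF open_UNIV UNIV_I sfun_const] vf_deriv_const)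

lemma vf_deriv_diff:
 assumes f: "sfun UNIV f" and h: "sfun UNIV h" shows "vf_deriv A X (%q. f q - h q) p = vf_deriv A X f p - vf_deriv A X h p"
 using vf_deriv_rules(1)[OF open_UNIV UNIV_I f sfun_mult[OF open_UNIV sfun_const[of UNIV "-1"] h], of X p] by (simp only: vf_deriv_scale[OF h]) simp

lemma vf_deriv_sum:
 assumes "finite I" "!!a. a : I ==> sfun UNIV (h a)" shows "vf_deriv A X (%q. SUM a:I. h a q) p = (SUM a:I. vf_deriv A X (h a) p)" using assms
proof (induct I)
 case (insert a I)
 have "vf_deriv A X (%q. h a q + (SUM a:I. h a q)) p = vf_deriv A X (h a) p + vf_deriv A X (%q. SUM a:I. h a q) p"
  by (rule vf_deriv_rules(1)[OF open_UNIV UNIV_I]) (auto intro!: insert sfun_sum)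
 thus ?case using insert by simp
qed (simp add: vf_deriv_const)

lemma levi_civita_sum:
 assumes g: "pseudo_riemannian_metric A g" and X: "svf UNIV X" and "finite I" "!!j. j : I ==> svf UNIV (Y j)" "!!j. j : I ==> sfun UNIV (f j)"
 shows "levi_civita A g X (%q. SUM j:I. f j q *\<^sub>R Y j q) p = (SUM j:I. vf_deriv A X (f j) p *\<^sub>R Y j p + f j p *\<^sub>R levi_civita A g X (Y j) p)"
 using assms(3-5) proof (induct I)
 case empty
 have "levi_civita A g X (%q. 0 *\<^sub>R 0) p = vf_deriv A X (%q. 0) p *\<^sub>R 0 + 0 *\<^sub>R levi_civita A g X (%q. 0) p"
  by (rule levi_civita_scale2[OF g sfun_const X svf_zero])
 thus ?case by simp
next
 case (insert j I)
 have s: "svf UNIV (%q. f j q *\<^sub>R Y j q)" by (intro svf_scale open_UNIV insert) simp_all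
 have s': "svf UNIV (%q. SUM j:I. f j q *\<^sub>R Y j q)" by (intro svf_sum svf_scale open_UNIV insert) simp_all
 have "levi_civita A g X (%q. f j q *\<^sub>R Y j q + (SUM j:I. f j q *\<^sub>R Y j q)) p =
   (vf_deriv A X (f j) p *\<^sub>R Y j p + f j p *\<^sub>R levi_civita A g X (Y j) p) + levi_civita A g X (%q. SUM j:I. f j q *\<^sub>R Y j q) p"
  unfolding levi_civita_add2[OF g X s s'] by (subst levi_civita_scale2[OF g]) (use insert X in auto)
 thus ?case using insert by simp
qed

end

context multi_product
begin

section \<open>Sums over pairs of frame vectors from different distributions\<close>

definition od :: "(nat \<times> nat => nat \<times> nat => 'b::ab_group_add) => 'b" where
 "od F = (SUM i:Ix. SUM j:Ix. if fst i = fst j then 0 else F i j)"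

lemma od_cong: "(!!i j. i : Ix ==> j : Ix ==> fst i ~= fst j ==> F i j = G i j) ==> od F = od G" unfolding od_def by (intro sum.cong refl) auto

lemma od_add: "od (%i j. F i j + G i j) = od F + od G" unfolding od_def sum.distrib[symmetric] by (intro sum.cong refl) auto

lemma od_diff: "od (%i j. F i j - G i j) = od F - od G" unfolding od_def sum_subtractf[symmetric] by (intro sum.cong refl) auto

lemma od_swap: "od (%i j. F j i) = od F" unfolding od_def by (subst sum.swap) (simp add: eq_commute)

lemma od_blocks: "od F = (SUM \<mu>:{1..k}. SUM \<nu>:{1..k}-{\<mu>}. SUM i:Blk \<nu>. SUM j:Blk \<mu>. F i j)" proof -
 have "od F = (SUM j:Ix. SUM i:Ix. if fst i = fst j then 0 else F i j)" unfolding od_def by (rule sum.swap)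
 also have "... = (\<Sum>\<mu>=1..k. SUM j:Blk \<mu>. \<Sum>\<nu>=1..k. SUM i:Blk \<nu>. if \<nu> = \<mu> then 0 else F i j)"
  unfolding sum_Ix by (intro sum.cong refl) (auto simp: Blk_def)
 also have "... = (\<Sum>\<mu>=1..k. SUM j:Blk \<mu>. SUM \<nu>:{1..k}-{\<mu>}. SUM i:Blk \<nu>. F i j)"
 proof (rule sum.cong[OF refl], rule sum.cong[OF refl])
  fix \<mu> j assume "\<mu> : {1..k}"
  thus "(\<Sum>\<nu>=1..k. SUM i:Blk \<nu>. if \<nu> = \<mu> then 0 else F i j) = (SUM \<nu>:{1..k}-{\<mu>}. SUM i:Blk \<nu>. F i j)"
   by (subst sum.remove[of _ \<mu>]) (auto intro!: sum.cong)
 qed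
 also have "... = (SUM \<mu>:{1..k}. SUM \<nu>:{1..k}-{\<mu>}. SUM j:Blk \<mu>. SUM i:Blk \<nu>. F i j)" by (rule sum.cong[OF refl], rule sum.swap)
 also have "... = (SUM \<mu>:{1..k}. SUM \<nu>:{1..k}-{\<mu>}. SUM i:Blk \<nu>. SUM j:Blk \<mu>. F i j)"
  by (rule sum.cong[OF refl], rule sum.cong[OF refl], rule sum.swap)
 finally show ?thesis .
qed

lemma fctr_od:
 "2 * fctr g p e Q = od (%i j. g p (e i) (e i) * g p (e j) (e j) * g p (Q (e i) (e j) (e i)) (e j))" unfolding fctr_def od_blocks by simp

lemma aonb_block: "aonb g p e ==> onb g p (Blk \<mu>) e" by (rule onb_subset[OF aonb_onb Blk_subset])

lemma block_trace_indep:
 assumes g: "adapted_metric A k D g" and e: "aonb g p e" and f: "aonb g p f" and \<mu>: "\<mu> : {1..k}"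
  and lin: "!!u. linear (\<beta> u)" "!!v. linear (%u. \<beta> u v)"
 shows "(SUM i:Blk \<mu>. g p (e i) (e i) *\<^sub>R \<beta> (e i) (e i)) = (SUM j:Blk \<mu>. g p (f j) (f j) *\<^sub>R \<beta> (f j) (f j))"
 by (rule onb_trace_indep[OF adapted_metric_pr[OF g] aonb_block[OF e] aonb_block[OF f] _ lin])
  (simp only: aonb_span[OF g e \<mu>] aonb_span[OF g f \<mu>])

section \<open>The skew tensor A and the field Z built from it\<close>

definition At :: "('m, 'n) metric => ('m, 'n) tensor12 => 'm => real^'n => real^'n => real^'n => real" where
 "At g S p u v w = g p (S p u v) w - g p (S p u w) v"

lemma At_simps:
 assumes g: "pseudo_riemannian_metric A g" and S: "smooth_tensor12 A S"
 shows "At g S p (u + u') v w = At g S p u v w + At g S p u' v w" "At g S p u (v + v') w = At g S p u v w + At g S p u v' w"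
  "At g S p u v (w + w') = At g S p u v w + At g S p u v w'"
  "At g S p (r *\<^sub>R u) v w = r * At g S p u v w" "At g S p u (r *\<^sub>R v) w = r * At g S p u v w" "At g S p u v (r *\<^sub>R w) = r * At g S p u v w"
 by (simp_all add: At_def metric_facts[OF g] tensor_facts[OF tensor_bilinear[OF S]] algebra_simps)

definition ZF :: "('m, 'n) metric => ('m, 'n) tensor12 => 'm => (nat \<times> nat => real^'n) => real^'n" where
 "ZF g S p e = od (%a b. (g p (e a) (e a) * g p (e b) (e b) * At g S p (e a) (e a) (e b)) *\<^sub>R e b)"

text \<open>Invariance of traces, used block by block, first in b and then in a. Thus Z is one
  global field although frames exist only locally.\<close>

lemma ZF_indep:
 assumes g: "adapted_metric A k D g" and S: "smooth_tensor12 A S" and e: "aonb g p e" and f: "aonb g p f" shows "ZF g S p e = ZF g S p f"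
 unfolding ZF_def od_blocks proof (rule sum.cong[OF refl], rule sum.cong[OF refl])
 note At_l = At_simps[OF adapted_metric_pr[OF g] S]
 fix \<mu> \<nu> assume "\<mu> : {1..k}" "\<nu> : {1..k} - {\<mu>}"
 hence \<mu>: "\<mu> : {1..k}" and \<nu>: "\<nu> : {1..k}" by auto
 have r: "(SUM i:Blk \<nu>. SUM j:Blk \<mu>. (g p (e i) (e i) * g p (e j) (e j) * At g S p (e i) (e i) (e j)) *\<^sub>R e j) =
   (SUM i:Blk \<nu>. g p (e i) (e i) *\<^sub>R (SUM j:Blk \<mu>. g p (e j) (e j) *\<^sub>R (At g S p (e i) (e i) (e j) *\<^sub>R e j)))" for e
  by (simp add: scaleR_sum_right mult_ac)
 have 1: "(SUM j:Blk \<mu>. g p (e j) (e j) *\<^sub>R (At g S p u v (e j) *\<^sub>R e j)) = (SUM j:Blk \<mu>. g p (f j) (f j) *\<^sub>R (At g S p u v (f j) *\<^sub>R f j))" for u v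
  by (rule block_trace_indep[OF g e f \<mu>, of "%w w'. At g S p u v w *\<^sub>R w'"])
   (simp_all add: linear_iff At_l scaleR_add_right scaleR_add_left)
 show "(SUM i:Blk \<nu>. SUM j:Blk \<mu>. (g p (e i) (e i) * g p (e j) (e j) * At g S p (e i) (e i) (e j)) *\<^sub>R e j) =
   (SUM i:Blk \<nu>. SUM j:Blk \<mu>. (g p (f i) (f i) * g p (f j) (f j) * At g S p (f i) (f i) (f j)) *\<^sub>R f j)" unfolding r 1
  by (rule block_trace_indep[OF g e f \<nu>, of "%u v. SUM j:Blk \<mu>. g p (f j) (f j) *\<^sub>R (At g S p u v (f j) *\<^sub>R f j)"])
   (simp_all add: linear_iff At_l scaleR_add_right scaleR_add_left distrib_left sum.distrib scaleR_sum_right mult_ac)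
qed

definition ZS :: "('m, 'n) metric => ('m, 'n) tensor12 => ('m, 'n) vfield" where
 "ZS g S p = ZF g S p (oe g p)"

lemma ZS_frame:
 assumes "adapted_metric A k D g" "smooth_tensor12 A S" "aonb g p e" shows "ZS g S p = ZF g S p e"
 unfolding ZS_def by (rule ZF_indep[OF assms(1,2) oe_aonb[OF assms(1)] assms(3)])

text \<open>The signs are required to be constant on U. They are continuous with values
  \<plusminus>1, so this only costs a smaller U, and under derivatives they behave as
  constants.\<close>

definition local_frame :: "('m, 'n) metric => 'm => (nat \<times> nat => ('m, 'n) vfield) => 'm set => bool" where
 "local_frame g p e U \<longleftrightarrow> open U & p : U & (ALL i:Ix. svf UNIV (e i) & (ALL q. e i q : D (fst i) q)) \<and>
   (ALL q:U. aonb g q (%i. e i q)) & (ALL q:U. ALL i:Ix. g q (e i q) (e i q) = g p (e i p) (e i p))"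

lemma local_frame_exists:
 assumes g: "adapted_metric A k D g" shows "EX e U. local_frame g p e U" proof -
 obtain e U where U: "open U" "p : U" and e: "ALL i:Ix. svf UNIV (e i) & (ALL q. e i q : D (fst i) q)" and on: "ALL q:U. aonb g q (%i. e i q)"
  using adapted_frame_exists[OF g, of p] by (elim exE conjE)
 define s where "s = (%i q. g q (e i q) (e i q))"
 define V where "V = U Int (INT i:Ix. {q. 0 < s i p * s i q})"
 have cont: "continuous_on UNIV (s i)" if "i : Ix" for i
  unfolding s_def using e that by (intro continuous_on_sfun[OF open_UNIV sfun_metric[OF adapted_metric_pr[OF g]]]) blast+
 have "open {q. 0 < s i p * s i q}" if "i : Ix" for i by (intro open_Collect_less continuous_intros cont that)
 hence oV: "open V" unfolding V_def by (intro open_Int open_INT U finite_Ix ballI)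
 have sgn: "s i q : {1, -1}" if "q : U" "i : Ix" for i q unfolding s_def using onb_sign[OF aonb_onb[OF bspec[OF on that(1)]] that(2)] .
 have pV: "p : V" unfolding V_def proof (intro IntI INT_I CollectI U)
  show "0 < s i p * s i p" if "i : Ix" for i using sgn[OF U(2) that] by auto
 qed
 have sV: "g q (e i q) (e i q) = g p (e i p) (e i p)" if "q : V" "i : Ix" for i q
  using that sgn[OF U(2) that(2)] sgn[of q i] by (auto simp: V_def s_def)
 have VU: "V <= U" unfolding V_def by (rule Int_lower1)
 have "local_frame g p e V" unfolding local_frame_def by (intro conjI oV pV e ballI sV; (assumption | rule bspec[OF on subsetD[OF VU]]))
 thus ?thesis by (intro exI)
qed

end

context multi_product
begin

lemma local_frameD:
 assumes "local_frame g p e U" shows "open U" "p : U" "i : Ix ==> svf UNIV (e i)" "i : Ix ==> e i q : D (fst i) q" "q : U ==> aonb g q (%i. e i q)"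
  "q : U ==> i : Ix ==> g q (e i q) (e i q) = g p (e i p) (e i p)" using assms unfolding local_frame_def by blast+

lemma sfun_At:
 assumes g: "pseudo_riemannian_metric A g" and S: "smooth_tensor12 A S" and X: "svf UNIV X" and Y: "svf UNIV Y" and Z: "svf UNIV Z"
 shows "sfun UNIV (%q. At g S q (X q) (Y q) (Z q))" unfolding At_def by (intro sfun_diff open_UNIV sfun_metric[OF g] svf_tensor[OF S] X Y Z)

text \<open>The signs \<open>s\<close> are constant on a local frame, so they can be frozen at the base point.\<close>

lemma ZS_local:
 fixes e
 assumes g: "adapted_metric A k D g" and S: "smooth_tensor12 A S" and e: "local_frame g p e U"
 defines "s \<equiv> %i. g p (e i p) (e i p)"
 defines "f \<equiv> %j q. SUM a:Ix. (if fst a = fst j then 0 else s a * s j) * At g S q (e a q) (e a q) (e j q)"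
 shows "q : U ==> ZS g S q = (SUM j:Ix. f j q *\<^sub>R e j q)" and "j : Ix ==> sfun UNIV (f j)" proof -
 show "j : Ix ==> sfun UNIV (f j)" unfolding f_def
  by (intro sfun_sum sfun_mult sfun_const open_UNIV sfun_At[OF adapted_metric_pr[OF g] S] local_frameD(3)[OF e])
 assume q: "q : U"
 have "ZS g S q = (SUM a:Ix. SUM j:Ix. ((if fst a = fst j then 0 else s a * s j) * At g S q (e a q) (e a q) (e j q)) *\<^sub>R e j q)"
  unfolding ZS_frame[where S = S and p = q, OF g S local_frameD(5)[OF e q]] ZF_def od_def
  by (intro sum.cong refl) (simp add: s_def local_frameD(6)[OF e q])
 also have "... = (SUM j:Ix. f j q *\<^sub>R e j q)" unfolding f_def scaleR_sum_left by (rule sum.swap)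
 finally show "ZS g S q = (SUM j:Ix. f j q *\<^sub>R e j q)" .
qed

lemma svf_ZS:
 assumes g: "adapted_metric A k D g" and S: "smooth_tensor12 A S" shows "svf UNIV (ZS g S)" proof (rule svf_pointwise)
 fix p
 obtain e U where e: "local_frame g p e U" using local_frame_exists[OF g, of p] by (elim exE)
 note Z = ZS_local[OF g S e]
 have "svf UNIV (%q. SUM j:Ix. (SUM a:Ix. (if fst a = fst j then 0 else g p (e a p) (e a p) * g p (e j p) (e j p)) * At g S q (e a q) (e a q) (e j q)) *\<^sub>R e j q)"
  by (intro svf_sum svf_scale open_UNIV Z(2) local_frameD(3)[OF e])
 hence "svf U (%q. SUM j:Ix. (SUM a:Ix. (if fst a = fst j then 0 else g p (e a p) (e a p) * g p (e j p) (e j p)) * At g S q (e a q) (e a q) (e j q)) *\<^sub>R e j q)"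
  by (rule svf_subset) simp
 hence "svf U (ZS g S)" by (subst svf_cong[OF local_frameD(1)[OF e] Z(1)])
 thus "EX V. p : V & svf V (ZS g S)" using local_frameD(2)[OF e] by blast
qed

lemma ZS_zero:
 assumes g: "adapted_metric A k D g" and "!!u v. S p u v = 0" shows "ZS g S p = 0" unfolding ZS_def ZF_def od_def At_def
 by (intro sum.neutral ballI) (simp add: assms(2) metric_zero[OF adapted_metric_pr[OF g]])

text \<open>The part of the divergence of Z in which the frame is differentiated:
  \<open>\<nu> b a\<close> is the derivative of a along b, and the innermost sum is the divergence
  of the frame field b.\<close>

definition XS :: "('m, 'n) metric => ('m, 'n) tensor12 => 'm => (nat \<times> nat => real^'n) => (nat \<times> nat => nat \<times> nat => real^'n) => real" where
 "XS g S p f \<nu> = od (%a b. g p (f a) (f a) * g p (f b) (f b) *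
   (At g S p (\<nu> b a) (f a) (f b) + At g S p (f a) (\<nu> b a) (f b) + At g S p (f a) (f a) (\<nu> b b)
   + At g S p (f a) (f a) (f b) * (SUM c:Ix. g p (f c) (f c) * g p (\<nu> c b) (f c))))"

text \<open>The terms of the varied curvature in which S meets the contorsion and not the
  Levi-Civita connection.\<close>

definition alS :: "('m, 'n) metric => ('m, 'n) tensor12 => ('m, 'n) tensor12 => 'm => (nat \<times> nat => real^'n) => real" where
 "alS g T S p f = od (%a b. g p (f a) (f a) * g p (f b) (f b) *
   g p (T p (f b) (S p (f a) (f a)) + S p (f b) (T p (f a) (f a)) - T p (f a) (S p (f b) (f a)) - S p (f a) (T p (f b) (f a))) (f b))"

text \<open>The derivative terms of the varied curvature are \<langle>(\<nabla>_b S)(a, a),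
  b\<rangle> - \<langle>(\<nabla>_a S)(b, a), b\<rangle>, because the Levi-Civita connection is
  torsion-free. Exchanging the names a and b in the second one, as the sum permits, turns them into
  the derivative of A(a, a, b) along b. The product rule for the divergence of Z then accounts for
  all other terms.\<close>

theorem fv_divergence:
 fixes e
 assumes g: "adapted_metric A k D g" and T: "smooth_tensor12 A T" and S: "smooth_tensor12 A S" and e: "local_frame g p e U"
 shows "2 * fv g T S p = dv g (ZS g S) p - XS g S p (%i. e i p) (%b a. levi_civita A g (e b) (e a) p) + alS g T S p (%i. e i p)" proof -
 note pg = adapted_metric_pr[OF g]
 note lf = local_frameD[OF e]
 define s where "s = (%i. g p (e i p) (e i p))"
 define f where "f = (%j q. SUM a:Ix. (if fst a = fst j then 0 else s a * s j) * At g S q (e a q) (e a q) (e j q))"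
 define \<nu> where "\<nu> = (%b a. levi_civita A g (e b) (e a) p)"
 define V where "V = (%b a c. levi_civita A g (e b) (%q. S q (e a q) (e c q)) p)"
 define E where "E = (%i. e i p)"
 let ?dA = "%a b. g p (V b a a) (E b) + g p (S p (E a) (E a)) (\<nu> b b) - g p (V b a b) (E a) - g p (S p (E a) (E b)) (\<nu> b a)"
 have Zl1: "ZS g S q = (SUM j:Ix. f j q *\<^sub>R e j q)" if "q : U" for q unfolding f_def s_def by (rule ZS_local(1)[OF g S e that])
 have Zl2: "sfun UNIV (f j)" if "j : Ix" for j unfolding f_def s_def by (rule ZS_local(2)[OF g S e that])
 have on: "aonb g p E" unfolding E_def by (rule lf(5)[OF lf(2)])
 have ss: "s b * s b = 1" if "b : Ix" for b using onb_sq[OF aonb_onb[OF on] that] by (simp add: s_def E_def)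
 have dl: "g p (E a) (E b) = (if a = b then s a else 0)" if "a : Ix" "b : Ix" for a b
  using onb_delta[OF aonb_onb[OF on] that] by (simp add: s_def E_def)
 have sAt: "sfun UNIV (%q. At g S q (e a q) (e a q) (e b q))" if "a : Ix" "b : Ix" for a b by (intro sfun_At[OF pg S] lf(3) that)
 have dAt: "vf_deriv A (e b) (%q. At g S q (e a q) (e a q) (e b q)) p =
   ?dA a b"
  if "a : Ix" "b : Ix" for a b proof -
  note sa = lf(3)[OF that(1)] and sb = lf(3)[OF that(2)]
  note aa = svf_tensor[OF S sa sa] and ab = svf_tensor[OF S sa sb]
  show ?thesis unfolding At_def vf_deriv_diff[OF sfun_metric[OF pg aa sb] sfun_metric[OF pg ab sa]]
    levi_civita_metric[OF pg sb aa sb] levi_civita_metric[OF pg sb ab sa] V_def \<nu>_def E_def by simp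
 qed
 have df: "vf_deriv A (e b) (f b) p = (SUM a:Ix. (if fst a = fst b then 0 else s a * s b) *
   ?dA a b)"
  if b: "b : Ix" for b proof -
  have "vf_deriv A (e b) (f b) p = (SUM a:Ix. vf_deriv A (e b) (%q. (if fst a = fst b then 0 else s a * s b) * At g S q (e a q) (e a q) (e b q)) p)"
   unfolding f_def by (rule vf_deriv_sum) (intro finite_Ix sfun_mult sfun_const open_UNIV sAt b; assumption)+
  thus ?thesis using b by (simp only: vf_deriv_scale[OF sAt] dAt cong: sum.cong)
 qed
 have covZ: "cov g (E b) (ZS g S) p = (SUM j:Ix. vf_deriv A (e b) (f j) p *\<^sub>R E j + f j p *\<^sub>R \<nu> b j)" if b: "b : Ix" for b proof -
  have sZ: "svf UNIV (%q. SUM j:Ix. f j q *\<^sub>R e j q)" by (intro svf_sum svf_scale open_UNIV Zl2 lf(3))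
  have "cov g (E b) (ZS g S) p = levi_civita A g (e b) (ZS g S) p" unfolding cov_levi_civita[OF pg lf(3)[OF b] svf_ZS[OF g S]] E_def ..
  also have "... = levi_civita A g (e b) (%q. SUM j:Ix. f j q *\<^sub>R e j q) p"
   by (rule levi_civita_cong[OF pg lf(3)[OF b] svf_ZS[OF g S] lf(3)[OF b] sZ lf(1,2) refl Zl1])
  also have "... = (SUM j:Ix. vf_deriv A (e b) (f j) p *\<^sub>R E j + f j p *\<^sub>R \<nu> b j)"
   unfolding E_def \<nu>_def by (rule levi_civita_sum[OF pg lf(3)[OF b] finite_Ix lf(3) Zl2])
  finally show ?thesis .
 qed
 have "dv g (ZS g S) p = (SUM b:Ix. s b * g p (cov g (E b) (ZS g S) p) (E b))" using dv_frame[OF g on svf_ZS[OF g S]] by (simp add: s_def E_def)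
 also have "... = (SUM b:Ix. vf_deriv A (e b) (f b) p + (SUM j:Ix. s b * (f j p * g p (\<nu> b j) (E b))))" proof (rule sum.cong[OF refl])
  fix b assume b: "b : Ix"
  have "g p (cov g (E b) (ZS g S) p) (E b) = (SUM j:Ix. vf_deriv A (e b) (f j) p * g p (E j) (E b)) + (SUM j:Ix. f j p * g p (\<nu> b j) (E b))"
   unfolding covZ[OF b] by (simp add: metric_facts[OF pg] sum.distrib)
  also have "(SUM j:Ix. vf_deriv A (e b) (f j) p * g p (E j) (E b)) = (SUM j:Ix. if j = b then vf_deriv A (e b) (f b) p * s b else 0)"
   by (rule sum.cong[OF refl]) (simp add: dl b)
  also have "... = vf_deriv A (e b) (f b) p * s b" using b by simp
  finally show "s b * g p (cov g (E b) (ZS g S) p) (E b) = vf_deriv A (e b) (f b) p + (SUM j:Ix. s b * (f j p * g p (\<nu> b j) (E b)))"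
   using ss[OF b] by (simp add: distrib_left sum_distrib_left mult.left_commute)
 qed
 also have "... = (SUM b:Ix. vf_deriv A (e b) (f b) p) + (SUM j:Ix. f j p * (SUM b:Ix. s b * g p (\<nu> b j) (E b)))"
  unfolding sum.distrib sum_distrib_left by (intro arg_cong2[of _ _ _ _ "(+)"] refl, subst sum.swap, intro sum.cong refl, rule mult.left_commute)
 also have "(SUM b:Ix. vf_deriv A (e b) (f b) p) = od (%a b. s a * s b *
   ?dA a b)" unfolding od_def by (rule trans[OF _ sum.swap], rule sum.cong[OF refl], simp only: df, rule sum.cong[OF refl], simp)
 also have "(SUM j:Ix. f j p * (SUM b:Ix. s b * g p (\<nu> b j) (E b))) = od (%a b. s a * s b * (At g S p (E a) (E a) (E b) * (SUM c:Ix. s c * g p (\<nu> c b) (E c))))"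
  unfolding od_def f_def sum_distrib_right[where A = Ix and r = "sum _ _"]
  by (rule trans[OF _ sum.swap], rule sum.cong[OF refl], rule sum.cong[OF refl], simp add: E_def)
 finally have dvZ: "dv g (ZS g S) p = od (%a b. s a * s b *
   ?dA a b)
  + od (%a b. s a * s b * (At g S p (E a) (E a) (E b) * (SUM c:Ix. s c * g p (\<nu> c b) (E c))))" .
 have fvod: "2 * fv g T S p = od (%a b. s a * s b * g p (DRm g T S p (E a) (E b) (E a)) (E b))"
  unfolding fv_frame[OF g T S on] fctr_od by (simp add: s_def E_def)
 have DR: "DRm g T S p (E a) (E b) (E a) = V b a a + T p (E b) (S p (E a) (E a)) + S p (E b) (\<nu> a a + T p (E a) (E a))
   - (V a b a + T p (E a) (S p (E b) (E a))) - S p (E a) (\<nu> b a + T p (E b) (E a)) + S p (\<nu> a b - \<nu> b a) (E a)"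
  if "a : Ix" "b : Ix" for a b
  unfolding E_def DRm_field[OF pg T S lf(3)[OF that(1)] lf(3)[OF that(2)] lf(3)[OF that(1)]] contorted_connection_def V_def \<nu>_def
   levi_civita_torsion[OF pg lf(3)[OF that(1)] lf(3)[OF that(2)]] ..
 \<comment> \<open>Collects the terms that match only after a and b have been exchanged. They enter
   as \<open>W a b - W b a\<close> and cancel, since the range of summation is symmetric.\<close>
 define W where "W = (%a b. s a * s b * (g p (S p (\<nu> b a) (E b)) (E a) + g p (S p (E a) (\<nu> b b)) (E a) - g p (V b a b) (E a)))"
 have t: "bilinear (S p)" by (rule tensor_bilinear[OF S])
 have "dv g (ZS g S) p - XS g S p E \<nu> + alS g T S p E - 2 * fv g T S p = od (%a b. W a b - W b a)"
  unfolding dvZ fvod XS_def alS_def od_add[symmetric] od_diff[symmetric] proof (rule od_cong, goal_cases)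
  case (1 a b)
  have s': "g p (E i) (E i) = s i" for i by (simp add: s_def E_def)
  show ?case unfolding DR[OF 1(1,2)] s' W_def At_def metric_facts[OF pg] tensor_facts[OF t] by (simp add: algebra_simps)
 qed
 also have "... = 0" unfolding od_diff od_swap[of W] by simp
 finally show ?thesis by (simp add: E_def \<nu>_def)
qed

end

section \<open>Algebra of the Euler-Lagrange equations\<close>

lemma sum_antisym:
 fixes F :: "'i => 'i => real"
 assumes "!!a c. a : I ==> c : I ==> F a c = - F c a" shows "(SUM a:I. SUM c:I. F a c) = 0" proof -
 have "(SUM a:I. SUM c:I. F a c) = (SUM a:I. SUM c:I. - F c a)" by (intro sum.cong refl assms)
 also have "... = - (SUM a:I. SUM c:I. F a c)" unfolding sum_negf by (subst sum.swap) simp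
 finally show ?thesis by simp
qed

context multi_product
begin

lemma Ix_Blk: "i : Blk \<mu> \<longleftrightarrow> i : Ix & fst i = \<mu>" by (auto simp: Blk_def)

lemma sum_Blk_Ix: "(SUM b:Blk \<mu>. F b) = (SUM b:Ix. if fst b = \<mu> then F b else 0)" unfolding Blk_def by (rule sum.inter_filter) simp

lemma Blk_other:
 assumes "i : Ix" "n (fst i) > 1"
 obtains j where "j : Ix" "fst j = fst i" "j ~= i" proof -
 have "card (Blk (fst i) - {i}) > 0" using assms card_Blk[OF fst_Ix[OF assms(1)]] by (subst card_Diff_singleton) (auto simp: Ix_Blk)
 then obtain j where "j : Blk (fst i) - {i}" by (metis card_gt_0_iff ex_in_conv)
 thus ?thesis using that[of j] by (auto simp: Ix_Blk)
qed

text \<open>The skew part of the Euler-Lagrange equations in terms of \<open>w c a b = \<langle>\<nabla>\<^sub>c a, b\<rangle>\<close>.\<close>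

lemma connection_equations:
 fixes w :: "nat \<times> nat => nat \<times> nat => nat \<times> nat => real" and s :: "nat \<times> nat => real"
 defines "K \<equiv> %\<mu> z. SUM b:Ix. if fst b = \<mu> then 0 else s b * w b b z"
 defines "H \<equiv> %z. SUM c:Ix. s c * w c z c"
 defines "X \<equiv> %x y z. (if fst y = fst z then 0 else w z y x) + (if fst x = fst z then 0 else w z x y)
   + (if x = y then s x * K (fst x) z else 0) + (if x = y & fst x ~= fst z then s x * H z else 0)"
 assumes ss: "!!a. a : Ix ==> s a * s a = 1" and anti: "!!a b c. a : Ix ==> b : Ix ==> c : Ix ==> w c a b = - w c b a"
  and E: "!!x y z. x : Ix ==> y : Ix ==> z : Ix ==> X x y z = X x z y" and n: "!!\<mu>. \<mu> : {2..k} ==> n \<mu> > 1"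
  and xyz: "x : Ix" "y : Ix" "z : Ix" "fst x = fst z" "fst x ~= fst y" shows "w z x y = 0" proof -
 have w0: "w c a a = 0" if "a : Ix" "c : Ix" for a c using anti[OF that(1,1,2)] by simp
 \<comment> \<open>For different vectors x, z of one block the equation leaves
   \<open>w y z x + w y x z\<close>, which is zero by skewness.\<close>
 have off: "w z x y = 0" if "x : Ix" "y : Ix" "z : Ix" "fst x = fst z" "fst x ~= fst y" "x ~= z" for x y z proof -
  have "x ~= y" "fst y ~= fst z" "fst z ~= fst y" using that by auto
  hence "w z y x = w y z x + w y x z" using E[OF that(1,2,3)] that unfolding X_def by simp
  thus ?thesis using anti[OF that(3,1,2)] anti[OF that(1,2,3)] by simp
 qed
 have diag: "w x x y = - (s x * (K (fst x) y + H y))" if "x : Ix" "y : Ix" "fst x ~= fst y" for x y proof -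
  have "x ~= y" "fst y ~= fst x" using that by auto
  thus ?thesis using E[OF that(1,2,1)] that anti[OF that(1,2,1)] w0[OF that(1,2)] unfolding X_def by (simp add: algebra_simps)
 qed
 \<comment> \<open>The value h in the diagonal equations is the same for the whole block of x. It is
   also minus the trace of w over this block, to which each of the n vectors contributes - h; hence
   h = n h.\<close>
 have big: "w x x y = 0" if "x : Ix" "y : Ix" "fst x ~= fst y" "n (fst x) ~= 1" for x y proof -
  let ?h = "K (fst x) y + H y"
  have "?h = (SUM b:Ix. (if fst b = fst x then 0 else s b * w b b y) - s b * w b b y)"
   unfolding K_def H_def sum.distrib[symmetric] by (intro sum.cong refl) (simp add: anti[OF that(2)])
  also have "... = (SUM b:Blk (fst x). - (s b * w b b y))" unfolding sum_Blk_Ix by (intro sum.cong refl) simp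
  also have "... = (SUM b:Blk (fst x). ?h)" proof (rule sum.cong[OF refl])
   fix b assume "b : Blk (fst x)"
   hence b: "b : Ix" "fst b = fst x" by (auto simp: Ix_Blk)
   have "- (s b * w b b y) = s b * s b * ?h" using diag[OF b(1) that(2)] b that(3) by (simp add: mult.assoc)
   thus "- (s b * w b b y) = ?h" using ss[OF b(1)] by simp
  qed
  also have "... = n (fst x) * ?h" using card_Blk[OF fst_Ix[OF that(1)]] by simp
  finally have e: "?h = n (fst x) * ?h" .
  have "(real (n (fst x)) - 1) * ?h = n (fst x) * ?h - ?h" by (simp only: left_diff_distrib mult_1_left)
  with e have "(real (n (fst x)) - 1) * ?h = 0" by linarith
  hence "?h = 0" using that(4) by simp
  thus ?thesis using diag[OF that(1-3)] by simp
 qed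
 show ?thesis proof (cases "x = z")
  case False thus ?thesis by (rule off[OF xyz])
 next
  case True
  have "w x x y = 0" proof (cases "n (fst x) = 1")
   case False thus ?thesis by (rule big[OF xyz(1,2,5)])
  next
   case nx: True
   \<comment> \<open>Only the first distribution may have rank 1, so y lies in a larger block. The
     equation for two different vectors of that block gives \<open>K (fst y) y = 0\<close>, and by
     \<open>big\<close> the vector x alone contributes to this sum.\<close>
   have "fst x = 1" using fst_Ix[OF xyz(1)] n[of "fst x"] nx by (cases "fst x = 1") auto
   hence "n (fst y) > 1" using fst_Ix[OF xyz(2)] xyz(5) by (intro n) auto
   then obtain y' where y': "y' : Ix" "fst y' = fst y" "y' ~= y" using Blk_other[OF xyz(2)] by blast
   have "s y' * K (fst y) y = 0" using E[OF y'(1,1) xyz(2)] y' unfolding X_def by simp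
   hence "0 = K (fst y) y" using ss[OF y'(1)] by auto
   also have "K (fst y) y = (SUM b:Ix. if b = x then s x * w x x y else 0)" unfolding K_def proof (rule sum.cong[OF refl])
    fix b assume b: "b : Ix"
    show "(if fst b = fst y then 0 else s b * w b b y) = (if b = x then s x * w x x y else 0)" proof (cases "b = x")
     case True thus ?thesis using xyz(5) by simp
    next
     case bx: False
     have "fst b ~= 1" proof
      assume "fst b = 1"
      hence "{x, b} <= Blk 1" using b xyz(1) \<open>fst x = 1\<close> by (auto simp: Ix_Blk)
      hence "card {x, b} <= card (Blk 1)" by (intro card_mono finite_Blk)
      thus False using card_Blk[of 1] fst_Ix[OF xyz(1)] \<open>fst x = 1\<close> nx bx by simp
     qed
     hence "n (fst b) > 1" using fst_Ix[OF b] by (intro n) auto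
     thus ?thesis using big[OF b xyz(2)] bx by auto
    qed
   qed
   also have "... = s x * w x x y" using xyz(1) by simp
   finally show ?thesis using ss[OF xyz(1)] by auto
  qed
  thus ?thesis using True by simp
 qed
qed

text \<open>If the block of x differs from those of y and z, the equation reads 0 = 2 t x y z; total
  symmetry then removes all mixed components. Diagonal equations control traces over complements of
  blocks. For the block of z one takes the complement of another block: all other terms of that
  trace are mixed.\<close>

lemma contorsion_equations:
 fixes t :: "nat \<times> nat => nat \<times> nat => nat \<times> nat => real" and s :: "nat \<times> nat => real"
 defines "\<tau> \<equiv> %\<mu> z. SUM b:Ix. if fst b = \<mu> then 0 else s b * t b b z"
 assumes ss: "!!a. a : Ix ==> s a * s a = 1" and sym: "!!a b c. a : Ix ==> b : Ix ==> c : Ix ==> t a b c = t b a c"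
   "!!a b c. a : Ix ==> b : Ix ==> c : Ix ==> t a b c = t a c b" and E: "!!x y z. x : Ix ==> y : Ix ==> z : Ix ==>
   (if x = y then s x * \<tau> (fst x) z else 0) + (if x = z then s x * \<tau> (fst x) y else 0) =
   (if fst x = fst y then 0 else t x y z) + (if fst x = fst z then 0 else t x y z)" and k: "k > 2" and n: "!!\<mu>. \<mu> : {2..k} ==> n \<mu> > 1"
 shows "!!x y z. x : Ix ==> y : Ix ==> z : Ix ==> fst x ~= fst y ==> t x y z = 0" and "!!z \<mu>. z : Ix ==> (SUM b:Blk \<mu>. s b * t b b z) = 0"
proof -
 have t2: "t x y z = 0" if "x : Ix" "y : Ix" "z : Ix" "fst x ~= fst y" "fst x ~= fst z" for x y z proof -
  have "x ~= y" "x ~= z" using that by auto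
  thus ?thesis using E[OF that(1-3)] that by simp
 qed
 show t1: "t x y z = 0" if "x : Ix" "y : Ix" "z : Ix" "fst x ~= fst y" for x y z proof (cases "fst x = fst z")
  case True
  thus ?thesis using t2[OF that(2,1,3)] sym(1)[OF that(1-3)] that(4) by simp
 next
  case False thus ?thesis by (rule t2[OF that])
 qed
 have tau0: "\<tau> (fst x) z = 0" if "x : Ix" "z : Ix" "fst x ~= fst z" for x z proof -
  have "x ~= z" using that by auto
  hence "s x * \<tau> (fst x) z = t x x z" using E[OF that(1,1,2)] that by simp
  also have "... = 0" using t1[OF that(1,2,1,3)] sym(2)[OF that(1,1,2)] by simp
  finally show ?thesis using ss[OF that(1)] by auto
 qed
 show "(SUM b:Blk \<mu>. s b * t b b z) = 0" if z: "z : Ix" for z \<mu> proof (cases "\<mu> = fst z")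
  case False
  have "t b b z = 0" if "b : Blk \<mu>" for b using that t1[of b z b] sym(2)[of b b z] z False by (auto simp: Ix_Blk)
  thus ?thesis by simp
 next
  case True
  \<comment> \<open>A distribution other than that of z, with index at least 2 so that its rank is
    positive and a frame vector x exists in it; k > 2 makes both 2 and 3 available.\<close>
  define \<nu> where "\<nu> = (if fst z = 2 then 3 else 2::nat)"
  have \<nu>: "\<nu> : {2..k}" "\<nu> ~= fst z" using k by (auto simp: \<nu>_def)
  have x: "(\<nu>, 0) : Ix" using n[OF \<nu>(1)] \<nu>(1) by (auto simp: Ix_def)
  have "0 = \<tau> \<nu> z" using tau0[OF x z] \<nu> by simp
  also have "... = (SUM b:Blk \<mu>. s b * t b b z)" unfolding \<tau>_def sum_Blk_Ix proof (rule sum.cong[OF refl])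
   fix b assume b: "b : Ix"
   show "(if fst b = \<nu> then 0 else s b * t b b z) = (if fst b = \<mu> then s b * t b b z else 0)" proof (cases "fst b = fst z")
    case True thus ?thesis using \<nu>(2) \<open>\<mu> = fst z\<close> by simp
   next
    case False
    hence "t b b z = 0" using t1[OF b z b] sym(2)[OF b b z] by simp
    thus ?thesis by simp
   qed
  qed
  finally show ?thesis by simp
 qed
qed

section \<open>Evaluation on elementary test tensors\<close>

lemma od_left: "x : Ix ==> od (%a b. if a = x then G b else 0) = (SUM b:Ix. if fst b = fst x then 0 else (G b :: real))" proof -
 assume x: "x : Ix"
 have "od (%a b. if a = x then G b else 0) = (SUM a:Ix. if a = x then (SUM b:Ix. if fst b = fst x then 0 else G b) else 0)" unfolding od_def
 proof (rule sum.cong[OF refl])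
  fix a
  show "(SUM b:Ix. if fst a = fst b then 0 else if a = x then G b else 0) = (if a = x then SUM b:Ix. if fst b = fst x then 0 else G b else 0)"
   by (cases "a = x") (simp_all add: eq_commute cong: if_cong)
 qed
 thus ?thesis using x by simp
qed

lemma od_right: "x : Ix ==> od (%a b. if b = x then G a else 0) = (SUM a:Ix. if fst a = fst x then 0 else (G a :: real))"
 using od_left[of x G] od_swap[of "%a b. if a = x then G b else 0"] by simp

lemma od_both: "x : Ix ==> y : Ix ==> od (%a b. if a = x & b = y then c else 0) = (if fst x = fst y then 0 else (c :: real))" proof -
 assume x: "x : Ix" and y: "y : Ix"
 have "od (%a b. if a = x & b = y then c else 0) = od (%a b. if a = x then (if b = y then c else 0) else 0)" by (rule od_cong) simp
 also have "... = (SUM b:Ix. if b = y then (if fst x = fst y then 0 else c) else 0)" unfolding od_left[OF x] by (rule sum.cong[OF refl]) auto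
 finally show ?thesis using y by simp
qed

lemma od_zero: "od (%a b. 0) = 0" by (simp add: od_def)

context
 fixes g :: "('m, 'n) metric" and p :: 'm and f :: "nat \<times> nat => real^'n" and s :: "nat \<times> nat => real"
 assumes g: "pseudo_riemannian_metric A g" and f: "aonb g p f" and s: "!!i. s i = g p (f i) (f i)"
begin

lemma frame_sq: "a : Ix ==> s a * s a = 1" unfolding s by (rule onb_sq[OF aonb_onb[OF f]])

lemma frame_delta: "a : Ix ==> b : Ix ==> g p (f a) (f b) = (if a = b then s a else 0)" unfolding s by (rule onb_delta[OF aonb_onb[OF f]])

text \<open>A frame vector inserted into an elementary S becomes a Kronecker delta, so two of the
  four terms of \<open>alS\<close> collapse to partial traces of T and the other two to a single
  component.\<close>

lemma alS_elementary:
 assumes T: "bilinear (T p)" and sym: "!!u v w. g p (T p u v) w = g p (T p v u) w" "!!u v w. g p (T p u v) w = g p (T p u w) v"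
  and S: "!!u v. S p u v = (r * g p (f x) u * g p (f y) v) *\<^sub>R f z" and x: "x : Ix" and y: "y : Ix" and z: "z : Ix"
 defines "\<tau> \<equiv> %\<mu> z. SUM b:Ix. if fst b = \<mu> then 0 else s b * g p (T p (f b) (f b)) (f z)"
 shows "alS g T S p f = r * ((if x = y then s x * \<tau> (fst x) z else 0) + (if x = z then s x * \<tau> (fst x) y else 0)
  - (if fst x = fst y then 0 else g p (T p (f x) (f y)) (f z)) - (if fst x = fst z then 0 else g p (T p (f x) (f y)) (f z)))" proof -
 have 1: "od (%a b. s a * s b * g p (T p (f b) (S p (f a) (f a))) (f b)) = r * (if x = y then s x * \<tau> (fst x) z else 0)" (is "?l = _") proof -
  have "?l = od (%a b. if a = x then (if x = y then s x * r else 0) * (s b * g p (T p (f b) (f b)) (f z)) else 0)" proof (rule od_cong, goal_cases)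
   case (1 a b)
   show ?case using frame_sq[OF x] sym(2)[of "f b" "f z" "f b"] by (auto simp: S frame_delta x y 1 tensor_facts[OF T] metric_facts[OF g] mult_ac)
  qed
  thus ?thesis unfolding od_left[OF x] \<tau>_def by (auto simp: sum_distrib_left mult_ac if_distrib[of "%t. _ * t"] cong: if_cong intro!: sum.cong)
 qed
 have 2: "od (%a b. s a * s b * g p (S p (f b) (T p (f a) (f a))) (f b)) = r * (if x = z then s x * \<tau> (fst x) y else 0)" (is "?l = _") proof -
  have "?l = od (%a b. if b = x then (if x = z then s x * r else 0) * (s a * g p (T p (f a) (f a)) (f y)) else 0)" proof (rule od_cong, goal_cases)
   case (1 a b)
   show ?case using frame_sq[OF x] metric_sym[OF g, of p "f y" "T p (f a) (f a)"] by (auto simp: S frame_delta x z 1 metric_facts[OF g] mult_ac)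
  qed
  thus ?thesis unfolding od_right[OF x] \<tau>_def
   by (auto simp: sum_distrib_left mult_ac if_distrib[of "%t. _ * t"] cong: if_cong intro!: sum.cong)
 qed
 have 3: "od (%a b. s a * s b * g p (T p (f a) (S p (f b) (f a))) (f b)) = r * (if fst x = fst y then 0 else g p (T p (f x) (f y)) (f z))" (is "?l = _")
 proof -
  have "?l = od (%a b. if a = y & b = x then r * g p (T p (f x) (f y)) (f z) else 0)" proof (rule od_cong, goal_cases)
   case (1 a b)
   have "g p (T p (f y) (f z)) (f x) = g p (T p (f x) (f y)) (f z)" using sym by metis
   thus ?case using frame_sq[OF x] frame_sq[OF y] by (auto simp: S frame_delta x y 1 tensor_facts[OF T] metric_facts[OF g] algebra_simps)
  qed
  thus ?thesis by (cases "fst x = fst y") (simp_all add: od_both[OF y x])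
 qed
 have 4: "od (%a b. s a * s b * g p (S p (f a) (T p (f b) (f a))) (f b)) = r * (if fst x = fst z then 0 else g p (T p (f x) (f y)) (f z))" (is "?l = _")
 proof -
  have "?l = od (%a b. if a = x & b = z then r * g p (T p (f x) (f y)) (f z) else 0)" proof (rule od_cong, goal_cases)
   case (1 a b)
   have "g p (f y) (T p (f z) (f x)) = g p (T p (f x) (f y)) (f z)" using sym metric_sym[OF g] by metis
   thus ?case using frame_sq[OF x] frame_sq[OF z] by (auto simp: S frame_delta x z 1 metric_facts[OF g] algebra_simps)
  qed
  thus ?thesis by (simp add: od_both[OF x z])
 qed
 have "alS g T S p f = od (%a b. s a * s b * g p (T p (f b) (S p (f a) (f a))) (f b)) + od (%a b. s a * s b * g p (S p (f b) (T p (f a) (f a))) (f b))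
   - od (%a b. s a * s b * g p (T p (f a) (S p (f b) (f a))) (f b)) - od (%a b. s a * s b * g p (S p (f a) (T p (f b) (f a))) (f b))"
  unfolding alS_def od_add[symmetric] od_diff[symmetric] by (rule od_cong) (simp add: s metric_facts[OF g] distrib_left right_diff_distrib)
 thus ?thesis unfolding 1 2 3 4 by (simp only: distrib_left right_diff_distrib)
qed

text \<open>For an elementary S the tensor A is the difference of two elementary expressions that
  arise from each other by exchanging y and z; each of them evaluates to X.\<close>

lemma XS_elementary:
 fixes \<nu> :: "nat \<times> nat => nat \<times> nat => real^'n"
 assumes S: "!!u v. S p u v = (r * g p (f x) u * g p (f y) v) *\<^sub>R f z" and x: "x : Ix" and y: "y : Ix" and z: "z : Ix"
 defines "w \<equiv> %c a b. g p (\<nu> c a) (f b)"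
 defines "K \<equiv> %\<mu> z. SUM b:Ix. if fst b = \<mu> then 0 else s b * w b b z"
 defines "H \<equiv> %z. SUM c:Ix. s c * w c z c"
 defines "X \<equiv> %x y z. (if fst y = fst z then 0 else w z y x) + (if fst x = fst z then 0 else w z x y)
   + (if x = y then s x * K (fst x) z else 0) + (if x = y & fst x ~= fst z then s x * H z else 0)"
 shows "XS g S p f \<nu> = r * (X x y z - X x z y)" proof -
 let ?B = "%x y z a b. s a * s b * (g p (f x) (\<nu> b a) * g p (f y) (f a) * g p (f z) (f b) + g p (f x) (f a) * g p (f y) (\<nu> b a) * g p (f z) (f b)
   + g p (f x) (f a) * g p (f y) (f a) * g p (f z) (\<nu> b b) + g p (f x) (f a) * g p (f y) (f a) * g p (f z) (f b) * H b)"
 have B: "od (%a b. ?B x y z a b) = X x y z"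
  if x: "x : Ix" and y: "y : Ix" and z: "z : Ix" for x y z proof -
  have wg: "g p (f b) (\<nu> c a) = w c a b" for a b c unfolding w_def by (rule metric_sym[OF g])
  have "od (%a b. ?B x y z a b) =
   od (%a b. if a = y & b = z then w z y x else 0) + od (%a b. if a = x & b = z then w z x y else 0)
   + od (%a b. if a = x then (if x = y then s x else 0) * (s b * w b b z) else 0)
   + od (%a b. if a = x & b = z then (if x = y then s x * H z else 0) else 0)" unfolding od_add[symmetric] proof (rule od_cong, goal_cases)
   case (1 a b)
   have e: "s i * (s i * c) = c" if "i : Ix" for i c using frame_sq[OF that] by (simp add: mult.assoc[symmetric])
   show ?case by (cases "a = x"; cases "a = y"; cases "b = z")
     (simp_all add: wg frame_delta x y z 1 e frame_sq distrib_left mult.left_commute mult.assoc)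
  qed
  also have "od (%a b. if a = x then (if x = y then s x else 0) * (s b * w b b z) else 0) = (if x = y then s x * K (fst x) z else 0)"
   unfolding od_left[OF x] K_def by (auto simp: sum_distrib_left mult_ac if_distrib[of "%t. _ * t"] cong: if_cong intro!: sum.cong)
  finally show ?thesis unfolding od_both[OF y z] od_both[OF x z] X_def by simp
 qed
 have "XS g S p f \<nu> = od (%a b. r * (?B x y z a b)
   - r * (?B x z y a b))" unfolding XS_def proof (rule od_cong, goal_cases)
  case (1 a b)
  have H: "(SUM c:Ix. s c * g p (\<nu> c b) (f c)) = H b" by (simp add: H_def w_def)
  have At: "At g S p u v w = r * (g p (f x) u * g p (f y) v * g p (f z) w - g p (f x) u * g p (f z) v * g p (f y) w)" for u v w
   by (simp add: At_def S metric_facts[OF g] algebra_simps)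
  show ?case unfolding s[symmetric] H At by (simp only: algebra_simps)
 qed
 also have "... = r * (X x y z - X x z y)" unfolding od_diff B[OF x y z, symmetric] B[OF x z y, symmetric]
  by (simp add: od_def sum_distrib_left right_diff_distrib if_distrib[of "%t. r * t"] cong: if_cong)
 finally show ?thesis .
qed

end

end

section \<open>Translation of the geometric conditions to adapted frames\<close>

context multi_product
begin

lemma D_memI:
 assumes g: "adapted_metric A k D g" and f: "aonb g p f" and \<mu>: "\<mu> : {1..k}" and v: "!!b. b : Ix ==> fst b ~= \<mu> ==> g p v (f b) = 0"
 shows "v : D \<mu> p" proof -
 have "v = (SUM i:Ix. (g p (f i) (f i) * g p v (f i)) *\<^sub>R f i)" by (rule aonb_expand[OF g f])
 also have "... : D \<mu> p" proof (rule subspace_sum[OF D_subspace[OF \<mu>]])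
  fix i assume i: "i : Ix"
  show "(g p (f i) (f i) * g p v (f i)) *\<^sub>R f i : D \<mu> p" proof (cases "fst i = \<mu>")
   case True thus ?thesis using aonb_D[OF f i] by (intro subspace_mul[OF D_subspace[OF \<mu>]]) simp
  next
   case False thus ?thesis using v[OF i] subspace_0[OF D_subspace[OF \<mu>]] by simp
  qed
 qed
 finally show ?thesis .
qed

lemma D_orth_frame:
 assumes g: "adapted_metric A k D g" and f: "aonb g p f" and \<mu>: "\<mu> : {1..k}" and v: "v : D \<mu> p" and b: "b : Ix" "fst b ~= \<mu>"
 shows "g p v (f b) = 0" "g p (f b) v = 0"
 using adapted_orth[OF g \<mu> fst_Ix[OF b(1)] _ v aonb_D[OF f b(1)]] b(2) metric_sym[OF adapted_metric_pr[OF g], of p v] by (metis)+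

lemma D_expand:
 assumes g: "adapted_metric A k D g" and f: "aonb g p f" and \<mu>: "\<mu> : {1..k}" and v: "v : D \<mu> p"
 shows "v = (SUM i:Blk \<mu>. (g p (f i) (f i) * g p v (f i)) *\<^sub>R f i)"
 using onb_expand[OF adapted_metric_pr[OF g] aonb_block[OF f, of \<mu>]] v aonb_span[OF g f \<mu>] by simp

lemma perp_iff:
 assumes g: "adapted_metric A k D g" and f: "aonb g p f" and \<mu>: "\<mu> : {1..k}"
 shows "(ALL w:D \<mu> p. g p v w = 0) \<longleftrightarrow> (ALL b:Ix. fst b = \<mu> --> g p v (f b) = 0)" proof
 assume *: "ALL w:D \<mu> p. g p v w = 0"
 show "ALL b:Ix. fst b = \<mu> --> g p v (f b) = 0" proof (intro ballI impI)
  fix b assume b: "b : Ix" "fst b = \<mu>"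
  show "g p v (f b) = 0" by (rule bspec[OF *]) (use aonb_D[OF f b(1)] b(2) in simp)
 qed
next
 assume *: "ALL b:Ix. fst b = \<mu> --> g p v (f b) = 0"
 show "ALL w:D \<mu> p. g p v w = 0" proof
  fix w assume w: "w : D \<mu> p"
  have z: "g p v (f i) = 0" if "i : Blk \<mu>" for i using * that by (simp add: Ix_Blk)
  show "g p v w = 0" by (subst D_expand[OF g f \<mu> w]) (simp add: metric_facts[OF adapted_metric_pr[OF g]] z)
 qed
qed

lemma g_perp_frame:
 assumes g: "adapted_metric A k D g" and f: "aonb g p f" and \<mu>: "\<mu> : {1..k}"
 shows "v : g_perp g (D \<mu>) p \<longleftrightarrow> (ALL b:Ix. fst b : {\<mu>} --> g p v (f b) = 0)"
 unfolding g_perp_def mem_Collect_eq perp_iff[OF g f \<mu>] by simp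

lemma g_perp_sum_frame:
 assumes g: "adapted_metric A k D g" and f: "aonb g p f" and \<mu>: "\<mu> : {1..k}" and \<nu>: "\<nu> : {1..k}"
 shows "v : g_perp g (dist_sum (D \<mu>) (D \<nu>)) p \<longleftrightarrow> (ALL b:Ix. fst b : {\<mu>, \<nu>} --> g p v (f b) = 0)" proof -
 note pg = adapted_metric_pr[OF g]
 have "v : g_perp g (dist_sum (D \<mu>) (D \<nu>)) p \<longleftrightarrow> (ALL w:D \<mu> p. g p v w = 0) & (ALL w:D \<nu> p. g p v w = 0)" proof
  assume *: "v : g_perp g (dist_sum (D \<mu>) (D \<nu>)) p"
  have "g p v (w + w') = 0" if "w : D \<mu> p" "w' : D \<nu> p" for w w' using * that unfolding g_perp_def dist_sum_def by blast
  from this[OF _ subspace_0[OF D_subspace[OF \<nu>]]] this[OF subspace_0[OF D_subspace[OF \<mu>]]]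
  show "(ALL w:D \<mu> p. g p v w = 0) & (ALL w:D \<nu> p. g p v w = 0)" by simp
 next
  assume "(ALL w:D \<mu> p. g p v w = 0) & (ALL w:D \<nu> p. g p v w = 0)"
  thus "v : g_perp g (dist_sum (D \<mu>) (D \<nu>)) p" by (auto simp: g_perp_def dist_sum_def metric_add[OF pg])
 qed
 thus ?thesis unfolding perp_iff[OF g f \<mu>] perp_iff[OF g f \<nu>] by blast
qed

text \<open>I lists the distributions to which W is the orthogonal complement: one of them for the
  second fundamental form, two for the mixed conditions. The projection keeps exactly the frame
  components outside I.\<close>

lemma g_proj_zero_iff:
 assumes g: "adapted_metric A k D g" and f: "aonb g p f" and W: "!!v. v : W p \<longleftrightarrow> (ALL b:Ix. fst b : I --> g p v (f b) = 0)"
 shows "g_proj g W p v = 0 \<longleftrightarrow> (ALL b:Ix. fst b ~: I --> g p v (f b) = 0)" proof -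
 note pg = adapted_metric_pr[OF g]
 note on = aonb_onb[OF f]
 define w where "w = (SUM i:Ix. (if fst i : I then 0 else g p (f i) (f i) * g p v (f i)) *\<^sub>R f i)"
 have wb: "g p w (f b) = (if fst b : I then 0 else g p v (f b))" if "b : Ix" for b
  unfolding w_def onb_coeff[OF pg on that] using onb_sq[OF on that] by (simp add: mult_ac)
 have fW: "f b : W p" if "b : Ix" "fst b ~: I" for b unfolding W using onb_orth[OF on that(1)] that(2) by (intro ballI impI) blast
 have proj: "g_proj g W p v = w" unfolding g_proj_def proof (rule the_equality)
  show "w : W p & (ALL z:W p. g p (v - w) z = 0)" proof (intro conjI ballI)
   show "w : W p" unfolding W using wb by simp
   fix z assume z: "z : W p"
   have "g p (v - w) z = (SUM i:Ix. g p (f i) (f i) * g p z (f i) * g p (v - w) (f i))"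
    by (subst aonb_expand[OF g f, of z]) (simp add: metric_facts[OF pg])
   also have "... = 0" by (intro sum.neutral ballI) (use z in \<open>auto simp: W metric_diff[OF pg] wb\<close>)
   finally show "g p (v - w) z = 0" .
  qed
 next
  fix w' assume w': "w' : W p & (ALL z:W p. g p (v - w') z = 0)"
  have "g p w' (f b) = g p w (f b)" if b: "b : Ix" for b proof (cases "fst b : I")
   case True thus ?thesis using w' b wb[OF b] unfolding W by simp
  next
   case False
   hence "g p (v - w') (f b) = 0" using w' fW[OF b] by blast
   thus ?thesis using False wb[OF b] by (simp add: metric_diff[OF pg])
  qed
  thus "w' = w" using aonb_expand[OF g f, of w'] aonb_expand[OF g f, of w] by (simp cong: sum.cong)
 qed
 show ?thesis unfolding proj proof
  assume "w = 0"
  thus "ALL b:Ix. fst b ~: I --> g p v (f b) = 0" using wb metric_zero[OF pg] by metis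
 next
  assume "ALL b:Ix. fst b ~: I --> g p v (f b) = 0"
  thus "w = 0" unfolding w_def by (intro sum.neutral) auto
 qed
qed

lemma local_frame_section: "local_frame g p e U ==> i : Ix ==> section_of A (D (fst i)) (e i)"
 unfolding section_of_def smooth_vfield_svf using local_frameD(3,4) by blast

lemma totally_geodesic_frame:
 assumes g: "adapted_metric A k D g" and f: "aonb g p f" and \<mu>: "\<mu> : {1..k}"
 shows "second_fundamental_form A g (D \<mu>) X Y p = 0 \<longleftrightarrow>
  (ALL b:Ix. fst b ~= \<mu> --> g p (levi_civita A g X Y p + levi_civita A g Y X p) (f b) = 0)"
 unfolding second_fundamental_form_def using g_proj_zero_iff[where W = "g_perp g (D \<mu>)", OF g f g_perp_frame[OF g f \<mu>]] by simp

text \<open>The inner products of the frame fields are constant on U, so differentiating them gives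
  zero.\<close>

lemma frame_connection_skew:
 assumes g: "adapted_metric A k D g" and e: "local_frame g p e U" and i: "a : Ix" "b : Ix" "c : Ix"
 shows "g p (levi_civita A g (e c) (e a) p) (e b p) = - g p (levi_civita A g (e c) (e b) p) (e a p)" proof -
 note pg = adapted_metric_pr[OF g] and lf = local_frameD[OF e]
 have "vf_deriv A (e c) (%q. g q (e a q) (e b q)) p = vf_deriv A (e c) (%q. if a = b then g p (e a p) (e a p) else 0) p"
 proof (rule vf_deriv_cong[OF lf(1,2) _ refl])
  fix q assume q: "q : U"
  show "g q (e a q) (e b q) = (if a = b then g p (e a p) (e a p) else 0)"
   using onb_delta[OF aonb_onb[OF lf(5)[OF q]] i(1,2)] lf(6)[OF q i(1)] by (cases "a = b") simp_all
 qed
 hence "g p (levi_civita A g (e c) (e a) p) (e b p) + g p (e a p) (levi_civita A g (e c) (e b) p) = 0"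
  unfolding levi_civita_metric[OF pg lf(3)[OF i(3)] lf(3)[OF i(1)] lf(3)[OF i(2)], symmetric] vf_deriv_const .
 thus ?thesis using metric_sym[OF pg, of p "e a p"] by simp
qed

section \<open>Parallel distributions and local products\<close>

definition parallel :: "('m, 'n) metric => bool" where
 "parallel g \<longleftrightarrow> (ALL X \<mu> p. svf UNIV X --> \<mu> : {1..k} --> (ALL q. X q : D \<mu> q) --> (ALL v. cov g v X p : D \<mu> p))"

text \<open>Symmetric and skew parts of a covariant derivative vanish separately: for fields of one
  distribution by total geodesy and integrability, for fields of two distributions tested against a
  third by the mixed conditions. What is left, a derivative along the distribution of the test
  vector, reduces to the first case by differentiating an inner product that is zero.\<close>

lemma parallelI:
 assumes g: "adapted_metric A k D g" and lp: "locally_product A k D g"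
  and mg: "!!\<mu> \<nu>. [|\<mu> : {1..k}; \<nu> : {1..k}; \<mu> ~= \<nu>|] ==> mixed_totally_geodesic A g (D \<mu>) (D \<nu>)"
  and mi: "!!\<mu> \<nu>. [|\<mu> : {1..k}; \<nu> : {1..k}; \<mu> ~= \<nu>|] ==> mixed_integrable A g (D \<mu>) (D \<nu>)" shows "parallel g"
 unfolding parallel_def proof (intro allI impI)
 note pg = adapted_metric_pr[OF g]
 have half: "a = 0" if "a + b = 0" "a - b = 0" for a b :: real using that by simp
 have same: "g p (levi_civita A g X Y p) (f b) = 0"
  if \<mu>: "\<mu> : {1..k}" and X: "section_of A (D \<mu>) X" and Y: "section_of A (D \<mu>) Y" and f: "aonb g p f" and b: "b : Ix" "fst b ~= \<mu>"
  for \<mu> X Y p f b proof (rule half)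
  have sX: "svf UNIV X" and sY: "svf UNIV Y" using X Y by (simp_all add: section_of_def smooth_vfield_svf)
  have "second_fundamental_form A g (D \<mu>) X Y p = 0" using lp \<mu> X Y unfolding locally_product_def totally_geodesic_def by blast
  thus "g p (levi_civita A g X Y p) (f b) + g p (levi_civita A g Y X p) (f b) = 0"
   using b unfolding totally_geodesic_frame[OF g f \<mu>] metric_add[OF pg] by blast
  have "section_of A (D \<mu>) (lie_bracket A X Y)" using lp \<mu> X Y unfolding locally_product_def integrable_distribution_def by blast
  hence "lie_bracket A X Y p : D \<mu> p" by (simp add: section_of_def)
  thus "g p (levi_civita A g X Y p) (f b) - g p (levi_civita A g Y X p) (f b) = 0"
   unfolding metric_diff(1)[OF pg, symmetric] levi_civita_torsion[OF pg sX sY] by (rule D_orth_frame(1)[OF g f \<mu> _ b])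
 qed
 have mixed: "g p (levi_civita A g X Y p) (f b) = 0"
  if \<mu>: "\<mu> : {1..k}" and \<nu>: "\<nu> : {1..k}" and n: "\<mu> ~= \<nu>" and X: "section_of A (D \<mu>) X" and Y: "section_of A (D \<nu>) Y" and f: "aonb g p f"
   and b: "b : Ix" "fst b ~: {\<mu>, \<nu>}" for \<mu> \<nu> X Y p f b proof (rule half)
  have sX: "svf UNIV X" and sY: "svf UNIV Y" using X Y by (simp_all add: section_of_def smooth_vfield_svf)
  note pz = g_proj_zero_iff[where W = "g_perp g (dist_sum (D \<mu>) (D \<nu>))", OF g f g_perp_sum_frame[OF g f \<mu> \<nu>]]
  have "g_proj g (g_perp g (dist_sum (D \<mu>) (D \<nu>))) p (levi_civita A g X Y p + levi_civita A g Y X p) = 0"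
   using mg[OF \<mu> \<nu> n] X Y unfolding mixed_totally_geodesic_def by blast
  thus "g p (levi_civita A g X Y p) (f b) + g p (levi_civita A g Y X p) (f b) = 0" using b unfolding pz metric_add[OF pg] by blast
  have "g_proj g (g_perp g (dist_sum (D \<mu>) (D \<nu>))) p (lie_bracket A X Y p) = 0"
   using mi[OF \<mu> \<nu> n] X Y unfolding mixed_integrable_def by blast
  thus "g p (levi_civita A g X Y p) (f b) - g p (levi_civita A g Y X p) (f b) = 0"
   using b unfolding pz metric_diff(1)[OF pg, symmetric] levi_civita_torsion[OF pg sX sY] by blast
 qed
 fix X \<mu> p v assume sX: "svf UNIV X" and \<mu>: "\<mu> : {1..k}" and XD: "ALL q. X q : D \<mu> q"
 have X: "section_of A (D \<mu>) X" using sX XD by (simp add: section_of_def smooth_vfield_svf)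
 obtain e U where e: "local_frame g p e U" using local_frame_exists[OF g, of p] by (elim exE)
 note lf = local_frameD[OF e]
 have f: "aonb g p (%i. e i p)" by (rule lf(5)[OF lf(2)])
 show "cov g v X p : D \<mu> p" proof (rule D_memI[OF g f \<mu>])
  fix b assume b: "b : Ix" "fst b ~= \<mu>"
  have "g p (cov g (e c p) X p) (e b p) = 0" if c: "c : Ix" for c unfolding cov_levi_civita[OF pg lf(3)[OF c] sX, symmetric]
  proof (cases "fst c = \<mu>")
   case True
   thus "g p (levi_civita A g (e c) X p) (e b p) = 0" using same[OF \<mu> _ X f b, of "e c"] local_frame_section[OF e c] by simp
  next
   case cm: False
   show "g p (levi_civita A g (e c) X p) (e b p) = 0" proof (cases "fst c = fst b")
    case False
    thus ?thesis using mixed[OF fst_Ix[OF c] \<mu> cm local_frame_section[OF e c] X f b(1)] b by simp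
   next
    case True
    have "vf_deriv A (e c) (%q. g q (X q) (e b q)) p = vf_deriv A (e c) (%q. 0) p" proof (rule vf_deriv_cong[OF open_UNIV UNIV_I _ refl])
     fix q show "g q (X q) (e b q) = 0" by (rule adapted_orth[OF g \<mu> fst_Ix[OF b(1)] b(2)[symmetric] _ lf(4)[OF b(1)]]) (use XD in blast)
    qed
    hence 1: "g p (levi_civita A g (e c) X p) (e b p) + g p (X p) (levi_civita A g (e c) (e b) p) = 0"
     unfolding levi_civita_metric[OF pg lf(3)[OF c] sX lf(3)[OF b(1)], symmetric] vf_deriv_const .
    have "levi_civita A g (e c) (e b) p : D (fst b) p" by (rule D_memI[OF g f fst_Ix[OF b(1)]])
      (use same[OF fst_Ix[OF b(1)] _ local_frame_section[OF e b(1)] f, of "e c"] local_frame_section[OF e c] True in simp)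
    hence "g p (X p) (levi_civita A g (e c) (e b) p) = 0" using adapted_orth[OF g \<mu> fst_Ix[OF b(1)] b(2)[symmetric]] XD by blast
    thus ?thesis using 1 by simp
   qed
  qed
  hence z: "g p (cov g (e c p) X p) (e b p) = 0" if "c : Ix" for c using that .
  note l = linear_cov[OF pg sX, of p]
  show "g p (cov g v X p) (e b p) = 0" by (subst aonb_expand[OF g f, of v])
    (simp add: linear_sum[OF l] linear_cmul[OF l] metric_facts[OF pg] z)
 qed
qed

end

context multi_product
begin

lemma locally_productI:
 assumes g: "adapted_metric A k D g"
  and w: "!!p e U x y z. local_frame g p e U ==> x : Ix ==> y : Ix ==> z : Ix ==> fst x = fst z ==> fst x ~= fst y ==>
    g p (levi_civita A g (e z) (e x) p) (e y p) = 0" shows "locally_product A k D g" proof -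
 note pg = adapted_metric_pr[OF g]
 have in_D: "levi_civita A g X Y p : D \<mu> p" if \<mu>: "\<mu> : {1..k}" and X: "section_of A (D \<mu>) X" and Y: "section_of A (D \<mu>) Y" for \<mu> X Y p
 proof -
  have sX: "svf UNIV X" and sY: "svf UNIV Y" and XD: "!!q. X q : D \<mu> q" and YD: "!!q. Y q : D \<mu> q"
   using X Y by (simp_all add: section_of_def smooth_vfield_svf)
  obtain e U where e: "local_frame g p e U" using local_frame_exists[OF g, of p] by (elim exE)
  note lf = local_frameD[OF e]
  have f: "aonb g p (%i. e i p)" by (rule lf(5)[OF lf(2)])
  show ?thesis proof (rule D_memI[OF g f \<mu>])
   fix b assume b: "b : Ix" "fst b ~= \<mu>"
   have z: "g p (cov g (e c p) Y p) (e b p) = 0" if c: "c : Blk \<mu>" for c proof -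
    have c: "c : Ix" "fst c = \<mu>" using c by (simp_all add: Ix_Blk)
    \<comment> \<open>Y is orthogonal to \<open>e b\<close>, so the derivative can be moved from Y
      to \<open>e b\<close>. Then Y enters by its value at p alone and may be expanded in the
      frame.\<close>
    have "vf_deriv A (e c) (%q. g q (Y q) (e b q)) p = vf_deriv A (e c) (%q. 0) p" proof (rule vf_deriv_cong[OF open_UNIV UNIV_I _ refl])
     fix q show "g q (Y q) (e b q) = 0" by (rule adapted_orth[OF g \<mu> fst_Ix[OF b(1)] b(2)[symmetric] YD lf(4)[OF b(1)]])
    qed
    hence "g p (levi_civita A g (e c) Y p) (e b p) + g p (Y p) (levi_civita A g (e c) (e b) p) = 0"
     unfolding levi_civita_metric[OF pg lf(3)[OF c(1)] sY lf(3)[OF b(1)], symmetric] vf_deriv_const .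
    moreover have "g p (Y p) (levi_civita A g (e c) (e b) p) = 0"
    proof (subst D_expand[OF g f \<mu> YD], unfold metric_sum[OF pg] metric_scale[OF pg], intro sum.neutral ballI)
     fix i assume "i : Blk \<mu>"
     hence i: "i : Ix" "fst i = \<mu>" by (simp_all add: Ix_Blk)
     have "g p (e i p) (levi_civita A g (e c) (e b) p) = - g p (levi_civita A g (e c) (e i) p) (e b p)"
      using frame_connection_skew[OF g e i(1) b(1) c(1)] metric_sym[OF pg, of p "e i p"] by simp
     also have "... = 0" using w[OF e i(1) b(1) c(1)] i c b by simp
     finally show "g p (e i p) (e i p) * g p (Y p) (e i p) * g p (e i p) (levi_civita A g (e c) (e b) p) = 0" by simp
    qed
    ultimately show ?thesis unfolding cov_levi_civita[OF pg lf(3)[OF c(1)] sY, symmetric] by simp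
   qed
   note l = linear_cov[OF pg sY, of p]
   show "g p (levi_civita A g X Y p) (e b p) = 0" unfolding cov_levi_civita[OF pg sX sY]
    by (subst D_expand[OF g f \<mu> XD]) (simp add: linear_sum[OF l] linear_cmul[OF l] metric_facts[OF pg] z)
  qed
 qed
 show ?thesis unfolding locally_product_def integrable_distribution_def totally_geodesic_def proof (intro ballI conjI allI impI; elim conjE)
  fix \<mu> X Y assume \<mu>: "\<mu> : {1..k}" and X: "section_of A (D \<mu>) X" and Y: "section_of A (D \<mu>) Y"
  have sX: "svf UNIV X" and sY: "svf UNIV Y" using X Y by (simp_all add: section_of_def smooth_vfield_svf)
  have "lie_bracket A X Y q : D \<mu> q" for q unfolding levi_civita_torsion[OF pg sX sY, symmetric]
   by (intro subspace_diff[OF D_subspace[OF \<mu>]] in_D[OF \<mu> X Y] in_D[OF \<mu> Y X])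
  thus "section_of A (D \<mu>) (lie_bracket A X Y)" unfolding section_of_def smooth_vfield_svf by (intro conjI allI svf_lie_bracket sX sY)
  fix p
  have "g p (levi_civita A g X Y p + levi_civita A g Y X p) (oe g p b) = 0" if "b : Ix" "fst b ~= \<mu>" for b
   by (rule D_orth_frame(1)[OF g oe_aonb[OF g] \<mu> subspace_add[OF D_subspace[OF \<mu>] in_D[OF \<mu> X Y] in_D[OF \<mu> Y X]] that])
  thus "second_fundamental_form A g (D \<mu>) X Y p = 0" unfolding totally_geodesic_frame[OF g oe_aonb[OF g] \<mu>] by blast
 qed
qed

lemma At_linear:
 assumes g: "pseudo_riemannian_metric A g" and S: "smooth_tensor12 A S"
 shows "linear (%u. At g S p u v w)" "linear (%v. At g S p u v w)" "linear (%w. At g S p u v w)" by (simp_all add: linear_iff At_simps[OF g S])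

text \<open>The derivative of a frame vector stays in its block and has skew components there. In
  the first pair of terms these meet a factor symmetric in the two indices; in the second pair an
  exchange of the indices swaps the two summands up to sign. Either way the sum is
  antisymmetric.\<close>

lemma XS_parallel:
 assumes g: "adapted_metric A k D g" and S: "smooth_tensor12 A S" and f: "aonb g p f"
  and skew: "!!a b c. a : Ix ==> b : Ix ==> c : Ix ==> g p (\<nu> c a) (f b) = - g p (\<nu> c b) (f a)"
  and par: "!!a b c. a : Ix ==> b : Ix ==> c : Ix ==> fst a ~= fst b ==> g p (\<nu> c a) (f b) = 0" shows "XS g S p f \<nu> = 0" proof -
 note pg = adapted_metric_pr[OF g]
 define s where "s = (%i. g p (f i) (f i))"
 define w where "w = (%c a b. g p (\<nu> c a) (f b))"
 note lin = At_linear[OF pg S, of p]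
 have ex: "\<nu> c a = (SUM i:Ix. (s i * w c a i) *\<^sub>R f i)" for c a unfolding s_def w_def by (rule aonb_expand[OF g f])
 have 1: "(SUM a:Ix. if fst a = fst b then 0 else s a * s b * (At g S p (\<nu> b a) (f a) (f b) + At g S p (f a) (\<nu> b a) (f b))) = 0" (is "?l = 0")
  if b: "b : Ix" for b proof -
  have "?l = (SUM a:Ix. SUM c:Ix. if fst a = fst b then 0 else s a * s b * s c * w b a c * (At g S p (f c) (f a) (f b) + At g S p (f a) (f c) (f b)))"
   unfolding ex[of b] linear_sum[OF lin(1)] linear_sum[OF lin(2)] linear_cmul[OF lin(1)] linear_cmul[OF lin(2)]
   by (intro sum.cong refl) (simp add: sum_distrib_left sum.distrib[symmetric] algebra_simps)
  also have "... = 0" proof (rule sum_antisym, goal_cases)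
   case ac: (1 a c)
   show ?case using skew[OF ac b] par[OF ac b] par[OF ac(2,1) b] unfolding w_def by (cases "fst a = fst c") (auto simp: algebra_simps)
  qed
  finally show ?thesis .
 qed
 have 2: "(SUM b:Ix. if fst a = fst b then 0 else s a * s b * (At g S p (f a) (f a) (\<nu> b b) + At g S p (f a) (f a) (f b) * (SUM c:Ix. s c * w c b c))) = 0" (is "?l = 0")
  if a: "a : Ix" for a proof -
  have "?l = (SUM b:Ix. SUM c:Ix. if fst a = fst b then 0 else s a * s b * s c * (w b b c * At g S p (f a) (f a) (f c) + w c b c * At g S p (f a) (f a) (f b)))"
   unfolding ex linear_sum[OF lin(3)] linear_cmul[OF lin(3)]
   by (intro sum.cong refl) (simp add: sum_distrib_left sum.distrib[symmetric] algebra_simps)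
  also have "... = 0" proof (rule sum_antisym, goal_cases)
   case bc: (1 b c)
   show ?case using skew[OF bc bc(1)] skew[OF bc bc(2)] par[OF bc bc(1)] par[OF bc bc(2)] par[OF bc(2,1) bc(1)] par[OF bc(2,1) bc(2)] unfolding w_def
    by (cases "fst b = fst c") (auto simp: algebra_simps)
  qed
  finally show ?thesis .
 qed
 have "XS g S p f \<nu> = od (%a b. s a * s b * (At g S p (\<nu> b a) (f a) (f b) + At g S p (f a) (\<nu> b a) (f b)))
   + od (%a b. s a * s b * (At g S p (f a) (f a) (\<nu> b b) + At g S p (f a) (f a) (f b) * (SUM c:Ix. s c * w c b c)))"
  unfolding XS_def od_add[symmetric] by (rule od_cong) (simp add: s_def w_def distrib_left)
 also have "od (%a b. s a * s b * (At g S p (\<nu> b a) (f a) (f b) + At g S p (f a) (\<nu> b a) (f b))) = 0"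
  unfolding od_def by (subst sum.swap) (simp add: 1)
 also have "od (%a b. s a * s b * (At g S p (f a) (f a) (\<nu> b b) + At g S p (f a) (f a) (f b) * (SUM c:Ix. s c * w c b c))) = 0"
  unfolding od_def by (simp add: 2)
 finally show ?thesis by simp
qed

text \<open>By symmetry of T, two of the four terms contain T on frame vectors of different blocks,
  and the other two contain the trace of T over the complement of a block.\<close>

lemma alS_zero:
 assumes g: "adapted_metric A k D g" and S: "smooth_tensor12 A S" and T: "smooth_tensor12 A T"
  and sym: "!!u v w. g p (T p u v) w = g p (T p v u) w" "!!u v w. g p (T p u v) w = g p (T p u w) v"
  and T0: "!!a b. a : Ix ==> b : Ix ==> fst a ~= fst b ==> T p (f a) (f b) = 0"
  and tr: "!!b. b : Ix ==> (SUM a:Ix. if fst a = fst b then 0 else g p (f a) (f a) *\<^sub>R T p (f a) (f a)) = 0" shows "alS g T S p f = 0" proof -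
 note pg = adapted_metric_pr[OF g]
 note tT = tensor_facts[OF tensor_bilinear[OF T]] and tS = tensor_facts[OF tensor_bilinear[OF S]]
 define s where "s = (%i. g p (f i) (f i))"
 have tr': "(SUM a:Ix. if fst a = fst b then 0 else s a *\<^sub>R T p (f a) (f a)) = 0" if "b : Ix" for b using tr[OF that] by (simp only: s_def)
 have 1: "(SUM b:Ix. if fst a = fst b then 0 else s a * s b * g p (T p (f b) (S p (f a) (f a))) (f b)) = 0" if a: "a : Ix" for a proof -
  have "(SUM b:Ix. if fst a = fst b then 0 else s a * s b * g p (T p (f b) (S p (f a) (f a))) (f b)) =
   s a * g p (SUM b:Ix. if fst b = fst a then 0 else s b *\<^sub>R T p (f b) (f b)) (S p (f a) (f a))" unfolding metric_sum[OF pg] sum_distrib_left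
   by (rule sum.cong[OF refl]) (use sym(2)[of "f _" "S p (f a) (f a)"] in \<open>auto simp: metric_zero[OF pg] metric_scale[OF pg]\<close>)
  thus ?thesis by (simp add: tr'[OF a] metric_zero[OF pg])
 qed
 have 2: "(SUM a:Ix. if fst a = fst b then 0 else s a * s b * g p (S p (f b) (T p (f a) (f a))) (f b)) = 0" if b: "b : Ix" for b proof -
  have "(SUM a:Ix. if fst a = fst b then 0 else s a * s b * g p (S p (f b) (T p (f a) (f a))) (f b)) =
   s b * g p (S p (f b) (SUM a:Ix. if fst a = fst b then 0 else s a *\<^sub>R T p (f a) (f a))) (f b)"
   unfolding tS metric_sum[OF pg] sum_distrib_left by (rule sum.cong[OF refl]) (auto simp: metric_zero[OF pg] metric_scale[OF pg] tS)
  thus ?thesis by (simp add: tr'[OF b] metric_zero[OF pg] tS)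
 qed
 have "alS g T S p f = od (%a b. s a * s b * g p (T p (f b) (S p (f a) (f a))) (f b)) + od (%a b. s a * s b * g p (S p (f b) (T p (f a) (f a))) (f b))"
  unfolding alS_def od_add[symmetric] proof (rule od_cong, goal_cases)
  case ab: (1 a b)
  have "g p (T p (f a) (S p (f b) (f a))) (f b) = 0" unfolding sym(2)[of "f a" "S p (f b) (f a)" "f b"] by (simp add: T0[OF ab] metric_zero[OF pg])
  thus ?case using T0[OF ab(2,1) ab(3)[symmetric]] by (simp add: s_def metric_facts[OF pg] tS distrib_left)
 qed
 also have "od (%a b. s a * s b * g p (T p (f b) (S p (f a) (f a))) (f b)) = 0" unfolding od_def by (simp add: 1)
 also have "od (%a b. s a * s b * g p (S p (f b) (T p (f a) (f a))) (f b)) = 0" unfolding od_def by (subst sum.swap) (simp add: 2)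
 finally show ?thesis by simp
qed

text \<open>The Levi-Civita part and the contorsion both map sections of \<open>D \<mu>\<close> to
  sections, hence so does every term of the curvature.\<close>

lemma curvature_parallel:
 assumes g: "adapted_metric A k D g" and T: "smooth_tensor12 A T" and par: "parallel g"
  and TD: "!!p \<mu> u v. \<mu> : {1..k} ==> v : D \<mu> p ==> T p u v : D \<mu> p" and \<mu>: "\<mu> : {1..k}" and w: "w : D \<mu> p"
 shows "Rm g T p u v w : D \<mu> p" proof -
 note pg = adapted_metric_pr[OF g]
 let ?N = "contorted_connection A g T"
 have N: "?N X Y q : D \<mu> q" if X: "svf UNIV X" and Y: "svf UNIV Y" "ALL q. Y q : D \<mu> q" for X Y q
  unfolding contorted_connection_def cov_levi_civita[OF pg X Y(1)]
  using par \<mu> Y TD[OF \<mu>] unfolding parallel_def by (intro subspace_add[OF D_subspace[OF \<mu>]]) blast+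
 obtain e U where e: "local_frame g p e U" using local_frame_exists[OF g, of p] by (elim exE)
 note lf = local_frameD[OF e]
 obtain X where X: "svf UNIV X" "X p = u" by (rule field_through)
 obtain Y where Y: "svf UNIV Y" "Y p = v" by (rule field_through)
 \<comment> \<open>A global section through w: constant coefficients in front of frame fields, which
   lie in the distribution everywhere and not only on U.\<close>
 define W where "W = (%q. SUM i:Blk \<mu>. (g p (e i p) (e i p) * g p w (e i p)) *\<^sub>R e i q)"
 have W: "svf UNIV W" unfolding W_def by (intro svf_sum svf_scale_const open_UNIV lf(3)) (simp add: Ix_Blk)
 have WD: "ALL q. W q : D \<mu> q" unfolding W_def
  by (intro allI subspace_sum[OF D_subspace[OF \<mu>]] subspace_mul[OF D_subspace[OF \<mu>]]) (use lf(4) in \<open>auto simp: Ix_Blk\<close>)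
 have Wp: "W p = w" unfolding W_def by (rule D_expand[OF g lf(5)[OF lf(2)] \<mu> w, symmetric])
 have NX: "ALL q. ?N X W q : D \<mu> q" and NY: "ALL q. ?N Y W q : D \<mu> q" by (intro allI N X Y W WD)+
 have "Rm g T p (X p) (Y p) (W p) = ?N Y (?N X W) p - ?N X (?N Y W) p + ?N (lie_bracket A X Y) W p"
  unfolding Rm_curvature[OF pg T X(1) Y(1) W, symmetric] curvature_def ..
 also have "... : D \<mu> p"
  by (intro subspace_add[OF D_subspace[OF \<mu>]] subspace_diff[OF D_subspace[OF \<mu>]] N svf_contorted[OF pg T] svf_lie_bracket X Y W WD NX NY)
 finally show ?thesis unfolding X(2) Y(2) Wp .
qed

section \<open>Traces of the contorsion in adapted frames\<close>

lemma trace_along_D: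
 assumes g: "adapted_metric A k D g" and T: "smooth_tensor12 A T" and \<mu>: "\<mu> : {1..k}" and f: "aonb g p f"
 shows "trace_along A g (D \<mu>) T p = (SUM i:Blk \<mu>. g p (f i) (f i) *\<^sub>R T p (f i) (f i))" proof -
 have b: "bilinear (T p)" by (rule tensor_bilinear[OF T])
 have "trace_along A g (D \<mu>) T p = (SUM i:Blk \<mu>. g p (oe g p i) (oe g p i) *\<^sub>R T p (oe g p i) (oe g p i))"
  unfolding sum_Blk[OF \<mu>] trace_along_def Let_def D_dim[OF \<mu>] by (simp add: oe_def)
 also have "... = (SUM i:Blk \<mu>. g p (f i) (f i) *\<^sub>R T p (f i) (f i))"
  by (rule block_trace_indep[OF g oe_aonb[OF g] f \<mu>]) (use b in \<open>simp_all add: bilinear_def\<close>)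
 finally show ?thesis .
qed

text \<open>The frame inside \<open>trace_along\<close> is a choice that means something only if an
  orthonormal frame of the complement exists. One is exhibited by renumbering the frame vectors
  outside the block; then traces do not depend on the choice.\<close>

lemma trace_along_perp:
 assumes g: "adapted_metric A k D g" and T: "smooth_tensor12 A T" and \<mu>: "\<mu> : {1..k}" and f: "aonb g p f"
 shows "trace_along A g (g_perp g (D \<mu>)) T p = (SUM i:Ix - Blk \<mu>. g p (f i) (f i) *\<^sub>R T p (f i) (f i))" proof -
 note pg = adapted_metric_pr[OF g]
 let ?J = "Ix - Blk \<mu>" and ?W = "g_perp g (D \<mu>)"
 have fin: "finite ?J" by simp
 have sp: "?W q = span (h ` ?J)" if h: "aonb g q h" for q h proof
  show "?W q <= span (h ` ?J)" proof
   fix v assume v: "v : ?W q"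
   have "v = (SUM i:Ix. (g q (h i) (h i) * g q v (h i)) *\<^sub>R h i)" by (rule aonb_expand[OF g h])
   also have "... : span (h ` ?J)" proof (rule span_sum)
    fix i assume i: "i : Ix"
    show "(g q (h i) (h i) * g q v (h i)) *\<^sub>R h i : span (h ` ?J)" proof (cases "i : Blk \<mu>")
     case True
     hence "g q v (h i) = 0" using v i unfolding g_perp_frame[OF g h \<mu>] by (simp add: Ix_Blk)
     thus ?thesis by (simp add: span_zero)
    next
     case False thus ?thesis using i by (intro span_scale span_base imageI) simp
    qed
   qed
   finally show "v : span (h ` ?J)" .
  qed
  have "h i : ?W q" if "i : ?J" for i unfolding g_perp_frame[OF g h \<mu>] using that onb_orth[OF aonb_onb[OF h], of i] by (auto simp: Ix_Blk)
  moreover have "subspace (?W q)" unfolding subspace_def g_perp_def by (simp add: metric_facts[OF pg])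
  ultimately show "span (h ` ?J) <= ?W q" by (intro span_minimal) auto
 qed
 have onJ: "onb g q ?J h" if "aonb g q h" for q h by (rule onb_subset[OF aonb_onb[OF that]]) blast
 have dim: "dim (?W p) = card ?J" unfolding sp[OF f] dim_span_eq_card_independent[OF onb_independent(2)[OF pg onJ[OF f]]]
  by (rule card_image[OF onb_independent(1)[OF pg onJ[OF f]]])
 obtain e U where e: "local_frame g p e U" using local_frame_exists[OF g, of p] by (elim exE)
 note lf = local_frameD[OF e]
 obtain h where h: "bij_betw h {..<card ?J} ?J" using ex_bij_betw_nat_finite[OF fin] by (auto simp: lessThan_atLeast0)
 have hJ: "h a : ?J" if "a < card ?J" for a using bij_betwE[OF h] that by simp
 have hin: "h a ~= h b" if "a < card ?J" "b < card ?J" "a ~= b" for a b using bij_betw_imp_inj_on[OF h] that by (auto dest: inj_onD)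
 have "orthonormal_frame_at A g ?W p (%a. e (h a))" unfolding orthonormal_frame_at_def dim proof (intro conjI allI impI exI[of _ U] ballI)
  show "smooth_vfield A (e (h a))" if "a < card ?J" for a unfolding smooth_vfield_svf by (rule lf(3)) (use hJ[OF that] in simp)
  fix q assume q: "q : U"
  note on = lf(5)[OF q]
  have "(%a. e (h a) q) ` {..<card ?J} = (%i. e i q) ` (h ` {..<card ?J})" by (rule image_image[symmetric])
  thus "?W q = span ((%a. e (h a) q) ` {..<card ?J})" unfolding sp[OF on] bij_betw_imp_surj_on[OF h] by simp
  show "g q (e (h a) q) (e (h a) q) : {1, -1}" if "a < card ?J" for a by (rule onb_sign[OF aonb_onb[OF on]]) (use hJ[OF that] in simp)
  show "g q (e (h a) q) (e (h b) q) = 0" if "a < card ?J" "b < card ?J" "a ~= b" for a b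
   by (rule onb_orth[OF aonb_onb[OF on] _ _ hin[OF that]]) (use hJ that in simp_all)
 qed (use lf(1,2) in simp_all)
 hence of: "orthonormal_frame_at A g ?W p (onframe A g ?W p)" unfolding onframe_def by (rule someI[where P = "orthonormal_frame_at A g ?W p"])
 define E where "E = (%a. onframe A g ?W p a p)"
 from of obtain V where V: "p : V" and Vq: "ALL q:V. ?W q = span ((%a. onframe A g ?W p a q) ` {..<dim (?W p)}) \<and>
    (ALL a<dim (?W p). g q (onframe A g ?W p a q) (onframe A g ?W p a q) : {1, -1}) \<and>
    (ALL a<dim (?W p). ALL b<dim (?W p). a ~= b --> g q (onframe A g ?W p a q) (onframe A g ?W p b q) = 0)"
  unfolding orthonormal_frame_at_def by (elim conjE exE)
 note Ep = bspec[OF Vq V, folded E_def]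
 have E: "onb g p {..<dim (?W p)} E" using Ep by (intro onbI) (simp_all add: E_def)
 have spE: "span (E ` {..<dim (?W p)}) = span (f ` ?J)" unfolding sp[OF f, symmetric] by (rule conjunct1[OF Ep, symmetric])
 have b: "bilinear (T p)" by (rule tensor_bilinear[OF T])
 have "trace_along A g ?W T p = (SUM a:{..<dim (?W p)}. g p (E a) (E a) *\<^sub>R T p (E a) (E a))" unfolding trace_along_def Let_def E_def ..
 also have "... = (SUM i:?J. g p (f i) (f i) *\<^sub>R T p (f i) (f i))"
  by (rule onb_trace_indep[OF pg E onJ[OF f] spE]) (use b in \<open>simp_all add: bilinear_def\<close>)
 finally show ?thesis .
qed

end

section \<open>Sufficiency\<close>

context adapted_family
begin

lemma gram_time:
 assumes c: "c : A" and q: "q : fst c" shows "((%t. gt t q (ci c q (axis i 1)) (ci c q (axis j 1))) has_real_derivative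
  dird (%z. gram (gt (fst z)) c (snd z) $ i $ j) (0, snd c q) (1, 0)) (at 0)" proof -
 have "((%t. gram (gt (fst (t, snd c q))) c (snd (t, snd c q)) $ i $ j) has_real_derivative
  dird (%z. gram (gt (fst z)) c (snd z) $ i $ j) (0, snd c q) (1, 0)) (at 0)"
  by (rule partial_time_derivative[OF gram_joint[OF c]]) (use q zero_J in simp)
 thus ?thesis using c q by (simp add: gram_def metric_comp_def coord_vec_eq)
qed

text \<open>Off the support of the variation the Christoffel symbols are stationary at time 0. They
  solve a linear system G C = L whose data are stationary there, and differentiating the system
  avoids the derivative of an inverse matrix.\<close>

lemma \<Gamma>f_time_metric:
 assumes T: "!!t. Tt t = T" and c: "c : A" "p : fst c" and U: "open U" "p : U" and z: "!!q u v. q : U ==> deriv (%s. gt s q u v) 0 = 0"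
 shows "dird (%z. \<Gamma>f c z i j) (0, snd c p) (1, 0) = 0" proof -
 let ?x = "snd c p" and ?O = "J \<times> chart_image c"
 define G where "G = (%z. gram (gt (fst z)) c (snd z))"
 have sG: "smooth_on ?O (%z. G z $ a $ b)" for a b unfolding G_def by (rule gram_joint[OF c(1)])
 have x: "?x : chart_image c" using c by simp
 have zx: "(0, ?x) : ?O" using x zero_J by simp
 have oV: "open (snd c ` (U Int fst c))" by (rule open_chart_img[OF c(1) U(1)])
 have xV: "?x : snd c ` (U Int fst c)" using U c by simp
 have G0: "dird (%z. G z $ a $ b) (0, y) (1, 0) = 0" if "y : snd c ` (U Int fst c)" for a b y proof -
  from that obtain q where q: "q : U" "q : fst c" "y = snd c q" by blast
  show ?thesis using DERIV_imp_deriv[OF gram_time[OF c(1) q(2), of a b]] z[OF q(1)] unfolding G_def q(3) by simp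
 qed
 have mixed: "dird (%z. dird (%z. G z $ a $ b) z (0, v)) (0, ?x) (1, 0) = 0" for a b v proof -
  have "dird (%z. dird (%z. G z $ a $ b) z (0, v)) (0, ?x) (1, 0) = dird (%z. dird (%z. G z $ a $ b) z (1, 0)) (0, ?x) (0, v)"
   by (rule second_dird_symmetric[OF open_Jc[OF c(1)] sG zx])
  also have "... = dird (%y. dird (%z. G z $ a $ b) (0, y) (1, 0)) ?x v" by (rule partial_dird_eq[OF smooth_on_dird[OF sG] zx, symmetric])
  also have "... = 0" by (rule dird_eq[OF has_derivative_transform_within_open[OF has_derivative_const oV xV]]) (simp add: G0)
  finally show ?thesis .
 qed
 define L where "L = (%t m. (1/2) * (dird (%z. G z $ j $ m) (t, ?x) (0, axis i 1) + dird (%z. G z $ i $ m) (t, ?x) (0, axis j 1)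
   - dird (%z. G z $ i $ j) (t, ?x) (0, axis m 1)))"
 define C where "C = (%t. christ (gram (gt t) c) ?x i j)"
 have LC: "L t m = (SUM l:UNIV. G (t, ?x) $ m $ l * C t $ l)" if t: "t : J" for t m proof -
  let ?G = "gram (gt t) c ?x"
  have tx: "(t, ?x) : ?O" using t x by simp
  have nz: "det ?G ~= 0" by (rule det_gram_nz[OF fam_pr[OF t] c(1) x])
  have d: "dird (%y. gram (gt t) c y $ a $ b) ?x v = dird (%z. G z $ a $ b) (t, ?x) (0, v)" for a b v
   using partial_dird_eq[OF sG tx, of a b v] by (simp add: G_def)
  have "C t = matrix_inv ?G *v (\<chi> m. L t m)" unfolding C_def christ_def d L_def ..
  hence "?G *v C t = (\<chi> m. L t m)" using nz by (simp add: matrix_vector_mul_assoc matrix_inv_right_left invertible_det_nz)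
  hence "(?G *v C t) $ m = L t m" by simp
  thus ?thesis by (simp add: matrix_vector_mult_def G_def)
 qed
 have dG: "((%t. G (t, ?x) $ a $ b) has_real_derivative 0) (at 0)" for a b using partial_time_derivative[OF sG zx, of a b] G0[OF xV, of a b] by simp
 have dL: "((%t. L t m) has_real_derivative 0) (at 0)" for m proof -
  have "((%t. dird (%z. G z $ a $ b) (t, ?x) (0, v)) has_real_derivative 0) (at 0)" for a b v
   using partial_time_derivative[OF smooth_on_dird[OF sG] zx, of a b "(0, v)"] unfolding mixed .
  note t = this
  show ?thesis unfolding L_def by (rule DERIV_cong[OF DERIV_cmult[OF DERIV_diff[OF DERIV_add[OF t t] t]]]) simp
 qed
 have sC: "smooth_on ?O (%z. christ (gram (gt (fst z)) c) (snd z) i j)" by (rule christ_joint[OF c(1)])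
 let ?C' = "dird (%z. christ (gram (gt (fst z)) c) (snd z) i j) (0, ?x) (1, 0)"
 have dC: "(C has_vector_derivative ?C') (at 0)" using partial_time_vector_derivative[OF sC zx] by (simp add: C_def[abs_def])
 have dCl: "((%t. C t $ l) has_real_derivative ?C' $ l) (at 0)" for l
  using bounded_linear.has_vector_derivative[OF bounded_linear_vec_nth dC] by (simp add: has_real_derivative_iff_has_vector_derivative)
 have "(SUM l:UNIV. G (0, ?x) $ m $ l * ?C' $ l) = 0" for m proof -
  have "((%t. SUM l:UNIV. G (t, ?x) $ m $ l * C t $ l) has_real_derivative (SUM l:UNIV. 0 * C 0 $ l + ?C' $ l * G (0, ?x) $ m $ l)) (at 0)"
   by (intro DERIV_sum DERIV_mult dG dCl)
  moreover have "((%t. SUM l:UNIV. G (t, ?x) $ m $ l * C t $ l) has_real_derivative 0) (at 0)"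
   by (rule has_field_derivative_transform_within_open[OF dL open_J zero_J]) (rule LC)
  ultimately have "(SUM l:UNIV. 0 * C 0 $ l + ?C' $ l * G (0, ?x) $ m $ l) = 0" by (rule DERIV_unique)
  thus ?thesis by (simp add: mult.commute)
 qed
 hence GC: "G (0, ?x) *v ?C' = 0" by (simp add: vec_eq_iff matrix_vector_mult_def)
 have "det (G (0, ?x)) ~= 0" unfolding G_def using det_joint[OF c(1) zx] .
 hence "matrix_inv (G (0, ?x)) *v (G (0, ?x) *v ?C') = ?C'" by (simp add: matrix_vector_mul_assoc matrix_inv_right_left invertible_det_nz)
 hence C'0: "?C' = 0" unfolding GC by simp
 have "((%t. C t + tcomp c T ?x i j) has_vector_derivative 0) (at 0)" using has_vector_derivative_add[OF dC has_vector_derivative_const] C'0 by simp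
 moreover have "(%t. \<Gamma>f c (t, ?x) i j) = (%t. C t + tcomp c T ?x i j)" by (simp add: \<Gamma>f_def ccomp_def C_def T)
 ultimately have "((%t. \<Gamma>f c (t, ?x) i j) has_vector_derivative 0) (at 0)" by simp
 thus ?thesis by (rule vector_derivative_unique_at[OF \<Gamma>f_time[OF c(1) x]])
qed

lemma \<Gamma>f_time_tensor:
 assumes g: "!!t. gt t = g" and c: "c : A" "p : fst c" shows "((%t. Tt t p (ci c p (axis i 1)) (ci c p (axis j 1))) has_vector_derivative
   ci c p (dird (%z. \<Gamma>f c z i j) (0, snd c p) (1, 0))) (at 0)" proof -
 let ?x = "snd c p"
 have x: "?x : chart_image c" using c by simp
 let ?S = "dird (%z. \<Gamma>f c z i j) (0, ?x) (1, 0)"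
 have "((%t. \<Gamma>f c (t, ?x) i j - christ (gram g c) ?x i j) has_vector_derivative ?S) (at 0)"
  using has_vector_derivative_diff[OF \<Gamma>f_time[OF c(1) x] has_vector_derivative_const] by simp
 hence "((%t. tcomp c (Tt t) ?x i j) has_vector_derivative ?S) (at 0)" by (simp add: \<Gamma>f_def ccomp_def g)
 hence "((%t. ci c p (tcomp c (Tt t) ?x i j)) has_vector_derivative ci c p ?S) (at 0)"
  by (rule bounded_linear.has_vector_derivative[OF linear_conv_bounded_linear[THEN iffD1, OF linear_ci[OF c]]])
 thus ?thesis using c by (simp add: tcomp_def tensor12_comp_def coord_vec_eq)
qed

lemma derivative_tensor_zero:
 assumes S: "smooth_tensor12 A S" and c: "c : A" "p : fst c" and z: "!!i j. tcomp c S (snd c p) i j = 0" shows "S p u v = 0" proof -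
 have "cc c p (S p u v) = cc c p 0" unfolding tensor_chart[OF S c] bl_def z by (simp add: cc_simps[OF c])
 thus ?thesis unfolding cc_inject[OF c] .
qed

text \<open>Serves both kinds of variation, which differ only in the reason why the derivative of
  the connection vanishes off K.\<close>

lemma sufficient_derivative:
 assumes par: "parallel (gt 0)" and TD: "!!p \<mu> u v. \<mu> : {1..k} ==> v : D \<mu> p ==> Tt 0 p u v : D \<mu> p"
  and sym: "!!p u v w. gt 0 p (Tt 0 p u v) w = gt 0 p (Tt 0 p v u) w" "!!p u v w. gt 0 p (Tt 0 p u v) w = gt 0 p (Tt 0 p u w) v"
  and T0: "!!p f a b. aonb (gt 0) p f ==> a : Ix ==> b : Ix ==> fst a ~= fst b ==> Tt 0 p (f a) (f b) = 0"
  and tr: "!!p f b. aonb (gt 0) p f ==> b : Ix ==> (SUM a:Ix. if fst a = fst b then 0 else gt 0 p (f a) (f a) *\<^sub>R Tt 0 p (f a) (f a)) = 0"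
  and \<Omega>: "\<Omega> : sets borel" "\<Omega> <= C" "compact C" and K: "compact K" "K <= \<Omega>"
  and supp: "!!p c i j. p ~: K ==> c : A ==> p : fst c ==> dird (%z. \<Gamma>f c z i j) (0, snd c p) (1, 0) = 0"
 shows "((%t. action A k D \<Omega> (gt t) (Tt t)) has_real_derivative 0) (at 0)" proof -
 note g = fam_metric[OF zero_J] and T = fam_tensor[OF zero_J]
 note pg = adapted_metric_pr[OF g]
 obtain S where S: "smooth_tensor12 A S"
  and Sc: "ALL c:A. ALL x:chart_image c. ALL i j. tcomp c S x i j = dird (%z. \<Gamma>f c z i j) (0, x) (1, 0)"
  using fam_derivative_tensor_exists by (elim exE conjE)
 have Sc': "tcomp c S x i j = dird (%z. \<Gamma>f c z i j) (0, x) (1, 0)" if "c : A" "x : chart_image c" for c x i j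
  using bspec[OF bspec[OF Sc that(1)] that(2)] by blast
 have S0: "S p u v = 0" if "p ~: K" for p u v proof (rule derivative_tensor_zero[OF S chart_at_in in_chart_at])
  show "tcomp (chart_at A p) S (snd (chart_at A p) p) i j = 0" for i j
   unfolding Sc'[OF chart_at_in snd_in_image[OF in_chart_at]] by (rule supp[OF that chart_at_in in_chart_at])
 qed
 \<comment> \<open>The initial curvature maps each distribution to itself, and the distributions are
   orthogonal for every metric of the family. So its mixed contraction is zero at all times, and the
   condition \<open>conserved\<close> of the first variation becomes 0 = 0.\<close>
 have cons: "ctr (gt t) c x (rc (ccomp (gt 0) (Tt 0) c) x) = 0" if c: "c : A" and x: "x : chart_image c" and t: "t : J" for c x t proof -
  let ?p = "chart_inv c x" and ?R = "rc (ccomp (gt 0) (Tt 0) c) x" and ?e = "oe (gt t) (chart_inv c x)"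
  note gt = fam_metric[OF t]
  have p: "?p : fst c" and sx: "snd c ?p = x" using c x by simp_all
  have "ctr (gt t) c (snd c ?p) (rc (ccomp (gt 0) (Tt 0) c) x) =
    fctr (gt t) ?p ?e (%u v w. ci c ?p (?R (cc c ?p u) (cc c ?p v) (cc c ?p w)))"
   by (rule ctr_fctr[OF gt oe_aonb[OF gt] c p rc_linear(2,1,3)[OF ccomp_smooth[OF pg T c] x]])
  also have "(%u v w. ci c ?p (?R (cc c ?p u) (cc c ?p v) (cc c ?p w))) = Rm (gt 0) (Tt 0) ?p"
   by (simp only: Rm_chart[OF pg T c p, unfolded sx, symmetric] ci_cc[OF c p])
  also have "fctr (gt t) ?p ?e (Rm (gt 0) (Tt 0) ?p) = 0" proof -
   have "od (%i j. gt t ?p (?e i) (?e i) * gt t ?p (?e j) (?e j) *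
     gt t ?p (Rm (gt 0) (Tt 0) ?p (?e i) (?e j) (?e i)) (?e j)) = od (%i j. 0)" proof (rule od_cong, goal_cases)
    case (1 i j)
    have "gt t ?p (Rm (gt 0) (Tt 0) ?p (?e i) (?e j) (?e i)) (?e j) = 0"
     by (rule adapted_orth[OF gt fst_Ix[OF 1(1)] fst_Ix[OF 1(2)] 1(3) curvature_parallel[OF g T par TD fst_Ix[OF 1(1)]]])
      (use aonb_D[OF oe_aonb[OF gt]] 1 in simp_all)
    thus ?case by simp
   qed
   hence "2 * fctr (gt t) ?p ?e (Rm (gt 0) (Tt 0) ?p) = 0" unfolding fctr_od od_zero .
   thus ?thesis by simp
  qed
  finally show ?thesis unfolding sx .
 qed
 have cons': "ctr (gt t) c x (rc (ccomp (gt 0) (Tt 0) c) x) * vol_density (gt t) c x =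
   ctr (gt 0) c x (rc (ccomp (gt 0) (Tt 0) c) x) * vol_density (gt 0) c x" if "c : A" "x : chart_image c" "t : J" for c x t
  using cons[OF that] cons[OF that(1,2) zero_J] by simp
 have fv: "fv (gt 0) (Tt 0) S p = (1/2) * dv (gt 0) (ZS (gt 0) S) p" for p proof -
  obtain e U where e: "local_frame (gt 0) p e U" using local_frame_exists[OF g, of p] by (elim exE)
  note lf = local_frameD[OF e]
  have f: "aonb (gt 0) p (%i. e i p)" by (rule lf(5)[OF lf(2)])
  have "XS (gt 0) S p (%i. e i p) (%b a. levi_civita A (gt 0) (e b) (e a) p) = 0" proof (rule XS_parallel[OF g S f frame_connection_skew[OF g e]])
   fix a b c assume i: "a : Ix" "b : Ix" "c : Ix" "fst a ~= fst b"
   have "cov (gt 0) (e c p) (e a) p : D (fst a) p" using par lf(3)[OF i(1)] fst_Ix[OF i(1)] lf(4)[OF i(1)] unfolding parallel_def by blast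
   thus "gt 0 p (levi_civita A (gt 0) (e c) (e a) p) (e b p) = 0" unfolding cov_levi_civita[OF pg lf(3)[OF i(3)] lf(3)[OF i(1)]]
    by (rule D_orth_frame(1)[OF g f fst_Ix[OF i(1)] _ i(2) i(4)[symmetric]])
  qed
  moreover have "alS (gt 0) (Tt 0) S p (%i. e i p) = 0" by (rule alS_zero[OF g S T sym T0[OF f] tr[OF f]])
  ultimately show ?thesis using fv_divergence[OF g T S e] by simp
 qed
 note d = divergence_theorem[OF g svf_ZS[OF g S] K(1) ZS_zero[OF g S0] K(2)]
 have "((%t. action A k D \<Omega> (gt t) (Tt t)) has_real_derivative
   set_lebesgue_integral (volume_measure A (gt 0)) \<Omega> (fv (gt 0) (Tt 0) S)) (at 0)" by (rule first_variation(1)[OF S Sc' cons' \<Omega>])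
 also have "set_lebesgue_integral (volume_measure A (gt 0)) \<Omega> (fv (gt 0) (Tt 0) S) = 0"
  unfolding fv[abs_def] using d by (simp add: set_integral_mult_right)
 finally show ?thesis .
qed

end

section \<open>Necessity\<close>

context smooth_mfd
begin

text \<open>A positive value of h would persist on a coordinate ball, which is not a null
  set.\<close>

lemma integral_zero_imp_zero:
 assumes g: "pseudo_riemannian_metric A g" and c: "c : A" and h: "sfun UNIV h" "!!q. 0 <= h q"
  and K: "K <= fst c" "K <= \<Omega>" "!!q. q ~: K ==> h q = 0"
  and i: "set_integrable (volume_measure A g) \<Omega> h" "set_lebesgue_integral (volume_measure A g) \<Omega> h = 0" shows "h p = 0"
proof (rule ccontr)
 assume "h p ~= 0"
 hence p: "p : fst c" and hp: "0 < h p" using K h(2)[of p] by (blast, simp)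
 define F where "F = (%x. indicator (snd c ` fst c) x * (h (chart_inv c x) * vol_density g c x))"
 have ind: "indicator \<Omega> q *\<^sub>R h q = indicator (fst c) q *\<^sub>R h q" for q
  using K(3)[of q] K(1,2) by (cases "q : K") (auto simp: indicator_def)
 have meas: "h : borel_measurable borel" using continuous_on_sfun[OF open_UNIV h(1)] by (rule borel_measurable_continuous_onI)
 have bc: "fst c : sets borel" using open_dom[OF c] by simp
 have "set_integrable (volume_measure A g) (fst c) h" "set_lebesgue_integral (volume_measure A g) (fst c) h = 0"
  using i unfolding set_integrable_def set_lebesgue_integral_def ind by auto
 hence F: "integrable lborel F" "(\<integral>x. F x \<partial>lborel) = 0"
  unfolding volume_integral(1)[OF g c bc order_refl meas] volume_integral(2)[OF g c bc order_refl meas] F_def by auto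
 have F_in: "F x = h (chart_inv c x) * vol_density g c x" if "x : chart_image c" for x using that by (simp add: F_def chart_image_def)
 have "0 <= F x" for x using h(2) vol_density_pos[OF g c, of x] by (cases "x : chart_image c") (auto simp: F_def chart_image_def)
 hence AE: "AE x in lborel. F x = 0" using integral_nonneg_eq_0_iff_AE[OF F(1)] F(2) by simp
 have "continuous_on (chart_image c) (%x. h (chart_inv c x))" by (rule smooth_on_continuous_on[OF sfun_smooth[OF h(1) c]])
 hence "open (chart_image c Int (%x. h (chart_inv c x)) -` {0<..})" by (rule continuous_open_preimage) (auto intro: open_chart_image[OF c])
 hence "open {x : chart_image c. 0 < h (chart_inv c x)}" by (simp add: Int_def vimage_def)
 moreover have "snd c p : {x : chart_image c. 0 < h (chart_inv c x)}" using p c hp by simp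
 ultimately obtain r where r: "0 < r" "ball (snd c p) r <= {x : chart_image c. 0 < h (chart_inv c x)}" using open_contains_ball by blast
 have "AE x in lborel. x ~: ball (snd c p) r" using AE proof eventually_elim
  fix x assume x: "F x = 0"
  show "x ~: ball (snd c p) r" proof
   assume "x : ball (snd c p) r"
   hence "x : chart_image c" "0 < h (chart_inv c x)" using r by auto
   thus False using x F_in vol_density_pos[OF g c, of x] by simp
  qed
 qed
 hence "ball (snd c p) r : null_sets lborel" by (subst AE_iff_null_sets) auto
 thus False using content_ball_pos[OF r(1), of "snd c p"] by (simp add: null_sets_def measure_def)
qed

text \<open>On a compact manifold the only admissible domain is the manifold itself, which is why
  connectedness is assumed; otherwise a coordinate ball will do.\<close>

lemma action_domain_exists:
 fixes p :: 'm
 assumes "connected (UNIV :: 'm set)" shows "EX \<Omega>. action_domain \<Omega> & p : \<Omega>" proof (cases "compact (UNIV :: 'm set)")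
 case True
 thus ?thesis using assms by (intro exI[of _ UNIV]) (simp add: action_domain_def)
next
 case False
 let ?c = "chart_at A p"
 have c: "?c : A" and p: "p : fst ?c" by simp_all
 obtain r where r: "0 < r" "cball (snd ?c p) r <= chart_image ?c" using open_contains_cball open_chart_image[OF c] snd_in_image[OF p] by blast
 have ball: "ball (snd ?c p) r <= chart_image ?c" using r ball_subset_cball by blast
 let ?\<Omega> = "chart_inv ?c ` ball (snd ?c p) r"
 have cont: "continuous_on (chart_image ?c) (chart_inv ?c)" by (rule continuous_on_chart_inv[OF c])
 have eq: "?\<Omega> = {q : fst ?c. snd ?c q : ball (snd ?c p) r}" proof
  show "?\<Omega> <= {q : fst ?c. snd ?c q : ball (snd ?c p) r}" using ball c by auto
  show "{q : fst ?c. snd ?c q : ball (snd ?c p) r} <= ?\<Omega>" proof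
   fix q assume "q : {q : fst ?c. snd ?c q : ball (snd ?c p) r}"
   thus "q : ?\<Omega>" using c by (intro image_eqI[of _ _ "snd ?c q"]) auto
  qed
 qed
 have cK: "compact (chart_inv ?c ` cball (snd ?c p) r)" by (rule compact_continuous_image[OF continuous_on_subset[OF cont r(2)] compact_cball])
 have "closure ?\<Omega> <= chart_inv ?c ` cball (snd ?c p) r"
  by (rule closure_minimal[OF image_mono[OF ball_subset_cball] compact_imp_closed[OF cK]])
 hence "compact (closure ?\<Omega>)" by (metis cK closed_closure compact_Int_closed inf.absorb_iff2)
 moreover have "open ?\<Omega>" unfolding eq by (rule open_chart_preimg[OF c open_ball])
 moreover have "connected ?\<Omega>" by (rule connected_continuous_image[OF continuous_on_subset[OF cont ball] connected_ball])
 moreover have pO: "p : ?\<Omega>" unfolding eq using r by simp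
 ultimately show ?thesis using False r(1) by (intro exI[of _ ?\<Omega>] conjI) (auto simp: action_domain_def)
qed

lemma elementary_tensor_smooth:
 assumes g: "pseudo_riemannian_metric A g" and \<phi>: "sfun UNIV \<phi>" and X: "svf UNIV X" and Y: "svf UNIV Y" and Z: "svf UNIV Z"
 shows "smooth_tensor12 A (%q u v. (\<phi> q * g q (X q) u * g q (Y q) v) *\<^sub>R Z q)" unfolding smooth_tensor12_def
proof (intro conjI allI ballI)
 show "bilinear (%u v. (\<phi> p * g p (X p) u * g p (Y p) v) *\<^sub>R Z p)" for p
  unfolding bilinear_def by (simp add: linear_iff metric_facts[OF g] scaleR_add_left distrib_left distrib_right mult_ac)
 fix c i j assume c: "c : A"
 let ?S = "%q u v. (\<phi> q * g q (X q) u * g q (Y q) v) *\<^sub>R Z q"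
 have O: "open (chart_image c)" by (rule open_chart_image[OF c])
 have "smooth_on (chart_image c) (%x. (\<phi> (chart_inv c x) * (vrep c X x \<bullet> (gram g c x *v axis i 1)) * (vrep c Y x \<bullet> (gram g c x *v axis j 1))) *\<^sub>R vrep c Z x)"
  by (intro smooth_on_scaleR smooth_on_mult smooth_on_quadratic smooth_on_const O sfun_smooth[OF \<phi> c] vrep_smooth[OF X c] vrep_smooth[OF Y c] vrep_smooth[OF Z c] gram_smooth[OF g c])
 moreover have "(tensor12_comp A c ?S i j \<circ> chart_inv c) x =
   (\<phi> (chart_inv c x) * (vrep c X x \<bullet> (gram g c x *v axis i 1)) * (vrep c Y x \<bullet> (gram g c x *v axis j 1))) *\<^sub>R vrep c Z x"
  if x: "x : chart_image c" for x using c x inv_in_dom[OF c x]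
  by (simp add: tensor12_comp_def coord_vec_eq cc_simps vrep_def metric_coords_inner[OF g c])
 ultimately show "smooth_on (chart_image c) (tensor12_comp A c ?S i j \<circ> chart_inv c)" by (subst smooth_on_cong[OF O])
qed

lemma tcomp_linear_family:
 assumes "c : A" "x : chart_image c" shows "tcomp c (%p u v. T p u v + t *\<^sub>R S p u v) x i j = tcomp c T x i j + t *\<^sub>R tcomp c S x i j"
 using assms by (simp add: tcomp_def tensor12_comp_def cc_simps)

lemma linear_family:
 assumes T: "smooth_tensor12 A T" and S: "smooth_tensor12 A S" and J: "open J" shows "smooth_tensor12 A (%p u v. T p u v + t *\<^sub>R S p u v)"
  and "c : A ==> smooth_on (J \<times> chart_image c) (%z. tcomp c (%p u v. T p u v + fst z *\<^sub>R S p u v) (snd z) i j)" proof -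
 have joint: "smooth_on (J \<times> chart_image c) (%z. tcomp c (%p u v. T p u v + fst z *\<^sub>R S p u v) (snd z) i j)" if J: "open J" and c: "c : A" for J c i j
 proof -
  have o: "open (J \<times> chart_image c)" by (intro open_Times J open_chart_image c)
  have "smooth_on (J \<times> chart_image c) (%z. tcomp c T (snd z) i j + fst z *\<^sub>R tcomp c S (snd z) i j)"
   by (intro smooth_on_add smooth_on_scaleR smooth_on_linear o bounded_linear_fst smooth_on_snd open_chart_image c J tcomp_smooth T S)
  thus ?thesis by (subst smooth_on_cong[OF o]) (auto simp: tcomp_linear_family[OF c])
 qed
 show "c : A ==> smooth_on (J \<times> chart_image c) (%z. tcomp c (%p u v. T p u v + fst z *\<^sub>R S p u v) (snd z) i j)" by (rule joint[OF J])
 show "smooth_tensor12 A (%p u v. T p u v + t *\<^sub>R S p u v)" unfolding smooth_tensor12_def proof (intro conjI allI ballI)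
  show "bilinear (%u v. T p u v + t *\<^sub>R S p u v)" for p unfolding bilinear_def
   by (simp add: linear_iff tensor_facts[OF tensor_bilinear[OF T]] tensor_facts[OF tensor_bilinear[OF S]] scaleR_add_right mult_ac)
  fix c i j assume c: "c : A"
  have "smooth_on (chart_image c) (%x. tcomp c (%p u v. T p u v + t *\<^sub>R S p u v) x i j)"
   using smooth_on_slice[OF open_chart_image[OF c] joint[OF open_UNIV c] UNIV_I, of t] by simp
  thus "smooth_on (chart_image c) (tensor12_comp A c (%p u v. T p u v + t *\<^sub>R S p u v) i j \<circ> chart_inv c)"
   by (simp add: tcomp_def o_def)
 qed
qed

lemma contorsion_variation_linear:
 assumes T: "smooth_tensor12 A T" and S: "smooth_tensor12 A S" and K: "closed K" "K <= \<Omega>" "!!p u v. p ~: K ==> S p u v = 0"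
 shows "contorsion_variation A \<Omega> T 1 (%t p u v. T p u v + t *\<^sub>R S p u v)" unfolding contorsion_variation_def
proof (intro conjI ballI allI)
 show "smooth_tensor12 A (%p u v. T p u v + t *\<^sub>R S p u v)" for t by (rule linear_family(1)[OF T S open_UNIV])
 show "smooth_on ({-1<..<1} \<times> chart_image c) (%(t, x). tensor12_comp A c (%p u v. T p u v + t *\<^sub>R S p u v) i j (chart_inv c x))"
  if "c : A" for c i j using linear_family(2)[OF T S open_greaterThanLessThan that] by (simp add: tcomp_def case_prod_beta')
 fix t :: real
 have "((%s. T p u v + s *\<^sub>R S p u v) has_vector_derivative S p u v) (at t)" for p u v by (auto intro!: derivative_eq_intros)
 hence vd: "vector_derivative (%s. T p u v + s *\<^sub>R S p u v) (at t) = S p u v" for p u v by (rule vector_derivative_at)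
 have "{p. EX u v. vector_derivative (%s. T p u v + s *\<^sub>R S p u v) (at t) ~= 0} <= K" unfolding vd using K(3) by blast
 thus "closure {p. EX u v. vector_derivative (%s. T p u v + s *\<^sub>R S p u v) (at t) ~= 0} <= \<Omega>"
  by (rule order_trans[OF closure_minimal[OF _ K(1)] K(2)])
qed simp_all

end

context multi_product
begin

text \<open>Tests criticality on the line T + t S with the metric fixed; the condition
  \<open>conserved\<close> then holds by reflexivity.\<close>

lemma critical_integral_zero:
 assumes g: "adapted_metric A k D g" and T: "smooth_tensor12 A T" and S: "smooth_tensor12 A S"
  and crit: "critical_pair A k D g T" and \<Omega>: "action_domain \<Omega>" and K: "closed K" "K <= \<Omega>" "!!p u v. p ~: K ==> S p u v = 0"
 shows "set_integrable (volume_measure A g) \<Omega> (fv g T S)" "set_lebesgue_integral (volume_measure A g) \<Omega> (fv g T S) = 0" proof -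
 let ?T = "%t p u v. T p u v + t *\<^sub>R S p u v"
 interpret F: adapted_family A k n D 1 "%t. g" ?T proof unfold_locales
  show "adapted_metric A k D g" by (rule g)
  show "smooth_tensor12 A (?T t)" for t by (rule linear_family(1)[OF T S open_UNIV])
  fix c i j assume c: "c : A"
  show "smooth_on ({-1<..<1::real} \<times> chart_image c) (%z. gram g c (snd z) $ i $ j)"
   by (rule smooth_on_snd[OF open_chart_image[OF c] open_greaterThanLessThan gram_smooth[OF adapted_metric_pr[OF g] c]])
  show "smooth_on ({-1<..<1} \<times> chart_image c) (%z. tcomp c (?T (fst z)) (snd z) i j)" if "c : A" for c i j
   by (rule linear_family(2)[OF T S open_greaterThanLessThan that])
 qed simp
 have Sc: "tcomp c S x i j = dird (%z. F.\<Gamma>f c z i j) (0, x) (1, 0)" if c: "c : A" and x: "x : chart_image c" for c x i j proof -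
  have "((%t. (christ (gram g c) x i j + tcomp c T x i j) + t *\<^sub>R tcomp c S x i j) has_vector_derivative tcomp c S x i j) (at 0)"
   by (auto intro!: derivative_eq_intros)
  hence "((%t. F.\<Gamma>f c (t, x) i j) has_vector_derivative tcomp c S x i j) (at 0)"
   by (simp add: F.\<Gamma>f_def ccomp_def tcomp_linear_family[OF c x] add.assoc)
  thus ?thesis by (rule vector_derivative_unique_at[OF _ F.\<Gamma>f_time[OF c x]])
 qed
 have T0: "?T 0 = T" by simp
 have O: "\<Omega> : sets borel" "\<Omega> <= closure \<Omega>" "compact (closure \<Omega>)" using \<Omega> closure_subset unfolding action_domain_def by auto
 have fv1: "((%t. action A k D \<Omega> g (?T t)) has_real_derivative set_lebesgue_integral (volume_measure A g) \<Omega> (fv g T S)) (at 0)"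
  using F.first_variation(1)[OF S Sc refl O] by (simp only: T0)
 show "set_integrable (volume_measure A g) \<Omega> (fv g T S)" using F.first_variation(2)[OF S Sc refl O] by (simp only: T0)
 have "((%t. action A k D \<Omega> g (?T t)) has_real_derivative 0) (at 0)"
  using crit \<Omega> contorsion_variation_linear[OF T S K] unfolding critical_pair_def by blast
 thus "set_lebesgue_integral (volume_measure A g) \<Omega> (fv g T S) = 0" by (rule DERIV_unique[OF fv1])
qed

end

context multi_product
begin

lemma statistical_contorsionD:
 assumes "statistical_contorsion A g T" shows "smooth_tensor12 A T" "g p (T p u v) w = g p (T p v u) w" "g p (T p u v) w = g p (T p u w) v"
 using assms unfolding statistical_contorsion_def by blast+

text \<open>The factor found in \<open>alS_elementary\<close>, with signs and components as
  arguments: in a neighbourhood of p the signs stay frozen while the components vary.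
  \<open>XE\<close> does the same for \<open>XS_elementary\<close>.\<close>

definition alE :: "(nat \<times> nat => real) => (nat \<times> nat => nat \<times> nat => nat \<times> nat => real) => nat \<times> nat => nat \<times> nat => nat \<times> nat => real" where
 "alE s t x y z = (if x = y then s x * (SUM b:Ix. if fst b = fst x then 0 else s b * t b b z) else 0)
  + (if x = z then s x * (SUM b:Ix. if fst b = fst x then 0 else s b * t b b y) else 0)
  - (if fst x = fst y then 0 else t x y z) - (if fst x = fst z then 0 else t x y z)"

definition XE :: "(nat \<times> nat => real) => (nat \<times> nat => nat \<times> nat => nat \<times> nat => real) => nat \<times> nat => nat \<times> nat => nat \<times> nat => real" where
 "XE s w x y z = (if fst y = fst z then 0 else w z y x) + (if fst x = fst z then 0 else w z x y)
  + (if x = y then s x * (SUM b:Ix. if fst b = fst x then 0 else s b * w b b z) else 0)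
  + (if x = y & fst x ~= fst z then s x * (SUM c:Ix. s c * w c z c) else 0)"

lemma sfun_if: "(P ==> sfun U f) ==> (\<not> P ==> sfun U h) ==> sfun U (%q. if P then f q else h q)" by (cases P) auto

text \<open>The fundamental lemma of the calculus of variations. A bump function times the sign of
  \<open>G p\<close> makes the algebraic term h nonnegative; its integral is zero, so h vanishes at
  p, where its value is the modulus of \<open>G p\<close>.\<close>

lemma euler_lagrange:
 fixes e
 assumes g: "adapted_metric A k D g" and st: "statistical_contorsion A g T" and crit: "critical_pair A k D g T"
  and conn: "connected (UNIV :: 'm set)" and e: "local_frame g p e U" and x: "x : Ix" and y: "y : Ix" and z: "z : Ix"
 defines "s \<equiv> %i. g p (e i p) (e i p)"
 defines "G \<equiv> %q. alE s (%a b c. g q (T q (e a q) (e b q)) (e c q)) x y z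
  - (XE s (%c a b. g q (levi_civita A g (e c) (e a) q) (e b q)) x y z - XE s (%c a b. g q (levi_civita A g (e c) (e a) q) (e b q)) x z y)"
 shows "G p = 0" proof (rule ccontr)
 assume Gp: "G p ~= 0"
 note pg = adapted_metric_pr[OF g] and lf = local_frameD[OF e]
 note T = statistical_contorsionD(1)[OF st] and sym = statistical_contorsionD(2,3)[OF st]
 have st: "sfun UNIV (%q. g q (T q (e a q) (e b q)) (e c q))" if "a : Ix" "b : Ix" "c : Ix" for a b c
  by (intro sfun_metric[OF pg] svf_tensor[OF T] lf(3) that)
 have sw: "sfun UNIV (%q. g q (levi_civita A g (e c) (e a) q) (e b q))" if "a : Ix" "b : Ix" "c : Ix" for a b c
  by (intro sfun_metric[OF pg] levi_civita_smooth[OF pg] lf(3) that)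
 have sG: "sfun UNIV G" unfolding G_def alE_def XE_def
  by (intro sfun_add sfun_diff sfun_if sfun_mult sfun_sum sfun_const open_UNIV st sw x y z; assumption)
 obtain \<Omega> where \<Omega>: "action_domain \<Omega>" "p : \<Omega>" using action_domain_exists[OF conn, of p] by (elim exE conjE)
 define \<sigma> where "\<sigma> = sgn (G p)"
 \<comment> \<open>Inside V the frame is available, the support is admissible, and G keeps the sign
   that it has at p.\<close>
 define V where "V = U Int \<Omega> Int {q. 0 < \<sigma> * G q}"
 have "open V" unfolding V_def using \<Omega>(1) lf(1)
  by (intro open_Int open_Collect_less continuous_intros continuous_on_sfun[OF open_UNIV sG]) (simp_all add: action_domain_def)
 moreover have "p : V" unfolding V_def using lf(2) \<Omega>(2) Gp by (simp add: \<sigma>_def sgn_mult_self_eq sgn_if)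
 ultimately obtain \<phi> W K where \<phi>: "sfun UNIV \<phi>" "ALL q. 0 <= \<phi> q" and W: "p : W" and K: "compact K" "K <= V Int fst (chart_at A p)"
  and \<phi>1: "ALL q:W. \<phi> q = 1" and \<phi>0: "ALL q. q ~: K --> \<phi> q = 0"
  using manifold_bump[OF chart_at_in in_chart_at, of V p] by metis
 have KV: "K <= V" and Kc: "K <= fst (chart_at A p)" using K(2) by simp_all
 have KO: "K <= \<Omega>" using KV by (auto simp: V_def)
 define S where "S = (%q u v. (\<sigma> * \<phi> q * g q (e x q) u * g q (e y q) v) *\<^sub>R e z q)"
 have S: "smooth_tensor12 A S"
  unfolding S_def by (rule elementary_tensor_smooth[OF pg sfun_mult[OF open_UNIV sfun_const \<phi>(1)] lf(3)[OF x] lf(3)[OF y] lf(3)[OF z]])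
 have S0: "S q u v = 0" if "q ~: K" for q u v using \<phi>0 that by (simp add: S_def)
 define h where "h = (%q. \<phi> q * (\<sigma> * G q))"
 have hK: "h q = 0" if "q ~: K" for q using \<phi>0 that by (simp add: h_def)
 have h_nn: "0 <= h q" for q proof (cases "q : K")
  case True
  hence "0 < \<sigma> * G q" using KV by (auto simp: V_def)
  thus ?thesis using \<phi>(2) by (simp add: h_def)
 qed (simp add: hK)
 have sh: "sfun UNIV h" unfolding h_def by (intro sfun_mult sfun_const open_UNIV \<phi>(1) sG)
 have fv: "2 * fv g T S q = dv g (ZS g S) q + h q" for q proof (cases "q : U")
  case True
  \<comment> \<open>The same frame serves every base point of U, because its signs there agree with
    those at p.\<close>
  have eq: "local_frame g q e U" unfolding local_frame_def proof (intro conjI ballI allI lf(1) True)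
   show "svf UNIV (e i)" "e i r : D (fst i) r" if "i : Ix" for i r using lf(3,4)[OF that] by blast+
   show "aonb g r (%i. e i r)" if "r : U" for r by (rule lf(5)[OF that])
   show "g r (e i r) (e i r) = g q (e i q) (e i q)" if "r : U" "i : Ix" for r i
    by (rule trans[OF lf(6)[OF that] lf(6)[OF True that(2), symmetric]])
  qed
  have f: "aonb g q (%i. e i q)" by (rule lf(5)[OF True])
  have al: "alS g T S q (%i. e i q) = (\<sigma> * \<phi> q) * alE (%i. g q (e i q) (e i q)) (%a b c. g q (T q (e a q) (e b q)) (e c q)) x y z"
   unfolding alE_def by (rule alS_elementary[where S = S and T = T, OF pg f refl tensor_bilinear[OF T] sym _ x y z]) (simp add: S_def)
  have Xs: "XS g S q (%i. e i q) (%b a. levi_civita A g (e b) (e a) q) =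
    (\<sigma> * \<phi> q) * (XE (%i. g q (e i q) (e i q)) (%c a b. g q (levi_civita A g (e c) (e a) q) (e b q)) x y z
     - XE (%i. g q (e i q) (e i q)) (%c a b. g q (levi_civita A g (e c) (e a) q) (e b q)) x z y)" unfolding XE_def
   by (rule XS_elementary[where S = S, OF pg f refl _ x y z]) (simp add: S_def)
  have sE: "g q (e i q) (e i q) = s i" if "i : Ix" for i unfolding s_def by (rule lf(6)[OF True that])
  have alE: "alE (%i. g q (e i q) (e i q)) t x y z = alE s t x y z" for t unfolding alE_def sE[OF x] by (simp only: sE cong: sum.cong)
  have XE: "XE (%i. g q (e i q) (e i q)) w x y' z' = XE s w x y' z'" for w y' z' unfolding XE_def sE[OF x] by (simp only: sE cong: sum.cong)
  show ?thesis unfolding fv_divergence[OF g T S eq] al Xs alE XE h_def G_def by (simp add: algebra_simps)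
 next
  case False
  hence qK: "q ~: K" using KV by (auto simp: V_def)
  obtain e' U' where e': "local_frame g q e' U'" using local_frame_exists[OF g, of q] by (elim exE)
  have "XS g S q (%i. e' i q) (%b a. levi_civita A g (e' b) (e' a) q) = od (%a b. 0)"
   unfolding XS_def by (rule od_cong) (simp add: At_def S0[OF qK] metric_zero[OF pg])
  moreover have "alS g T S q (%i. e' i q) = od (%a b. 0)"
   unfolding alS_def by (rule od_cong) (simp add: S0[OF qK] metric_zero[OF pg] tensor_facts[OF tensor_bilinear[OF T]])
  ultimately show ?thesis using fv_divergence[OF g T S e'] by (simp add: od_zero hK[OF qK])
 qed
 note i = critical_integral_zero[OF g T S crit \<Omega>(1) compact_imp_closed[OF K(1)] KO S0]
 note d = divergence_theorem[OF g svf_ZS[OF g S] K(1) ZS_zero[OF g S0] KO]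
 have hd: "h q = 2 * fv g T S q - dv g (ZS g S) q" for q using fv[of q] by simp
 have hi: "set_integrable (volume_measure A g) \<Omega> h" "set_lebesgue_integral (volume_measure A g) \<Omega> h = 0"
  unfolding hd[abs_def] using i d by (simp_all add: set_integral_diff set_integral_mult_right)
 have "h p = 0" by (rule integral_zero_imp_zero[where h = h and K = K, OF pg chart_at_in sh h_nn Kc KO hK hi])
 moreover have "h p = \<bar>G p\<bar>" using \<phi>1 W by (simp add: h_def \<sigma>_def abs_sgn[of "G p"] mult.commute)
 ultimately show False using Gp by simp
qed

lemma necessary_frame:
 fixes e
 assumes g: "adapted_metric A k D g" and st: "statistical_contorsion A g T" and crit: "critical_pair A k D g T"
  and conn: "connected (UNIV :: 'm set)" and k: "k > 2" and n: "ALL \<mu>:{2..k}. n \<mu> > 1" and e: "local_frame g p e U"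
 shows "!!x y z. x : Ix ==> y : Ix ==> z : Ix ==> fst x = fst z ==> fst x ~= fst y ==>
   g p (levi_civita A g (e z) (e x) p) (e y p) = 0"
  and "!!x y z. x : Ix ==> y : Ix ==> z : Ix ==> fst x ~= fst y ==> g p (T p (e x p) (e y p)) (e z p) = 0"
  and "!!z \<mu>. z : Ix ==> (SUM b:Blk \<mu>. g p (e b p) (e b p) * g p (T p (e b p) (e b p)) (e z p)) = 0" proof -
 note lf = local_frameD[OF e]
 note sym = statistical_contorsionD(2,3)[OF st]
 define s where "s = (%i. g p (e i p) (e i p))"
 define t where "t = (%a b c. g p (T p (e a p) (e b p)) (e c p))"
 define w where "w = (%c a b. g p (levi_civita A g (e c) (e a) p) (e b p))"
 have ss: "s a * s a = 1" if "a : Ix" for a unfolding s_def by (rule onb_sq[OF aonb_onb[OF lf(5)[OF lf(2)]] that])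
 have EL: "alE s t x y z - (XE s w x y z - XE s w x z y) = 0" if "x : Ix" "y : Ix" "z : Ix" for x y z
  unfolding s_def t_def w_def by (rule euler_lagrange[OF g st crit conn e that])
 have al_sym: "alE s t x y z = alE s t x z y" for x y z using sym(2)[of p "e x p" "e y p" "e z p"] unfolding alE_def t_def by simp
 \<comment> \<open>The equations for (x, y, z) and (x, z, y), added and subtracted, separate the
   symmetric part from the skew one.\<close>
 have both: "alE s t x y z = 0 & XE s w x y z = XE s w x z y" if "x : Ix" "y : Ix" "z : Ix" for x y z
  using EL[OF that] EL[OF that(1,3,2)] al_sym[of x y z] by linarith
 have skew: "w c a b = - w c b a" if "a : Ix" "b : Ix" "c : Ix" for a b c unfolding w_def by (rule frame_connection_skew[OF g e that])
 show "g p (levi_civita A g (e z) (e x) p) (e y p) = 0" if "x : Ix" "y : Ix" "z : Ix" "fst x = fst z" "fst x ~= fst y" for x y z proof -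
  have "w z x y = 0" by (rule connection_equations[of s w, OF ss skew conjunct2[OF both, unfolded XE_def] bspec[OF n] that])
  thus ?thesis unfolding w_def .
 qed
 have al0: "(if x = y then s x * (SUM b:Ix. if fst b = fst x then 0 else s b * t b b z) else 0)
  + (if x = z then s x * (SUM b:Ix. if fst b = fst x then 0 else s b * t b b y) else 0)
  = (if fst x = fst y then 0 else t x y z) + (if fst x = fst z then 0 else t x y z)" if "x : Ix" "y : Ix" "z : Ix" for x y z
  using conjunct1[OF both[OF that]] unfolding alE_def by linarith
 have t_sym: "t a b c = t b a c" "t a b c = t a c b" for a b c unfolding t_def by (rule sym)+
 have t0: "t x y z = 0" if "x : Ix" "y : Ix" "z : Ix" "fst x ~= fst y" for x y z
  by (rule contorsion_equations(1)[of s t, OF ss t_sym al0 k bspec[OF n] that])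
 have tr0: "(SUM b:Blk \<mu>. s b * t b b z) = 0" if "z : Ix" for z \<mu>
  by (rule contorsion_equations(2)[of s t, OF ss t_sym al0 k bspec[OF n] that])
 show "g p (T p (e x p) (e y p)) (e z p) = 0" if "x : Ix" "y : Ix" "z : Ix" "fst x ~= fst y" for x y z using t0[OF that] by (simp add: t_def)
 show "(SUM b:Blk \<mu>. g p (e b p) (e b p) * g p (T p (e b p) (e b p)) (e z p)) = 0" if "z : Ix" for z \<mu>
  using tr0[OF that] by (simp add: t_def s_def)
qed

end

context multi_product
begin

section \<open>From frame equations to conditions on the distributions\<close>

lemma frame_zero:
 assumes g: "adapted_metric A k D g" and f: "aonb g p f" and v: "!!b. b : Ix ==> g p v (f b) = 0" shows "v = 0"
 using aonb_expand[OF g f, of v] v by simp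

text \<open>Symmetry in the last two slots carries the vanishing over from the pair of arguments to
  an argument and the value. So T with any first argument maps each distribution to itself.\<close>

lemma contorsion_block:
 assumes g: "adapted_metric A k D g" and T: "smooth_tensor12 A T" and f: "aonb g p f" and sym: "!!u v w. g p (T p u v) w = g p (T p u w) v"
  and t: "!!a b c. a : Ix ==> b : Ix ==> c : Ix ==> fst a ~= fst b ==> g p (T p (f a) (f b)) (f c) = 0"
 shows "!!a b. a : Ix ==> b : Ix ==> fst a ~= fst b ==> T p (f a) (f b) = 0"
  and "!!\<mu> u v. \<mu> : {1..k} ==> v : D \<mu> p ==> T p u v : D \<mu> p" proof -
 note tT = tensor_facts[OF tensor_bilinear[OF T]]
 show T0: "T p (f a) (f b) = 0" if "a : Ix" "b : Ix" "fst a ~= fst b" for a b by (rule frame_zero[OF g f t[OF that(1,2) _ that(3)]])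
 show "T p u v : D \<mu> p" if \<mu>: "\<mu> : {1..k}" and v: "v : D \<mu> p" for \<mu> u v proof -
  have ab: "T p (f a) (f b) : D \<mu> p" if a: "a : Ix" and b: "b : Blk \<mu>" for a b proof (cases "fst a = \<mu>")
   case True
   show ?thesis proof (rule D_memI[OF g f \<mu>])
    fix c assume c: "c : Ix" "fst c ~= \<mu>"
    have "b : Ix" using b by (simp add: Ix_Blk)
    thus "g p (T p (f a) (f b)) (f c) = 0" unfolding sym[of _ "f b"] using t[OF a c(1)] c(2) True by simp
   qed
  next
   case False
   thus ?thesis using T0[OF a, of b] b subspace_0[OF D_subspace[OF \<mu>]] by (auto simp: Ix_Blk)
  qed
  show ?thesis proof -
   have "T p u v = T p (SUM a:Ix. (g p (f a) (f a) * g p u (f a)) *\<^sub>R f a) (SUM b:Blk \<mu>. (g p (f b) (f b) * g p v (f b)) *\<^sub>R f b)"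
    by (rule arg_cong2[OF aonb_expand[OF g f] D_expand[OF g f \<mu> v]])
   also have "... : D \<mu> p" unfolding tT by (intro subspace_sum[OF D_subspace[OF \<mu>]] subspace_mul[OF D_subspace[OF \<mu>]] ab)
   finally show ?thesis .
  qed
 qed
qed

lemma sum_off_block: "(SUM i:Ix - Blk \<mu>. F i) = (SUM i:Ix. if fst i = \<mu> then 0 else F i)" proof -
 have "(SUM i:Ix. if fst i = \<mu> then 0 else F i) = (SUM i:Ix - Blk \<mu>. if fst i = \<mu> then 0 else F i)"
  by (rule sum.mono_neutral_right) (auto simp: Ix_Blk)
 also have "... = (SUM i:Ix - Blk \<mu>. F i)" by (rule sum.cong[OF refl]) (auto simp: Ix_Blk)
 finally show ?thesis ..
qed

lemma necessity:
 assumes g: "adapted_metric A k D g" and st: "statistical_contorsion A g T" and crit: "critical_pair A k D g T"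
  and conn: "connected (UNIV :: 'm set)" and k: "k > 2" and n: "ALL \<mu>:{2..k}. n \<mu> > 1" shows "locally_product A k D g"
  and "!!p \<mu> u v. \<mu> : {1..k} ==> v : D \<mu> p ==> T p u v : D \<mu> p"
  and "!!p \<mu>. \<mu> : {1..k} ==> trace_along A g (g_perp g (D \<mu>)) T p = 0"
  and "!!p \<mu>. \<mu> : {1..k} ==> trace_along A g (D \<mu>) T p = 0" proof -
 note nf = necessary_frame[OF g st crit conn k n]
 note pg = adapted_metric_pr[OF g]
 note T = statistical_contorsionD(1)[OF st] and sym = statistical_contorsionD(3)[OF st]
 show "locally_product A k D g" by (rule locally_productI[OF g nf(1)])
 fix p \<mu> assume \<mu>: "\<mu> : {1..k}"
 obtain e U where e: "local_frame g p e U" using local_frame_exists[OF g, of p] by (elim exE)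
 have f: "aonb g p (%i. e i p)" by (rule local_frameD(5)[OF e local_frameD(2)[OF e]])
 show "T p u v : D \<mu> p" if "v : D \<mu> p" for u v by (rule contorsion_block(2)[OF g T f sym nf(2)[OF e] \<mu> that])
 have tr: "g p (SUM i:Blk \<rho>. g p (e i p) (e i p) *\<^sub>R T p (e i p) (e i p)) (e z p) = 0" if "z : Ix" for \<rho> z
  using nf(3)[OF e that, of \<rho>] by (simp add: metric_facts[OF pg])
 show "trace_along A g (D \<mu>) T p = 0" unfolding trace_along_D[OF g T \<mu> f] by (rule frame_zero[OF g f tr])
 \<comment> \<open>Every block trace vanishes, hence so does the trace over a complement, which is
   the total trace minus one block.\<close>
 have "(SUM i:Blk \<rho>. g p (e i p) (e i p) *\<^sub>R T p (e i p) (e i p)) = 0" for \<rho> by (rule frame_zero[OF g f tr])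
 thus "trace_along A g (g_perp g (D \<mu>)) T p = 0" unfolding trace_along_perp[OF g T \<mu> f] sum_diff[OF finite_Ix Blk_subset] sum_Ix by simp
qed

lemma sufficiency:
 assumes g: "adapted_metric A k D g" and st: "statistical_contorsion A g T" and par: "parallel g"
  and t: "!!p f a b c. aonb g p f ==> a : Ix ==> b : Ix ==> c : Ix ==> fst a ~= fst b ==> g p (T p (f a) (f b)) (f c) = 0"
  and tr: "!!p \<mu>. \<mu> : {1..k} ==> trace_along A g (g_perp g (D \<mu>)) T p = 0" shows "critical_pair A k D g T" unfolding critical_pair_def
proof (intro allI impI conjI; (elim conjE)?)
 note T = statistical_contorsionD(1)[OF st] and sym = statistical_contorsionD(2,3)[OF st]
 note pg = adapted_metric_pr[OF g]
 have TD: "T p u v : D \<mu> p" if "\<mu> : {1..k}" "v : D \<mu> p" for p \<mu> u v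
  by (rule contorsion_block(2)[OF g T oe_aonb[OF g] sym(2) t[OF oe_aonb[OF g]] that])
 have T0: "T p (f a) (f b) = 0" if "aonb g p f" "a : Ix" "b : Ix" "fst a ~= fst b" for p f a b
  by (rule contorsion_block(1)[OF g T that(1) sym(2) t[OF that(1)] that(2-4)])
 have tr0: "(SUM a:Ix. if fst a = fst b then 0 else g p (f a) (f a) *\<^sub>R T p (f a) (f a)) = 0" if "aonb g p f" "b : Ix" for p f b
  using tr[OF fst_Ix[OF that(2)], of p] unfolding trace_along_perp[OF g T fst_Ix[OF that(2)] that(1)] sum_off_block .
 fix \<Omega> :: "'m set" assume \<Omega>: "action_domain \<Omega>"
 have O: "\<Omega> : sets borel" "\<Omega> <= closure \<Omega>" "compact (closure \<Omega>)"
  using \<Omega> closure_subset unfolding action_domain_def by auto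
 \<comment> \<open>Supports of variations are closed subsets of the relatively compact domain; the
   divergence theorem wants them compact.\<close>
 have compact_K: "compact K" if "closed K" "K <= \<Omega>" for K proof -
  have "K = closure \<Omega> Int K" using that(2) O(2) by blast
  thus ?thesis using compact_Int_closed[OF O(3) that(1)] by simp
 qed
 {
  fix \<epsilon> gt assume v: "adapted_variation A k D \<Omega> g \<epsilon> gt"
  note v' = v[unfolded adapted_variation_def]
  have eps: "0 < \<epsilon>" and gt0: "gt 0 = g" and gt: "ALL t:{-\<epsilon><..<\<epsilon>}. adapted_metric A k D (gt t)"
   and sm: "ALL c:A. ALL i j. smooth_on ({-\<epsilon><..<\<epsilon>} \<times> chart_image c) (%(t, x). metric_comp A c (gt t) i j (chart_inv c x))"
   and supp: "ALL t:{-\<epsilon><..<\<epsilon>}. closure {p. EX u v. deriv (%s. gt s p u v) t ~= 0} <= \<Omega>"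
   by (rule conjunct1[OF v'] conjunct1[OF conjunct2[OF v']] conjunct1[OF conjunct2[OF conjunct2[OF v']]]
     conjunct1[OF conjunct2[OF conjunct2[OF conjunct2[OF v']]]] conjunct2[OF conjunct2[OF conjunct2[OF conjunct2[OF v']]]])+
  interpret F: adapted_family A k n D \<epsilon> gt "%t. T" proof unfold_locales
   show "0 < \<epsilon>" by (rule eps)
   show "adapted_metric A k D (gt t)" if "t : {-\<epsilon><..<\<epsilon>}" for t by (rule bspec[OF gt that])
   show "smooth_tensor12 A T" by (rule T)
   fix c i j assume c: "c : A"
   show "smooth_on ({-\<epsilon><..<\<epsilon>} \<times> chart_image c) (%z. gram (gt (fst z)) c (snd z) $ i $ j)"
    using sm c by (simp add: gram_def case_prod_beta')
   show "smooth_on ({-\<epsilon><..<\<epsilon>} \<times> chart_image c) (%z. tcomp c T (snd z) i j)"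
    by (rule smooth_on_snd[OF open_chart_image[OF c] open_greaterThanLessThan tcomp_smooth[OF T c]])
  qed
  let ?K = "closure {p. EX u v. deriv (%s. gt s p u v) 0 ~= 0}"
  have KO: "?K <= \<Omega>" by (rule bspec[OF supp F.zero_J])
  have out: "deriv (%s. gt s q u v) 0 = 0" if "q ~: ?K" for q u v proof (rule ccontr)
   assume "deriv (%s. gt s q u v) 0 ~= 0"
   hence "q : {p. EX u v. deriv (%s. gt s p u v) 0 ~= 0}" by (intro CollectI exI)
   from subsetD[OF closure_subset this] show False by (rule notE[OF that])
  qed
  show "((%t. action A k D \<Omega> (gt t) T) has_real_derivative 0) (at 0)"
  proof (rule F.sufficient_derivative[OF _ _ _ _ _ _ O compact_K[OF closed_closure KO] KO], unfold gt0)
   fix p c i j assume p: "p ~: ?K" and c: "c : A" "p : fst c"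
   have o: "open (- ?K)" by (simp add: open_Compl)
   have pU: "p : - ?K" unfolding Compl_iff by (rule p)
   show "dird (%z. F.\<Gamma>f c z i j) (0, snd c p) (1, 0) = 0" proof (rule F.\<Gamma>f_time_metric[OF _ c o pU])
    show "T = T" by (rule refl)
    show "deriv (%s. gt s q u v) 0 = 0" if "q : - ?K" for q u v by (rule out[OF ComplD[OF that]])
   qed
  qed (rule par TD sym T0 tr0; assumption)+
 next
  fix \<epsilon> Tt assume v: "contorsion_variation A \<Omega> T \<epsilon> Tt"
  note v' = v[unfolded contorsion_variation_def]
  have eps: "0 < \<epsilon>" and Tt0: "Tt 0 = T" and Tt: "ALL t:{-\<epsilon><..<\<epsilon>}. smooth_tensor12 A (Tt t)"
   and sm: "ALL c:A. ALL i j. smooth_on ({-\<epsilon><..<\<epsilon>} \<times> chart_image c) (%(t, x). tensor12_comp A c (Tt t) i j (chart_inv c x))"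
   and supp: "ALL t:{-\<epsilon><..<\<epsilon>}. closure {p. EX u v. vector_derivative (%s. Tt s p u v) (at t) ~= 0} <= \<Omega>"
   by (rule conjunct1[OF v'] conjunct1[OF conjunct2[OF v']] conjunct1[OF conjunct2[OF conjunct2[OF v']]]
     conjunct1[OF conjunct2[OF conjunct2[OF conjunct2[OF v']]]] conjunct2[OF conjunct2[OF conjunct2[OF conjunct2[OF v']]]])+
  interpret F: adapted_family A k n D \<epsilon> "%t. g" Tt proof unfold_locales
   show "0 < \<epsilon>" by (rule eps)
   show "adapted_metric A k D g" by (rule g)
   show "smooth_tensor12 A (Tt t)" if "t : {-\<epsilon><..<\<epsilon>}" for t by (rule bspec[OF Tt that])
   fix c i j assume c: "c : A"
   show "smooth_on ({-\<epsilon><..<\<epsilon>} \<times> chart_image c) (%z. gram g c (snd z) $ i $ j)"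
    by (rule smooth_on_snd[OF open_chart_image[OF c] open_greaterThanLessThan gram_smooth[OF pg c]])
   show "smooth_on ({-\<epsilon><..<\<epsilon>} \<times> chart_image c) (%z. tcomp c (Tt (fst z)) (snd z) i j)"
    using sm c by (simp add: tcomp_def case_prod_beta')
  qed
  let ?K = "closure {p. EX u v. vector_derivative (%s. Tt s p u v) (at 0) ~= 0}"
  have KO: "?K <= \<Omega>" by (rule bspec[OF supp F.zero_J])
  have out: "vector_derivative (%s. Tt s q u v) (at 0) = 0" if "q ~: ?K" for q u v proof (rule ccontr)
   assume "vector_derivative (%s. Tt s q u v) (at 0) ~= 0"
   hence "q : {p. EX u v. vector_derivative (%s. Tt s p u v) (at 0) ~= 0}" by (intro CollectI exI)
   from subsetD[OF closure_subset this] show False by (rule notE[OF that])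
  qed
  show "((%t. action A k D \<Omega> g (Tt t)) has_real_derivative 0) (at 0)"
  proof (rule F.sufficient_derivative[OF _ _ _ _ _ _ O compact_K[OF closed_closure KO] KO], unfold Tt0)
   fix p c i j assume p: "p ~: ?K" and c: "c : A" "p : fst c"
   have "ci c p (dird (%z. F.\<Gamma>f c z i j) (0, snd c p) (1, 0)) = 0"
    using vector_derivative_at[OF F.\<Gamma>f_time_tensor[OF refl c, of i j]] out[OF p] by simp
   hence "cc c p (ci c p (dird (%z. F.\<Gamma>f c z i j) (0, snd c p) (1, 0))) = 0" by (simp only: cc_simps[OF c])
   thus "dird (%z. F.\<Gamma>f c z i j) (0, snd c p) (1, 0) = 0" unfolding cc_ci[OF c] .
  qed (rule par TD sym T0 tr0; assumption)+
 }
qed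

end

theorem corollary4:
  fixes A :: "('m::{t2_space, second_countable_topology}, 'n::finite) chart set" and k :: nat and n :: "nat \<Rightarrow> nat"
    and D :: "nat \<Rightarrow> ('m, 'n) distribution" and g :: "('m, 'n) metric" and T :: "('m, 'n) tensor12"
  assumes "connected_smooth_manifold A" and "k > 2" and "almost_multi_product A k n D" and "adapted_metric A k D g"
    and "\<And>\<mu> \<nu>. \<lbrakk>\<mu> \<in> {1..k}; \<nu> \<in> {1..k}; \<mu> \<noteq> \<nu>\<rbrakk> \<Longrightarrow> mixed_totally_geodesic A g (D \<mu>) (D \<nu>)"
    and "\<And>\<mu> \<nu>. \<lbrakk>\<mu> \<in> {1..k}; \<nu> \<in> {1..k}; \<mu> \<noteq> \<nu>\<rbrakk> \<Longrightarrow> mixed_integrable A g (D \<mu>) (D \<nu>)"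
    and "\<And>\<mu>. \<mu> \<in> {2..k} \<Longrightarrow> n \<mu> > 1" and "statistical_contorsion A g T"
  shows "critical_pair A k D g T \<longleftrightarrow>
    locally_product A k D g \<and>
    (\<forall>\<mu>\<in>{1..k}. \<forall>p. \<forall>X\<in>D \<mu> p. \<forall>Y\<in>D \<mu> p. \<forall>Z\<in>g_perp g (D \<mu>) p. g p (T p X Y) Z = 0) \<and>
    (\<forall>\<mu>\<in>{1..k}. \<forall>p. trace_along A g (g_perp g (D \<mu>)) T p = 0 \<and> trace_along A g (D \<mu>) T p = 0) \<and>
    (\<forall>\<rho>\<in>{1..k}. \<forall>\<mu>\<in>{1..k}. \<forall>\<nu>\<in>{1..k}. \<rho> \<noteq> \<mu> \<and> \<rho> \<noteq> \<nu> \<and> \<mu> \<noteq> \<nu> \<longrightarrow>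
       (\<forall>p. \<forall>X\<in>D \<rho> p. \<forall>Y\<in>D \<mu> p. \<forall>Z\<in>D \<nu> p. g p (T p X Y) Z = 0))" proof -
  have atlas: "smooth_atlas A" and conn: "connected (UNIV :: 'm set)" using assms(1) by (simp_all add: connected_smooth_manifold_def)
  interpret multi_product A k n D by unfold_locales (rule atlas, rule assms(3))
  note g = assms(4) and st = assms(8)
  note pg = adapted_metric_pr[OF g]
  note sym = statistical_contorsionD(2,3)[OF st]
  have n: "ALL \<mu>:{2..k}. n \<mu> > 1" using assms(7) by blast
  show ?thesis (is "?L \<longleftrightarrow> ?P & ?I & ?II & ?III") proof
    assume crit: ?L
    note nec = necessity[OF g st crit conn assms(2) n]
    show "?P & ?I & ?II & ?III" proof (intro conjI ballI allI impI nec(1,3,4); (elim conjE)?)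
      fix \<mu> p X Y Z assume \<mu>: "\<mu> : {1..k}" and Y: "Y : D \<mu> p" and Z: "Z : g_perp g (D \<mu>) p"
      have "g p Z (T p X Y) = 0" using Z nec(2)[OF \<mu> Y, of X] unfolding g_perp_def by blast
      thus "g p (T p X Y) Z = 0" using metric_sym[OF pg, of p Z] by simp
    next
      fix \<rho> \<mu> \<nu> p X Y Z
      assume \<mu>: "\<mu> : {1..k}" and \<nu>: "\<nu> : {1..k}" "\<mu> ~= \<nu>" and Y: "Y : D \<mu> p" and Z: "Z : D \<nu> p"
      show "g p (T p X Y) Z = 0" by (rule adapted_orth[OF g \<mu> \<nu> nec(2)[OF \<mu> Y] Z])
    qed
  next
    assume R: "?P & ?I & ?II & ?III"
    have lp: ?P and II: ?II by (rule conjunct1[OF R] conjunct1[OF conjunct2[OF conjunct2[OF R]]])+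
    have I: "g p (T p X Y) Z = 0" if "\<mu> : {1..k}" "X : D \<mu> p" "Y : D \<mu> p" "Z : g_perp g (D \<mu>) p" for \<mu> p X Y Z
      using R that by (elim conjE) (drule bspec, assumption, drule spec, drule bspec, assumption, drule bspec, assumption, drule bspec, assumption, assumption)
    have III: "g p (T p X Y) Z = 0" if "\<rho> : {1..k}" "\<mu> : {1..k}" "\<nu> : {1..k}" "\<rho> ~= \<mu>" "\<rho> ~= \<nu>" "\<mu> ~= \<nu>" "X : D \<rho> p" "Y : D \<mu> p" "Z : D \<nu> p" for \<rho> \<mu> \<nu> p X Y Z
      using R that by blast
    show ?L proof (rule sufficiency[OF g st parallelI[OF g lp assms(5,6)]])
      fix p f a b c assume f: "aonb g p f" and i: "a : Ix" "b : Ix" "c : Ix" "fst a ~= fst b"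
      have fD: "f i : D (fst i) p" if "i : Ix" for i by (rule aonb_D[OF f that])
      have perp: "f j : g_perp g (D (fst i)) p" if "i : Ix" "j : Ix" "fst i ~= fst j" for i j
        unfolding g_perp_def using adapted_orth[OF g fst_Ix[OF that(2)] fst_Ix[OF that(1)] that(3)[symmetric] fD[OF that(2)]] by blast
      \<comment> \<open>If c shares its block with a or with b, total symmetry brings the component
        into the form of condition (i); otherwise the three blocks differ and condition (iii)
        applies.\<close>
      consider "fst c = fst a" | "fst c = fst b" | "fst c ~= fst a" "fst c ~= fst b" by blast
      thus "g p (T p (f a) (f b)) (f c) = 0" proof cases
        case 1
        have "g p (T p (f a) (f c)) (f b) = 0" by (rule I[OF fst_Ix[OF i(1)] fD[OF i(1)] _ perp[OF i(1,2,4)]]) (use fD[OF i(3)] 1 in simp)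
        thus ?thesis unfolding sym(2)[of p "f a" "f b"] .
      next
        case 2
        have "g p (T p (f b) (f c)) (f a) = 0"
          by (rule I[OF fst_Ix[OF i(2)] fD[OF i(2)] _ perp[OF i(2,1) i(4)[symmetric]]]) (use fD[OF i(3)] 2 in simp)
        thus ?thesis unfolding sym(1)[of p "f a" "f b"] sym(2)[of p "f b" "f a"] .
      next
        case 3
        show ?thesis
          by (rule III[OF fst_Ix[OF i(1)] fst_Ix[OF i(2)] fst_Ix[OF i(3)] i(4) 3(1)[symmetric] 3(2)[symmetric] fD[OF i(1)] fD[OF i(2)] fD[OF i(3)]])
      qed
    next
      show "trace_along A g (g_perp g (D \<mu>)) T p = 0" if "\<mu> : {1..k}" for p \<mu> using II that by blast
    qed
  qed
qed

end
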